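(* There exist $\varepsilon_0>0$ and a nondecreasing function $C(\varepsilon)>0$ such that for every $0<\varepsilon\le\varepsilon_0$, every $(\underline\theta,\underline{\mathbf{W}})$ (of the class described in the context) with $\|\underline{\mathbf{W}}\|_{X_{\mathrm{ch}}}<\varepsilon$ and $\|\underline\theta\|_{\ell^1}<\varepsilon$, every $j\in\mathbb{Z}$ and every $1\le p\le\infty$, the nonlinear terms $\mathbf{N}^\theta,\mathbf{N}^{\mathbf{w}}$ of the normal form lattice system satisfy $$\begin{aligned}|\mathbf{N}^\theta_j|\le C(\varepsilon)\Big[&\sum_{k=-1}^{0}|(\delta_+\underline\theta)_{j+k}|^2+\Big(\sum_{k=-1}^1|\theta_{j+k}|^3\Big)\Big(\sum_{k=-1}^0|(\delta_+\underline\theta)_{j+k}|\Big)\\&+\Big(\sum_{k=-1}^1|\theta_{j+k}|\Big)\Big(|(\delta_+\underline{\mathbf{W}})_j(-\pi)|+|(\delta_+\partial_x\underline{\mathbf{W}})_j(-\pi)|\Big)\\&+\|\mathbf{W}_j\|_{L^p}|(\delta_+\underline{\mathbf{W}})_j(-\pi)|+\|\mathbf{W}_j^2\|_{L^p}\Big],\end{aligned}$$ $$\begin{aligned}\|\mathbf{N}^{\mathbf{w}}_j\|_{L^p}\le C(\varepsilon)\Big[&\Big(\sum_{k=-1}^0|(\delta_+\underline\theta)_{j+k}|\Big)\Big(\sum_{k=-1}^1|\theta_{j+k}|\Big)+|\theta_j|\|\mathbf{W}_j\|_{L^p}\\&+\Big(\sum_{k=-1}^1|\theta_{j+k}|\B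ig)\Big(\sum_{k=-1}^1|(\delta_+\underline{\mathbf{W}})_{j+k}(-\pi)|+|(\delta_+\partial_x\underline{\mathbf{W}})_{j+k}(-\pi)|\Big)\\&+\|\mathbf{W}_j\|_{L^p}|(\delta_+\underline{\mathbf{W}})_j(-\pi)|+\|\mathbf{W}_j^2\|_{L^p}+|\mathbf{N}^\theta_j|+|\mathbf{N}^\theta_{j+1}|+|\mathbf{N}^\theta_{j-1}|\Big].\end{aligned}$$
   Context: Setting: $D\in\mathbb{R}^{n\times n}$ is diagonal with strictly positive diagonal entries, $\mathbf{f}:\mathbb{R}^n\to\mathbb{R}^n$ is smooth (smooth = sufficiently many derivatives), and $\mathbf{u}_\star$ is a smooth even $2\pi$-periodic solution of $D\partial_{xx}\mathbf{u}+\mathbf{f}(\mathbf{u})=0$. For $\sigma\in[-\frac12,\frac12]$, $B(\sigma)=D(\partial_x+\mathrm{i}\sigma)^2+\mathbf{f}'(\mathbf{u}_\star):(H^2(\mathbb{T}_{2\pi}))^n\to(L^2(\mathbb{T}_{2\pi}))^n$, $\mathbb{T}_{2\pi}=\mathbb{R}/2\pi\mathbb{Z}$. Spectral stability is assumed: (i) $\mathrm{spec}(B(\sigma))\cap\{\mathrm{Re}\,\lambda\ge0\}=\emptyset$ for $\sigma\ne0$; (ii) $\mathrm{spec}(B(0))\cap\{\mathrm{Re}\,\lambda\ge0\}=\{0\}$, with $0$ simple and eigenspace $\mathrm{span}\{\mathbf{u}_\star'\}$; (iii) near $\sigma=0$ the eigenvalue continuing $0$ is smooth with $\lambda(\sigma)=-d\sigma^2+O(|\sigma|^3)$,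 $d>0$. $(\cdot,\cdot)$ is the Euclidean inner product, $\langle\mathbf{u},\mathbf{v}\rangle=\int_{-\pi}^{\pi}(\mathbf{u},\mathbf{v})\,dx$. $\mathbf{u}_{\mathrm{ad}}$ is the (odd) element of the kernel of the adjoint of $B(0)$ with $\langle\mathbf{u}_\star',\mathbf{u}_{\mathrm{ad}}\rangle=1$. $\mathbf{W}_j^2$ stands for $|\mathbf{W}_j|^2$. $L^p$ norms are over $(-\pi,\pi)$. $(\delta_+\underline{x})_j=x_{j+1}-x_j$. Spaces: $X_{\mathrm{ch}}=\ell^1(\mathbb{Z},(L^1(-\pi,\pi))^n)\cap\ell^\infty(\mathbb{Z},(L^\infty(-\pi,\pi))^n)$ with norm $\sum_j\|\mathbf{w}_j\|_{L^1}+\sup_j\|\mathbf{w}_j\|_{L^\infty}$; $X_{\mathrm{ch}}^\perp=\{\underline{\mathbf{v}}\in X_{\mathrm{ch}}:\langle\mathbf{v}_j,\mathbf{u}_{\mathrm{ad}}\rangle=0\ \forall j\}$; $X_2=\ell^2(\mathbb{Z},(L^2(-\pi,\pi))^n)$, $X_{2,\perp}$ its subspace with $\langle\mathbf{v}_j,\mathbf{u}_{\mathrm{ad}}\rangle=0$ for all $j$. $\mathscr{T}_{\mathrm{ch}}$ glues pieces: $\mathscr{T}_{\mathrm{ch}}(\underline{\mathbf{v}})(2\pi j+x)=\mathbf{v}_j(x)$, $x\in[-\pi,\pi]$. Class of arguments: $\underline\theta\in\ell^1$ (real sequences) and $\underline{\mathbf{W}}\in X_{\mathrm{ch}}^\perp$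 with $\mathscr{T}_{\mathrm{ch}}\underline{\mathbf{W}}\in (H^2(\mathbb{R}))^n$; in particular $\partial_x^m\mathbf{W}_j(\pi)=\partial_x^m\mathbf{W}_{j+1}(-\pi)$ for $m=0,1$. Phase decomposition: let $\phi$ be a fixed smooth odd (weakly) increasing function on $[-\pi,\pi]$ with $\phi=\frac12$ for $x>\frac\pi2$, $\phi=-\frac12$ for $x<-\frac\pi2$, and $\psi\in(C_c^\infty(-\pi,\pi))^n$ a fixed odd function (extended by $0$) with $\langle\psi,\mathbf{u}_{\mathrm{ad}}\rangle=1$. Put $\mathbf{H}_j=\mathbf{H}_j^1+c_j\psi(\cdot-\theta_j)$ with $\mathbf{H}_j^1(x)=\frac12\phi(x)(\mathbf{u}_\star(x-\theta_{j+1})-\mathbf{u}_\star(x-\theta_{j-1}))+\frac14(\mathbf{u}_\star(x-\theta_{j+1})+\mathbf{u}_\star(x-\theta_{j-1})-2\mathbf{u}_\star(x-\theta_j))$ and $c_j=-\langle\mathbf{H}_j^1,\mathbf{u}_{\mathrm{ad}}(\cdot-\theta_j)\rangle-\langle\mathbf{W}_j,\mathbf{u}_{\mathrm{ad}}(\cdot-\theta_j)-\mathbf{u}_{\mathrm{ad}}\rangle$. Define $\mathscr{T}_{\mathrm{phd}}(\underline\theta,\underline{\mathbf{W}})=\{\mathbf{W}_j+\mathbf{H}_j+\mathbf{u}_\star(\cdot-\theta_j)-\mathbf{u}_\star\}_{j\in\mathbb{Z}}$. Put $\mathbf{E}_{-1}=\frac14\psi-(\frac14+\frac12\phi)\mathbf{u}_\star'$,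 $\mathbf{E}_0=-\frac12(\psi+\mathbf{u}_\star')$, $\mathbf{E}_1=\frac14\psi-(\frac14-\frac12\phi)\mathbf{u}_\star'$, $\mathbf{E}_j=0$ otherwise, and $(\mathbf{E}*\underline\theta)_j=\sum_k\mathbf{E}_{j-k}\theta_k$. Normal form system and nonlinear terms: on each piece $(A_{\mathrm{ch}}\underline{\mathbf{v}})_j=D\partial_{xx}\mathbf{v}_j+\mathbf{f}'(\mathbf{u}_\star)\mathbf{v}_j$, $\mathbf{G}(\underline{\mathbf{v}})_j=\mathbf{f}(\mathbf{u}_\star+\mathbf{v}_j)-\mathbf{f}(\mathbf{u}_\star)-\mathbf{f}'(\mathbf{u}_\star)\mathbf{v}_j$, $(\Gamma\underline{\mathbf{v}})_j=(\mathbf{v}_j(-\pi),D\mathbf{u}_{\mathrm{ad}}'(\pi))$, and $$A_{\mathrm{nf}}(\underline\theta,\underline{\mathbf{W}})=\big(\delta_+\Gamma\underline{\mathbf{W}},\ A_{\mathrm{ch}}(\mathbf{E}*\underline\theta)+A_{\mathrm{ch}}\underline{\mathbf{W}}-\mathbf{E}*(\delta_+\Gamma\underline{\mathbf{W}})\big).$$ The change of variables $\underline{\mathbf{v}}=\mathscr{T}_{\mathrm{phd}}(\underline\theta,\underline{\mathbf{W}})$ turns the chopped equation $\partial_t\underline{\mathbf{v}}=A_{\mathrm{ch}}\underline{\mathbf{v}}+\mathbf{G}(\underline{\mathbf{v}})$ into $\frac{d}{dt}(\underline\theta,\underline{\mathbf{W}})=A_{\mathrm{nf}}(\underline\theta,\underline{\mathbf{W}})+(\mathbf{N}^\theta,\mathbf{N}^{\mathbf{w}})$;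 that is, $(\mathbf{N}^\theta,\mathbf{N}^{\mathbf{w}})(\underline\theta,\underline{\mathbf{W}})$ is determined by $$\mathscr{T}_{\mathrm{phd}}'(\underline\theta,\underline{\mathbf{W}})\big[A_{\mathrm{nf}}(\underline\theta,\underline{\mathbf{W}})+(\mathbf{N}^\theta,\mathbf{N}^{\mathbf{w}})\big]=A_{\mathrm{ch}}\underline{\mathbf{v}}+\mathbf{G}(\underline{\mathbf{v}}),\qquad\underline{\mathbf{v}}=\mathscr{T}_{\mathrm{phd}}(\underline\theta,\underline{\mathbf{W}}),$$ where $\mathscr{T}_{\mathrm{phd}}'(\underline\theta,\underline{\mathbf{W}})$ is the (locally defined, nearest-neighbor in $j$) derivative, viewed as an operator $\ell^2\times X_{2,\perp}\to X_2$, invertible for small $(\underline\theta,\underline{\mathbf{W}})$. *)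

theory Defs
  imports "HOL-Analysis.Analysis" "HOL-Probability.Essential_Supremum"
begin

section \<open>Function spaces\<close>

text \<open>\<open>k\<close> times continuously differentiable on an open subset of a finite-dimensional space.\<close>

primrec C_k_on :: "nat \<Rightarrow> 'a::real_normed_vector set \<Rightarrow> ('a \<Rightarrow> 'b::real_normed_vector) \<Rightarrow> bool" where
  "C_k_on 0 S f \<longleftrightarrow> continuous_on S f"
| "C_k_on (Suc k) S f \<longleftrightarrow>
     f differentiable_on S \<and> (\<forall>h. C_k_on k S (\<lambda>x. frechet_derivative f (at x) h))"

definition test_function :: "real set \<Rightarrow> (real \<Rightarrow> 'b::real_normed_vector) \<Rightarrow> bool" where
  "test_function S \<tau> \<longleftrightarrow>
     (\<forall>k. C_k_on k UNIV \<tau>) \<and> compact (closure {x. \<tau> x \<noteq> 0}) \<and> closure {x. \<tau> x \<noteq> 0} \<subseteq> S"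

definition has_weak_deriv ::
    "real set \<Rightarrow> (real \<Rightarrow> 'b::euclidean_space) \<Rightarrow> (real \<Rightarrow> 'b) \<Rightarrow> bool" where
  "has_weak_deriv S u g \<longleftrightarrow>
     (\<forall>K. compact K \<and> K \<subseteq> S \<longrightarrow> integrable (lebesgue_on K) u \<and> integrable (lebesgue_on K) g) \<and>
     (\<forall>\<tau> :: real \<Rightarrow> real. test_function S \<tau> \<longrightarrow>
        (LINT x|lebesgue_on S. deriv \<tau> x *\<^sub>R u x) = - (LINT x|lebesgue_on S. \<tau> x *\<^sub>R g x))"

text \<open>Weak derivatives are unique up to null sets; every use below is insensitive to
  the representative that is chosen here.\<close>

definition weak_deriv :: "real set \<Rightarrow> (real \<Rightarrow> 'b::euclidean_space) \<Rightarrow> real \<Rightarrow> 'b" where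
  "weak_deriv S u = (SOME g. has_weak_deriv S u g)"

text \<open>The \<open>L\<^sup>p\<close> norm, \<open>1 \<le> p \<le> \<infinity>\<close>, takes the value \<open>\<infinity>\<close> for measurable functions outside \<open>L\<^sup>p\<close>.\<close>

definition Lp_norm :: "ennreal \<Rightarrow> real set \<Rightarrow> (real \<Rightarrow> 'b::real_normed_vector) \<Rightarrow> ennreal" where
  "Lp_norm p S u =
     (if p = \<infinity> then esssup (lebesgue_on S) (\<lambda>x. ennreal (norm (u x)))
      else let I = (\<integral>\<^sup>+ x. ennreal (norm (u x) powr enn2real p) \<partial>lebesgue_on S)
           in if I = \<infinity> then \<infinity> else ennreal (enn2real I powr (1 / enn2real p)))"

definition in_Lp :: "ennreal \<Rightarrow> real set \<Rightarrow> (real \<Rightarrow> 'b::real_normed_vector) \<Rightarrow> bool" where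
  "in_Lp p S u \<longleftrightarrow> u \<in> borel_measurable (lebesgue_on S) \<and> Lp_norm p S u < \<infinity>"

definition in_H2_line :: "(real \<Rightarrow> 'b::euclidean_space) \<Rightarrow> bool" where
  "in_H2_line u \<longleftrightarrow> in_Lp 2 UNIV u \<and>
     (\<exists>g h. in_Lp 2 UNIV g \<and> in_Lp 2 UNIV h \<and> has_weak_deriv UNIV u g \<and> has_weak_deriv UNIV g h)"

abbreviation cell :: "real set" where
  "cell \<equiv> {-pi<..<pi}"

text \<open>Functions on the torus are \<open>2\<pi>\<close>-periodic functions on the line.\<close>

definition periodic :: "(real \<Rightarrow> 'b) \<Rightarrow> bool" where
  "periodic u \<longleftrightarrow> (\<forall>x. u (x + 2 * pi) = u x)"

definition in_L2_torus :: "(real \<Rightarrow> 'b::euclidean_space) \<Rightarrow> bool" where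
  "in_L2_torus u \<longleftrightarrow> periodic u \<and> in_Lp 2 cell u"

definition in_H2_torus :: "(real \<Rightarrow> 'b::euclidean_space) \<Rightarrow> bool" where
  "in_H2_torus u \<longleftrightarrow> in_L2_torus u \<and>
     (\<exists>g h. in_L2_torus g \<and> in_L2_torus h \<and> has_weak_deriv UNIV u g \<and> has_weak_deriv UNIV g h)"

definition pairing :: "(real \<Rightarrow> real^'n) \<Rightarrow> (real \<Rightarrow> real^'n) \<Rightarrow> real" where
  "pairing u v = (LINT x|lebesgue_on cell. u x \<bullet> v x)"


section \<open>The periodic pattern and its spectral stability\<close>

abbreviation ddx :: "(real \<Rightarrow> 'b::real_normed_vector) \<Rightarrow> real \<Rightarrow> 'b" where
  "ddx u x \<equiv> vector_derivative u (at x)"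

definition jac :: "(real^'n \<Rightarrow> real^'n) \<Rightarrow> real^'n \<Rightarrow> real^'n^'n" where
  "jac f y = matrix (frechet_derivative f (at y))"

definition periodic_pattern ::
    "nat \<Rightarrow> real^'n^'n \<Rightarrow> (real^'n \<Rightarrow> real^'n) \<Rightarrow> (real \<Rightarrow> real^'n) \<Rightarrow> bool" where
  "periodic_pattern K D f ustar \<longleftrightarrow>
     (\<forall>i j. i \<noteq> j \<longrightarrow> D $ i $ j = 0) \<and> (\<forall>i. D $ i $ i > 0) \<and>
     C_k_on K UNIV f \<and> C_k_on K UNIV ustar \<and>
     (\<forall>x. ustar (-x) = ustar x) \<and> periodic ustar \<and>
     (\<forall>x. ustar differentiable at x \<and> ddx ustar differentiable at x \<and>
          D *v ddx (ddx ustar) x + f (ustar x) = 0)"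

definition cvec :: "real^'n \<Rightarrow> complex^'n" where
  "cvec v = (\<chi> i. complex_of_real (v $ i))"

definition cmat :: "real^'n^'n \<Rightarrow> complex^'n^'n" where
  "cmat A = (\<chi> i j. complex_of_real (A $ i $ j))"

definition bloch_deriv :: "real \<Rightarrow> (real \<Rightarrow> complex^'n) \<Rightarrow> real \<Rightarrow> complex^'n" where
  "bloch_deriv \<sigma> u = (\<lambda>x. weak_deriv UNIV u x + (\<i> * complex_of_real \<sigma>) *s u x)"

definition bloch_op ::
    "real^'n^'n \<Rightarrow> (real^'n \<Rightarrow> real^'n) \<Rightarrow> (real \<Rightarrow> real^'n) \<Rightarrow> real \<Rightarrow>
     (real \<Rightarrow> complex^'n) \<Rightarrow> real \<Rightarrow> complex^'n" where
  "bloch_op D f ustar \<sigma> u =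
     (\<lambda>x. cmat D *v bloch_deriv \<sigma> (bloch_deriv \<sigma> u) x + cmat (jac f (ustar x)) *v u x)"

text \<open>Spectrum of the unbounded operator on \<open>L\<^sup>2\<close> of the torus with domain \<open>H\<^sup>2\<close> of the torus:
  the complement of the points where the shifted operator has a bounded everywhere defined
  inverse (the norm bound contains injectivity).\<close>

definition bloch_spec ::
    "real^'n^'n \<Rightarrow> (real^'n \<Rightarrow> real^'n) \<Rightarrow> (real \<Rightarrow> real^'n) \<Rightarrow> real \<Rightarrow> complex set" where
  "bloch_spec D f ustar \<sigma> = - {z.
     (\<forall>g. in_L2_torus g \<longrightarrow>
        (\<exists>u. in_H2_torus u \<and> (AE x in lebesgue_on cell. bloch_op D f ustar \<sigma> u x - z *s u x = g x))) \<and>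
     (\<exists>M::real. \<forall>u. in_H2_torus u \<longrightarrow>
        Lp_norm 2 cell u \<le> ennreal M * Lp_norm 2 cell (\<lambda>x. bloch_op D f ustar \<sigma> u x - z *s u x))}"

text \<open>Simplicity of the eigenvalue 0 is algebraic simplicity: besides the kernel being spanned by
  the nonzero function \<open>ustar'\<close>, there is no Jordan chain. In the last conjunct \<open>lam\<close> is the
  eigenvalue of the operator at \<open>\<sigma>\<close> that continues 0, that is, the only spectral point near 0.\<close>

definition spectrally_stable ::
    "nat \<Rightarrow> real^'n^'n \<Rightarrow> (real^'n \<Rightarrow> real^'n) \<Rightarrow> (real \<Rightarrow> real^'n) \<Rightarrow> bool" where
  "spectrally_stable K D f ustar \<longleftrightarrow>
     (\<forall>\<sigma>\<in>{-1/2..1/2}. \<sigma> \<noteq> 0 \<longrightarrow> bloch_spec D f ustar \<sigma> \<inter> {z. Re z \<ge> 0} = {}) \<and>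
     bloch_spec D f ustar 0 \<inter> {z. Re z \<ge> 0} = {0} \<and>
     (\<exists>x. ddx ustar x \<noteq> 0) \<and>
     (\<forall>u. in_H2_torus u \<longrightarrow>
        ((AE x in lebesgue_on cell. bloch_op D f ustar 0 u x = 0) \<longleftrightarrow>
         (\<exists>c. AE x in lebesgue_on cell. u x = c *s cvec (ddx ustar x)))) \<and>
     (\<forall>u w. in_H2_torus u \<and> in_H2_torus w \<and>
        (AE x in lebesgue_on cell. bloch_op D f ustar 0 u x = w x) \<and>
        (AE x in lebesgue_on cell. bloch_op D f ustar 0 w x = 0) \<longrightarrow>
        (AE x in lebesgue_on cell. w x = 0)) \<and>
     (\<exists>(lam :: real \<Rightarrow> complex) (d :: real) s r M.
        d > 0 \<and> 0 < s \<and> s \<le> 1/2 \<and> r > 0 \<and> C_k_on K {-s<..<s} lam \<and> lam 0 = 0 \<and>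
        (\<forall>\<sigma>\<in>{-s<..<s}. bloch_spec D f ustar \<sigma> \<inter> ball 0 r = {lam \<sigma>} \<and>
           cmod (lam \<sigma> + complex_of_real (d * \<sigma>\<^sup>2)) \<le> M * \<bar>\<sigma>\<bar> ^ 3))"

text \<open>Kernel of the Hilbert space adjoint of the operator at \<open>\<sigma> = 0\<close>.\<close>

definition in_adjoint_kernel ::
    "real^'n^'n \<Rightarrow> (real^'n \<Rightarrow> real^'n) \<Rightarrow> (real \<Rightarrow> real^'n) \<Rightarrow> (real \<Rightarrow> complex^'n) \<Rightarrow> bool" where
  "in_adjoint_kernel D f ustar v \<longleftrightarrow> in_L2_torus v \<and>
     (\<forall>u. in_H2_torus u \<longrightarrow>
        (LINT x|lebesgue_on cell. (\<Sum>i\<in>UNIV. bloch_op D f ustar 0 u x $ i * cnj (v x $ i))) = 0)"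

text \<open>Continuity selects the representative, which is needed for point values such as
  \<open>uad' \<pi>\<close>.\<close>

definition adjoint_mode ::
    "real^'n^'n \<Rightarrow> (real^'n \<Rightarrow> real^'n) \<Rightarrow> (real \<Rightarrow> real^'n) \<Rightarrow> (real \<Rightarrow> real^'n) \<Rightarrow> bool" where
  "adjoint_mode D f ustar uad \<longleftrightarrow>
     in_adjoint_kernel D f ustar (\<lambda>x. cvec (uad x)) \<and> continuous_on UNIV uad \<and>
     (\<forall>x. uad (-x) = - uad x) \<and> pairing (ddx ustar) uad = 1"


section \<open>Sequence spaces\<close>

definition delta_plus :: "(int \<Rightarrow> 'a::minus) \<Rightarrow> int \<Rightarrow> 'a" where
  "delta_plus a j = a (j + 1) - a j"

definition Xch_norm :: "(int \<Rightarrow> real \<Rightarrow> real^'n) \<Rightarrow> ennreal" where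
  "Xch_norm w = (\<Sum>\<^sub>\<infinity>j. Lp_norm 1 cell (w j)) + (SUP j. Lp_norm \<infinity> cell (w j))"

definition in_Xch_perp :: "(real \<Rightarrow> real^'n) \<Rightarrow> (int \<Rightarrow> real \<Rightarrow> real^'n) \<Rightarrow> bool" where
  "in_Xch_perp uad w \<longleftrightarrow>
     (\<forall>j. w j \<in> borel_measurable (lebesgue_on cell)) \<and> Xch_norm w < \<infinity> \<and>
     (\<forall>j. pairing (w j) uad = 0)"

definition in_X2_perp :: "(real \<Rightarrow> real^'n) \<Rightarrow> (int \<Rightarrow> real \<Rightarrow> real^'n) \<Rightarrow> bool" where
  "in_X2_perp uad v \<longleftrightarrow>
     (\<forall>j. in_Lp 2 cell (v j)) \<and> (\<Sum>\<^sub>\<infinity>j. (Lp_norm 2 cell (v j))\<^sup>2) < \<infinity> \<and>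
     (\<forall>j. pairing (v j) uad = 0)"

definition in_l2 :: "(int \<Rightarrow> real) \<Rightarrow> bool" where
  "in_l2 a \<longleftrightarrow> (\<lambda>j. (a j)\<^sup>2) summable_on UNIV"

text \<open>\<open>glues_to W w\<close>: the function \<open>w\<close> on the line is glued from the pieces \<open>W j\<close> on the closed cells.
  For an admissible \<open>W\<close> it is the continuous representative of an element of \<open>H\<^sup>2\<close>, so that
  the \<open>W j\<close> are \<open>C\<^sup>1\<close> on the closed cell and their boundary values make sense.\<close>

definition glues_to :: "(int \<Rightarrow> real \<Rightarrow> 'b) \<Rightarrow> (real \<Rightarrow> 'b) \<Rightarrow> bool" where
  "glues_to W w \<longleftrightarrow> (\<forall>j. \<forall>x\<in>{-pi..pi}. w (2 * pi * of_int j + x) = W j x)"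

definition admissible ::
    "(real \<Rightarrow> real^'n) \<Rightarrow> (int \<Rightarrow> real) \<Rightarrow> (int \<Rightarrow> real \<Rightarrow> real^'n) \<Rightarrow> bool" where
  "admissible uad \<theta> W \<longleftrightarrow>
     (\<lambda>j. \<bar>\<theta> j\<bar>) summable_on UNIV \<and> in_Xch_perp uad W \<and>
     (\<exists>w. glues_to W w \<and> continuous_on UNIV w \<and> in_H2_line w)"

definition cell_deriv :: "(int \<Rightarrow> real \<Rightarrow> real^'n) \<Rightarrow> int \<Rightarrow> real \<Rightarrow> real^'n" where
  "cell_deriv W j x = vector_derivative (W j) (at x within {-pi..pi})"


section \<open>Phase decomposition\<close>

definition phase_cutoffs ::
    "nat \<Rightarrow> (real \<Rightarrow> real^'n) \<Rightarrow> (real \<Rightarrow> real) \<Rightarrow> (real \<Rightarrow> real^'n) \<Rightarrow> bool" where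
  "phase_cutoffs K uad \<phi> \<psi> \<longleftrightarrow>
     C_k_on K cell \<phi> \<and> (\<forall>x\<in>{-pi..pi}. \<phi> (-x) = - \<phi> x) \<and> mono_on {-pi..pi} \<phi> \<and>
     (\<forall>x\<in>{pi/2<..pi}. \<phi> x = 1/2) \<and> (\<forall>x\<in>{-pi..<-pi/2}. \<phi> x = -1/2) \<and>
     test_function cell \<psi> \<and> (\<forall>x. \<psi> (-x) = - \<psi> x) \<and> pairing \<psi> uad = 1"

definition H1 ::
    "(real \<Rightarrow> real^'n) \<Rightarrow> (real \<Rightarrow> real) \<Rightarrow> (int \<Rightarrow> real) \<Rightarrow> int \<Rightarrow> real \<Rightarrow> real^'n" where
  "H1 ustar \<phi> \<theta> j x =
     (1/2 * \<phi> x) *\<^sub>R (ustar (x - \<theta> (j + 1)) - ustar (x - \<theta> (j - 1))) +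
     (1/4) *\<^sub>R (ustar (x - \<theta> (j + 1)) + ustar (x - \<theta> (j - 1)) - 2 *\<^sub>R ustar (x - \<theta> j))"

definition phase_coeff ::
    "(real \<Rightarrow> real^'n) \<Rightarrow> (real \<Rightarrow> real^'n) \<Rightarrow> (real \<Rightarrow> real) \<Rightarrow>
     (int \<Rightarrow> real) \<Rightarrow> (int \<Rightarrow> real \<Rightarrow> real^'n) \<Rightarrow> int \<Rightarrow> real" where
  "phase_coeff ustar uad \<phi> \<theta> W j =
     - pairing (H1 ustar \<phi> \<theta> j) (\<lambda>x. uad (x - \<theta> j)) -
     pairing (W j) (\<lambda>x. uad (x - \<theta> j) - uad x)"

definition T_phd ::
    "(real \<Rightarrow> real^'n) \<Rightarrow> (real \<Rightarrow> real^'n) \<Rightarrow> (real \<Rightarrow> real) \<Rightarrow> (real \<Rightarrow> real^'n) \<Rightarrow>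
     (int \<Rightarrow> real) \<Rightarrow> (int \<Rightarrow> real \<Rightarrow> real^'n) \<Rightarrow> int \<Rightarrow> real \<Rightarrow> real^'n" where
  "T_phd ustar uad \<phi> \<psi> \<theta> W j x =
     W j x + (H1 ustar \<phi> \<theta> j x + phase_coeff ustar uad \<phi> \<theta> W j *\<^sub>R \<psi> (x - \<theta> j)) +
     ustar (x - \<theta> j) - ustar x"

text \<open>The derivative of the phase decomposition in the direction \<open>(\<eta>, V)\<close>. Each component depends
  on \<open>\<theta>\<close> at \<open>j - 1\<close>, \<open>j\<close>, \<open>j + 1\<close> and on \<open>W j\<close> only, so it is defined for all square summable
  directions.\<close>

definition dT_phd ::
    "(real \<Rightarrow> real^'n) \<Rightarrow> (real \<Rightarrow> real^'n) \<Rightarrow> (real \<Rightarrow> real) \<Rightarrow> (real \<Rightarrow> real^'n) \<Rightarrow>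
     (int \<Rightarrow> real) \<Rightarrow> (int \<Rightarrow> real \<Rightarrow> real^'n) \<Rightarrow>
     (int \<Rightarrow> real) \<Rightarrow> (int \<Rightarrow> real \<Rightarrow> real^'n) \<Rightarrow> int \<Rightarrow> real \<Rightarrow> real^'n" where
  "dT_phd ustar uad \<phi> \<psi> \<theta> W \<eta> V j x =
     vector_derivative
       (\<lambda>s. T_phd ustar uad \<phi> \<psi> (\<lambda>k. \<theta> k + s * \<eta> k) (\<lambda>k y. W k y + s *\<^sub>R V k y) j x) (at 0)"


section \<open>Normal form system\<close>

definition A_ch ::
    "real^'n^'n \<Rightarrow> (real^'n \<Rightarrow> real^'n) \<Rightarrow> (real \<Rightarrow> real^'n) \<Rightarrow>
     (int \<Rightarrow> real \<Rightarrow> real^'n) \<Rightarrow> int \<Rightarrow> real \<Rightarrow> real^'n" where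
  "A_ch D f ustar v j x =
     D *v weak_deriv cell (weak_deriv cell (v j)) x + jac f (ustar x) *v v j x"

definition G ::
    "(real^'n \<Rightarrow> real^'n) \<Rightarrow> (real \<Rightarrow> real^'n) \<Rightarrow>
     (int \<Rightarrow> real \<Rightarrow> real^'n) \<Rightarrow> int \<Rightarrow> real \<Rightarrow> real^'n" where
  "G f ustar v j x = f (ustar x + v j x) - f (ustar x) - jac f (ustar x) *v v j x"

definition Gam ::
    "real^'n^'n \<Rightarrow> (real \<Rightarrow> real^'n) \<Rightarrow> (int \<Rightarrow> real \<Rightarrow> real^'n) \<Rightarrow> int \<Rightarrow> real" where
  "Gam D uad v j = v j (-pi) \<bullet> (D *v ddx uad pi)"

definition E ::
    "(real \<Rightarrow> real^'n) \<Rightarrow> (real \<Rightarrow> real) \<Rightarrow> (real \<Rightarrow> real^'n) \<Rightarrow> int \<Rightarrow> real \<Rightarrow> real^'n" where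
  "E ustar \<phi> \<psi> j x =
     (if j = -1 then (1/4) *\<^sub>R \<psi> x - (1/4 + 1/2 * \<phi> x) *\<^sub>R ddx ustar x
      else if j = 0 then - ((1/2) *\<^sub>R (\<psi> x + ddx ustar x))
      else if j = 1 then (1/4) *\<^sub>R \<psi> x - (1/4 - 1/2 * \<phi> x) *\<^sub>R ddx ustar x
      else 0)"

definition E_conv ::
    "(real \<Rightarrow> real^'n) \<Rightarrow> (real \<Rightarrow> real) \<Rightarrow> (real \<Rightarrow> real^'n) \<Rightarrow>
     (int \<Rightarrow> real) \<Rightarrow> int \<Rightarrow> real \<Rightarrow> real^'n" where
  "E_conv ustar \<phi> \<psi> \<theta> j x = (\<Sum>\<^sub>\<infinity>k. \<theta> k *\<^sub>R E ustar \<phi> \<psi> (j - k) x)"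

definition A_nf_theta ::
    "real^'n^'n \<Rightarrow> (real \<Rightarrow> real^'n) \<Rightarrow> (int \<Rightarrow> real \<Rightarrow> real^'n) \<Rightarrow> int \<Rightarrow> real" where
  "A_nf_theta D uad W = delta_plus (Gam D uad W)"

definition A_nf_w ::
    "real^'n^'n \<Rightarrow> (real^'n \<Rightarrow> real^'n) \<Rightarrow> (real \<Rightarrow> real^'n) \<Rightarrow> (real \<Rightarrow> real^'n) \<Rightarrow>
     (real \<Rightarrow> real) \<Rightarrow> (real \<Rightarrow> real^'n) \<Rightarrow>
     (int \<Rightarrow> real) \<Rightarrow> (int \<Rightarrow> real \<Rightarrow> real^'n) \<Rightarrow> int \<Rightarrow> real \<Rightarrow> real^'n" where
  "A_nf_w D f ustar uad \<phi> \<psi> \<theta> W j x =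
     A_ch D f ustar (E_conv ustar \<phi> \<psi> \<theta>) j x + A_ch D f ustar W j x -
     E_conv ustar \<phi> \<psi> (delta_plus (Gam D uad W)) j x"

text \<open>\<open>(N\<theta>, Nw)\<close> are the nonlinear terms of the normal form system at \<open>(\<theta>, W)\<close>; \<open>Nw\<close> is determined
  up to null sets.\<close>

definition nonlinear_terms ::
    "real^'n^'n \<Rightarrow> (real^'n \<Rightarrow> real^'n) \<Rightarrow> (real \<Rightarrow> real^'n) \<Rightarrow> (real \<Rightarrow> real^'n) \<Rightarrow>
     (real \<Rightarrow> real) \<Rightarrow> (real \<Rightarrow> real^'n) \<Rightarrow>
     (int \<Rightarrow> real) \<Rightarrow> (int \<Rightarrow> real \<Rightarrow> real^'n) \<Rightarrow>
     (int \<Rightarrow> real) \<Rightarrow> (int \<Rightarrow> real \<Rightarrow> real^'n) \<Rightarrow> bool" where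
  "nonlinear_terms D f ustar uad \<phi> \<psi> \<theta> W N\<theta> Nw \<longleftrightarrow>
     (let v = T_phd ustar uad \<phi> \<psi> \<theta> W;
          \<eta> = (\<lambda>j. A_nf_theta D uad W j + N\<theta> j);
          V = (\<lambda>j x. A_nf_w D f ustar uad \<phi> \<psi> \<theta> W j x + Nw j x)
      in in_l2 \<eta> \<and> in_X2_perp uad V \<and>
         (\<forall>j. AE x in lebesgue_on cell.
            dT_phd ustar uad \<phi> \<psi> \<theta> W \<eta> V j x = A_ch D f ustar v j x + G f ustar v j x))"

end

theory Submission imports Defs begin

text \<open>Write u for the pattern and z for the adjoint mode, and fix a cell j with phases a =
  theta_(j+1), b = theta_j, c = theta_(j-1). The profile in this cell is u(x-b) + W + H, and u(.-b)
  is again stationary. Hence the right-hand side of the chopped equation is Fr = D(W''+H'') +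
  f(u(.-b)+W+H) - f(u(.-b)): the linearization at the shifted pattern applied to W+H, plus a Taylor
  remainder Q that is quadratic in W+H.

  Phase component. The coefficient c_j is chosen such that W+H stays orthogonal to z(.-b). Pairing
  the derivative of the decomposition in a direction (eta, V) with z(.-b) therefore removes V, the
  speeds of the neighbouring phases and the speed of c_j, and leaves eta_j (kap - 1) with kap =
  <W+H, z'(.-b)> (\<open>dT_pairing\<close>). Pairing Fr with z(.-b) and integrating by parts twice
  leaves boundary terms and <Q, z(.-b)> (\<open>green\<close>, \<open>Fr_pairing\<close>). Because
  z(pi) = 0, the boundary terms of W are minus the jump of Gamma W, up to errors of size b times the
  jumps of W and W'. At each end of the cell H is half a difference of two translates of u; its
  first-order part is cancelled by the identity (D u'').z = (D u').z' (\<open>wronskian\<close>), so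
  squares of phase differences remain (\<open>unif_bdH\<close>). Dividing by 1 - kap gives the bound
  for N^theta (\<open>unif_N_theta\<close>).

  Profile component. Solving the same equation for V and subtracting the linear part of the normal
  form leaves explicit differences, each controlled by products of small factors or by N^theta in
  the three cells, plus multiples of psi (\<open>remainder_eq\<close>). The unknown multiple of psi
  is determined by orthogonality to z, which V has by membership in its space and the linear part
  has by \<open>Anf_pairing\<close>. The result is a pointwise bound by |W|^2 + |b||W| plus a
  constant of the cell (\<open>unif_PN\<close>); \<open>Lp_norm_dominated\<close> and
  \<open>integral_le_Lp_norm\<close> turn it into L^p bounds whose constants do not depend on p.

  Existence. The same equations, read as definitions, produce the nonlinear terms: the phase
  equation fixes each eta_j from its own cell, and V is what is then left over, with its multiple of
  psi chosen for orthogonality (\<open>solution\<close>). Square summability over the lattice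
  follows because W and its second derivative are in L^2 of the line and theta is in l^1
  (\<open>nonlinear_terms_exist\<close>).

  Regularity. An H^2 function is shown to be C^1 with absolutely continuous derivative
  (\<open>weak_second_derivative_regularity\<close>), and z, given only as a continuous element of
  the adjoint kernel, to be a classical solution of D z'' + f'(u)^T z = 0
  (\<open>adjoint_mode_regular\<close>).

  Uniformity. All cell estimates are proved for an arbitrary family of cells with one constant for
  the whole family (\<open>unif_le\<close>). Taking as family all cells of all sufficiently small
  states gives a single constant (\<open>uniform_bounds\<close>), which serves as C(epsilon) for
  every epsilon.\<close>

section \<open>Functions of class C^k on the line\<close>

lemma C_k_on_cong:
  assumes "open S" "\<And>x. x \<in> S \<Longrightarrow> f x = g x"
  shows "C_k_on k S f \<longleftrightarrow> C_k_on k S g"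
  using assms
proof (induction k arbitrary: f g)
  case 0
  then show ?case by (simp cong: continuous_on_cong)
next
  case (Suc k)
  have d: "f differentiable (at x) \<longleftrightarrow> g differentiable (at x)" if "x \<in> S" for x
    using that Suc.prems has_derivative_transform_within_open[of f _ x UNIV S g] has_derivative_transform_within_open[of g _ x UNIV S f]
    unfolding differentiable_def by auto
  have fd: "frechet_derivative f (at x) = frechet_derivative g (at x)" if "x \<in> S" for x
  proof -
    have "(f has_derivative F) (at x) \<longleftrightarrow> (g has_derivative F) (at x)" for F
      using that Suc.prems has_derivative_transform_within_open[of f F x UNIV S g] has_derivative_transform_within_open[of g F x UNIV S f] by auto
    then show ?thesis by (simp add: frechet_derivative_def)
  qed
  have "f differentiable_on S \<longleftrightarrow> g differentiable_on S"
    using d Suc.prems(1) by (simp add: differentiable_on_eq_differentiable_at)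
  moreover have "C_k_on k S (\<lambda>x. frechet_derivative f (at x) h) \<longleftrightarrow>
      C_k_on k S (\<lambda>x. frechet_derivative g (at x) h)" for h
    using Suc.prems fd by (intro Suc.IH) auto
  ultimately show ?case by simp
qed

lemma C_k_on_linear:
  fixes L :: "'b::real_normed_vector \<Rightarrow> 'c::real_normed_vector"
  assumes "open S" "bounded_linear L" "C_k_on k S f"
  shows "C_k_on k S (\<lambda>x. L (f x))"
  using assms(3)
proof (induction k arbitrary: f)
  case 0
  then show ?case
    using assms(2) by (simp add: linear_continuous_on linear_continuous_on_compose bounded_linear.continuous_on)
next
  case (Suc k)
  have D: "f differentiable (at x)" if "x \<in> S" for x
    using Suc.prems assms(1) that by (simp add: differentiable_on_eq_differentiable_at)
  have D': "((\<lambda>x. L (f x)) has_derivative (\<lambda>h. L (frechet_derivative f (at x) h))) (at x)" if "x \<in> S" for x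
    using bounded_linear.has_derivative[OF assms(2) D[OF that, unfolded frechet_derivative_works]] .
  have "(\<lambda>x. L (f x)) differentiable_on S"
    using D' assms(1) by (auto simp: differentiable_on_eq_differentiable_at differentiable_def)
  moreover have "C_k_on k S (\<lambda>x. frechet_derivative (\<lambda>x. L (f x)) (at x) h)" for h
  proof (subst C_k_on_cong[OF assms(1)])
    show "frechet_derivative (\<lambda>x. L (f x)) (at x) h = L (frechet_derivative f (at x) h)" if "x \<in> S" for x
      using frechet_derivative_at[OF D'[OF that]] by metis
    show "C_k_on k S (\<lambda>x. L (frechet_derivative f (at x) h))"
      using Suc.prems by (intro Suc.IH) simp
  qed
  ultimately show ?case by simp
qed

text \<open>On the line a Frechet derivative is h times its value at 1, so the directional
  derivatives in the recursion of \<open>C_k_on\<close> are all multiples of one function. This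
  replaces the recursion by ordinary iterated derivatives; the closure properties on the line rest
  on it.\<close>

lemma C_k_on_Suc_real:
  fixes f :: "real \<Rightarrow> 'b::real_normed_vector"
  assumes "open S"
  shows "C_k_on (Suc k) S f \<longleftrightarrow>
    (\<exists>f'. (\<forall>x\<in>S. (f has_vector_derivative f' x) (at x)) \<and> C_k_on k S f')"
proof
  assume L: "C_k_on (Suc k) S f"
  have "(f has_vector_derivative frechet_derivative f (at x) 1) (at x)" if "x \<in> S" for x
  proof -
    have "(f has_derivative frechet_derivative f (at x)) (at x)"
      using L assms that by (simp add: differentiable_on_eq_differentiable_at frechet_derivative_works[symmetric])
    moreover from this have "frechet_derivative f (at x) = (\<lambda>h. h *\<^sub>R frechet_derivative f (at x) 1)"
      by (metis has_derivative_bounded_linear linear_simps(5) mult.right_neutral real_scaleR_def)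
    ultimately show ?thesis by (simp add: has_vector_derivative_def)
  qed
  with L show "\<exists>f'. (\<forall>x\<in>S. (f has_vector_derivative f' x) (at x)) \<and> C_k_on k S f'"
    by (intro exI[of _ "\<lambda>x. frechet_derivative f (at x) 1"]) simp
next
  assume "\<exists>f'. (\<forall>x\<in>S. (f has_vector_derivative f' x) (at x)) \<and> C_k_on k S f'"
  then obtain f' where f': "\<And>x. x \<in> S \<Longrightarrow> (f has_vector_derivative f' x) (at x)" "C_k_on k S f'" by auto
  have "f differentiable_on S"
    using f'(1) assms by (meson differentiable_at_withinI differentiable_on_def differentiable_def has_vector_derivative_def)
  moreover have "C_k_on k S (\<lambda>x. frechet_derivative f (at x) h)" for h
  proof (subst C_k_on_cong[OF assms])
    show "frechet_derivative f (at x) h = h *\<^sub>R f' x" if "x \<in> S" for x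
      using frechet_derivative_at[OF f'(1)[OF that, unfolded has_vector_derivative_def]] by metis
    show "C_k_on k S (\<lambda>x. h *\<^sub>R f' x)"
      using f'(2) by (rule C_k_on_linear[OF assms bounded_linear_scaleR_right])
  qed
  ultimately show "C_k_on (Suc k) S f" by simp
qed

lemma C_k_on_SucI:
  fixes f :: "real \<Rightarrow> 'b::real_normed_vector"
  assumes "open S" "\<And>x. x \<in> S \<Longrightarrow> (f has_vector_derivative f' x) (at x)" "C_k_on k S f'"
  shows "C_k_on (Suc k) S f"
  unfolding C_k_on_Suc_real[OF assms(1)] using assms(2,3) by (intro exI[of _ f']) simp

lemma C_k_on_SucE:
  fixes f :: "real \<Rightarrow> 'b::real_normed_vector"
  assumes "open S" "C_k_on (Suc k) S f"
  obtains f' where "\<forall>x\<in>S. (f has_vector_derivative f' x) (at x)" "C_k_on k S f'"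
  using assms(2) unfolding C_k_on_Suc_real[OF assms(1)] by (elim exE conjE)

lemma C_k_on_SucE_UNIV:
  fixes f :: "real \<Rightarrow> 'b::real_normed_vector"
  assumes "C_k_on (Suc k) UNIV f"
  obtains f' where "\<forall>x. (f has_vector_derivative f' x) (at x)" "C_k_on k UNIV f'"
  using assms unfolding C_k_on_Suc_real[OF open_UNIV] ball_UNIV by (elim exE conjE)

lemma C_k_on_Suc_imp:
  fixes f :: "real \<Rightarrow> 'b::real_normed_vector"
  assumes "open S"
  shows "C_k_on (Suc k) S f \<Longrightarrow> C_k_on k S f"
proof (induction k arbitrary: f)
  case 0
  then show ?case by (simp add: differentiable_imp_continuous_on)
next
  case (Suc k)
  obtain f' where f':
    "\<forall>x\<in>S. (f has_vector_derivative f' x) (at x)" "C_k_on (Suc k) S f'"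
    by (rule C_k_on_SucE[OF assms Suc.prems])
  show ?case by (rule C_k_on_SucI[OF assms bspec[OF f'(1)] Suc.IH[OF f'(2)]])
qed

lemma C_k_on_add:
  fixes f g :: "real \<Rightarrow> 'b::real_normed_vector"
  assumes "open S" "C_k_on k S f" "C_k_on k S g"
  shows "C_k_on k S (\<lambda>x. f x + g x)"
  using assms(2,3)
proof (induction k arbitrary: f g)
  case 0
  then show ?case by (simp add: continuous_on_add)
next
  case (Suc k)
  obtain f' where f': "\<forall>x\<in>S. (f has_vector_derivative f' x) (at x)" "C_k_on k S f'"
    by (rule C_k_on_SucE[OF assms(1) Suc.prems(1)])
  obtain g' where g': "\<forall>x\<in>S. (g has_vector_derivative g' x) (at x)" "C_k_on k S g'"
    by (rule C_k_on_SucE[OF assms(1) Suc.prems(2)])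
  have "((\<lambda>x. f x + g x) has_vector_derivative f' x + g' x) (at x)" if "x \<in> S" for x
    using f'(1) g'(1) that by (intro has_vector_derivative_add) simp_all
  then show ?case by (rule C_k_on_SucI[OF assms(1) _ Suc.IH[OF f'(2) g'(2)]])
qed

lemma C_k_on_mult:
  fixes f g :: "real \<Rightarrow> real"
  assumes "open S" "C_k_on k S f" "C_k_on k S g"
  shows "C_k_on k S (\<lambda>x. f x * g x)"
  using assms(2,3)
proof (induction k arbitrary: f g)
  case 0
  then show ?case by (simp add: continuous_on_mult)
next
  case (Suc k)
  obtain f' where f': "\<forall>x\<in>S. (f has_vector_derivative f' x) (at x)" "C_k_on k S f'"
    by (rule C_k_on_SucE[OF assms(1) Suc.prems(1)])
  obtain g' where g': "\<forall>x\<in>S. (g has_vector_derivative g' x) (at x)" "C_k_on k S g'"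
    by (rule C_k_on_SucE[OF assms(1) Suc.prems(2)])
  have "C_k_on k S (\<lambda>x. f x * g' x)" "C_k_on k S (\<lambda>x. f' x * g x)"
    using Suc.IH Suc.prems[THEN C_k_on_Suc_imp[OF assms(1)]] f'(2) g'(2) by simp_all
  then have "C_k_on k S (\<lambda>x. f x * g' x + f' x * g x)" by (rule C_k_on_add[OF assms(1)])
  moreover have "((\<lambda>x. f x * g x) has_vector_derivative f x * g' x + f' x * g x) (at x)" if "x \<in> S" for x
    using f'(1) g'(1) that by (intro has_vector_derivative_mult) simp_all
  ultimately show ?case by (rule C_k_on_SucI[OF assms(1), rotated])
qed

lemma C_k_on_affine:
  fixes f :: "real \<Rightarrow> 'b::real_normed_vector"
  assumes "C_k_on k UNIV f"
  shows "C_k_on k UNIV (\<lambda>x. f (m * x + c))"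
  using assms
proof (induction k arbitrary: f)
  case 0
  then show ?case by (auto intro!: continuous_on_compose2[of UNIV f] continuous_intros)
next
  case (Suc k)
  obtain f' where f': "\<forall>x. (f has_vector_derivative f' x) (at x)" "C_k_on k UNIV f'"
    by (rule C_k_on_SucE_UNIV[OF Suc.prems])
  have "((\<lambda>x. f (m * x + c)) has_vector_derivative m *\<^sub>R f' (m * x + c)) (at x)" for x :: real
    by (rule vector_diff_chain_at[of "\<lambda>x. m * x + c" m x f, unfolded o_def])
      (auto intro!: derivative_eq_intros f'(1)[rule_format] simp: has_real_derivative_iff_has_vector_derivative[symmetric])
  moreover have "C_k_on k UNIV (\<lambda>x. m *\<^sub>R f' (m * x + c))"
    by (rule C_k_on_linear[OF open_UNIV bounded_linear_scaleR_right]) (rule Suc.IH[OF f'(2)])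
  ultimately show ?case by (rule C_k_on_SucI[OF open_UNIV])
qed

section \<open>Smooth bumps and test functions\<close>

text \<open>Differentiating \<open>exp (-1/x) / x\<^sup>n\<close> raises \<open>n\<close>, so the whole family is treated at once.\<close>

definition flat_exp :: "nat \<Rightarrow> real \<Rightarrow> real" where
  "flat_exp n x = (if x > 0 then exp (- 1 / x) / x ^ n else 0)"

text \<open>With y = 1/x the right limit is that of y^n / exp y at infinity; on the left the
  function is identically zero.\<close>

lemma flat_exp_tendsto: "(flat_exp n \<longlongrightarrow> 0) (at 0)"
proof -
  have "((\<lambda>y::real. y ^ n / exp y) \<longlongrightarrow> 0) at_top"
    by (rule tendsto_power_div_exp_0)
  then have "((\<lambda>x::real. inverse x ^ n / exp (inverse x)) \<longlongrightarrow> 0) (at_right 0)"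
    by (rule filterlim_compose[OF _ filterlim_inverse_at_top_right])
  then have "(flat_exp n \<longlongrightarrow> 0) (at_right 0)"
    by (rule Lim_transform_eventually)
      (auto simp: eventually_at_filter flat_exp_def exp_minus field_simps)
  moreover have "(flat_exp n \<longlongrightarrow> 0) (at_left 0)"
    by (rule tendsto_eventually) (auto simp: eventually_at_filter flat_exp_def)
  ultimately show ?thesis by (simp add: filterlim_at_split)
qed

lemma flat_exp_has_derivative:
  "(flat_exp n has_vector_derivative flat_exp (n + 2) x - real n * flat_exp (n + 1) x) (at x)"
proof -
  consider "x > 0" | "x < 0" | "x = 0" by linarith
  then show ?thesis
  proof cases
    case 1
    have "((\<lambda>x. exp (- 1 / x) / x ^ n) has_real_derivative
        flat_exp (n + 2) x - real n * flat_exp (n + 1) x) (at x)"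
    proof -
      have "((\<lambda>x. exp (- 1 / x)) has_real_derivative exp (- 1 / x) / x\<^sup>2) (at x)"
        using 1 by (auto intro!: derivative_eq_intros simp: power2_eq_square)
      from DERIV_divide[OF this DERIV_pow[of n x]] 1
      have "((\<lambda>x. exp (- 1 / x) / x ^ n) has_real_derivative
          (exp (- 1 / x) / x\<^sup>2 * x ^ n - exp (- 1 / x) * (real n * x ^ (n - Suc 0))) / (x ^ n * x ^ n)) (at x)"
        by simp
      also have "(exp (- 1 / x) / x\<^sup>2 * x ^ n - exp (- 1 / x) * (real n * x ^ (n - Suc 0))) / (x ^ n * x ^ n) =
          flat_exp (n + 2) x - real n * flat_exp (n + 1) x"
        using 1 by (cases n) (simp_all add: flat_exp_def field_simps power2_eq_square)
      finally show ?thesis .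
    qed
    then have "(flat_exp n has_real_derivative
        flat_exp (n + 2) x - real n * flat_exp (n + 1) x) (at x)"
      by (rule has_field_derivative_transform_within_open[where S="{0<..}"])
        (use 1 in \<open>auto simp: flat_exp_def\<close>)
    then show ?thesis by (simp add: has_real_derivative_iff_has_vector_derivative)
  next
    case 2
    have "(flat_exp n has_real_derivative 0) (at x)"
      by (rule has_field_derivative_transform_within_open[where S="{..<0}" and f="\<lambda>x. 0"])
        (use 2 in \<open>auto simp: flat_exp_def\<close>)
    with 2 show ?thesis by (simp add: has_real_derivative_iff_has_vector_derivative flat_exp_def)
  next
    case 3
    \<comment> \<open>At the origin the difference quotient of \<open>flat_exp n\<close> is
      \<open>flat_exp (Suc n)\<close> itself, whose limit is already known.\<close>
    have "((\<lambda>h. (flat_exp n h - flat_exp n 0) / (h - 0)) \<longlongrightarrow> 0) (at 0)"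
      by (rule Lim_transform_eventually[OF flat_exp_tendsto[of "Suc n"]])
        (auto simp: eventually_at_filter flat_exp_def)
    then have "(flat_exp n has_real_derivative 0) (at 0)"
      by (simp add: has_field_derivative_iff)
    with 3 show ?thesis by (simp add: has_real_derivative_iff_has_vector_derivative flat_exp_def)
  qed
qed

lemma flat_exp_smooth: "C_k_on k UNIV (flat_exp n)"
proof (induction k arbitrary: n)
  case 0
  have "isCont (flat_exp n) x" for x
    using flat_exp_has_derivative has_vector_derivative_continuous by blast
  then show ?case by (simp add: continuous_at_imp_continuous_on)
next
  case (Suc k)
  have "C_k_on k UNIV (\<lambda>x. flat_exp (n + 2) x + (- real n) *\<^sub>R flat_exp (n + 1) x)"
    by (intro C_k_on_add open_UNIV Suc.IH C_k_on_linear[OF open_UNIV bounded_linear_scaleR_right])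
  then show ?case
    by (rule C_k_on_SucI[OF open_UNIV, rotated]) (use flat_exp_has_derivative[of n] in simp)
qed

text \<open>The factor \<open>Suc n\<close> drives both exponentials to 1 inside the interval, so
  these are smooth functions below 1 that converge pointwise to the indicator of the open interval,
  ready for dominated convergence.\<close>

definition interval_bump :: "real \<Rightarrow> real \<Rightarrow> nat \<Rightarrow> real \<Rightarrow> real" where
  "interval_bump a b n x = flat_exp 0 (real (Suc n) * (x - a)) * flat_exp 0 (real (Suc n) * (b - x))"

lemma interval_bump_smooth: "C_k_on k UNIV (interval_bump a b n)"
proof -
  have "C_k_on k UNIV (\<lambda>x. flat_exp 0 (real (Suc n) * x + (- real (Suc n) * a)) *
      flat_exp 0 ((- real (Suc n)) * x + real (Suc n) * b))"
    by (intro C_k_on_mult open_UNIV C_k_on_affine flat_exp_smooth)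
  moreover have "m * x + (- m * a) = m * (x - a)" "(- m) * x + m * b = m * (b - x)" for m x :: real
    by algebra+
  ultimately show ?thesis unfolding interval_bump_def[abs_def] by (simp only:)
qed

lemma flat_exp_0_bounds: "0 \<le> flat_exp 0 y" "flat_exp 0 y \<le> 1" "0 < flat_exp 0 y \<longleftrightarrow> 0 < y"
  by (simp_all add: flat_exp_def)

lemma interval_bump_bounds: "0 \<le> interval_bump a b n x" "interval_bump a b n x \<le> 1"
  unfolding interval_bump_def by (intro mult_nonneg_nonneg mult_le_one flat_exp_0_bounds)+

lemma interval_bump_pos: "x \<in> {a<..<b} \<Longrightarrow> 0 < interval_bump a b n x"
  unfolding interval_bump_def by (intro mult_pos_pos) (simp_all add: flat_exp_0_bounds)

lemma interval_bump_eq_0: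
  assumes "x \<notin> {a<..<b}"
  shows "interval_bump a b n x = 0"
proof -
  have "real (Suc n) * (x - a) \<le> 0 \<or> real (Suc n) * (b - x) \<le> 0"
    using assms by (auto simp: mult_le_0_iff)
  then show ?thesis by (auto simp: interval_bump_def flat_exp_def)
qed

lemma interval_bump_LIMSEQ:
  "(\<lambda>n. interval_bump a b n x) \<longlonglongrightarrow> indicat_real {a<..<b} x"
proof (cases "x \<in> {a<..<b}")
  case True
  have *: "(\<lambda>n. flat_exp 0 (real (Suc n) * y)) \<longlonglongrightarrow> 1" if "y > 0" for y
  proof -
    have "(\<lambda>n. exp (- (1 / y) * inverse (real (Suc n)))) \<longlonglongrightarrow> exp (- (1 / y) * 0)"
      by (intro tendsto_intros LIMSEQ_inverse_real_of_nat)
    moreover have "exp (- (1 / y) * inverse (real (Suc n))) = flat_exp 0 (real (Suc n) * y)" for n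
      using that by (simp add: flat_exp_def zero_less_mult_iff field_simps del: of_nat_Suc)
    ultimately show ?thesis by simp
  qed
  have "(\<lambda>n. interval_bump a b n x) \<longlonglongrightarrow> 1 * 1"
    unfolding interval_bump_def using True by (intro tendsto_mult *) auto
  with True show ?thesis by simp
next
  case False
  then show ?thesis by (simp add: interval_bump_eq_0)
qed

lemma test_functionD:
  assumes "test_function S \<tau>"
  shows "C_k_on k UNIV \<tau>" "compact (closure {x. \<tau> x \<noteq> 0})" "closure {x. \<tau> x \<noteq> 0} \<subseteq> S"
  using assms by (simp_all only: test_function_def)

lemma test_functionI:
  fixes \<tau> :: "real \<Rightarrow> 'b::real_normed_vector"
  assumes "\<And>k. C_k_on k UNIV \<tau>" "\<And>x. x \<notin> {a..b} \<Longrightarrow> \<tau> x = 0" "{a..b} \<subseteq> S"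
  shows "test_function S \<tau>"
proof -
  have c: "closure {x. \<tau> x \<noteq> 0} \<subseteq> {a..b}"
  proof (rule closure_minimal)
    show "{x. \<tau> x \<noteq> 0} \<subseteq> {a..b}" using assms(2) by blast
  qed simp
  then have "compact (closure {x. \<tau> x \<noteq> 0})"
    using compact_Int_closed[OF compact_Icc closed_closure, of a b "{x. \<tau> x \<noteq> 0}"]
    by (simp add: Int_absorb1)
  then show ?thesis
    unfolding test_function_def using order_trans[OF c assms(3)] by (intro conjI allI assms(1))
qed

lemma test_function_interval_bump:
  assumes "{a..b} \<subseteq> S"
  shows "test_function S (interval_bump a b n)"
proof (rule test_functionI[OF interval_bump_smooth _ assms])
  show "interval_bump a b n x = 0" if "x \<notin> {a..b}" for x
    by (rule interval_bump_eq_0) (use that in auto)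
qed

lemma test_function_support:
  assumes "test_function {l<..<r} (\<tau> :: real \<Rightarrow> 'b::real_normed_vector)" "l < r"
  obtains a b where "l < a" "a < b" "b < r" "\<And>x. x \<notin> {a..b} \<Longrightarrow> \<tau> x = 0"
proof -
  define C where "C = closure {x. \<tau> x \<noteq> 0}"
  \<comment> \<open>The midpoint keeps \<open>K\<close> nonempty when \<open>\<tau>\<close> vanishes
    identically, so that a least and a greatest point exist.\<close>
  define K where "K = insert ((l + r)/2) C"
  note C = test_functionD(2,3)[OF assms(1), folded C_def]
  have CI: "x \<in> C" if "\<tau> x \<noteq> 0" for x
    unfolding C_def by (rule subsetD[OF closure_subset]) (rule CollectI, rule that)
  have "(l + r)/2 \<in> {l<..<r}" using assms(2) by auto
  with C have K: "compact K" "K \<noteq> {}" "K \<subseteq> {l<..<r}"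
    by (simp_all add: K_def compact_insert)
  obtain a where a: "a \<in> K" "\<forall>x\<in>K. a \<le> x" using compact_attains_inf[OF K(1,2)] by blast
  obtain b where b: "b \<in> K" "\<forall>x\<in>K. x \<le> b" using compact_attains_sup[OF K(1,2)] by blast
  have K': "l < a" "b < r" "a \<le> b" using K(3) a b by auto
  \<comment> \<open>\<open>K\<close> may be a single point; moving the right end halfway towards
    \<open>r\<close> makes the interval nondegenerate and still keeps it inside.\<close>
  have z: "\<tau> x = 0" if x: "x \<notin> {a..(b + r)/2}" for x
  proof (rule ccontr)
    assume "\<tau> x \<noteq> 0"
    then have "x \<in> K" using CI by (simp add: K_def)
    with a b x K' show False by force
  qed
  show thesis
    by (rule that[of a "(b + r)/2", OF _ _ _ z]) (use K' in simp_all)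
qed

lemma test_function_support_UNIV:
  assumes "test_function S (\<tau> :: real \<Rightarrow> 'b::real_normed_vector)"
  obtains a b where "a < b" "\<And>x. x \<notin> {a..b} \<Longrightarrow> \<tau> x = 0"
proof -
  have "bounded {x. \<tau> x \<noteq> 0}"
    using compact_imp_bounded[OF test_functionD(2)[OF assms]] closure_subset by (rule bounded_subset)
  then obtain B where B: "\<forall>x\<in>{x. \<tau> x \<noteq> 0}. norm x \<le> B" unfolding bounded_iff ..
  have z: "\<tau> x = 0" if "x \<notin> {-\<bar>B\<bar>-1..\<bar>B\<bar>+1}" for x
  proof (rule ccontr)
    assume "\<tau> x \<noteq> 0"
    then have "\<bar>x\<bar> \<le> B" using B by simp
    with that show False by auto
  qed
  have "-\<bar>B\<bar>-1 < \<bar>B\<bar>+1" by simp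
  from that[OF this z] show thesis .
qed

lemma test_function_derivative:
  assumes "test_function S (\<tau> :: real \<Rightarrow> real)"
  shows "(\<tau> has_real_derivative deriv \<tau> x) (at x)" "continuous_on UNIV \<tau>" "continuous_on UNIV (deriv \<tau>)"
proof -
  have "C_k_on (Suc 0) UNIV \<tau>" by (rule test_functionD(1)[OF assms])
  then obtain g where g: "\<forall>x. (\<tau> has_vector_derivative g x) (at x)" "continuous_on UNIV g"
    by (rule C_k_on_SucE_UNIV) simp
  have "deriv \<tau> = g"
    using g(1) by (intro ext DERIV_imp_deriv) (simp add: has_real_derivative_iff_has_vector_derivative)
  with g show "(\<tau> has_real_derivative deriv \<tau> x) (at x)" "continuous_on UNIV (deriv \<tau>)"
    by (auto simp: has_real_derivative_iff_has_vector_derivative)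
  show "continuous_on UNIV \<tau>"
    using g(1) by (meson continuous_at_imp_continuous_on has_vector_derivative_continuous)
qed

text \<open>The primitive started at the left end returns to zero beyond \<open>b\<close> exactly
  because the total integral vanishes, and is therefore again compactly supported. This supplies
  test functions with a prescribed derivative for the proof that a function with zero weak
  derivative is constant.\<close>

lemma test_function_primitive:
  fixes k :: "real \<Rightarrow> real"
  assumes "test_function UNIV k" "integral {a..b} k = 0" "\<And>x. x \<notin> {a..b} \<Longrightarrow> k x = 0" "a < b"
  obtains \<tau> where "test_function UNIV \<tau>" "\<And>x. (\<tau> has_real_derivative k x) (at x)" "deriv \<tau> = k"
    "\<And>x. x \<notin> {a..b} \<Longrightarrow> \<tau> x = 0"
proof -
  have k: "continuous_on UNIV k" using test_function_derivative(2)[OF assms(1)] .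
  define \<tau> where "\<tau> x = (if x \<le> a then 0 else integral {a..x} k)" for x
  have int: "k integrable_on {u..v}" for u v
    using k continuous_on_subset integrable_continuous_real by blast
  \<comment> \<open>Starting the integral at \<open>a - 1\<close> gives a single formula on both
    sides of \<open>a\<close>, so that the derivative at \<open>a\<close> itself follows from the
    fundamental theorem.\<close>
  have tb: "\<tau> x = integral {a - 1..x} k" if "x \<ge> a - 1" for x
  proof -
    have z: "integral {a - 1..y} k = 0" if "y \<le> a" for y
    proof -
      have "integral {a - 1..y} k = integral {a - 1..y} (\<lambda>x. 0)"
        by (rule integral_spike[of "{a}"]) (use that assms(3) in auto)
      then show ?thesis by simp
    qed
    show ?thesis
    proof (cases "x \<le> a")
      case False
      then have "integral {a - 1..a} k + integral {a..x} k = integral {a - 1..x} k"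
        by (intro Henstock_Kurzweil_Integration.integral_combine int) auto
      with z[of a] False show ?thesis by (simp add: \<tau>_def)
    qed (simp add: \<tau>_def z)
  qed
  have d: "(\<tau> has_vector_derivative k x) (at x)" for x
  proof (cases "x < a")
    case True
    have "((\<lambda>x. 0) has_vector_derivative 0) (at x)" by (rule has_vector_derivative_const)
    then have "(\<tau> has_vector_derivative 0) (at x)"
      by (rule has_vector_derivative_transform_within_open[where S="{..<a}"]) (use True in \<open>auto simp: \<tau>_def\<close>)
    with True assms(3) show ?thesis by auto
  next
    case False
    have "((\<lambda>u. integral {a - 1..u} k) has_vector_derivative k x) (at x within {a - 1..x + 1})"
      using False by (intro integral_has_vector_derivative continuous_on_subset[OF k]) auto
    moreover have "at x within {a - 1..x + 1} = at x"
      by (rule at_within_interior) (use False in \<open>simp add: interior_atLeastAtMost_real\<close>)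
    ultimately have "((\<lambda>u. integral {a - 1..u} k) has_vector_derivative k x) (at x)"
      by (simp only:)
    then show ?thesis
      by (rule has_vector_derivative_transform_within_open[where S="{a - 1<..}"]) (use False tb in auto)
  qed
  have z: "\<tau> x = 0" if "x \<notin> {a..b}" for x
  proof (cases "x \<le> a")
    case False
    then have x: "x > b" using that by auto
    then have "integral {a..b} k + integral {b..x} k = integral {a..x} k"
      using assms(4) by (intro Henstock_Kurzweil_Integration.integral_combine int) auto
    moreover have "integral {b..x} k = integral {b..x} (\<lambda>x. 0)"
      by (rule integral_spike[of "{b}"]) (use assms(3) in auto)
    ultimately show ?thesis using False assms(2) by (simp add: \<tau>_def)
  qed (simp add: \<tau>_def)
  have "C_k_on (Suc m) UNIV \<tau>" for m
    by (rule C_k_on_SucI[OF open_UNIV d test_functionD(1)[OF assms(1)]])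
  then have "C_k_on m UNIV \<tau>" for m by (rule C_k_on_Suc_imp[OF open_UNIV])
  then have t: "test_function UNIV \<tau>" by (rule test_functionI[OF _ z subset_UNIV])
  have d': "(\<tau> has_real_derivative k x) (at x)" for x
    using d by (simp add: has_real_derivative_iff_has_vector_derivative)
  then have "deriv \<tau> = k" by (intro ext DERIV_imp_deriv)
  from that[OF t d' this z] show thesis .
qed

section \<open>Integration by parts for absolutely continuous functions\<close>

text \<open>The increment of \<open>\<Phi>\<close> tends to zero by continuity, so the bound is
  \<open>y - x\<close> times a vanishing quantity.\<close>

lemma has_vector_derivative_zero_if_lipschitz_small:
  fixes F :: "real \<Rightarrow> 'c::real_normed_vector"
  assumes F: "\<And>x y. a \<le> x \<Longrightarrow> x \<le> y \<Longrightarrow> y \<le> b \<Longrightarrow> norm (F y - F x) \<le> C * (y - x) * (\<Phi> y - \<Phi> x)"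
    and \<Phi>: "continuous_on {a..b} \<Phi>" and x: "x \<in> {a..b}"
  shows "(F has_vector_derivative 0) (at x within {a..b})"
proof -
  have bound: "norm (F y - F x) \<le> \<bar>C\<bar> * \<bar>y - x\<bar> * \<bar>\<Phi> y - \<Phi> x\<bar>" if "y \<in> {a..b}" for y
  proof (cases "x \<le> y")
    case True
    have "norm (F y - F x) \<le> C * (y - x) * (\<Phi> y - \<Phi> x)"
      using F[of x y] that x True by simp
    also have "\<dots> \<le> \<bar>C * (y - x) * (\<Phi> y - \<Phi> x)\<bar>" by (rule abs_ge_self)
    finally show ?thesis by (simp add: abs_mult)
  next
    case False
    have "norm (F x - F y) \<le> C * (x - y) * (\<Phi> x - \<Phi> y)"
      using F[of y x] that x False by simp
    also have "\<dots> \<le> \<bar>C * (x - y) * (\<Phi> x - \<Phi> y)\<bar>" by (rule abs_ge_self)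
    finally show ?thesis by (simp add: abs_mult norm_minus_commute abs_minus_commute)
  qed
  have lim: "((\<lambda>y. \<bar>C\<bar> * \<bar>\<Phi> y - \<Phi> x\<bar>) \<longlongrightarrow> 0) (at x within {a..b})"
  proof -
    have "(\<Phi> \<longlongrightarrow> \<Phi> x) (at x within {a..b})"
      using \<Phi> x by (simp add: continuous_on_def)
    then have "((\<lambda>y. \<bar>C\<bar> * \<bar>\<Phi> y - \<Phi> x\<bar>) \<longlongrightarrow> \<bar>C\<bar> * \<bar>\<Phi> x - \<Phi> x\<bar>) (at x within {a..b})"
      by (intro tendsto_intros)
    then show ?thesis by simp
  qed
  have "((\<lambda>y. norm (F y - F x) / norm (y - x)) \<longlongrightarrow> 0) (at x within {a..b})"
  proof (rule Lim_null_comparison[OF _ lim])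
    have "norm (norm (F y - F x) / norm (y - x)) \<le> \<bar>C\<bar> * \<bar>\<Phi> y - \<Phi> x\<bar>" if "y \<in> {a..b}" "y \<noteq> x" for y
      using bound[OF that(1)] that(2) by (simp add: divide_le_eq mult.commute mult.left_commute)
    then show "\<forall>\<^sub>F y in at x within {a..b}. norm (norm (F y - F x) / norm (y - x)) \<le> \<bar>C\<bar> * \<bar>\<Phi> y - \<Phi> x\<bar>"
      unfolding eventually_at_filter by (intro always_eventually) blast
  qed
  then have "((\<lambda>y. norm ((1 / norm (y - x)) *\<^sub>R (F y - (F x + (y - x) *\<^sub>R 0)))) \<longlongrightarrow> 0) (at x within {a..b})"
    by simp
  then have "((\<lambda>y. (1 / norm (y - x)) *\<^sub>R (F y - (F x + (y - x) *\<^sub>R 0))) \<longlongrightarrow> 0) (at x within {a..b})"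
    by (rule tendsto_norm_zero_cancel)
  then show ?thesis
    unfolding has_vector_derivative_def has_derivative_within
    by (simp add: bounded_linear_zero)
qed

text \<open>The defect of the integration by parts formula on \<open>[x, y]\<close> is bounded by \<open>y - x\<close> times the
  integral of \<open>norm h\<close>, so it has derivative zero although \<open>H\<close> is only absolutely continuous.\<close>

lemma integral_by_parts_primitive:
  fixes h H :: "real \<Rightarrow> 'a::euclidean_space" and e e' :: "real \<Rightarrow> 'b::euclidean_space"
    and prod :: "'a \<Rightarrow> 'b \<Rightarrow> 'c::euclidean_space"
  assumes bil: "bounded_bilinear prod" and ab: "a \<le> b"
    and h: "h absolutely_integrable_on {a..b}"
    and H: "\<And>x. x \<in> {a..b} \<Longrightarrow> H x - H a = integral {a..x} h"
    and e: "\<And>x. x \<in> {a..b} \<Longrightarrow> (e has_vector_derivative e' x) (at x within {a..b})"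
    and e': "continuous_on {a..b} e'"
  shows "(\<lambda>x. prod (h x) (e x)) absolutely_integrable_on {a..b}"
    "integral {a..b} (\<lambda>x. prod (h x) (e x)) =
      prod (H b) (e b) - prod (H a) (e a) - integral {a..b} (\<lambda>x. prod (H x) (e' x))"
proof -
  interpret bounded_bilinear prod by (rule bil)
  obtain K where K: "\<And>u v. norm (prod u v) \<le> norm u * norm v * K" and K0: "0 \<le> K"
    using nonneg_bounded by blast
  have ce: "continuous_on {a..b} e"
    using e by (meson continuous_on_eq_continuous_within has_vector_derivative_continuous)
  obtain M where "\<forall>y\<in>e' ` {a..b}. norm y \<le> M"
    using compact_imp_bounded[OF compact_continuous_image[OF e' compact_Icc]] unfolding bounded_iff ..
  then have M: "norm (e' x) \<le> M" if "x \<in> {a..b}" for x using that by blast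
  have M0: "0 \<le> M" using M[of a] ab norm_ge_zero[of "e' a"] by (meson atLeastAtMost_iff order_refl order_trans)
  have sub: "f integrable_on {x..y}" if "f integrable_on {a..b}" "a \<le> x" "y \<le> b" for f :: "real \<Rightarrow> 'd::euclidean_space" and x y
    using that by (intro integrable_on_subinterval[OF that(1)]) auto
  have hi: "h integrable_on {a..b}" and hn: "(\<lambda>x. norm (h x)) integrable_on {a..b}"
    using h by (auto simp: absolutely_integrable_on_def)
  have cH: "continuous_on {a..b} H"
  proof -
    have "continuous_on {a..b} (\<lambda>x. H a + integral {a..x} h)"
      by (intro continuous_intros indefinite_integral_continuous_1 hi)
    then show ?thesis
      by (rule continuous_on_eq) (simp add: H[symmetric])
  qed
  have bb: "bilinear (\<lambda>u v. prod v u)" unfolding bilinear_conv_bounded_bilinear by (rule flip)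
  have ai: "(\<lambda>x. prod (h x) (g x)) absolutely_integrable_on {a..b}" if "continuous_on {a..b} g" for g
  proof -
    have "g \<in> borel_measurable (lebesgue_on {a..b})"
      by (rule continuous_imp_measurable_on_sets_lebesgue[OF that]) simp
    moreover have "bounded (g ` {a..b})"
      using compact_imp_bounded[OF compact_continuous_image[OF that compact_Icc]] .
    ultimately show ?thesis
      using absolutely_integrable_bounded_measurable_product[OF bb _ _ _ h] by simp
  qed
  show "(\<lambda>x. prod (h x) (e x)) absolutely_integrable_on {a..b}" by (rule ai[OF ce])
  have i1: "(\<lambda>x. prod (h x) (g x)) integrable_on {a..b}" if "continuous_on {a..b} g" for g
    using ai[OF that] by (simp add: absolutely_integrable_on_def)
  have i2: "(\<lambda>x. prod (G x) (e' x)) integrable_on {a..b}" if "continuous_on {a..b} G" for G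
    by (intro integrable_continuous_real continuous_on that e')
  define \<Phi> where "\<Phi> x = integral {a..x} (\<lambda>x. norm (h x))" for x
  define F where "F x = integral {a..x} (\<lambda>t. prod (h t) (e t)) + integral {a..x} (\<lambda>t. prod (H t) (e' t)) - prod (H x) (e x)" for x
  have c\<Phi>: "continuous_on {a..b} \<Phi>"
    unfolding \<Phi>_def[abs_def] by (rule indefinite_integral_continuous_1[OF hn])
  have comb: "integral {a..y} f = integral {a..x} f + integral {x..y} f"
    if "f integrable_on {a..b}" "a \<le> x" "x \<le> y" "y \<le> b" for f :: "real \<Rightarrow> 'd::euclidean_space" and x y
    using Henstock_Kurzweil_Integration.integral_combine[OF that(2,3) sub[OF that(1) order_refl that(4)]] by simp
  have bound: "norm (F y - F x) \<le> (2 * K * M) * (y - x) * (\<Phi> y - \<Phi> x)"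
    if xy: "a \<le> x" "x \<le> y" "y \<le> b" for x y
  proof -
    have Hx: "H t - H x = integral {x..t} h" if "x \<le> t" "t \<le> y" for t
      using H[of t] H[of x] comb[OF hi, of x t] xy that by (simp add: algebra_simps)
    have \<Phi>x: "\<Phi> t - \<Phi> x = integral {x..t} (\<lambda>x. norm (h x))" if "x \<le> t" "t \<le> y" for t
      using comb[OF hn, of x t] xy that by (simp add: \<Phi>_def)
    have \<Phi>y: "\<Phi> t - \<Phi> x \<le> \<Phi> y - \<Phi> x" if "x \<le> t" "t \<le> y" for t
    proof -
      have "integral {x..t} (\<lambda>x. norm (h x)) \<le> integral {x..y} (\<lambda>x. norm (h x))"
        using that xy by (intro integral_subset_le sub[OF hn]) auto
      then show ?thesis using \<Phi>x[OF that] \<Phi>x[of y] xy by simp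
    qed
    have ey: "norm (e t - e y) \<le> M * (y - x)" if "x \<le> t" "t \<le> y" for t
    proof -
      have "norm (e t - e y) \<le> M * norm (t - y)"
      proof (rule differentiable_bound[of "{x..y}" e "\<lambda>s h. h *\<^sub>R e' s"])
        show "(e has_derivative (\<lambda>h. h *\<^sub>R e' s)) (at s within {x..y})" if "s \<in> {x..y}" for s
          using e[of s] that xy unfolding has_vector_derivative_def
          by (auto intro: has_derivative_subset)
        show "onorm (\<lambda>h. h *\<^sub>R e' s) \<le> M" if "s \<in> {x..y}" for s
        proof (rule onorm_le)
          show "norm (h *\<^sub>R e' s) \<le> M * norm h" for h
            using mult_left_mono[OF M[of s] abs_ge_zero[of h]] that xy by (simp add: mult.commute)
        qed
      qed (use that in auto)
      also have "\<dots> \<le> M * (y - x)" using that M0 by (intro mult_left_mono) auto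
      finally show ?thesis .
    qed
    have e1: "integral {x..y} (\<lambda>t. prod (h t) (e t - e y)) =
        integral {x..y} (\<lambda>t. prod (h t) (e t)) - prod (H y - H x) (e y)"
    proof -
      have "integral {x..y} (\<lambda>t. prod (h t) (e t - e y)) =
          integral {x..y} (\<lambda>t. prod (h t) (e t)) - integral {x..y} (\<lambda>t. prod (h t) (e y))"
        using xy by (simp add: diff_right Henstock_Kurzweil_Integration.integral_diff sub i1 ce)
      also have "integral {x..y} (\<lambda>t. prod (h t) (e y)) = prod (integral {x..y} h) (e y)"
        using integral_linear[OF sub[OF hi xy(1,3)] bounded_linear_left[of "e y"]] by (simp add: o_def)
      finally show ?thesis using Hx[of y] xy by simp
    qed
    have e2: "integral {x..y} (\<lambda>t. prod (H t - H x) (e' t)) =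
        integral {x..y} (\<lambda>t. prod (H t) (e' t)) - prod (H x) (e y - e x)"
    proof -
      have "integral {x..y} (\<lambda>t. prod (H t - H x) (e' t)) =
          integral {x..y} (\<lambda>t. prod (H t) (e' t)) - integral {x..y} (\<lambda>t. prod (H x) (e' t))"
        using xy by (simp add: diff_left Henstock_Kurzweil_Integration.integral_diff sub i2 cH)
      also have "integral {x..y} (\<lambda>t. prod (H x) (e' t)) = prod (H x) (integral {x..y} e')"
        using integral_linear[OF sub[OF integrable_continuous_real[OF e'] xy(1,3)] bounded_linear_right[of "H x"]] by (simp add: o_def)
      also have "(e' has_integral (e y - e x)) {x..y}"
        using xy by (intro fundamental_theorem_of_calculus) (auto intro: has_vector_derivative_within_subset[OF e])
      then have "integral {x..y} e' = e y - e x" by (rule integral_unique)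
      finally show ?thesis .
    qed
    \<comment> \<open>Centering \<open>e\<close> at the right end and \<open>H\<close> at the left
      end absorbs the boundary terms exactly. What remains contains a small increment in each
      integrand: \<open>e\<close> moves by at most \<open>M * (y - x)\<close>, and \<open>H\<close>
      by at most the increment of \<open>\<Phi>\<close>.\<close>
    have F: "F y - F x = integral {x..y} (\<lambda>t. prod (h t) (e t - e y)) + integral {x..y} (\<lambda>t. prod (H t - H x) (e' t))"
      unfolding F_def e1 e2 using comb[OF i1[OF ce] xy] comb[OF i2[OF cH] xy]
      by (simp add: diff_left diff_right)
    have n1: "norm (integral {x..y} (\<lambda>t. prod (h t) (e t - e y))) \<le> integral {x..y} (\<lambda>t. (K * M * (y - x)) * norm (h t))"
    proof (rule integral_norm_bound_integral)
      show "(\<lambda>t. prod (h t) (e t - e y)) integrable_on {x..y}"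
        using xy by (intro sub[OF i1] continuous_intros ce) auto
      show "(\<lambda>t. K * M * (y - x) * norm (h t)) integrable_on {x..y}"
        using integrable_on_cmult_left[OF sub[OF hn xy(1,3)], of "K * M * (y - x)"] by simp
      show "norm (prod (h t) (e t - e y)) \<le> K * M * (y - x) * norm (h t)" if "t \<in> {x..y}" for t
      proof -
        have "norm (prod (h t) (e t - e y)) \<le> norm (h t) * norm (e t - e y) * K" by (rule K)
        also have "\<dots> \<le> norm (h t) * (M * (y - x)) * K"
          using ey[of t] that K0 by (intro mult_right_mono mult_left_mono) auto
        finally show ?thesis by (simp add: algebra_simps)
      qed
    qed
    have v1: "integral {x..y} (\<lambda>t. (K * M * (y - x)) * norm (h t)) = K * M * (y - x) * (\<Phi> y - \<Phi> x)"
      using \<Phi>x[of y] xy by simp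
    have n2: "norm (integral {x..y} (\<lambda>t. prod (H t - H x) (e' t))) \<le> integral {x..y} (\<lambda>t. K * M * (\<Phi> y - \<Phi> x))"
    proof (rule integral_norm_bound_integral)
      show "(\<lambda>t. prod (H t - H x) (e' t)) integrable_on {x..y}"
        using xy by (intro sub[OF i2] continuous_intros cH) auto
      show "norm (prod (H t - H x) (e' t)) \<le> K * M * (\<Phi> y - \<Phi> x)" if t: "t \<in> {x..y}" for t
      proof -
        have "norm (H t - H x) \<le> \<Phi> t - \<Phi> x"
          unfolding Hx[of t, OF t[unfolded atLeastAtMost_iff, THEN conjunct1] t[unfolded atLeastAtMost_iff, THEN conjunct2]]
            \<Phi>x[of t, OF t[unfolded atLeastAtMost_iff, THEN conjunct1] t[unfolded atLeastAtMost_iff, THEN conjunct2]]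
          using t xy by (intro integral_norm_bound_integral sub[OF hi] sub[OF hn]) auto
        also have "\<dots> \<le> \<Phi> y - \<Phi> x" using \<Phi>y t by simp
        finally have 1: "norm (H t - H x) \<le> \<Phi> y - \<Phi> x" .
        have "norm (prod (H t - H x) (e' t)) \<le> norm (H t - H x) * norm (e' t) * K" by (rule K)
        also have "\<dots> \<le> (\<Phi> y - \<Phi> x) * M * K"
          using 1 M[of t] t xy K0 order_trans[OF norm_ge_zero 1] by (intro mult_right_mono mult_mono) auto
        finally show ?thesis by (simp add: algebra_simps)
      qed
    qed (rule integrable_const_ivl)
    have v2: "integral {x..y} (\<lambda>t. K * M * (\<Phi> y - \<Phi> x)) = K * M * (y - x) * (\<Phi> y - \<Phi> x)"
      using xy by simp
    have "norm (F y - F x) \<le> K * M * (y - x) * (\<Phi> y - \<Phi> x) + K * M * (y - x) * (\<Phi> y - \<Phi> x)"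
      using norm_triangle_mono[OF n1 n2] unfolding F v1 v2 .
    then show ?thesis by simp
  qed
  have "(F has_vector_derivative 0) (at x within {a..b})" if "x \<in> {a..b}" for x
    using bound c\<Phi> that by (rule has_vector_derivative_zero_if_lipschitz_small)
  then have "((\<lambda>x. 0) has_integral (F b - F a)) {a..b}"
    using ab by (intro fundamental_theorem_of_calculus) auto
  then have "F b = F a" using has_integral_0_eq by fastforce
  then show "integral {a..b} (\<lambda>x. prod (h x) (e x)) =
      prod (H b) (e b) - prod (H a) (e a) - integral {a..b} (\<lambda>x. prod (H x) (e' x))"
    unfolding F_def by (simp add: algebra_simps)
qed

section \<open>Weak derivatives on an interval\<close>

lemma open_imp_sets_lebesgue: "open S \<Longrightarrow> S \<in> sets lebesgue"
  by (rule sets_completionI_sets) simp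

lemma integrable_lebesgue_on_iff:
  "S \<in> sets lebesgue \<Longrightarrow> integrable (lebesgue_on S) f \<longleftrightarrow> f absolutely_integrable_on S"
  by (simp add: integrable_restrict_space set_integrable_def)

lemma LINT_lebesgue_on_eq_integral:
  fixes f :: "'a::euclidean_space \<Rightarrow> 'b::euclidean_space"
  assumes "f absolutely_integrable_on S" "S \<in> sets lebesgue"
  shows "(LINT x|lebesgue_on S. f x) = integral S f"
  using assms by (simp add: lebesgue_integral_eq_integral integrable_lebesgue_on_iff)

lemma absolutely_integrable_bilinear_continuous:
  fixes g :: "real \<Rightarrow> 'a::euclidean_space" and q :: "real \<Rightarrow> 'b::euclidean_space"
    and prod :: "'a \<Rightarrow> 'b \<Rightarrow> 'c::euclidean_space"
  assumes "bounded_bilinear prod" "g absolutely_integrable_on {a..b}" "continuous_on {a..b} q"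
  shows "(\<lambda>x. prod (g x) (q x)) absolutely_integrable_on {a..b}"
proof (rule absolutely_integrable_bounded_measurable_product[of "\<lambda>u v. prod v u"])
  show "bilinear (\<lambda>u v. prod v u)"
    unfolding bilinear_conv_bounded_bilinear by (rule bounded_bilinear.flip[OF assms(1)])
  show "q \<in> borel_measurable (lebesgue_on {a..b})"
    by (rule continuous_imp_measurable_on_sets_lebesgue[OF assms(3)]) simp
  show "bounded (q ` {a..b})"
    by (rule compact_imp_bounded[OF compact_continuous_image[OF assms(3) compact_Icc]])
qed (use assms(2) in simp_all)

lemmas bounded_bilinear_scaleR_flip = bounded_bilinear.flip[OF bounded_bilinear_scaleR]

lemma LINT_supported:
  fixes \<tau> :: "real \<Rightarrow> real" and g :: "real \<Rightarrow> 'b::euclidean_space"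
  assumes "continuous_on {a..b} \<tau>" "\<And>x. x \<notin> {a..b} \<Longrightarrow> \<tau> x = 0" "{a..b} \<subseteq> S" "S \<in> sets lebesgue"
    and g: "g absolutely_integrable_on {a..b}"
  shows "(LINT x|lebesgue_on S. \<tau> x *\<^sub>R g x) = integral {a..b} (\<lambda>x. \<tau> x *\<^sub>R g x)"
proof -
  have ai: "(\<lambda>x. \<tau> x *\<^sub>R g x) absolutely_integrable_on {a..b}"
    by (rule absolutely_integrable_bilinear_continuous[OF bounded_bilinear_scaleR_flip g assms(1)])
  have "(LINT x|lebesgue_on S. \<tau> x *\<^sub>R g x) = (LINT x|lebesgue. indicat_real S x *\<^sub>R (\<tau> x *\<^sub>R g x))"
    using assms(4) by (simp add: integral_restrict_space)
  also have "\<dots> = (LINT x|lebesgue. indicat_real {a..b} x *\<^sub>R (\<tau> x *\<^sub>R g x))"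
  proof (rule Bochner_Integration.integral_cong[OF refl])
    show "indicat_real S x *\<^sub>R (\<tau> x *\<^sub>R g x) = indicat_real {a..b} x *\<^sub>R (\<tau> x *\<^sub>R g x)" for x
      using assms(2)[of x] assms(3) by (cases "x \<in> {a..b}") (auto simp: indicator_def)
  qed
  also have "\<dots> = integral {a..b} (\<lambda>x. \<tau> x *\<^sub>R g x)"
    using set_lebesgue_integral_eq_integral(2)[OF ai] by (simp add: set_lebesgue_integral_def)
  finally show ?thesis .
qed

lemma test_function_deriv_eq_0:
  assumes "test_function S (\<tau> :: real \<Rightarrow> real)" "\<And>x. x \<notin> {a..b} \<Longrightarrow> \<tau> x = 0" "x \<notin> {a..b}"
  shows "deriv \<tau> x = 0"
proof -
  have "((\<lambda>x. 0) has_real_derivative 0) (at x)" by simp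
  then have "(\<tau> has_real_derivative 0) (at x)"
    by (rule has_field_derivative_transform_within_open[where S="- {a..b}"])
      (use assms(2,3) in \<open>simp_all add: open_Compl\<close>)
  then show ?thesis by (rule DERIV_imp_deriv)
qed

lemma has_weak_deriv_integrable:
  assumes "has_weak_deriv S u g" "{a..b} \<subseteq> S"
  shows "u absolutely_integrable_on {a..b}" "g absolutely_integrable_on {a..b}"
  using assms by (auto simp: has_weak_deriv_def integrable_lebesgue_on_iff[symmetric])

lemma has_weak_deriv_test:
  fixes u g :: "real \<Rightarrow> 'b::euclidean_space"
  assumes w: "has_weak_deriv S u g" and S: "S \<in> sets lebesgue" "{a..b} \<subseteq> S"
    and \<tau>: "test_function S \<tau>" "\<And>x. x \<notin> {a..b} \<Longrightarrow> \<tau> x = 0"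
  shows "integral {a..b} (\<lambda>x. deriv \<tau> x *\<^sub>R u x) = - integral {a..b} (\<lambda>x. \<tau> x *\<^sub>R g x)"
proof -
  have "(LINT x|lebesgue_on S. deriv \<tau> x *\<^sub>R u x) = - (LINT x|lebesgue_on S. \<tau> x *\<^sub>R g x)"
    using w \<tau>(1) by (simp add: has_weak_deriv_def)
  moreover have "(LINT x|lebesgue_on S. deriv \<tau> x *\<^sub>R u x) = integral {a..b} (\<lambda>x. deriv \<tau> x *\<^sub>R u x)"
    by (rule LINT_supported[OF continuous_on_subset[OF test_function_derivative(3)[OF \<tau>(1)] subset_UNIV]
      test_function_deriv_eq_0[OF \<tau>] S(2,1) has_weak_deriv_integrable(1)[OF w S(2)]])
  moreover have "(LINT x|lebesgue_on S. \<tau> x *\<^sub>R g x) = integral {a..b} (\<lambda>x. \<tau> x *\<^sub>R g x)"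
    by (rule LINT_supported[OF continuous_on_subset[OF test_function_derivative(2)[OF \<tau>(1)] subset_UNIV]
      \<tau>(2) S(2,1) has_weak_deriv_integrable(2)[OF w S(2)]])
  ultimately show ?thesis by simp
qed

text \<open>Lebesgue differentiation: almost everywhere \<open>g x\<close> is the limit of its
  averages over short intervals to the right of \<open>x\<close>, and these all vanish. Countably
  many closed intervals exhaust the open set.\<close>

lemma AE_zero_if_interval_integrals_zero:
  fixes g :: "real \<Rightarrow> 'b::euclidean_space"
  assumes "open S" and g: "\<And>a b. {a..b} \<subseteq> S \<Longrightarrow> g absolutely_integrable_on {a..b}"
    and z: "\<And>a b. a < b \<Longrightarrow> {a..b} \<subseteq> S \<Longrightarrow> integral {a..b} g = 0"
  shows "AE x in lebesgue. x \<in> S \<longrightarrow> g x = 0"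
proof -
  obtain \<D> where \<D>: "countable \<D>" "\<D> \<subseteq> Pow S" "\<And>X. X \<in> \<D> \<Longrightarrow> \<exists>a b. X = cbox a b" "\<Union>\<D> = S"
    using open_countable_Union_open_cbox[OF assms(1)] by blast
  have "AE x in lebesgue. x \<in> X \<longrightarrow> g x = 0" if X: "X \<in> \<D>" for X
  proof -
    obtain a b where ab: "X = {a..b}" using \<D>(3)[OF X] by (auto simp: cbox_interval)
    have S: "{a..b} \<subseteq> S" using X \<D>(2) ab by auto
    define f where "f x = (if x \<in> {a..b} then g x else 0)" for x
    have "f absolutely_integrable_on UNIV"
      unfolding f_def[abs_def] absolutely_integrable_restrict_UNIV by (rule g[OF S])
    then have "f integrable_on UNIV" by (simp add: absolutely_integrable_on_def)
    then have "f integrable_on cbox u v" for u v by (rule integrable_on_subcbox) simp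
    then obtain N where N: "negligible N" "\<And>x e. \<lbrakk>x \<notin> N; 0 < e\<rbrakk> \<Longrightarrow>
        \<exists>d>0. \<forall>h. 0 < h \<and> h < d \<longrightarrow> norm (integral (cbox x (x + h *\<^sub>R One)) f /\<^sub>R h ^ DIM(real) - f x) < e"
      by (rule integrable_ccontinuous_explicit) blast
    have "g x = 0" if x: "x \<in> {a..b}" "x \<noteq> b" "x \<notin> N" for x
    proof -
      have "norm (f x) < e" if e: "e > 0" for e
      proof -
        obtain d where d: "d > 0" "\<forall>h. 0 < h \<and> h < d \<longrightarrow> norm (integral (cbox x (x + h *\<^sub>R One)) f /\<^sub>R h ^ DIM(real) - f x) < e"
          using N(2)[OF x(3) e] by blast
        \<comment> \<open>The cap \<open>b - x\<close> keeps the averaging interval inside the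
          closed interval under consideration; the point \<open>b\<close>, where it would be zero,
          goes into the null set.\<close>
        define h where "h = min (d/2) (b - x)"
        have h: "0 < h" "h < d" "x + h \<le> b" using d(1) x by (auto simp: h_def min_def)
        have "integral (cbox x (x + h *\<^sub>R One)) f = integral {x..x + h} f"
          by (simp add: cbox_interval)
        also have "\<dots> = integral {x..x + h} g"
          by (rule Henstock_Kurzweil_Integration.integral_cong) (use h x in \<open>auto simp: f_def\<close>)
        also have "\<dots> = 0"
          by (rule z) (use h x S in \<open>auto simp: subset_iff\<close>)
        finally have "integral (cbox x (x + h *\<^sub>R One)) f = 0" .
        moreover have "norm (integral (cbox x (x + h *\<^sub>R One)) f /\<^sub>R h ^ DIM(real) - f x) < e"
          using d(2) h by blast
        ultimately show ?thesis by simp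
      qed
      then have "norm (f x) \<le> 0" by (meson not_le order_less_irrefl)
      then show ?thesis using x(1) by (simp add: f_def)
    qed
    then have "{x. \<not> (x \<in> X \<longrightarrow> g x = 0)} \<subseteq> insert b N" using ab by blast
    moreover have "negligible (insert b N)" using N(1) by simp
    ultimately show ?thesis unfolding eventually_ae_filter_negligible by blast
  qed
  then have "AE x in lebesgue. \<forall>X\<in>\<D>. x \<in> X \<longrightarrow> g x = 0"
    by (subst AE_ball_countable[OF \<D>(1)]) blast
  then show ?thesis
    by (rule AE_mp) (rule AE_I2, use \<D>(4) in blast)
qed

text \<open>Fundamental lemma of the calculus of variations: the bumps converge to the indicator of
  an interval and \<open>norm (g x)\<close> dominates, so interval integrals vanish as well.\<close>

lemma AE_zero_if_test_integrals_zero: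
  fixes g :: "real \<Rightarrow> 'b::euclidean_space"
  assumes S: "open S" and g: "\<And>a b. {a..b} \<subseteq> S \<Longrightarrow> g absolutely_integrable_on {a..b}"
    and z: "\<And>\<tau> a b. test_function S \<tau> \<Longrightarrow> (\<And>x. x \<notin> {a..b} \<Longrightarrow> \<tau> x = 0) \<Longrightarrow> a < b \<Longrightarrow> {a..b} \<subseteq> S \<Longrightarrow>
      integral {a..b} (\<lambda>x. \<tau> x *\<^sub>R g x) = 0"
  shows "AE x in lebesgue. x \<in> S \<longrightarrow> g x = 0"
proof (rule AE_zero_if_interval_integrals_zero[OF S g])
  fix a b :: real assume ab: "a < b" "{a..b} \<subseteq> S"
  have gi: "g absolutely_integrable_on {a..b}" by (rule g[OF ab(2)])
  have gn: "(\<lambda>x. norm (g x)) integrable_on {a..b}" using gi by (simp add: absolutely_integrable_on_def)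
  have z0: "integral {a..b} (\<lambda>x. interval_bump a b n x *\<^sub>R g x) = 0" for n
    by (rule z[OF test_function_interval_bump[OF ab(2)] interval_bump_eq_0 ab]) auto
  have c: "continuous_on {a..b} (interval_bump a b n)" for n
    by (rule continuous_on_subset[OF test_function_derivative(2)[OF test_function_interval_bump[OF subset_UNIV]] subset_UNIV])
  have bi: "(\<lambda>x. interval_bump a b n x *\<^sub>R g x) integrable_on {a..b}" for n
    using absolutely_integrable_bilinear_continuous[OF bounded_bilinear_scaleR_flip gi c]
    by (simp add: absolutely_integrable_on_def)
  have "(\<lambda>n. integral {a..b} (\<lambda>x. interval_bump a b n x *\<^sub>R g x)) \<longlonglongrightarrow>
      integral {a..b} (\<lambda>x. indicat_real {a<..<b} x *\<^sub>R g x)"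
  proof (rule dominated_convergence(2)[OF bi gn])
    show "norm (interval_bump a b n x *\<^sub>R g x) \<le> norm (g x)" for n x
      using mult_right_mono[OF interval_bump_bounds(2)[of a b n x] norm_ge_zero[of "g x"]]
      by (simp add: interval_bump_bounds(1))
    show "(\<lambda>n. interval_bump a b n x *\<^sub>R g x) \<longlonglongrightarrow> indicat_real {a<..<b} x *\<^sub>R g x" for x
      by (rule tendsto_scaleR[OF interval_bump_LIMSEQ tendsto_const])
  qed
  then have "integral {a..b} (\<lambda>x. indicat_real {a<..<b} x *\<^sub>R g x) = 0"
    unfolding z0 by (rule LIMSEQ_unique[OF _ tendsto_const])
  moreover have "integral {a..b} (\<lambda>x. indicat_real {a<..<b} x *\<^sub>R g x) = integral {a..b} g"
    by (rule integral_spike[of "{a, b}"]) auto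
  ultimately show "integral {a..b} g = 0" by simp
qed

lemma weak_deriv_unique:
  fixes u v g h :: "real \<Rightarrow> 'b::euclidean_space"
  assumes S: "open S" and u: "has_weak_deriv S u g" and v: "has_weak_deriv S v h"
    and uv: "AE x in lebesgue. x \<in> S \<longrightarrow> u x = v x"
  shows "AE x in lebesgue. x \<in> S \<longrightarrow> g x = h x"
proof -
  have sets: "S \<in> sets lebesgue" by (rule open_imp_sets_lebesgue[OF S])
  have "AE x in lebesgue. x \<in> S \<longrightarrow> g x - h x = 0"
  proof (rule AE_zero_if_test_integrals_zero[OF S])
    fix a b :: real assume ab: "{a..b} \<subseteq> S"
    note iu = has_weak_deriv_integrable[OF u ab] and iv = has_weak_deriv_integrable[OF v ab]
    show "(\<lambda>x. g x - h x) absolutely_integrable_on {a..b}"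
      by (rule set_integral_diff(1)[OF iu(2) iv(2)])
    fix \<tau> :: "real \<Rightarrow> real" assume t: "test_function S \<tau>" "\<And>x. x \<notin> {a..b} \<Longrightarrow> \<tau> x = 0"
    have c: "continuous_on {a..b} \<tau>"
      by (rule continuous_on_subset[OF test_function_derivative(2)[OF t(1)] subset_UNIV])
    have i: "(\<lambda>x. \<tau> x *\<^sub>R q x) integrable_on {a..b}" if "q absolutely_integrable_on {a..b}" for q :: "real \<Rightarrow> 'b"
      using absolutely_integrable_bilinear_continuous[OF bounded_bilinear_scaleR_flip that c]
      by (simp add: absolutely_integrable_on_def)
    obtain N where N: "negligible N" "{x. \<not> (x \<in> S \<longrightarrow> u x = v x)} \<subseteq> N"
      using uv unfolding eventually_ae_filter_negligible by blast
    have "integral {a..b} (\<lambda>x. deriv \<tau> x *\<^sub>R u x) = integral {a..b} (\<lambda>x. deriv \<tau> x *\<^sub>R v x)"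
    proof (rule integral_spike[OF N(1)])
      fix x assume "x \<in> {a..b} - N"
      then have "u x = v x" using N(2) ab by blast
      then show "deriv \<tau> x *\<^sub>R v x = deriv \<tau> x *\<^sub>R u x" by simp
    qed
    then show "integral {a..b} (\<lambda>x. \<tau> x *\<^sub>R (g x - h x)) = 0"
      using has_weak_deriv_test[OF u sets ab t] has_weak_deriv_test[OF v sets ab t]
      by (simp add: scaleR_diff_right Henstock_Kurzweil_Integration.integral_diff i iu iv)
  qed
  then show ?thesis by simp
qed

text \<open>The representative picked by \<open>weak_deriv\<close> is arbitrary. By uniqueness any
  explicit weak derivative may be substituted for it outside a null set, which is how the operators
  of the normal form become computable.\<close>

lemma weak_deriv_AE:
  fixes u g :: "real \<Rightarrow> 'b::euclidean_space"
  assumes "open S" "has_weak_deriv S u g"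
  shows "has_weak_deriv S u (weak_deriv S u)" "AE x in lebesgue. x \<in> S \<longrightarrow> weak_deriv S u x = g x"
proof -
  show 1: "has_weak_deriv S u (weak_deriv S u)"
    unfolding weak_deriv_def by (rule someI[of "has_weak_deriv S u", OF assms(2)])
  show "AE x in lebesgue. x \<in> S \<longrightarrow> weak_deriv S u x = g x"
    by (rule weak_deriv_unique[OF assms(1) 1 assms(2)]) simp
qed

text \<open>In an interval every compact subset lies in a closed subinterval, so local integrability
  and the test identity need checking on closed intervals only.\<close>

lemma has_weak_derivI:
  fixes u g :: "real \<Rightarrow> 'b::euclidean_space"
  assumes S: "open S" "is_interval S" "S \<noteq> {}"
    and u: "\<And>a b. {a..b} \<subseteq> S \<Longrightarrow> u absolutely_integrable_on {a..b}"
    and g: "\<And>a b. {a..b} \<subseteq> S \<Longrightarrow> g absolutely_integrable_on {a..b}"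
    and p: "\<And>\<tau> a b. test_function S \<tau> \<Longrightarrow> (\<And>x. x \<notin> {a..b} \<Longrightarrow> \<tau> x = 0) \<Longrightarrow> a \<le> b \<Longrightarrow> {a..b} \<subseteq> S \<Longrightarrow>
      integral {a..b} (\<lambda>x. deriv \<tau> x *\<^sub>R u x) = - integral {a..b} (\<lambda>x. \<tau> x *\<^sub>R g x)"
  shows "has_weak_deriv S u g"
proof -
  have sets: "S \<in> sets lebesgue" by (rule open_imp_sets_lebesgue[OF S(1)])
  have seg: "\<exists>a b. a \<le> b \<and> K \<subseteq> {a..b} \<and> {a..b} \<subseteq> S" if K: "compact K" "K \<subseteq> S" for K
  proof (cases "K = {}")
    case True
    obtain x where "x \<in> S" using S(3) by blast
    with True show ?thesis by (intro exI[of _ x]) auto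
  next
    case False
    obtain a where a: "a \<in> K" "\<forall>x\<in>K. a \<le> x" using compact_attains_inf[OF K(1) False] by blast
    obtain b where b: "b \<in> K" "\<forall>x\<in>K. x \<le> b" using compact_attains_sup[OF K(1) False] by blast
    have "{a..b} \<subseteq> S"
      using S(2) a(1) b(1) K(2) unfolding is_interval_1 by (meson atLeastAtMost_iff subsetD subsetI)
    moreover have "a \<le> b" "K \<subseteq> {a..b}" using a b by auto
    ultimately show ?thesis by blast
  qed
  have int: "integrable (lebesgue_on K) q" if K: "compact K" "K \<subseteq> S"
    and q: "\<And>a b. {a..b} \<subseteq> S \<Longrightarrow> q absolutely_integrable_on {a..b}" for K and q :: "real \<Rightarrow> 'b"
  proof -
    obtain a b where ab: "K \<subseteq> {a..b}" "{a..b} \<subseteq> S" using seg[OF K] by blast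
    have Ks: "K \<in> sets lebesgue" using K(1) by (simp add: lmeasurable_compact fmeasurableD)
    have "q absolutely_integrable_on K"
      by (rule set_integrable_subset[OF q[OF ab(2)] Ks ab(1)])
    then show ?thesis by (simp add: integrable_lebesgue_on_iff[OF Ks])
  qed
  have "(LINT x|lebesgue_on S. deriv \<tau> x *\<^sub>R u x) = - (LINT x|lebesgue_on S. \<tau> x *\<^sub>R g x)"
    if t: "test_function S \<tau>" for \<tau> :: "real \<Rightarrow> real"
  proof -
    obtain a b where ab: "a \<le> b" "closure {x. \<tau> x \<noteq> 0} \<subseteq> {a..b}" "{a..b} \<subseteq> S"
      using seg[OF test_functionD(2,3)[OF t]] by blast
    have z: "\<tau> x = 0" if "x \<notin> {a..b}" for x
      using that ab(2) closure_subset[of "{x. \<tau> x \<noteq> 0}"] by blast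
    have "(LINT x|lebesgue_on S. deriv \<tau> x *\<^sub>R u x) = integral {a..b} (\<lambda>x. deriv \<tau> x *\<^sub>R u x)"
      by (rule LINT_supported[OF continuous_on_subset[OF test_function_derivative(3)[OF t] subset_UNIV]
        test_function_deriv_eq_0[OF t z] ab(3) sets u[OF ab(3)]])
    moreover have "(LINT x|lebesgue_on S. \<tau> x *\<^sub>R g x) = integral {a..b} (\<lambda>x. \<tau> x *\<^sub>R g x)"
      by (rule LINT_supported[OF continuous_on_subset[OF test_function_derivative(2)[OF t] subset_UNIV]
        z ab(3) sets g[OF ab(3)]])
    ultimately show ?thesis using p[OF t z ab(1,3)] by simp
  qed
  then show ?thesis
    unfolding has_weak_deriv_def using int u g by blast
qed

text \<open>Integration by parts against a test function; the boundary terms vanish because the test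
  function is zero at both ends.\<close>

lemma has_weak_deriv_primitive:
  fixes u g :: "real \<Rightarrow> 'b::euclidean_space"
  assumes S: "open S" "is_interval S" "S \<noteq> {}"
    and g: "\<And>a b. {a..b} \<subseteq> S \<Longrightarrow> g absolutely_integrable_on {a..b}"
    and u: "\<And>a b. a \<le> b \<Longrightarrow> {a..b} \<subseteq> S \<Longrightarrow> u b - u a = integral {a..b} g"
  shows "has_weak_deriv S u g"
proof (rule has_weak_derivI[OF S _ g])
  fix a b :: real assume ab: "{a..b} \<subseteq> S"
  have gi: "g integrable_on {a..b}" using g[OF ab] by (simp add: absolutely_integrable_on_def)
  have ua: "u a + integral {a..x} g = u x" if "x \<in> {a..b}" for x
    using u[of a x] that ab by (simp add: subset_iff flip: u)
  have "continuous_on {a..b} (\<lambda>x. u a + integral {a..x} g)"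
    by (intro continuous_intros indefinite_integral_continuous_1 gi)
  then have "continuous_on {a..b} u" by (rule continuous_on_eq) (rule ua)
  then show "u absolutely_integrable_on {a..b}" by (rule absolutely_integrable_continuous_real)
  fix \<tau> :: "real \<Rightarrow> real" assume t: "test_function S \<tau>" "\<And>x. x \<notin> {a..b} \<Longrightarrow> \<tau> x = 0" "a \<le> b"
  have c: "continuous_on UNIV \<tau>" by (rule test_function_derivative(2)[OF t(1)])
  have cl: "closed {x. \<tau> x = 0}" by (rule closed_Collect_eq[OF c continuous_on_const])
  \<comment> \<open>The support hypothesis speaks only about points outside the closed interval; the
    values at \<open>a\<close> and \<open>b\<close> follow by continuity.\<close>
  have "closure {..<a} \<subseteq> {x. \<tau> x = 0}" "closure {b<..} \<subseteq> {x. \<tau> x = 0}"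
    by (rule closure_minimal[OF _ cl]; use t(2) in force)+
  then have end0: "\<tau> a = 0" "\<tau> b = 0" by auto
  have "integral {a..b} (\<lambda>x. \<tau> x *\<^sub>R g x) = \<tau> b *\<^sub>R u b - \<tau> a *\<^sub>R u a - integral {a..b} (\<lambda>x. deriv \<tau> x *\<^sub>R u x)"
  proof (rule integral_by_parts_primitive(2)[OF bounded_bilinear_scaleR_flip t(3) g[OF ab]])
    show "u x - u a = integral {a..x} g" if "x \<in> {a..b}" for x
      using u[of a x] that ab by (simp add: subset_iff)
    show "(\<tau> has_vector_derivative deriv \<tau> x) (at x within {a..b})" for x
      using test_function_derivative(1)[OF t(1)]
      by (simp add: has_real_derivative_iff_has_vector_derivative has_vector_derivative_at_within)
    show "continuous_on {a..b} (deriv \<tau>)"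
      by (rule continuous_on_subset[OF test_function_derivative(3)[OF t(1)] subset_UNIV])
  qed
  with end0 show "integral {a..b} (\<lambda>x. deriv \<tau> x *\<^sub>R u x) = - integral {a..b} (\<lambda>x. \<tau> x *\<^sub>R g x)"
    by simp
qed

lemma has_weak_deriv_add:
  fixes u u' g g' :: "real \<Rightarrow> 'b::euclidean_space"
  assumes S: "open S" "is_interval S" "S \<noteq> {}"
    and u: "has_weak_deriv S u g" and u': "has_weak_deriv S u' g'"
  shows "has_weak_deriv S (\<lambda>x. u x + c *\<^sub>R u' x) (\<lambda>x. g x + c *\<^sub>R g' x)"
proof (rule has_weak_derivI[OF S])
  fix a b :: real assume ab: "{a..b} \<subseteq> S"
  note iu = has_weak_deriv_integrable[OF u ab] and iu' = has_weak_deriv_integrable[OF u' ab]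
  note sc = absolutely_integrable_scaleR_left
  show "(\<lambda>x. u x + c *\<^sub>R u' x) absolutely_integrable_on {a..b}"
    by (rule set_integral_add(1)[OF iu(1) sc[OF iu'(1)]])
  show "(\<lambda>x. g x + c *\<^sub>R g' x) absolutely_integrable_on {a..b}"
    by (rule set_integral_add(1)[OF iu(2) sc[OF iu'(2)]])
  fix \<tau> :: "real \<Rightarrow> real" assume t: "test_function S \<tau>" "\<And>x. x \<notin> {a..b} \<Longrightarrow> \<tau> x = 0" "a \<le> b"
  have sets: "S \<in> sets lebesgue" by (rule open_imp_sets_lebesgue[OF S(1)])
  have i: "(\<lambda>x. q x *\<^sub>R r x) integrable_on {a..b}"
    if "continuous_on UNIV q" "r absolutely_integrable_on {a..b}" for q :: "real \<Rightarrow> real" and r :: "real \<Rightarrow> 'b"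
    using absolutely_integrable_bilinear_continuous[OF bounded_bilinear_scaleR_flip that(2) continuous_on_subset[OF that(1) subset_UNIV]]
    by (simp add: absolutely_integrable_on_def)
  have l: "integral {a..b} (\<lambda>x. q x *\<^sub>R (r x + c *\<^sub>R s x)) =
      integral {a..b} (\<lambda>x. q x *\<^sub>R r x) + c *\<^sub>R integral {a..b} (\<lambda>x. q x *\<^sub>R s x)"
    if "continuous_on UNIV q" "r absolutely_integrable_on {a..b}" "s absolutely_integrable_on {a..b}"
    for q :: "real \<Rightarrow> real" and r s :: "real \<Rightarrow> 'b"
  proof -
    have "integral {a..b} (\<lambda>x. q x *\<^sub>R (r x + c *\<^sub>R s x)) = integral {a..b} (\<lambda>x. q x *\<^sub>R r x + c *\<^sub>R (q x *\<^sub>R s x))"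
      by (rule Henstock_Kurzweil_Integration.integral_cong) (simp add: scaleR_add_right)
    also have "\<dots> = integral {a..b} (\<lambda>x. q x *\<^sub>R r x) + integral {a..b} (\<lambda>x. c *\<^sub>R (q x *\<^sub>R s x))"
      by (rule Henstock_Kurzweil_Integration.integral_add[OF i[OF that(1,2)] integrable_cmul[OF i[OF that(1,3)]]])
    finally show ?thesis unfolding integral_cmul .
  qed
  show "integral {a..b} (\<lambda>x. deriv \<tau> x *\<^sub>R (u x + c *\<^sub>R u' x)) = - integral {a..b} (\<lambda>x. \<tau> x *\<^sub>R (g x + c *\<^sub>R g' x))"
    unfolding l[OF test_function_derivative(3)[OF t(1)] iu(1) iu'(1)] l[OF test_function_derivative(2)[OF t(1)] iu(2) iu'(2)]
    using has_weak_deriv_test[OF u sets ab t(1,2)] has_weak_deriv_test[OF u' sets ab t(1,2)] by simp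
qed

lemma has_weak_deriv_cong_AE:
  fixes u u' g g' :: "real \<Rightarrow> 'b::euclidean_space"
  assumes S: "open S" "is_interval S" "S \<noteq> {}" and u: "has_weak_deriv S u g"
    and "AE x in lebesgue. x \<in> S \<longrightarrow> u' x = u x" "AE x in lebesgue. x \<in> S \<longrightarrow> g' x = g x"
  shows "has_weak_deriv S u' g'"
proof -
  obtain N where N: "negligible N" "{x. \<not> (x \<in> S \<longrightarrow> u' x = u x)} \<subseteq> N"
    using assms(5) unfolding eventually_ae_filter_negligible by blast
  obtain M where M: "negligible M" "{x. \<not> (x \<in> S \<longrightarrow> g' x = g x)} \<subseteq> M"
    using assms(6) unfolding eventually_ae_filter_negligible by blast
  have sets: "S \<in> sets lebesgue" by (rule open_imp_sets_lebesgue[OF S(1)])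
  show ?thesis
  proof (rule has_weak_derivI[OF S])
    fix a b :: real assume ab: "{a..b} \<subseteq> S"
    show "u' absolutely_integrable_on {a..b}"
      by (rule absolutely_integrable_spike[OF has_weak_deriv_integrable(1)[OF u ab] N(1)]) (use N(2) ab in blast)
    show "g' absolutely_integrable_on {a..b}"
      by (rule absolutely_integrable_spike[OF has_weak_deriv_integrable(2)[OF u ab] M(1)]) (use M(2) ab in blast)
    fix \<tau> :: "real \<Rightarrow> real" assume t: "test_function S \<tau>" "\<And>x. x \<notin> {a..b} \<Longrightarrow> \<tau> x = 0" "a \<le> b"
    have "integral {a..b} (\<lambda>x. deriv \<tau> x *\<^sub>R u' x) = integral {a..b} (\<lambda>x. deriv \<tau> x *\<^sub>R u x)"
    proof (rule integral_spike[OF N(1)])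
      fix x assume "x \<in> {a..b} - N"
      then have "u' x = u x" using N(2) ab by blast
      then show "deriv \<tau> x *\<^sub>R u x = deriv \<tau> x *\<^sub>R u' x" by simp
    qed
    moreover have "integral {a..b} (\<lambda>x. \<tau> x *\<^sub>R g' x) = integral {a..b} (\<lambda>x. \<tau> x *\<^sub>R g x)"
    proof (rule integral_spike[OF M(1)])
      fix x assume "x \<in> {a..b} - M"
      then have "g' x = g x" using M(2) ab by blast
      then show "\<tau> x *\<^sub>R g x = \<tau> x *\<^sub>R g' x" by simp
    qed
    ultimately show "integral {a..b} (\<lambda>x. deriv \<tau> x *\<^sub>R u' x) = - integral {a..b} (\<lambda>x. \<tau> x *\<^sub>R g' x)"
      using has_weak_deriv_test[OF u sets ab t(1,2)] by simp
  qed
qed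

section \<open>Du Bois-Reymond lemma and regularity of H^2 functions\<close>

lemma test_function_lincomb:
  fixes \<sigma> \<tau> :: "real \<Rightarrow> real"
  assumes "test_function UNIV \<sigma>" "test_function UNIV \<tau>" "\<And>x. x \<notin> {a..b} \<Longrightarrow> \<sigma> x = 0" "\<And>x. x \<notin> {a..b} \<Longrightarrow> \<tau> x = 0"
  shows "test_function UNIV (\<lambda>x. \<sigma> x + c *\<^sub>R \<tau> x)"
proof (rule test_functionI[OF _ _ subset_UNIV])
  show "C_k_on k UNIV (\<lambda>x. \<sigma> x + c *\<^sub>R \<tau> x)" for k
    by (rule C_k_on_add[OF open_UNIV test_functionD(1)[OF assms(1)]
      C_k_on_linear[OF open_UNIV bounded_linear_scaleR_right test_functionD(1)[OF assms(2)]]])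
  show "\<sigma> x + c *\<^sub>R \<tau> x = 0" if "x \<notin> {a..b}" for x
    using assms(3,4)[OF that] by simp
qed

text \<open>Subtract from a test function the multiple of one fixed bump that makes its integral
  zero. The difference is the derivative of a test function and hence annihilates \<open>v\<close>.
  So integrating \<open>v\<close> against any test function gives \<open>c\<close> times the
  integral of that test function, which identifies \<open>v\<close> with \<open>c\<close>.\<close>

lemma weak_deriv_zero_AE_const:
  fixes v :: "real \<Rightarrow> 'b::euclidean_space"
  assumes v: "has_weak_deriv UNIV v (\<lambda>x. 0)"
  obtains c where "AE x in lebesgue. v x = c"
proof -
  define h where "h = interval_bump 0 1 0"
  have h: "test_function UNIV h" "\<And>x. x \<notin> {0<..<1} \<Longrightarrow> h x = 0" "\<And>x. 0 \<le> h x" "\<And>x. x \<in> {0<..<1} \<Longrightarrow> h x > 0"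
    unfolding h_def by (rule test_function_interval_bump[OF subset_UNIV] interval_bump_eq_0 interval_bump_bounds(1) interval_bump_pos; simp)+
  have h01: "h x = 0" if "x \<notin> {0..1}" for x by (rule h(2)) (use that in auto)
  have vi: "v absolutely_integrable_on {a..b}" for a b by (rule has_weak_deriv_integrable(1)[OF v subset_UNIV])
  have ci: "q integrable_on {a..b}" if "continuous_on UNIV q" for q :: "real \<Rightarrow> real" and a b
    by (rule integrable_continuous_real[OF continuous_on_subset[OF that subset_UNIV]])
  have i: "(\<lambda>x. q x *\<^sub>R r x) integrable_on {a..b}"
    if "continuous_on UNIV q" "r absolutely_integrable_on {a..b}" for q :: "real \<Rightarrow> real" and r :: "real \<Rightarrow> 'b" and a b
    using absolutely_integrable_bilinear_continuous[OF bounded_bilinear_scaleR_flip that(2) continuous_on_subset[OF that(1) subset_UNIV]]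
    by (simp add: absolutely_integrable_on_def)
  note ch = test_function_derivative(2)[OF h(1)]
  define I where "I = integral {0..1} h"
  have "I \<noteq> 0"
  proof
    assume "I = 0"
    then have "(h has_integral 0) (cbox 0 1)"
      using ci[OF ch, of 0 1] unfolding I_def cbox_interval by (simp add: has_integral_iff)
    then have "h (1/2) = 0"
      by (rule has_integral_0_cbox_imp_0[OF continuous_on_subset[OF ch subset_UNIV] h(3)]) (auto simp: cbox_interval)
    with h(4)[of "1/2"] show False by simp
  qed
  \<comment> \<open>The mean of \<open>v\<close> with weight \<open>h\<close> is the only possible
    value of the constant, as testing with \<open>h\<close> shows.\<close>
  define c where "c = integral {0..1} (\<lambda>x. h x *\<^sub>R v x) /\<^sub>R I"
  have "AE x in lebesgue. x \<in> UNIV \<longrightarrow> v x - c = 0"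
  proof (rule AE_zero_if_test_integrals_zero[OF open_UNIV])
    fix a b :: real
    show vc: "(\<lambda>x. v x - c) absolutely_integrable_on {a..b}"
      by (rule set_integral_diff(1)[OF vi]) simp
    fix \<tau> :: "real \<Rightarrow> real" assume t: "test_function UNIV \<tau>" "\<And>x. x \<notin> {a..b} \<Longrightarrow> \<tau> x = 0" and ab: "a < b"
    define A where "A = min a 0"
    define B where "B = max b 1"
    have AB: "{a..b} \<subseteq> {A..B}" "{0..1} \<subseteq> {A..B}" "A < B" by (auto simp: A_def B_def)
    note ct = test_function_derivative(2)[OF t(1)]
    have hAB: "h x = 0" if "x \<notin> {A..B}" for x by (rule h01) (use that AB in blast)
    have tAB: "\<tau> x = 0" if "x \<notin> {A..B}" for x by (rule t(2)) (use that AB in blast)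
    have ih: "integral {A..B} h = I"
      unfolding I_def
      by (rule integral_unique[OF has_integral_on_superset[OF integrable_integral[OF ci[OF ch]] h01 AB(2)]])
    have ihv: "integral {A..B} (\<lambda>x. h x *\<^sub>R v x) = I *\<^sub>R c"
    proof -
      have "integral {A..B} (\<lambda>x. h x *\<^sub>R v x) = integral {0..1} (\<lambda>x. h x *\<^sub>R v x)"
        by (rule integral_unique[OF has_integral_on_superset[OF integrable_integral[OF i[OF ch vi]] _ AB(2)]]) (simp add: h01)
      then show ?thesis using \<open>I \<noteq> 0\<close> by (simp add: c_def)
    qed
    define T where "T = integral {A..B} \<tau>"
    \<comment> \<open>The multiple of the bump is chosen for zero integral over an interval that
      contains both supports.\<close>
    define k where "k x = \<tau> x + (- T / I) *\<^sub>R h x" for x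
    have kt: "test_function UNIV k"
      unfolding k_def[abs_def] by (rule test_function_lincomb[OF t(1) h(1) tAB hAB])
    have k0: "k x = 0" if "x \<notin> {A..B}" for x using tAB[OF that] hAB[OF that] by (simp add: k_def)
    have "integral {A..B} k = T + (- T / I) *\<^sub>R integral {A..B} h"
      unfolding k_def[abs_def] T_def integral_cmul[symmetric]
      by (rule Henstock_Kurzweil_Integration.integral_add[OF ci[OF ct] integrable_cmul[OF ci[OF ch]]])
    with ih have "integral {A..B} k = 0" using \<open>I \<noteq> 0\<close> by simp
    then obtain \<sigma> where s: "test_function UNIV \<sigma>" "deriv \<sigma> = k" "\<And>x. x \<notin> {A..B} \<Longrightarrow> \<sigma> x = 0"
      using test_function_primitive[OF kt _ k0 AB(3)] by metis
    have "integral {A..B} (\<lambda>x. k x *\<^sub>R v x) = 0"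
      using has_weak_deriv_test[OF v _ subset_UNIV s(1,3)] s(2) by simp
    moreover have "integral {A..B} (\<lambda>x. k x *\<^sub>R v x) =
        integral {A..B} (\<lambda>x. \<tau> x *\<^sub>R v x) + (- T / I) *\<^sub>R integral {A..B} (\<lambda>x. h x *\<^sub>R v x)"
    proof -
      have "integral {A..B} (\<lambda>x. k x *\<^sub>R v x) = integral {A..B} (\<lambda>x. \<tau> x *\<^sub>R v x + (- T / I) *\<^sub>R (h x *\<^sub>R v x))"
        by (rule Henstock_Kurzweil_Integration.integral_cong) (simp add: k_def scaleR_diff_left)
      also have "\<dots> = integral {A..B} (\<lambda>x. \<tau> x *\<^sub>R v x) + integral {A..B} (\<lambda>x. (- T / I) *\<^sub>R (h x *\<^sub>R v x))"
        by (rule Henstock_Kurzweil_Integration.integral_add[OF i[OF ct vi] integrable_cmul[OF i[OF ch vi]]])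
      finally show ?thesis unfolding integral_cmul .
    qed
    ultimately have tv: "integral {A..B} (\<lambda>x. \<tau> x *\<^sub>R v x) = T *\<^sub>R c"
      using ihv \<open>I \<noteq> 0\<close> by simp
    have "integral {A..B} (\<lambda>x. \<tau> x *\<^sub>R (v x - c)) = integral {A..B} (\<lambda>x. \<tau> x *\<^sub>R v x) - integral {A..B} (\<lambda>x. \<tau> x *\<^sub>R c)"
      unfolding scaleR_diff_right
      by (rule Henstock_Kurzweil_Integration.integral_diff[OF i[OF ct vi] i[OF ct]]) simp
    also have "integral {A..B} (\<lambda>x. \<tau> x *\<^sub>R c) = T *\<^sub>R c"
      unfolding T_def using integral_linear[OF ci[OF ct] bounded_linear_scaleR_left] by (simp add: o_def)
    finally have "integral {A..B} (\<lambda>x. \<tau> x *\<^sub>R (v x - c)) = 0" using tv by simp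
    moreover have "integral {A..B} (\<lambda>x. \<tau> x *\<^sub>R (v x - c)) = integral {a..b} (\<lambda>x. \<tau> x *\<^sub>R (v x - c))"
      by (rule integral_unique[OF has_integral_on_superset[OF integrable_integral[OF i[OF ct vc]] _ AB(1)]]) (simp add: t(2))
    ultimately show "integral {a..b} (\<lambda>x. \<tau> x *\<^sub>R (v x - c)) = 0" by simp
  qed
  then show thesis by (intro that[of c]) simp
qed

lemma primitive_exists:
  fixes h :: "real \<Rightarrow> 'b::euclidean_space"
  assumes h: "\<And>a b. h integrable_on {a..b}"
  obtains \<gamma> where "\<And>a b. a \<le> b \<Longrightarrow> \<gamma> b - \<gamma> a = integral {a..b} h"
proof -
  define \<gamma> where "\<gamma> x = (if 0 \<le> x then integral {0..x} h else - integral {x..0} h)" for x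
  have c: "integral {a..b} h + integral {b..d} h = integral {a..d} h" if "a \<le> b" "b \<le> d" for a b d
    by (rule Henstock_Kurzweil_Integration.integral_combine[OF that h])
  have "\<gamma> b - \<gamma> a = integral {a..b} h" if "a \<le> b" for a b
    using c[of 0 a b] c[of a 0 b] c[of a b 0] that by (auto simp: \<gamma>_def algebra_simps)
  then show thesis by (rule that)
qed

lemma primitive_has_vector_derivative:
  fixes q :: "real \<Rightarrow> 'b::euclidean_space"
  assumes q: "continuous_on UNIV q" and \<omega>: "\<And>a b. a \<le> b \<Longrightarrow> \<omega> b - \<omega> a = integral {a..b} q"
  shows "(\<omega> has_vector_derivative q x) (at x)"
proof -
  have "((\<lambda>u. \<omega> (x - 1) + integral {x - 1..u} q) has_vector_derivative 0 + q x) (at x within {x - 1..x + 1})"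
    by (intro has_vector_derivative_add has_vector_derivative_const integral_has_vector_derivative continuous_on_subset[OF q]) auto
  moreover have "at x within {x - 1..x + 1} = at x"
    by (rule at_within_interior) (simp add: interior_atLeastAtMost_real)
  ultimately have "((\<lambda>u. \<omega> (x - 1) + integral {x - 1..u} q) has_vector_derivative q x) (at x)" by simp
  then show ?thesis
    by (rule has_vector_derivative_transform_within_open[where S="{x - 1<..}"]) (simp_all flip: \<omega>)
qed

lemma AE_eq_continuous_imp_eq:
  fixes u v :: "real \<Rightarrow> 'b::euclidean_space"
  assumes "continuous_on UNIV u" "continuous_on UNIV v" "AE x in lebesgue. u x = v x"
  shows "u x = v x"
proof (rule ccontr)
  assume ne: "u x \<noteq> v x"
  have o: "open {x. u x \<noteq> v x}" by (rule open_Collect_neq[OF assms(1,2)])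
  obtain N where "negligible N" "{x. u x \<noteq> v x} \<subseteq> N"
    using assms(3) unfolding eventually_ae_filter_negligible by blast
  then have "negligible {x. u x \<noteq> v x}" by (rule negligible_subset)
  with open_not_negligible[OF o] ne show False by blast
qed

text \<open>The weak derivative \<open>g\<close> minus a primitive of \<open>h\<close> has zero weak
  derivative, so \<open>g\<close> agrees almost everywhere with a continuous \<open>w1\<close>.
  Repeating the argument for \<open>w\<close> minus a primitive of \<open>w1\<close> gives a
  constant, and continuity of \<open>w\<close> upgrades the equality from almost everywhere to
  everywhere.\<close>

lemma weak_second_derivative_regularity:
  fixes w g h :: "real \<Rightarrow> 'b::euclidean_space"
  assumes w: "continuous_on UNIV w" and wg: "has_weak_deriv UNIV w g" and gh: "has_weak_deriv UNIV g h"
  obtains w1 where "\<And>x. (w has_vector_derivative w1 x) (at x)"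
    "\<And>a b. a \<le> b \<Longrightarrow> w1 b - w1 a = integral {a..b} h" "\<And>a b. h absolutely_integrable_on {a..b}"
    "AE x in lebesgue. g x = w1 x"
proof -
  note U = open_UNIV is_interval_univ UNIV_not_empty
  have hi: "h absolutely_integrable_on {a..b}" for a b by (rule has_weak_deriv_integrable(2)[OF gh subset_UNIV])
  then obtain \<gamma> where \<gamma>: "\<And>a b. a \<le> b \<Longrightarrow> \<gamma> b - \<gamma> a = integral {a..b} h"
    using primitive_exists[of h] by (auto simp: absolutely_integrable_on_def)
  have "has_weak_deriv UNIV \<gamma> h" by (rule has_weak_deriv_primitive[OF U hi \<gamma>])
  from has_weak_deriv_add[OF U gh this, of "-1"]
  have "has_weak_deriv UNIV (\<lambda>x. g x - \<gamma> x) (\<lambda>x. 0)" by simp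
  then obtain c where c: "AE x in lebesgue. g x - \<gamma> x = c" by (rule weak_deriv_zero_AE_const)
  define w1 where "w1 x = \<gamma> x + c" for x
  have w1: "w1 b - w1 a = integral {a..b} h" if "a \<le> b" for a b using \<gamma>[OF that] by (simp add: w1_def)
  have gw1: "AE x in lebesgue. g x = w1 x"
    using c by (rule AE_mp) (rule AE_I2, simp add: w1_def algebra_simps)
  have cw1: "continuous_on UNIV w1"
  proof -
    have "continuous_on {a<..<b} w1" for a b
    proof -
      have "continuous_on {a..b} (\<lambda>x. w1 a + integral {a..x} h)"
        using hi[of a b] by (intro continuous_intros indefinite_integral_continuous_1) (simp add: absolutely_integrable_on_def)
      then have "continuous_on {a..b} w1" by (rule continuous_on_eq) (simp flip: w1)
      then show ?thesis by (rule continuous_on_subset) auto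
    qed
    then have "isCont w1 x" for x
      by (rule continuous_on_interior[of "{x - 1<..<x + 1}"]) simp
    then show ?thesis by (simp add: continuous_at_imp_continuous_on)
  qed
  have w1i: "w1 absolutely_integrable_on {a..b}" for a b
    by (rule absolutely_integrable_continuous_real[OF continuous_on_subset[OF cw1 subset_UNIV]])
  then obtain \<omega> where \<omega>: "\<And>a b. a \<le> b \<Longrightarrow> \<omega> b - \<omega> a = integral {a..b} w1"
    using primitive_exists[of w1] by (auto simp: absolutely_integrable_on_def)
  have d\<omega>: "(\<omega> has_vector_derivative w1 x) (at x)" for x
    by (rule primitive_has_vector_derivative[OF cw1 \<omega>])
  have "has_weak_deriv UNIV w w1"
    by (rule has_weak_deriv_cong_AE[OF U wg]) (use gw1 in \<open>auto elim: AE_mp\<close>)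
  from has_weak_deriv_add[OF U this has_weak_deriv_primitive[OF U w1i \<omega>], of "-1"]
  have "has_weak_deriv UNIV (\<lambda>x. w x - \<omega> x) (\<lambda>x. 0)" by simp
  then obtain c' where c': "AE x in lebesgue. w x - \<omega> x = c'" by (rule weak_deriv_zero_AE_const)
  have c\<omega>: "continuous_on UNIV \<omega>"
    using d\<omega> by (meson continuous_at_imp_continuous_on has_vector_derivative_continuous)
  have "w x - \<omega> x = c'" for x
    by (rule AE_eq_continuous_imp_eq[OF continuous_on_diff[OF w c\<omega>] continuous_on_const c'])
  then have "w = (\<lambda>x. \<omega> x + c')" by (auto simp: fun_eq_iff algebra_simps)
  moreover have "((\<lambda>x. \<omega> x + c') has_vector_derivative w1 x + 0) (at x)" for x
    by (rule has_vector_derivative_add[OF d\<omega> has_vector_derivative_const])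
  ultimately have "(w has_vector_derivative w1 x) (at x)" for x by simp
  from that[OF this w1 hi gw1] show thesis .
qed

text \<open>Meant for the nested \<open>weak_deriv\<close> in \<open>A_ch\<close> and in
  \<open>bloch_op\<close>: for a function that is C^1 with absolutely continuous derivative it may
  be replaced by the explicit second derivative.\<close>

lemma weak_deriv_weak_deriv_AE:
  fixes v v0 v1 v2 :: "real \<Rightarrow> 'b::euclidean_space"
  assumes S: "open S" "is_interval S" "S \<noteq> {}"
    and v: "\<And>x. x \<in> S \<Longrightarrow> v x = v0 x" and v0: "\<And>x. x \<in> S \<Longrightarrow> (v0 has_vector_derivative v1 x) (at x)"
    and v2: "\<And>a b. {a..b} \<subseteq> S \<Longrightarrow> v2 absolutely_integrable_on {a..b}"
    and v1: "\<And>a b. a \<le> b \<Longrightarrow> {a..b} \<subseteq> S \<Longrightarrow> v1 b - v1 a = integral {a..b} v2"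
  shows "AE x in lebesgue. x \<in> S \<longrightarrow> weak_deriv S (weak_deriv S v) x = v2 x"
    "has_weak_deriv S (weak_deriv S v) (weak_deriv S (weak_deriv S v))"
proof -
  have w1: "has_weak_deriv S v1 v2" by (rule has_weak_deriv_primitive[OF S v2 v1])
  have "has_weak_deriv S v0 v1"
  proof (rule has_weak_deriv_primitive[OF S])
    show "v1 absolutely_integrable_on {a..b}" if "{a..b} \<subseteq> S" for a b
      by (rule has_weak_deriv_integrable(1)[OF w1 that])
    show "v0 b - v0 a = integral {a..b} v1" if ab: "a \<le> b" "{a..b} \<subseteq> S" for a b
    proof -
      have "(v1 has_integral (v0 b - v0 a)) {a..b}"
        using ab by (intro fundamental_theorem_of_calculus) (auto intro!: has_vector_derivative_at_within v0)
      then show ?thesis by (simp add: integral_unique)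
    qed
  qed
  then have wv: "has_weak_deriv S v v1"
    by (rule has_weak_deriv_cong_AE[OF S]) (use v in auto)
  note w = weak_deriv_AE[OF S(1) wv]
  have "has_weak_deriv S (weak_deriv S v) v2"
    by (rule has_weak_deriv_cong_AE[OF S w1 w(2)]) simp
  from weak_deriv_AE[OF S(1) this]
  show "AE x in lebesgue. x \<in> S \<longrightarrow> weak_deriv S (weak_deriv S v) x = v2 x"
    "has_weak_deriv S (weak_deriv S v) (weak_deriv S (weak_deriv S v))" by simp_all
qed

section \<open>Integrals over the cell and periodic functions\<close>

lemma has_vector_derivative_imp_continuous_on:
  assumes "\<And>x. (u has_vector_derivative u1 x) (at x)"
  shows "continuous_on S u"
  using has_vector_derivative_continuous[OF assms] by (simp add: continuous_at_imp_continuous_on)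

lemma has_integral_derivative:
  fixes u :: "real \<Rightarrow> 'b::euclidean_space"
  assumes "\<And>x. (u has_vector_derivative u1 x) (at x)" "a \<le> b"
  shows "(u1 has_integral (u b - u a)) {a..b}"
  by (rule fundamental_theorem_of_calculus[OF assms(2) has_vector_derivative_at_within[OF assms(1)]])

lemma absolutely_integrable_spike_AE:
  fixes F G :: "real \<Rightarrow> 'b::euclidean_space"
  assumes G: "G absolutely_integrable_on S" and S: "S \<in> sets lebesgue"
    and FG: "AE x in lebesgue. x \<in> S \<longrightarrow> F x = G x"
  shows "F absolutely_integrable_on S" "(LINT x|lebesgue_on S. F x) = integral S G"
proof -
  obtain N where N: "negligible N" "{x. \<not> (x \<in> S \<longrightarrow> F x = G x)} \<subseteq> N"
    using FG unfolding eventually_ae_filter_negligible by blast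
  show ai: "F absolutely_integrable_on S"
    by (rule absolutely_integrable_spike[OF G N(1)]) (use N(2) in blast)
  have "integral S F = integral S G"
    by (rule integral_spike[OF N(1)]) (use N(2) in auto)
  then show "(LINT x|lebesgue_on S. F x) = integral S G"
    using LINT_lebesgue_on_eq_integral[OF ai S] by simp
qed

lemma cell_sets: "cell \<in> sets lebesgue"
  by (rule open_imp_sets_lebesgue) simp

lemma cell_open_interval: "open cell" "is_interval cell" "cell \<noteq> {}"
  by (simp_all add: is_interval_oo not_le)

lemma absolutely_integrable_cell_iff:
  fixes F :: "real \<Rightarrow> 'b::euclidean_space"
  shows "F absolutely_integrable_on cell \<longleftrightarrow> F absolutely_integrable_on {-pi..pi}"
  by (simp add: absolutely_integrable_on_Icc_iff_Ioo)

lemma integral_cell: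
  fixes F :: "real \<Rightarrow> 'b::euclidean_space"
  shows "integral cell F = integral {-pi..pi} F"
  by (rule integral_open_interval_real[symmetric])

lemma pairing_eq_integral:
  assumes "(\<lambda>x. u x \<bullet> v x) absolutely_integrable_on {-pi..pi}"
  shows "pairing u v = integral {-pi..pi} (\<lambda>x. u x \<bullet> v x)"
  unfolding pairing_def
  using LINT_lebesgue_on_eq_integral[OF _ cell_sets, of "\<lambda>x. u x \<bullet> v x"] assms
  by (simp add: absolutely_integrable_cell_iff integral_cell)

lemma continuous_in_Lp2_cell:
  fixes q :: "real \<Rightarrow> 'b::euclidean_space"
  assumes "continuous_on UNIV q"
  shows "in_Lp 2 cell q"
proof -
  have m: "q \<in> borel_measurable (lebesgue_on cell)"
    by (rule continuous_imp_measurable_on_sets_lebesgue[OF continuous_on_subset[OF assms subset_UNIV] cell_sets])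
  obtain B where B: "\<forall>y\<in>q ` {-pi..pi}. norm y \<le> B"
    using compact_imp_bounded[OF compact_continuous_image[OF continuous_on_subset[OF assms subset_UNIV] compact_Icc]]
    unfolding bounded_iff ..
  have "(\<integral>\<^sup>+ x. ennreal (norm (q x) powr 2) \<partial>lebesgue_on cell) \<le> (\<integral>\<^sup>+ x. ennreal (B powr 2) \<partial>lebesgue_on cell)"
  proof (rule nn_integral_mono)
    fix x assume "x \<in> space (lebesgue_on cell)"
    then have "norm (q x) \<le> B" using B by auto
    then show "ennreal (norm (q x) powr 2) \<le> ennreal (B powr 2)"
      by (intro ennreal_leI powr_mono2) auto
  qed
  also have "\<dots> = ennreal (B powr 2) * emeasure lebesgue cell"
    by (simp add: emeasure_restrict_space)
  also have "\<dots> < \<infinity>" by (simp add: ennreal_mult_less_top)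
  finally show ?thesis using m by (simp add: in_Lp_def Lp_norm_def Let_def)
qed

lemma periodic_derivative:
  fixes u :: "real \<Rightarrow> 'b::real_normed_vector"
  assumes u: "\<And>x. (u has_vector_derivative u1 x) (at x)" and p: "periodic u"
  shows "periodic u1"
  unfolding periodic_def
proof
  fix x
  have "((\<lambda>x. u (x + 2 * pi)) has_vector_derivative 1 *\<^sub>R u1 (x + 2 * pi)) (at x)"
    by (rule vector_diff_chain_at[of "\<lambda>x. x + 2 * pi" 1 x u, unfolded o_def])
      (auto intro!: derivative_eq_intros u simp: has_real_derivative_iff_has_vector_derivative[symmetric])
  moreover have "(\<lambda>x. u (x + 2 * pi)) = u" using p by (simp add: periodic_def)
  ultimately show "u1 (x + 2 * pi) = u1 x" using vector_derivative_unique_at[OF u] by auto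
qed

lemma periodic_reduce:
  assumes "periodic u"
  obtains y where "y \<in> {-pi..pi}" "u x = u y"
proof -
  have n: "u (x - 2 * pi * real n) = u x" for n x
  proof (induction n arbitrary: x)
    case (Suc n)
    have "u (x - 2 * pi * real (Suc n)) = u (x - 2 * pi * real (Suc n) + 2 * pi)"
      using assms by (simp add: periodic_def)
    then show ?case using Suc by (simp add: algebra_simps)
  qed simp
  have z: "u (x - 2 * pi * of_int k) = u x" for k
  proof (cases "0 \<le> k")
    case True
    then show ?thesis using n[of x "nat k"] by simp
  next
    case False
    then show ?thesis using n[of "x - 2 * pi * of_int k" "nat (- k)"] by simp
  qed
  define k where "k = \<lfloor>(x + pi) / (2 * pi)\<rfloor>"
  have "of_int k \<le> (x + pi) / (2 * pi)" "(x + pi) / (2 * pi) < of_int k + 1"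
    unfolding k_def by linarith+
  then have "x - 2 * pi * of_int k \<in> {-pi..pi}" by (simp add: field_simps)
  with z show thesis by (intro that[of "x - 2 * pi * of_int k"]) auto
qed

lemma periodic_bounded:
  fixes u :: "real \<Rightarrow> 'b::real_normed_vector"
  assumes "periodic u" "continuous_on UNIV u"
  obtains B where "B > 0" "\<And>x. norm (u x) \<le> B"
proof -
  obtain B where B: "\<forall>y\<in>u ` {-pi..pi}. norm y \<le> B"
    using compact_imp_bounded[OF compact_continuous_image[OF continuous_on_subset[OF assms(2) subset_UNIV] compact_Icc]]
    unfolding bounded_iff ..
  have "norm (u x) \<le> \<bar>B\<bar> + 1" for x
  proof -
    obtain y where "y \<in> {-pi..pi}" "u x = u y" by (rule periodic_reduce[OF assms(1)])
    then have "norm (u x) \<le> B" using B by simp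
    then show ?thesis by simp
  qed
  then show thesis by (intro that[of "\<bar>B\<bar> + 1"]) auto
qed

lemma periodic_shift_integral:
  fixes u :: "real \<Rightarrow> 'b::euclidean_space"
  assumes p: "periodic u" and c: "continuous_on UNIV u"
  shows "integral {a..a + 2 * pi} u = integral {-pi..pi} u"
proof -
  have i: "u integrable_on {a..b}" for a b
    by (rule integrable_continuous_real[OF continuous_on_subset[OF c subset_UNIV]])
  obtain \<gamma> where \<gamma>: "\<And>a b. a \<le> b \<Longrightarrow> \<gamma> b - \<gamma> a = integral {a..b} u" using primitive_exists[OF i] by metis
  have d: "(\<gamma> has_vector_derivative u x) (at x)" for x by (rule primitive_has_vector_derivative[OF c \<gamma>])
  have "((\<lambda>x. \<gamma> (x + 2 * pi)) has_vector_derivative 1 *\<^sub>R u (x + 2 * pi)) (at x)" for x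
    by (rule vector_diff_chain_at[of "\<lambda>x. x + 2 * pi" 1 x \<gamma>, unfolded o_def])
      (auto intro!: derivative_eq_intros d simp: has_real_derivative_iff_has_vector_derivative[symmetric])
  then have "((\<lambda>x. \<gamma> (x + 2 * pi) - \<gamma> x) has_vector_derivative 1 *\<^sub>R u (x + 2 * pi) - u x) (at x)" for x
    by (rule has_vector_derivative_diff[OF _ d])
  then have "((\<lambda>x. \<gamma> (x + 2 * pi) - \<gamma> x) has_derivative (\<lambda>h. 0)) (at x)" for x
    using p by (simp add: has_vector_derivative_def periodic_def)
  then have "\<gamma> (a + 2 * pi) - \<gamma> a = \<gamma> (-pi + 2 * pi) - \<gamma> (-pi)"
    using has_derivative_zero_unique[of UNIV "\<lambda>x. \<gamma> (x + 2 * pi) - \<gamma> x" "-pi" a] by simp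
  then show ?thesis using \<gamma>[of a "a + 2 * pi"] \<gamma>[of "-pi" "-pi + 2 * pi"] by simp
qed

text \<open>Zero mean makes the primitive periodic; normalizing the primitive to zero mean again
  allows the construction to be iterated.\<close>

lemma periodic_primitive:
  fixes p :: "real \<Rightarrow> 'b::euclidean_space"
  assumes p: "periodic p" "continuous_on UNIV p" and z: "integral {-pi..pi} p = 0"
  obtains q where "periodic q" "\<forall>x. (q has_vector_derivative p x) (at x)" "integral {-pi..pi} q = 0"
    "continuous_on UNIV q"
proof -
  have i: "p integrable_on {a..b}" for a b
    by (rule integrable_continuous_real[OF continuous_on_subset[OF p(2) subset_UNIV]])
  obtain \<gamma> where \<gamma>: "\<And>a b. a \<le> b \<Longrightarrow> \<gamma> b - \<gamma> a = integral {a..b} p" using primitive_exists[OF i] by metis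
  have d: "(\<gamma> has_vector_derivative p x) (at x)" for x by (rule primitive_has_vector_derivative[OF p(2) \<gamma>])
  have c: "continuous_on UNIV \<gamma>"
    by (rule has_vector_derivative_imp_continuous_on[OF d])
  have per: "\<gamma> (x + 2 * pi) = \<gamma> x" for x
    using \<gamma>[of x "x + 2 * pi"] periodic_shift_integral[OF p, of x] z by simp
  define m where "m = integral {-pi..pi} \<gamma> /\<^sub>R (2 * pi)"
  define q where "q x = \<gamma> x - m" for x
  have "integral {-pi..pi} q = integral {-pi..pi} \<gamma> - integral {-pi..pi} (\<lambda>x. m)"
    unfolding q_def[abs_def]
    by (intro Henstock_Kurzweil_Integration.integral_diff integrable_const_ivl
      integrable_continuous_real[OF continuous_on_subset[OF c subset_UNIV]])
  also have "\<dots> = 0" by (simp add: m_def)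
  finally have 1: "integral {-pi..pi} q = 0" .
  have "(q has_vector_derivative p x - 0) (at x)" for x
    unfolding q_def[abs_def] by (rule has_vector_derivative_diff[OF d has_vector_derivative_const])
  moreover have "continuous_on UNIV q" unfolding q_def[abs_def] by (intro continuous_intros c)
  moreover have "periodic q" by (simp add: periodic_def q_def per)
  ultimately show thesis using 1 by (intro that) simp_all
qed

section \<open>Real test functions for the adjoint kernel\<close>

lemma continuous_matrix_vector_mult [continuous_intros]:
  fixes A :: "'a::topological_space \<Rightarrow> real^'n^'m"
  assumes "continuous_on S A" "continuous_on S v"
  shows "continuous_on S (\<lambda>x. A x *v v x)"
  unfolding matrix_vector_mult_def by (intro continuous_intros assms)

lemma cmat_cvec: "cmat A *v cvec v = cvec (A *v v)"
  by (simp add: cmat_def cvec_def matrix_vector_mult_def vec_eq_iff)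

lemma cvec_add: "cvec u + cvec v = cvec (u + v)"
  by (simp add: cvec_def vec_eq_iff)

lemma bounded_linear_cvec: "bounded_linear cvec"
proof (rule bounded_linear_intro)
  show "cvec (x + y) = cvec x + cvec y" for x y by (simp add: cvec_add)
  show "cvec (r *\<^sub>R x) = r *\<^sub>R cvec x" for r x
    by (simp add: cvec_def vec_eq_iff) (simp add: scaleR_conv_of_real)
  show "norm (cvec x) \<le> norm x * 1" for x
    by (simp add: cvec_def norm_vec_def L2_set_def)
qed

lemma cvec_cnj_sum: "(\<Sum>i\<in>UNIV. cvec a $ i * cnj (cvec b $ i)) = complex_of_real (a \<bullet> b)"
  by (simp add: cvec_def inner_vec_def)

lemma in_L2_torus_cvec:
  assumes "periodic u" "continuous_on UNIV u"
  shows "in_L2_torus (\<lambda>x. cvec (u x))"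
  unfolding in_L2_torus_def
proof
  show "periodic (\<lambda>x. cvec (u x))" using assms(1) by (simp add: periodic_def)
  show "in_Lp 2 cell (\<lambda>x. cvec (u x))"
    by (rule continuous_in_Lp2_cell[OF bounded_linear.continuous_on[OF bounded_linear_cvec assms(2)]])
qed

lemma has_weak_deriv_classical:
  fixes u :: "real \<Rightarrow> 'b::euclidean_space"
  assumes "\<And>x. (u has_vector_derivative u1 x) (at x)" "continuous_on UNIV u1"
  shows "has_weak_deriv UNIV u u1"
proof (rule has_weak_deriv_primitive[OF open_UNIV is_interval_univ UNIV_not_empty])
  show "u1 absolutely_integrable_on {a..b}" for a b
    by (rule absolutely_integrable_continuous_real[OF continuous_on_subset[OF assms(2) subset_UNIV]])
  show "u b - u a = integral {a..b} u1" if "a \<le> b" for a b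
    using integral_unique[OF has_integral_derivative[OF assms(1) that]] by simp
qed

text \<open>The kernel is defined with complex H^2 functions and weak derivatives. On real periodic
  C^2 functions the complexification splits off and the condition becomes a classical real integral
  identity.\<close>

lemma adjoint_kernel_test:
  fixes u :: "real \<Rightarrow> real^'n"
  assumes ker: "in_adjoint_kernel D f ustar (\<lambda>x. cvec (uad x))" and uad: "continuous_on UNIV uad"
    and J: "continuous_on UNIV (\<lambda>x. jac f (ustar x))"
    and u: "periodic u" "\<And>x. (u has_vector_derivative u1 x) (at x)" "\<And>x. (u1 has_vector_derivative u2 x) (at x)"
      "continuous_on UNIV u2"
  shows "integral {-pi..pi} (\<lambda>x. (D *v u2 x + jac f (ustar x) *v u x) \<bullet> uad x) = 0"
proof -
  have c: "continuous_on UNIV u" "continuous_on UNIV u1"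
    by (rule has_vector_derivative_imp_continuous_on[OF u(2)] has_vector_derivative_imp_continuous_on[OF u(3)])+
  have per: "periodic u1" "periodic u2"
    by (rule periodic_derivative[OF u(2,1)], rule periodic_derivative[OF u(3) periodic_derivative[OF u(2,1)]])
  let ?U = "\<lambda>x. cvec (u x)"
  have dU: "((\<lambda>x. cvec (u x)) has_vector_derivative cvec (u1 x)) (at x)"
    "((\<lambda>x. cvec (u1 x)) has_vector_derivative cvec (u2 x)) (at x)" for x
    by (rule bounded_linear.has_vector_derivative[OF bounded_linear_cvec u(2)]
      bounded_linear.has_vector_derivative[OF bounded_linear_cvec u(3)])+
  have cU: "continuous_on UNIV (\<lambda>x. cvec (u1 x))" "continuous_on UNIV (\<lambda>x. cvec (u2 x))"
    by (rule bounded_linear.continuous_on[OF bounded_linear_cvec c(2)]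
      bounded_linear.continuous_on[OF bounded_linear_cvec u(4)])+
  note w = has_weak_deriv_classical[OF dU(1) cU(1)] has_weak_deriv_classical[OF dU(2) cU(2)]
  have H2: "in_H2_torus ?U"
    unfolding in_H2_torus_def
    by (rule conjI[OF in_L2_torus_cvec[OF u(1) c(1)]], rule exI, rule exI,
      rule conjI[OF in_L2_torus_cvec[OF per(1) c(2)] conjI[OF in_L2_torus_cvec[OF per(2) u(4)] conjI[OF w]]])
  have bd: "bloch_deriv 0 v = weak_deriv UNIV v" for v :: "real \<Rightarrow> complex^'n"
    by (simp add: bloch_deriv_def)
  have ae0: "AE x in lebesgue. x \<in> UNIV \<longrightarrow> weak_deriv UNIV (weak_deriv UNIV ?U) x = cvec (u2 x)"
  proof (rule weak_deriv_weak_deriv_AE(1)[OF open_UNIV is_interval_univ UNIV_not_empty refl dU(1)])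
    show "(\<lambda>x. cvec (u2 x)) absolutely_integrable_on {a..b}" for a b
      by (rule absolutely_integrable_continuous_real[OF continuous_on_subset[OF cU(2) subset_UNIV]])
    show "cvec (u1 b) - cvec (u1 a) = integral {a..b} (\<lambda>x. cvec (u2 x))" if "a \<le> b" for a b
      using integral_unique[OF has_integral_derivative[OF dU(2) that]] by simp
  qed
  have bl: "bloch_op D f ustar 0 ?U x = cvec (D *v u2 x + jac f (ustar x) *v u x)"
    if "weak_deriv UNIV (weak_deriv UNIV ?U) x = cvec (u2 x)" for x
    unfolding bloch_op_def bd that cmat_cvec cvec_add ..
  from ae0 have ae: "AE x in lebesgue. x \<in> cell \<longrightarrow>
      (\<Sum>i\<in>UNIV. bloch_op D f ustar 0 ?U x $ i * cnj (cvec (uad x) $ i)) =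
      complex_of_real ((D *v u2 x + jac f (ustar x) *v u x) \<bullet> uad x)"
    by (rule AE_mp) (rule AE_I2, intro impI, simp only: bl UNIV_I simp_thms cvec_cnj_sum)
  let ?G = "\<lambda>x. (D *v u2 x + jac f (ustar x) *v u x) \<bullet> uad x"
  have cG: "continuous_on UNIV ?G"
    by (intro continuous_intros u(4) c J uad)
  have aiG: "(\<lambda>x. complex_of_real (?G x)) absolutely_integrable_on {-pi..pi}"
    by (intro absolutely_integrable_continuous_real continuous_intros continuous_on_subset[OF u(4) subset_UNIV]
      continuous_on_subset[OF c(1) subset_UNIV] continuous_on_subset[OF J subset_UNIV] continuous_on_subset[OF uad subset_UNIV])
  have "0 = (LINT x|lebesgue_on cell. (\<Sum>i\<in>UNIV. bloch_op D f ustar 0 ?U x $ i * cnj (cvec (uad x) $ i)))"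
    using ker H2 by (simp add: in_adjoint_kernel_def)
  also have "\<dots> = integral cell (\<lambda>x. complex_of_real (?G x))"
    by (rule absolutely_integrable_spike_AE(2)[OF _ cell_sets ae]) (simp add: absolutely_integrable_cell_iff aiG)
  also have "\<dots> = complex_of_real (integral {-pi..pi} ?G)"
    unfolding integral_cell
    using integral_linear[OF integrable_continuous_real[OF continuous_on_subset[OF cG subset_UNIV]] bounded_linear_of_real]
    by (simp only: o_def)
  finally show ?thesis by simp
qed

section \<open>Local Lipschitz and Taylor bounds for the nonlinearity\<close>

text \<open>The operator norm of the derivative is at most the sum of its norms on basis vectors.
  That sum is continuous, hence bounded on the ball, and the mean value inequality applies.\<close>

lemma C_1_lipschitz_on_cball:
  fixes G :: "'a::euclidean_space \<Rightarrow> 'b::real_normed_vector"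
  assumes "C_k_on (Suc 0) UNIV G"
  obtains L where "L \<ge> 0" "\<And>y y'. norm y \<le> R \<Longrightarrow> norm y' \<le> R \<Longrightarrow> norm (G y - G y') \<le> L * norm (y - y')"
proof -
  define F where "F y = frechet_derivative G (at y)" for y
  have d: "(G has_derivative F y) (at y)" for y
    unfolding F_def using assms by (simp add: differentiable_on_def frechet_derivative_works[symmetric])
  have cF: "continuous_on UNIV (\<lambda>y. F y k)" for k
    using assms by (simp add: F_def)
  define S where "S y = (\<Sum>k\<in>Basis. norm (F y k))" for y
  have cS: "continuous_on UNIV S" unfolding S_def[abs_def] by (intro continuous_intros cF)
  obtain B where B0: "\<forall>s\<in>S ` cball 0 R. norm s \<le> B"
    using compact_imp_bounded[OF compact_continuous_image[OF continuous_on_subset[OF cS subset_UNIV] compact_cball]]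
    unfolding bounded_iff ..
  have B: "S y \<le> B" if "y \<in> cball 0 R" for y
  proof -
    have "norm (S y) \<le> B" using B0 that by blast
    then show ?thesis by (simp add: abs_le_iff)
  qed
  have on: "onorm (F y) \<le> S y" for y
  proof (rule onorm_le)
    fix v
    have "F y v = F y (\<Sum>k\<in>Basis. (v \<bullet> k) *\<^sub>R k)" by (simp add: euclidean_representation)
    also have "\<dots> = (\<Sum>k\<in>Basis. (v \<bullet> k) *\<^sub>R F y k)"
      using has_derivative_linear[OF d[of y]] by (simp add: linear_sum linear_cmul)
    finally have "norm (F y v) = norm (\<Sum>k\<in>Basis. (v \<bullet> k) *\<^sub>R F y k)" by simp
    also have "\<dots> \<le> (\<Sum>k\<in>Basis. norm v * norm (F y k))"
      by (rule sum_norm_le) (simp add: mult_right_mono Basis_le_norm)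
    finally show "norm (F y v) \<le> S y * norm v" by (simp add: S_def sum_distrib_left mult.commute)
  qed
  have "norm (G y - G y') \<le> \<bar>B\<bar> * norm (y - y')" if "norm y \<le> R" "norm y' \<le> R" for y y'
  proof (rule differentiable_bound[of "cball 0 R" G F])
    show "(G has_derivative F x) (at x within cball 0 R)" for x by (rule has_derivative_at_withinI[OF d])
    show "onorm (F x) \<le> \<bar>B\<bar>" if "x \<in> cball 0 R" for x using on[of x] B[OF that] by linarith
  qed (use that in auto)
  then show thesis by (intro that[of "\<bar>B\<bar>"]) auto
qed

lemma jac_mult: "f differentiable (at y) \<Longrightarrow> jac f y *v h = frechet_derivative f (at y) h"
  unfolding jac_def by (simp add: matrix_works linear_frechet_derivative)

lemma jac_has_derivative:
  assumes "f differentiable (at y)"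
  shows "(f has_derivative (\<lambda>h. jac f y *v h)) (at y)"
  unfolding jac_mult[OF assms] using assms by (simp add: frechet_derivative_works)

lemma C_k_on_differentiable: "C_k_on (Suc k) UNIV f \<Longrightarrow> f differentiable (at x)"
  by (simp add: differentiable_on_def)

lemma matrix_mult_norm_le_rows:
  fixes A :: "real^'n^'m"
  shows "norm (A *v v) \<le> (\<Sum>k\<in>UNIV. norm (A *v axis k 1)) * norm v"
proof -
  have "A *v v = A *v (\<Sum>k\<in>UNIV. v $ k *s axis k 1)" by (simp add: basis_expansion)
  also have "\<dots> = (\<Sum>k\<in>UNIV. v $ k *\<^sub>R (A *v axis k 1))"
    by (simp add: linear_sum[OF matrix_vector_mul_linear] matrix_vector_mult_scaleR scalar_mult_eq_scaleR)
  finally have "norm (A *v v) = norm (\<Sum>k\<in>UNIV. v $ k *\<^sub>R (A *v axis k 1))" by simp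
  also have "\<dots> \<le> (\<Sum>k\<in>UNIV. norm v * norm (A *v axis k 1))"
    by (rule sum_norm_le) (simp add: mult_right_mono component_le_norm_cart)
  finally show ?thesis by (simp add: sum_distrib_left mult.commute)
qed

text \<open>\<open>C_k_on\<close> controls the derivative in one fixed direction at a time, so the
  Lipschitz bound is obtained column by column and summed.\<close>

lemma jac_lipschitz_on_cball:
  fixes f :: "real^'n \<Rightarrow> real^'n"
  assumes f: "C_k_on (Suc (Suc 0)) UNIV f"
  obtains L where "L \<ge> 0" "\<And>y y' v. norm y \<le> R \<Longrightarrow> norm y' \<le> R \<Longrightarrow>
    norm (jac f y *v v - jac f y' *v v) \<le> L * norm (y - y') * norm v"
proof -
  have "\<exists>L\<ge>0. \<forall>y y'. norm y \<le> R \<longrightarrow> norm y' \<le> R \<longrightarrow>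
      norm (jac f y *v axis k 1 - jac f y' *v axis k 1) \<le> L * norm (y - y')" for k
  proof -
    have "C_k_on (Suc 0) UNIV (\<lambda>y. frechet_derivative f (at y) (axis k 1))"
      using f[unfolded C_k_on.simps(2)[of "Suc 0"]] by blast
    then obtain L where "L \<ge> 0" "\<And>y y'. norm y \<le> R \<Longrightarrow> norm y' \<le> R \<Longrightarrow>
        norm (frechet_derivative f (at y) (axis k 1) - frechet_derivative f (at y') (axis k 1)) \<le> L * norm (y - y')"
      using C_1_lipschitz_on_cball by blast
    then show ?thesis using jac_mult[OF C_k_on_differentiable[OF f]] by auto
  qed
  then obtain L where L: "\<And>k. L k \<ge> 0" "\<And>k y y'. norm y \<le> R \<Longrightarrow> norm y' \<le> R \<Longrightarrow>
      norm (jac f y *v axis k 1 - jac f y' *v axis k 1) \<le> L k * norm (y - y')"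
    by metis
  have "norm (jac f y *v v - jac f y' *v v) \<le> (\<Sum>k\<in>UNIV. L k) * norm (y - y') * norm v"
    if y: "norm y \<le> R" "norm y' \<le> R" for y y' v
  proof -
    have "norm ((jac f y - jac f y') *v v) \<le> (\<Sum>k\<in>UNIV. norm ((jac f y - jac f y') *v axis k 1)) * norm v"
      by (rule matrix_mult_norm_le_rows)
    also have "\<dots> \<le> (\<Sum>k\<in>UNIV. L k * norm (y - y')) * norm v"
      using L(2)[OF y] by (intro mult_right_mono sum_mono) (simp_all add: matrix_vector_mult_diff_rdistrib)
    finally show ?thesis by (simp add: matrix_vector_mult_diff_rdistrib sum_distrib_right)
  qed
  moreover have "(\<Sum>k\<in>UNIV. L k) \<ge> 0" by (rule sum_nonneg) (rule L(1))
  ultimately show thesis by (intro that)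
qed

lemma jac_continuous:
  fixes f :: "real^'n \<Rightarrow> real^'n"
  assumes f: "C_k_on (Suc (Suc 0)) UNIV f"
  shows "continuous_on UNIV (jac f)"
proof -
  have c: "continuous_on UNIV (\<lambda>y. jac f y *v axis k 1)" for k
  proof -
    have "C_k_on (Suc 0) UNIV (\<lambda>y. frechet_derivative f (at y) (axis k 1))"
      using f[unfolded C_k_on.simps(2)[of "Suc 0"]] by blast
    then have "continuous_on UNIV (\<lambda>y. frechet_derivative f (at y) (axis k 1))"
      by (simp add: differentiable_imp_continuous_on)
    then show ?thesis by (simp add: jac_mult[OF C_k_on_differentiable[OF f]])
  qed
  have "continuous_on UNIV (\<lambda>y. \<chi> i j. (jac f y *v axis j 1) $ i)"
    by (intro continuous_intros c)
  moreover have "(\<chi> i j. (jac f y *v axis j 1) $ i) = jac f y" for y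
    by (simp add: vec_eq_iff matrix_vector_mul_component inner_axis)
  ultimately show ?thesis by simp
qed

text \<open>Mean value inequality for \<open>f\<close> minus its linearization on the segment, where
  the Jacobian varies by at most \<open>L * norm h\<close>.\<close>

lemma jac_taylor_on_cball:
  fixes f :: "real^'n \<Rightarrow> real^'n"
  assumes f: "C_k_on (Suc (Suc 0)) UNIV f"
  obtains L where "L \<ge> 0" "\<And>y h. norm y \<le> R \<Longrightarrow> norm (y + h) \<le> R \<Longrightarrow>
    norm (f (y + h) - f y - jac f y *v h) \<le> L * (norm h)\<^sup>2"
proof -
  obtain L where L: "L \<ge> 0" "\<And>y y' v. norm y \<le> R \<Longrightarrow> norm y' \<le> R \<Longrightarrow>
    norm (jac f y *v v - jac f y' *v v) \<le> L * norm (y - y') * norm v"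
    using jac_lipschitz_on_cball[OF f] by blast
  have "norm (f (y + h) - f y - jac f y *v h) \<le> L * (norm h)\<^sup>2" if y: "norm y \<le> R" "norm (y + h) \<le> R" for y h
  proof -
    let ?S = "closed_segment y (y + h)"
    have S: "norm x \<le> R" "norm (x - y) \<le> norm h" if x: "x \<in> ?S" for x
    proof -
      have "?S \<subseteq> cball 0 R" using y by (intro closed_segment_subset) auto
      then show "norm x \<le> R" using x by auto
      obtain t where "0 \<le> t" "t \<le> 1" "x = (1 - t) *\<^sub>R y + t *\<^sub>R (y + h)"
        using x by (auto simp: in_segment)
      then have "x - y = t *\<^sub>R h" "0 \<le> t" "t \<le> 1" by (auto simp: algebra_simps)
      then show "norm (x - y) \<le> norm h" by (simp add: mult_left_le_one_le)
    qed
    have "norm (f (y + h) - f y - jac f y *v (y + h - y)) \<le> norm (y + h - y) * (L * norm h)"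
    proof (rule differentiable_bound_linearization[where S="?S" and f'="\<lambda>x h. jac f x *v h"])
      show "y + t *\<^sub>R (y + h - y) \<in> ?S" if "t \<in> {0..1}" for t
        using that unfolding in_segment by (intro exI[of _ t]) (auto simp: algebra_simps)
      show "(f has_derivative (\<lambda>h. jac f x *v h)) (at x within ?S)" for x
        by (rule has_derivative_at_withinI[OF jac_has_derivative[OF C_k_on_differentiable[OF f]]])
      show "onorm ((\<lambda>h. jac f x *v h) - (\<lambda>h. jac f y *v h)) \<le> L * norm h" if x: "x \<in> ?S" for x
      proof (rule onorm_le)
        fix v
        have "norm (jac f x *v v - jac f y *v v) \<le> L * norm (x - y) * norm v"
          using S(1)[OF x] y(1) by (rule L(2))
        also have "\<dots> \<le> L * norm h * norm v"
          using S(2)[OF x] L(1) by (intro mult_right_mono mult_left_mono) auto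
        finally show "norm (((\<lambda>h. jac f x *v h) - (\<lambda>h. jac f y *v h)) v) \<le> L * norm h * norm v"
          by simp
      qed
    qed simp
    then show ?thesis by (simp add: power2_eq_square algebra_simps)
  qed
  with L(1) show thesis by (intro that)
qed

section \<open>Regularity of the adjoint mode\<close>

lemma diagonal_mult_component:
  fixes D :: "real^'n^'n"
  assumes "\<And>i j. i \<noteq> j \<Longrightarrow> D $ i $ j = 0"
  shows "(D *v x) $ i = D $ i $ i * x $ i"
proof -
  have "(D *v x) $ i = (\<Sum>j\<in>UNIV. D $ i $ j * x $ j)" by (simp add: matrix_vector_mult_def)
  also have "\<dots> = (\<Sum>j\<in>UNIV. if j = i then D $ i $ i * x $ i else 0)"
    using assms by (intro sum.cong) auto
  finally show ?thesis by simp
qed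

lemma diagonal_inner:
  fixes D :: "real^'n^'n"
  assumes "\<And>i j. i \<noteq> j \<Longrightarrow> D $ i $ j = 0"
  shows "(D *v x) \<bullet> y = x \<bullet> (D *v y)"
  by (simp add: inner_vec_def diagonal_mult_component[OF assms] mult.left_commute mult.assoc)

text \<open>Elliptic regularity by hand. Let m = f'(ustar)^T uad. It has zero mean, so there is a
  periodic M with M'' = m. The claim is that r = D uad + M is constant. Let p be r minus its mean
  and u periodic with u'' = p. Testing the kernel condition with u and moving two derivatives from u
  to M gives that p is orthogonal to r; being also orthogonal to constants, p is orthogonal to
  itself, so p = 0. Since D is invertible, uad is D^(-1) applied to a constant minus M and is
  therefore C^2.\<close>

lemma adjoint_mode_regular:
  fixes D :: "real^'n^'n"
  assumes D: "\<And>i j. i \<noteq> j \<Longrightarrow> D $ i $ j = 0" "\<And>i. D $ i $ i > 0"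
    and J: "continuous_on UNIV (\<lambda>x. jac f (ustar x))" "periodic ustar"
    and ker: "in_adjoint_kernel D f ustar (\<lambda>x. cvec (uad x))" and uad: "continuous_on UNIV uad"
  obtains z1 z2 where "periodic uad" "\<And>x. (uad has_vector_derivative z1 x) (at x)"
    "\<And>x. (z1 has_vector_derivative z2 x) (at x)" "continuous_on UNIV z2"
    "\<And>x. D *v z2 x + transpose (jac f (ustar x)) *v uad x = 0"
proof -
  have per: "periodic uad"
    using ker by (simp add: in_adjoint_kernel_def in_L2_torus_def periodic_def cvec_def vec_eq_iff)
  define m where "m x = transpose (jac f (ustar x)) *v uad x" for x
  have pm: "periodic m" using per J(2) by (simp add: m_def periodic_def)
  have cm: "continuous_on UNIV m"
  proof -
    have "m = (\<lambda>x. uad x v* jac f (ustar x))" by (simp add: m_def fun_eq_iff)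
    then show ?thesis
      unfolding vector_matrix_mult_def by (simp only:) (intro continuous_intros uad J)
  qed
  have Jm: "(jac f (ustar x) *v v) \<bullet> uad x = v \<bullet> m x" for v x
    using dot_lmul_matrix[of "uad x" "jac f (ustar x)" v] by (simp add: m_def inner_commute)
  have ci: "q integrable_on {a..b}" if "continuous_on UNIV q" for q :: "real \<Rightarrow> 'z::euclidean_space" and a b
    by (rule integrable_continuous_real[OF continuous_on_subset[OF that subset_UNIV]])
  have m0: "integral {-pi..pi} m = 0"
  proof -
    have "v \<bullet> integral {-pi..pi} m = 0" for v
    proof -
      \<comment> \<open>Constants are periodic, so they are legitimate test functions; they show
        that \<open>m\<close> has zero mean.\<close>
      have "integral {-pi..pi} (\<lambda>x. (D *v 0 + jac f (ustar x) *v v) \<bullet> uad x) = 0"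
        by (rule adjoint_kernel_test[OF ker uad J(1), of "\<lambda>x. v" "\<lambda>x. 0" "\<lambda>x. 0"]) (simp_all add: periodic_def)
      then show ?thesis
        using integral_linear[OF ci[OF cm] bounded_linear_inner_right[of v]] by (simp add: o_def Jm)
    qed
    then show ?thesis by (metis inner_eq_zero_iff)
  qed
  obtain M1 where M1': "periodic M1" "\<forall>x. (M1 has_vector_derivative m x) (at x)" "integral {-pi..pi} M1 = 0"
    "continuous_on UNIV M1" by (rule periodic_primitive[OF pm cm m0])
  note M1 = M1'(1) M1'(2)[rule_format] M1'(3,4)
  obtain M where M': "periodic M" "\<forall>x. (M has_vector_derivative M1 x) (at x)" "integral {-pi..pi} M = 0"
    "continuous_on UNIV M" by (rule periodic_primitive[OF M1(1,4,3)])
  note M = M'(1) M'(2)[rule_format] M'(3,4)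
  define r where "r x = D *v uad x + M x" for x
  have pr: "periodic r" using per M(1) by (simp add: r_def periodic_def)
  have cr: "continuous_on UNIV r" unfolding r_def[abs_def] by (intro continuous_intros uad M)
  define rb where "rb = integral {-pi..pi} r /\<^sub>R (2 * pi)"
  define p where "p x = r x - rb" for x
  have pp: "periodic p" using pr by (simp add: p_def periodic_def)
  have cp: "continuous_on UNIV p" unfolding p_def[abs_def] by (intro continuous_intros cr)
  have p0: "integral {-pi..pi} p = 0"
  proof -
    have "integral {-pi..pi} p = integral {-pi..pi} r - integral {-pi..pi} (\<lambda>x. rb)"
      unfolding p_def[abs_def] by (intro Henstock_Kurzweil_Integration.integral_diff integrable_const_ivl ci cr)
    then show ?thesis by (simp add: rb_def)
  qed
  \<comment> \<open>Two successive zero-mean primitives of \<open>p\<close> give the periodic test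
    function \<open>u\<close> with second derivative \<open>p\<close>.\<close>
  obtain u1 where u1': "periodic u1" "\<forall>x. (u1 has_vector_derivative p x) (at x)" "integral {-pi..pi} u1 = 0"
    "continuous_on UNIV u1" by (rule periodic_primitive[OF pp cp p0])
  note u1 = u1'(1) u1'(2)[rule_format] u1'(3,4)
  obtain u where u': "periodic u" "\<forall>x. (u has_vector_derivative u1 x) (at x)" "integral {-pi..pi} u = 0"
    "continuous_on UNIV u" by (rule periodic_primitive[OF u1(1,4,3)])
  note u = u'(1) u'(2)[rule_format] u'(3,4)
  have 1: "integral {-pi..pi} (\<lambda>x. (D *v p x + jac f (ustar x) *v u x) \<bullet> uad x) = 0"
    by (rule adjoint_kernel_test[OF ker uad J(1) u(1,2) u1(2) cp])
  have 2: "((\<lambda>x. u x \<bullet> m x - p x \<bullet> M x) has_integral 0) {-pi..pi}"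
  proof -
    have "((\<lambda>x. u x \<bullet> M1 x - u1 x \<bullet> M x) has_vector_derivative
        (u x \<bullet> m x + u1 x \<bullet> M1 x) - (u1 x \<bullet> M1 x + p x \<bullet> M x)) (at x)" for x
      by (intro has_vector_derivative_diff bounded_bilinear.has_vector_derivative[OF bounded_bilinear_inner] u u1 M M1)
    from has_integral_derivative[OF this, of "-pi" pi] have "((\<lambda>x. (u x \<bullet> m x + u1 x \<bullet> M1 x) - (u1 x \<bullet> M1 x + p x \<bullet> M x)) has_integral
        (u pi \<bullet> M1 pi - u1 pi \<bullet> M pi) - (u (-pi) \<bullet> M1 (-pi) - u1 (-pi) \<bullet> M (-pi))) {-pi..pi}"
      by simp
    moreover have "q pi = q (-pi)" if "periodic q" for q :: "real \<Rightarrow> real^'n"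
      using that[unfolded periodic_def, rule_format, of "-pi"] by simp
    note this[OF u(1)] this[OF u1(1)] this[OF M(1)] this[OF M1(1)]
    ultimately show ?thesis by simp
  qed
  \<comment> \<open>By symmetry of \<open>D\<close> the integrand of the tested identity minus that
    of the integrated-by-parts identity is \<open>p x\<close> paired with \<open>D\<close> applied
    to \<open>uad x\<close> plus \<open>M x\<close>.\<close>
  have 3: "integral {-pi..pi} (\<lambda>x. p x \<bullet> r x) = 0"
  proof -
    have e: "p x \<bullet> r x = (D *v p x + jac f (ustar x) *v u x) \<bullet> uad x - (u x \<bullet> m x - p x \<bullet> M x)" for x
      by (simp add: r_def inner_add_left inner_add_right Jm diagonal_inner[OF D(1)])
    have i1: "(\<lambda>x. (D *v p x + jac f (ustar x) *v u x) \<bullet> uad x) integrable_on {-pi..pi}"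
      by (intro ci continuous_intros cp J u uad)
    show ?thesis
      unfolding e using Henstock_Kurzweil_Integration.integral_diff[OF i1 has_integral_integrable[OF 2]] 1 integral_unique[OF 2]
      by simp
  qed
  have 4: "integral {-pi..pi} (\<lambda>x. p x \<bullet> p x) = 0"
  proof -
    have "integral {-pi..pi} (\<lambda>x. p x \<bullet> p x) = integral {-pi..pi} (\<lambda>x. p x \<bullet> r x - p x \<bullet> rb)"
      by (simp add: p_def inner_diff_right)
    also have "\<dots> = integral {-pi..pi} (\<lambda>x. p x \<bullet> r x) - integral {-pi..pi} (\<lambda>x. p x \<bullet> rb)"
      by (intro Henstock_Kurzweil_Integration.integral_diff ci continuous_intros cp cr)
    also have "integral {-pi..pi} (\<lambda>x. p x \<bullet> rb) = integral {-pi..pi} p \<bullet> rb"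
      using integral_linear[OF ci[OF cp] bounded_linear_inner_left[of rb]] by (simp add: o_def)
    finally show ?thesis using 3 p0 by simp
  qed
  have p_cell: "p x = 0" if "x \<in> {-pi..pi}" for x
  proof -
    have c: "continuous_on (cbox (-pi) pi) (\<lambda>x. p x \<bullet> p x)"
      by (rule continuous_on_subset[OF _ subset_UNIV]) (intro continuous_intros cp)
    have "((\<lambda>x. p x \<bullet> p x) has_integral 0) (cbox (-pi) pi)"
      using 4 integrable_continuous[OF c] by (simp add: cbox_interval has_integral_iff)
    then have "p x \<bullet> p x = 0"
      by (rule has_integral_0_cbox_imp_0[OF c inner_ge_zero]) (use that in \<open>auto simp: cbox_interval not_le\<close>)
    then show ?thesis by simp
  qed
  have p_all: "p x = 0" for x
    using periodic_reduce[OF pp, of x] p_cell by metis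
  define Di :: "real^'n^'n" where "Di = (\<chi> i j. if i = j then 1 / D $ i $ i else 0)"
  have Di: "Di *v (D *v x) = x" "D *v (Di *v x) = x" for x
  proof -
    have 1: "(Di *v y) $ i = y $ i / D $ i $ i" for y i
      by (subst diagonal_mult_component) (simp_all add: Di_def)
    have "D $ i $ i \<noteq> 0" for i using D(2)[of i] by simp
    then show "Di *v (D *v x) = x" "D *v (Di *v x) = x"
      by (simp_all add: vec_eq_iff 1 diagonal_mult_component[OF D(1)])
  qed
  have uad_eq: "uad x = Di *v (rb - M x)" for x
  proof -
    have "rb - M x = D *v uad x" using p_all[of x] by (simp add: p_def r_def algebra_simps)
    then show ?thesis by (simp only: Di(1))
  qed
  have bl: "bounded_linear (\<lambda>v. Di *v v)" by (rule matrix_vector_mul_bounded_linear)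
  have d1: "(uad has_vector_derivative Di *v (0 - M1 x)) (at x)" for x
    unfolding uad_eq[abs_def]
    by (intro bounded_linear.has_vector_derivative[OF bl] has_vector_derivative_diff has_vector_derivative_const M)
  have d2: "((\<lambda>x. Di *v (0 - M1 x)) has_vector_derivative Di *v (0 - m x)) (at x)" for x
    by (intro bounded_linear.has_vector_derivative[OF bl] has_vector_derivative_diff has_vector_derivative_const M1)
  show thesis
  proof (rule that[OF per d1 d2])
    show "continuous_on UNIV (\<lambda>x. Di *v (0 - m x))" by (intro continuous_intros cm)
    show "D *v (Di *v (0 - m x)) + transpose (jac f (ustar x)) *v uad x = 0" for x
      unfolding Di(2) by (simp add: m_def)
  qed
qed

section \<open>Calculus of bounds uniform over a family\<close>

text \<open>An O-estimate whose constant serves all indices and all points of the closed cell at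
  once. The scale on the right may depend on both; scalar quantities enter as functions constant in
  the point, so one calculus serves functions, coefficients and boundary values.\<close>

definition unif_le :: "'i set \<Rightarrow> ('i \<Rightarrow> real \<Rightarrow> 'b::real_normed_vector) \<Rightarrow> ('i \<Rightarrow> real \<Rightarrow> real) \<Rightarrow> bool" where
  "unif_le I F gg \<longleftrightarrow> (\<exists>C\<ge>0. \<forall>i\<in>I. \<forall>x\<in>{-pi..pi}. norm (F i x) \<le> C * gg i x)"

lemma unif_leI:
  assumes "C \<ge> 0" "\<And>i x. i \<in> I \<Longrightarrow> x \<in> {-pi..pi} \<Longrightarrow> norm (F i x) \<le> C * gg i x"
  shows "unif_le I F gg"
  unfolding unif_le_def using assms by (intro exI[of _ C]) blast

lemma unif_leE:
  assumes "unif_le I F gg"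
  obtains C where "C \<ge> 0" "\<forall>i\<in>I. \<forall>x\<in>{-pi..pi}. norm (F i x) \<le> C * gg i x"
  using assms unfolding unif_le_def by (elim exE conjE)

lemma unif_le_mono:
  assumes "unif_le I F gg" "K \<ge> 0" "\<And>i x. i \<in> I \<Longrightarrow> x \<in> {-pi..pi} \<Longrightarrow> gg i x \<le> K * gg' i x"
  shows "unif_le I F gg'"
proof -
  obtain C where C: "C \<ge> 0" "\<forall>i\<in>I. \<forall>x\<in>{-pi..pi}. norm (F i x) \<le> C * gg i x" by (rule unif_leE[OF assms(1)])
  show ?thesis
  proof (rule unif_leI[of "C * K"])
    fix i x assume ix: "i \<in> I" "x \<in> {-pi..pi}"
    have "norm (F i x) \<le> C * gg i x" using C(2) ix by blast
    also have "\<dots> \<le> C * (K * gg' i x)" by (rule mult_left_mono[OF assms(3)[OF ix] C(1)])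
    finally show "norm (F i x) \<le> C * K * gg' i x" by (simp add: mult.assoc)
  qed (use C(1) assms(2) in simp)
qed

lemma unif_le_mono1:
  assumes "unif_le I F gg" "\<And>i x. i \<in> I \<Longrightarrow> x \<in> {-pi..pi} \<Longrightarrow> gg i x \<le> gg' i x"
  shows "unif_le I F gg'"
  by (rule unif_le_mono[OF assms(1), of 1]) (use assms(2) in simp_all)

lemma unif_le_cong:
  assumes "unif_le I F gg" "\<And>i x. i \<in> I \<Longrightarrow> x \<in> {-pi..pi} \<Longrightarrow> F' i x = F i x"
  shows "unif_le I F' gg"
  using assms unfolding unif_le_def by simp

lemma unif_le_add:
  assumes "unif_le I F gg" "unif_le I F' gg"
  shows "unif_le I (\<lambda>i x. F i x + F' i x) gg"
proof -
  obtain C where C: "C \<ge> 0" "\<forall>i\<in>I. \<forall>x\<in>{-pi..pi}. norm (F i x) \<le> C * gg i x" by (rule unif_leE[OF assms(1)])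
  obtain C' where C': "C' \<ge> 0" "\<forall>i\<in>I. \<forall>x\<in>{-pi..pi}. norm (F' i x) \<le> C' * gg i x" by (rule unif_leE[OF assms(2)])
  show ?thesis
  proof (rule unif_leI[of "C + C'"])
    fix i x assume ix: "i \<in> I" "x \<in> {-pi..pi}"
    have "norm (F i x + F' i x) \<le> C * gg i x + C' * gg i x"
      by (rule norm_triangle_mono) (use C(2) C'(2) ix in blast)+
    then show "norm (F i x + F' i x) \<le> (C + C') * gg i x" by (simp add: algebra_simps)
  qed (use C(1) C'(1) in simp)
qed

lemma unif_le_minus: "unif_le I F gg \<Longrightarrow> unif_le I (\<lambda>i x. - F i x) gg"
  by (simp add: unif_le_def)

lemma unif_le_diff:
  assumes "unif_le I F gg" "unif_le I F' gg"
  shows "unif_le I (\<lambda>i x. F i x - F' i x) gg"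
  using unif_le_add[OF assms(1) unif_le_minus[OF assms(2)]] by simp

lemma unif_le_bilinear:
  assumes "bounded_bilinear bil" "unif_le I F gg" "unif_le I F' gg'"
  shows "unif_le I (\<lambda>i x. bil (F i x) (F' i x)) (\<lambda>i x. gg i x * gg' i x)"
proof -
  interpret bounded_bilinear bil by (rule assms(1))
  obtain K where K: "\<And>u v. norm (bil u v) \<le> norm u * norm v * K" and K0: "0 \<le> K"
    using nonneg_bounded by blast
  obtain C where C: "C \<ge> 0" "\<forall>i\<in>I. \<forall>x\<in>{-pi..pi}. norm (F i x) \<le> C * gg i x" by (rule unif_leE[OF assms(2)])
  obtain C' where C': "C' \<ge> 0" "\<forall>i\<in>I. \<forall>x\<in>{-pi..pi}. norm (F' i x) \<le> C' * gg' i x" by (rule unif_leE[OF assms(3)])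
  show ?thesis
  proof (rule unif_leI[of "C * C' * K"])
    fix i x assume ix: "i \<in> I" "x \<in> {-pi..pi}"
    have n: "norm (F i x) \<le> C * gg i x" "norm (F' i x) \<le> C' * gg' i x" using C(2) C'(2) ix by blast+
    have "norm (bil (F i x) (F' i x)) \<le> norm (F i x) * norm (F' i x) * K" by (rule K)
    also have "\<dots> \<le> (C * gg i x) * (C' * gg' i x) * K"
      by (intro mult_right_mono mult_mono n K0 norm_ge_zero order_trans[OF norm_ge_zero n(1)])
    finally show "norm (bil (F i x) (F' i x)) \<le> C * C' * K * (gg i x * gg' i x)" by (simp add: ac_simps)
  qed (use C(1) C'(1) K0 in simp)
qed

lemmas unif_le_scaleR = unif_le_bilinear[OF bounded_bilinear_scaleR]
lemmas unif_le_inner = unif_le_bilinear[OF bounded_bilinear_inner]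
lemmas unif_le_mult = unif_le_bilinear[OF bounded_bilinear_mult]

lemma unif_le_scaleR_left:
  "unif_le I F gg \<Longrightarrow> unif_le I F' (\<lambda>i x. 1) \<Longrightarrow> unif_le I (\<lambda>i x. F i x *\<^sub>R F' i x) gg"
  using unif_le_scaleR[of I F gg F' "\<lambda>i x. 1"] by simp

lemma unif_le_scaleR_right:
  "unif_le I F (\<lambda>i x. 1) \<Longrightarrow> unif_le I F' gg \<Longrightarrow> unif_le I (\<lambda>i x. F i x *\<^sub>R F' i x) gg"
  using unif_le_scaleR[of I F "\<lambda>i x. 1" F' gg] by simp

lemma unif_le_inner_left:
  "unif_le I F gg \<Longrightarrow> unif_le I F' (\<lambda>i x. 1) \<Longrightarrow> unif_le I (\<lambda>i x. F i x \<bullet> F' i x) gg"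
  using unif_le_inner[of I F gg F' "\<lambda>i x. 1"] by simp

lemma unif_le_linear:
  assumes "bounded_linear L" "unif_le I F gg"
  shows "unif_le I (\<lambda>i x. L (F i x)) gg"
proof -
  obtain K where K: "\<And>v. norm (L v) \<le> norm v * K" and K0: "0 \<le> K"
    using bounded_linear.nonneg_bounded[OF assms(1)] by blast
  obtain C where C: "C \<ge> 0" "\<forall>i\<in>I. \<forall>x\<in>{-pi..pi}. norm (F i x) \<le> C * gg i x" by (rule unif_leE[OF assms(2)])
  show ?thesis
  proof (rule unif_leI[of "C * K"])
    fix i x assume ix: "i \<in> I" "x \<in> {-pi..pi}"
    have "norm (L (F i x)) \<le> norm (F i x) * K" by (rule K)
    also have "\<dots> \<le> (C * gg i x) * K" by (rule mult_right_mono) (use C(2) ix K0 in blast)+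
    finally show "norm (L (F i x)) \<le> C * K * gg i x" by (simp add: ac_simps)
  qed (use C(1) K0 in simp)
qed

lemma unif_le_bounded:
  assumes "\<And>y. norm (g y) \<le> B"
  shows "unif_le I (\<lambda>i x. g (h i x)) (\<lambda>i x. 1)"
  by (rule unif_leI[of "\<bar>B\<bar>"]) (use assms order_trans[OF _ abs_ge_self] in auto)

lemma unif_le_self: "unif_le I F (\<lambda>i x. norm (F i x))"
  by (rule unif_leI[of 1]) simp_all

lemma unif_le_norm: "unif_le I (\<lambda>i x. norm (F i x)) gg \<longleftrightarrow> unif_le I F gg"
  by (simp add: unif_le_def)

lemma unif_le_integral:
  fixes F :: "'i \<Rightarrow> real \<Rightarrow> 'b::euclidean_space"
  assumes "unif_le I F gg" "\<And>i. i \<in> I \<Longrightarrow> F i integrable_on {-pi..pi}" "\<And>i. i \<in> I \<Longrightarrow> gg i integrable_on {-pi..pi}"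
  shows "unif_le I (\<lambda>i x. integral {-pi..pi} (F i)) (\<lambda>i x. integral {-pi..pi} (gg i))"
proof -
  obtain C where C: "C \<ge> 0" "\<forall>i\<in>I. \<forall>x\<in>{-pi..pi}. norm (F i x) \<le> C * gg i x" by (rule unif_leE[OF assms(1)])
  show ?thesis
  proof (rule unif_leI[OF C(1)])
    fix i and x :: real assume i: "i \<in> I"
    have "norm (integral {-pi..pi} (F i)) \<le> integral {-pi..pi} (\<lambda>x. C *\<^sub>R gg i x)"
      by (rule integral_norm_bound_integral[OF assms(2)[OF i] integrable_cmul[OF assms(3)[OF i]]]) (use C(2) i in auto)
    then show "norm (integral {-pi..pi} (F i)) \<le> C * integral {-pi..pi} (gg i)" by simp
  qed
qed

lemma unif_le_integral_const:
  fixes F :: "'i \<Rightarrow> real \<Rightarrow> 'b::euclidean_space"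
  assumes "unif_le I F (\<lambda>i x. g i)" "\<And>i. i \<in> I \<Longrightarrow> F i integrable_on {-pi..pi}"
  shows "unif_le I (\<lambda>i x. integral {-pi..pi} (F i)) (\<lambda>i x. g i)"
  by (rule unif_le_mono[OF unif_le_integral[OF assms(1,2) integrable_const_ivl], of "2 * pi"]) simp_all

section \<open>Translation estimates\<close>

lemma shift_diff_bound:
  fixes g :: "real \<Rightarrow> 'b::real_normed_vector"
  assumes g: "\<And>x. (g has_vector_derivative g1 x) (at x)" and B: "\<And>x. norm (g1 x) \<le> B"
  shows "norm (g y - g x) \<le> B * \<bar>y - x\<bar>"
proof -
  have "norm (g y - g x) \<le> B * norm (y - x)"
  proof (rule differentiable_bound[of UNIV g "\<lambda>x h. h *\<^sub>R g1 x"])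
    show "(g has_derivative (\<lambda>h. h *\<^sub>R g1 x)) (at x within UNIV)" for x
      using g by (simp add: has_vector_derivative_def)
    show "onorm (\<lambda>h. h *\<^sub>R g1 x) \<le> B" for x
    proof (rule onorm_le)
      show "norm (h *\<^sub>R g1 x) \<le> B * norm h" for h
        using mult_left_mono[OF B[of x] abs_ge_zero[of h]] by (simp add: mult.commute)
    qed
  qed simp_all
  then show ?thesis by simp
qed

text \<open>The error carries the factor \<open>\<bar>a - b\<bar>\<close> and not just the squares
  of the shifts: this is what produces phase differences times phases in the final bound. It comes
  from comparing the two translates directly, not from expanding each of them.\<close>

lemma shift_diff_taylor:
  fixes g :: "real \<Rightarrow> 'b::real_normed_vector"
  assumes g: "\<And>x. (g has_vector_derivative g1 x) (at x)" and g1: "\<And>x. (g1 has_vector_derivative g2 x) (at x)"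
    and B: "\<And>x. norm (g2 x) \<le> B"
  shows "norm (g (x - a) - g (x - b) + (a - b) *\<^sub>R g1 x) \<le> B * (\<bar>a\<bar> + \<bar>b\<bar>) * \<bar>a - b\<bar>"
proof -
  have B0: "0 \<le> B" using order_trans[OF norm_ge_zero B] .
  define S where "S = closed_segment (x - b) (x - a)"
  have near: "\<bar>y - x\<bar> \<le> \<bar>a\<bar> + \<bar>b\<bar>" if "y \<in> S" for y
    using that by (auto simp: S_def closed_segment_eq_real_ivl split: if_splits)
  \<comment> \<open>Subtracting the slope at \<open>x\<close> leaves the derivative
    \<open>g1 y - g1 x\<close>, small of order \<open>\<bar>a\<bar> + \<bar>b\<bar>\<close> on the
    segment between the two shifted points.\<close>
  define h where "h y = g y - y *\<^sub>R g1 x" for y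
  have "norm (h (x - a) - h (x - b)) \<le> (B * (\<bar>a\<bar> + \<bar>b\<bar>)) * norm ((x - a) - (x - b))"
  proof (rule differentiable_bound[of S h "\<lambda>y k. k *\<^sub>R (g1 y - g1 x)"])
    show "convex S" by (simp add: S_def)
    show "(h has_derivative (\<lambda>k. k *\<^sub>R (g1 y - g1 x))) (at y within S)" for y
    proof -
      have "((\<lambda>y. g y - y *\<^sub>R g1 x) has_vector_derivative g1 y - 1 *\<^sub>R g1 x) (at y)"
        by (intro has_vector_derivative_diff g bounded_linear.has_vector_derivative[OF bounded_linear_scaleR_left] has_vector_derivative_id)
      then have "(h has_vector_derivative g1 y - g1 x) (at y)" by (simp add: h_def[abs_def])
      then show ?thesis unfolding has_vector_derivative_def by (rule has_derivative_at_withinI)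
    qed
    show "onorm (\<lambda>k. k *\<^sub>R (g1 y - g1 x)) \<le> B * (\<bar>a\<bar> + \<bar>b\<bar>)" if "y \<in> S" for y
    proof (rule onorm_le)
      fix k :: real
      have "norm (g1 y - g1 x) \<le> B * \<bar>y - x\<bar>" by (rule shift_diff_bound[OF g1 B])
      also have "\<dots> \<le> B * (\<bar>a\<bar> + \<bar>b\<bar>)" by (rule mult_left_mono[OF near[OF that] B0])
      finally have "norm (g1 y - g1 x) \<le> B * (\<bar>a\<bar> + \<bar>b\<bar>)" .
      then show "norm (k *\<^sub>R (g1 y - g1 x)) \<le> B * (\<bar>a\<bar> + \<bar>b\<bar>) * norm k"
        using mult_left_mono[OF \<open>norm (g1 y - g1 x) \<le> B * (\<bar>a\<bar> + \<bar>b\<bar>)\<close> abs_ge_zero[of k]] by (simp add: mult.commute)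
    qed
  qed (simp_all add: S_def)
  moreover have "h (x - a) - h (x - b) = g (x - a) - g (x - b) + (a - b) *\<^sub>R g1 x"
    by (simp add: h_def algebra_simps)
  ultimately show ?thesis by (simp add: abs_minus_commute)
qed

lemma odd_integral_zero:
  fixes q :: "real \<Rightarrow> 'b::euclidean_space"
  assumes "\<And>x. q (- x) = - q x"
  shows "integral {-r..r} q = 0"
proof -
  have "integral {-r..r} q = integral {-r..r} (\<lambda>x. q (- x))"
    using Henstock_Kurzweil_Integration.integral_reflect_real[of r "-r" q] by simp
  also have "\<dots> = - integral {-r..r} q" by (simp add: assms)
  finally have "2 *\<^sub>R integral {-r..r} q = 0" unfolding scaleR_2 by (metis add.right_inverse)
  then show ?thesis by simp
qed

lemma continuous_compose_UNIV:
  "continuous_on UNIV g \<Longrightarrow> continuous_on S h \<Longrightarrow> continuous_on S (\<lambda>x. g (h x))"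
  by (rule continuous_on_compose2[of UNIV g]) simp_all

lemma bounded_if_bounded_outside:
  fixes g :: "real \<Rightarrow> 'b::real_normed_vector"
  assumes c: "continuous_on UNIV g" and o: "\<And>x. \<bar>x\<bar> > r \<Longrightarrow> norm (g x) \<le> B"
  shows "\<exists>B. \<forall>x. norm (g x) \<le> B"
proof -
  obtain B' where B': "\<forall>y\<in>g ` {-r..r}. norm y \<le> B'"
    using compact_imp_bounded[OF compact_continuous_image[OF continuous_on_subset[OF c subset_UNIV] compact_Icc]]
    unfolding bounded_iff ..
  have "norm (g x) \<le> max B B'" for x
  proof (cases "\<bar>x\<bar> > r")
    case True
    then show ?thesis using o[OF True] by simp
  next
    case False
    then have "x \<in> {-r..r}" by auto
    then have "norm (g x) \<le> B'" using B' by blast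
    then show ?thesis by simp
  qed
  then show ?thesis by blast
qed

lemma derivative_zero_outside:
  fixes g :: "real \<Rightarrow> 'b::real_normed_vector"
  assumes d: "\<And>x. (g has_vector_derivative g1 x) (at x)"
    and p: "\<And>x. x > r \<Longrightarrow> g x = p" and q: "\<And>x. x < - r \<Longrightarrow> g x = q" and x: "\<bar>x\<bar> > r" "0 \<le> r"
  shows "g1 x = 0"
proof -
  have "x > r \<or> x < - r" using x by auto
  then have "(g has_vector_derivative 0) (at x)"
  proof
    assume "x > r"
    with p show ?thesis
      by (intro has_vector_derivative_transform_within_open[OF has_vector_derivative_const[of p], where S="{r<..}"]) auto
  next
    assume "x < - r"
    with q show ?thesis
      by (intro has_vector_derivative_transform_within_open[OF has_vector_derivative_const[of q], where S="{..<-r}"]) auto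
  qed
  then show ?thesis by (rule vector_derivative_unique_at[OF d])
qed

lemma has_vector_derivative_shift:
  fixes g :: "real \<Rightarrow> 'b::real_normed_vector"
  assumes "\<And>x. (g has_vector_derivative g1 x) (at x)"
  shows "((\<lambda>x. g (x - t)) has_vector_derivative g1 (x - t)) (at x)"
proof -
  have "((\<lambda>x. g (x - t)) has_vector_derivative 1 *\<^sub>R g1 (x - t)) (at x)"
    by (rule vector_diff_chain_at[of "\<lambda>x. x - t" 1 x g, unfolded o_def])
      (auto intro!: derivative_eq_intros assms simp: has_real_derivative_iff_has_vector_derivative[symmetric])
  then show ?thesis by simp
qed

section \<open>The data of a single cell\<close>

text \<open>\<open>u\<close> is the pattern, \<open>z\<close> the adjoint mode, and numbered letters
  are successive derivatives. \<open>\<phi>\<close> is here a cutoff on the whole line, constant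
  beyond \<open>pi / 2\<close>, so that every formula can be differentiated at each real point, ends
  of the cell included. \<open>\<rho>\<close> bounds the support of \<open>\<psi>\<close> and leaves
  room for shifts smaller than \<open>pi - \<rho>\<close>.\<close>

locale cell_problem =
  fixes D :: "real^'n^'n" and f :: "real^'n \<Rightarrow> real^'n"
    and u u1 u2 u3 u4 z z1 z2 :: "real \<Rightarrow> real^'n" and \<phi> \<phi>1 \<phi>2 :: "real \<Rightarrow> real"
    and \<psi> \<psi>1 \<psi>2 \<psi>3 :: "real \<Rightarrow> real^'n" and \<rho> :: real
  assumes D_sym: "\<And>x y. (D *v x) \<bullet> y = x \<bullet> (D *v y)"
    and f: "C_k_on (Suc (Suc 0)) UNIV f"
    and du: "\<And>x. (u has_vector_derivative u1 x) (at x)" "\<And>x. (u1 has_vector_derivative u2 x) (at x)"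
      "\<And>x. (u2 has_vector_derivative u3 x) (at x)" "\<And>x. (u3 has_vector_derivative u4 x) (at x)"
    and cu4: "continuous_on UNIV u4" and per_u: "periodic u" and u_even: "\<And>x. u (- x) = u x"
    and pattern: "\<And>x. D *v u2 x + f (u x) = 0"
    and dz: "\<And>x. (z has_vector_derivative z1 x) (at x)" "\<And>x. (z1 has_vector_derivative z2 x) (at x)"
    and cz2: "continuous_on UNIV z2" and per_z: "periodic z" and z_odd: "\<And>x. z (- x) = - z x"
    and adjoint: "\<And>x. D *v z2 x + transpose (jac f (u x)) *v z x = 0"
    and d\<phi>: "\<And>x. (\<phi> has_vector_derivative \<phi>1 x) (at x)" "\<And>x. (\<phi>1 has_vector_derivative \<phi>2 x) (at x)"
    and c\<phi>2: "continuous_on UNIV \<phi>2" and \<phi>_odd: "\<And>x. \<phi> (- x) = - \<phi> x"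
    and \<phi>_right: "\<And>x. x > pi / 2 \<Longrightarrow> \<phi> x = 1 / 2" and \<phi>_left: "\<And>x. x < - (pi / 2) \<Longrightarrow> \<phi> x = - 1 / 2"
    and d\<psi>: "\<And>x. (\<psi> has_vector_derivative \<psi>1 x) (at x)" "\<And>x. (\<psi>1 has_vector_derivative \<psi>2 x) (at x)"
      "\<And>x. (\<psi>2 has_vector_derivative \<psi>3 x) (at x)"
    and c\<psi>3: "continuous_on UNIV \<psi>3" and \<rho>: "0 < \<rho>" "\<rho> < pi" and \<psi>_supp: "\<And>x. \<bar>x\<bar> > \<rho> \<Longrightarrow> \<psi> x = 0"
    and uz: "integral {-pi..pi} (\<lambda>x. u1 x \<bullet> z x) = 1" and \<psi>z: "integral {-pi..pi} (\<lambda>x. \<psi> x \<bullet> z x) = 1"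
begin

lemmas cont_data =
  has_vector_derivative_imp_continuous_on[OF du(1)] has_vector_derivative_imp_continuous_on[OF du(2)]
  has_vector_derivative_imp_continuous_on[OF du(3)] has_vector_derivative_imp_continuous_on[OF du(4)] cu4
  has_vector_derivative_imp_continuous_on[OF dz(1)] has_vector_derivative_imp_continuous_on[OF dz(2)] cz2
  has_vector_derivative_imp_continuous_on[OF d\<phi>(1)] has_vector_derivative_imp_continuous_on[OF d\<phi>(2)] c\<phi>2
  has_vector_derivative_imp_continuous_on[OF d\<psi>(1)] has_vector_derivative_imp_continuous_on[OF d\<psi>(2)]
  has_vector_derivative_imp_continuous_on[OF d\<psi>(3)] c\<psi>3

lemma cont_shift [continuous_intros]:
  assumes "continuous_on S h"
  shows "continuous_on S (\<lambda>x. u (h x))" "continuous_on S (\<lambda>x. u1 (h x))" "continuous_on S (\<lambda>x. u2 (h x))"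
    "continuous_on S (\<lambda>x. u3 (h x))" "continuous_on S (\<lambda>x. u4 (h x))"
    "continuous_on S (\<lambda>x. z (h x))" "continuous_on S (\<lambda>x. z1 (h x))" "continuous_on S (\<lambda>x. z2 (h x))"
    "continuous_on S (\<lambda>x. \<phi> (h x))" "continuous_on S (\<lambda>x. \<phi>1 (h x))" "continuous_on S (\<lambda>x. \<phi>2 (h x))"
    "continuous_on S (\<lambda>x. \<psi> (h x))" "continuous_on S (\<lambda>x. \<psi>1 (h x))" "continuous_on S (\<lambda>x. \<psi>2 (h x))"
    "continuous_on S (\<lambda>x. \<psi>3 (h x))"
  by (rule continuous_compose_UNIV[OF _ assms], rule cont_data)+

lemma cont_jac [continuous_intros]:
  assumes "continuous_on S h"
  shows "continuous_on S (\<lambda>x. jac f (h x))"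
  by (rule continuous_on_compose2[OF jac_continuous[OF f] assms]) simp

lemma f_has_derivative: "(f has_derivative (\<lambda>h. jac f y *v h)) (at y)"
  by (rule jac_has_derivative[OF C_k_on_differentiable[OF f]])

lemma cont_f [continuous_intros]:
  assumes "continuous_on S h"
  shows "continuous_on S (\<lambda>x. f (h x))"
proof -
  have "continuous_on UNIV f"
    by (simp add: continuous_at_imp_continuous_on has_derivative_continuous[OF f_has_derivative])
  then show ?thesis by (rule continuous_on_compose2[OF _ assms]) simp
qed

lemma periodic_data: "periodic u1" "periodic u2" "periodic u3" "periodic u4" "periodic z1" "periodic z2"
proof -
  show 1: "periodic u1" by (rule periodic_derivative[OF du(1) per_u])
  show 2: "periodic u2" by (rule periodic_derivative[OF du(2) 1])
  show 3: "periodic u3" by (rule periodic_derivative[OF du(3) 2])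
  show "periodic u4" by (rule periodic_derivative[OF du(4) 3])
  show 4: "periodic z1" by (rule periodic_derivative[OF dz(1) per_z])
  show "periodic z2" by (rule periodic_derivative[OF dz(2) 4])
qed

lemma \<phi>1_outside:
  assumes "\<bar>x\<bar> > pi / 2"
  shows "\<phi>1 x = 0"
  by (rule derivative_zero_outside[OF d\<phi>(1) \<phi>_right \<phi>_left assms]) simp_all

lemma \<phi>2_outside:
  assumes "\<bar>x\<bar> > pi / 2"
  shows "\<phi>2 x = 0"
proof (rule derivative_zero_outside[OF d\<phi>(2) _ _ assms, where p=0 and q=0])
  show "\<phi>1 x = 0" if "x > pi / 2" for x by (rule \<phi>1_outside) (use that in linarith)
  show "\<phi>1 x = 0" if "x < - (pi / 2)" for x by (rule \<phi>1_outside) (use that in linarith)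
qed (use pi_gt_zero in linarith)

lemma \<psi>1_outside:
  assumes "\<bar>x\<bar> > \<rho>"
  shows "\<psi>1 x = 0"
proof (rule derivative_zero_outside[OF d\<psi>(1) _ _ assms, where p=0 and q=0])
  show "\<psi> x = 0" if "x > \<rho>" for x by (rule \<psi>_supp) (use that in linarith)
  show "\<psi> x = 0" if "x < - (\<rho>)" for x by (rule \<psi>_supp) (use that in linarith)
qed (use \<rho> in linarith)

lemma \<psi>2_outside:
  assumes "\<bar>x\<bar> > \<rho>"
  shows "\<psi>2 x = 0"
proof (rule derivative_zero_outside[OF d\<psi>(2) _ _ assms, where p=0 and q=0])
  show "\<psi>1 x = 0" if "x > \<rho>" for x by (rule \<psi>1_outside) (use that in linarith)
  show "\<psi>1 x = 0" if "x < - (\<rho>)" for x by (rule \<psi>1_outside) (use that in linarith)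
qed (use \<rho> in linarith)

lemma \<psi>3_outside:
  assumes "\<bar>x\<bar> > \<rho>"
  shows "\<psi>3 x = 0"
proof (rule derivative_zero_outside[OF d\<psi>(3) _ _ assms, where p=0 and q=0])
  show "\<psi>2 x = 0" if "x > \<rho>" for x by (rule \<psi>2_outside) (use that in linarith)
  show "\<psi>2 x = 0" if "x < - (\<rho>)" for x by (rule \<psi>2_outside) (use that in linarith)
qed (use \<rho> in linarith)

lemma bounded_data:
  "\<exists>B. \<forall>x. norm (u x) \<le> B" "\<exists>B. \<forall>x. norm (u1 x) \<le> B" "\<exists>B. \<forall>x. norm (u2 x) \<le> B"
  "\<exists>B. \<forall>x. norm (u3 x) \<le> B" "\<exists>B. \<forall>x. norm (u4 x) \<le> B"
  "\<exists>B. \<forall>x. norm (z x) \<le> B" "\<exists>B. \<forall>x. norm (z1 x) \<le> B" "\<exists>B. \<forall>x. norm (z2 x) \<le> B"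
  "\<exists>B. \<forall>x. norm (\<phi> x) \<le> B" "\<exists>B. \<forall>x. norm (\<phi>1 x) \<le> B" "\<exists>B. \<forall>x. norm (\<phi>2 x) \<le> B"
  "\<exists>B. \<forall>x. norm (\<psi> x) \<le> B" "\<exists>B. \<forall>x. norm (\<psi>1 x) \<le> B" "\<exists>B. \<forall>x. norm (\<psi>2 x) \<le> B" "\<exists>B. \<forall>x. norm (\<psi>3 x) \<le> B"
proof -
  have per: "\<exists>B. \<forall>x. norm (g x) \<le> B" if g: "periodic g" "continuous_on UNIV g" for g :: "real \<Rightarrow> real^'n"
    by (rule periodic_bounded[OF g]) blast
  show "\<exists>B. \<forall>x. norm (u x) \<le> B" "\<exists>B. \<forall>x. norm (u1 x) \<le> B" "\<exists>B. \<forall>x. norm (u2 x) \<le> B"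
    "\<exists>B. \<forall>x. norm (u3 x) \<le> B" "\<exists>B. \<forall>x. norm (u4 x) \<le> B"
    "\<exists>B. \<forall>x. norm (z x) \<le> B" "\<exists>B. \<forall>x. norm (z1 x) \<le> B" "\<exists>B. \<forall>x. norm (z2 x) \<le> B"
    by (rule per, fact per_u per_z periodic_data, rule cont_data)+
  show "\<exists>B. \<forall>x. norm (\<phi> x) \<le> B"
  proof (rule bounded_if_bounded_outside[of \<phi> "pi / 2" 1])
    show "norm (\<phi> x) \<le> 1" if "\<bar>x\<bar> > pi / 2" for x
    proof -
      have "x > pi / 2 \<or> x < - (pi / 2)" using that by linarith
      then show ?thesis using \<phi>_right[of x] \<phi>_left[of x] by auto
    qed
  qed (rule cont_data)
  show "\<exists>B. \<forall>x. norm (\<phi>1 x) \<le> B" "\<exists>B. \<forall>x. norm (\<phi>2 x) \<le> B"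
    by (rule bounded_if_bounded_outside[where r="pi / 2" and B=0], rule cont_data, simp add: \<phi>1_outside \<phi>2_outside)+
  show "\<exists>B. \<forall>x. norm (\<psi> x) \<le> B" "\<exists>B. \<forall>x. norm (\<psi>1 x) \<le> B" "\<exists>B. \<forall>x. norm (\<psi>2 x) \<le> B" "\<exists>B. \<forall>x. norm (\<psi>3 x) \<le> B"
    by (rule bounded_if_bounded_outside[where r=\<rho> and B=0], rule cont_data, simp add: \<psi>_supp \<psi>1_outside \<psi>2_outside \<psi>3_outside)+
qed

lemma unif_le_of_bounded:
  assumes "\<exists>B. \<forall>x. norm (g x) \<le> B"
  shows "unif_le I (\<lambda>i x. g (h i x)) (\<lambda>i x. 1)"
proof -
  from assms obtain B where "\<forall>x. norm (g x) \<le> B" ..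
  then show ?thesis by (intro unif_le_bounded) blast
qed

lemmas unif_le_data = bounded_data[THEN unif_le_of_bounded]

text \<open>\<open>al\<close> and \<open>be\<close> are the weights of the right and of the left
  neighbour in \<open>H1\<close>. They sum to 1/2, and at each end of the cell the weight of the
  adjacent neighbour is 1/2 while the other one vanishes.\<close>

definition al :: "real \<Rightarrow> real" where "al x = \<phi> x / 2 + 1 / 4"
definition be :: "real \<Rightarrow> real" where "be x = 1 / 4 - \<phi> x / 2"

lemma unif_le_al: "unif_le I (\<lambda>i x. al x) (\<lambda>i x. 1)" "unif_le I (\<lambda>i x. be x) (\<lambda>i x. 1)"
proof -
  have k: "unif_le I (\<lambda>i x. k) (\<lambda>i x. 1)" for k :: real by (rule unif_leI[of "\<bar>k\<bar>"]) simp_all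
  have p: "unif_le I (\<lambda>i x. \<phi> x / 2) (\<lambda>i x. 1)"
    using unif_le_scaleR_right[OF k[of "1/2"] unif_le_data(9)[where I=I and h="\<lambda>i x. x"]] by simp
  show "unif_le I (\<lambda>i x. al x) (\<lambda>i x. 1)" "unif_le I (\<lambda>i x. be x) (\<lambda>i x. 1)"
    unfolding al_def be_def by (rule unif_le_add[OF p k], rule unif_le_diff[OF k p])
qed

lemma cont_al [continuous_intros]:
  "continuous_on S h \<Longrightarrow> continuous_on S (\<lambda>x. al (h x))" "continuous_on S h \<Longrightarrow> continuous_on S (\<lambda>x. be (h x))"
  unfolding al_def be_def by (intro continuous_intros; simp)+

lemma d_al: "(al has_vector_derivative \<phi>1 x / 2) (at x)" "(be has_vector_derivative - \<phi>1 x / 2) (at x)"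
proof -
  have "((\<lambda>x. \<phi> x / 2 + 1 / 4) has_vector_derivative \<phi>1 x / 2 + 0) (at x)"
    "((\<lambda>x. 1 / 4 - \<phi> x / 2) has_vector_derivative 0 - \<phi>1 x / 2) (at x)"
    by (intro has_vector_derivative_add has_vector_derivative_diff has_vector_derivative_const has_vector_derivative_divide d\<phi>)+
  then show "(al has_vector_derivative \<phi>1 x / 2) (at x)" "(be has_vector_derivative - \<phi>1 x / 2) (at x)"
    by (simp_all add: al_def[abs_def] be_def[abs_def])
qed

text \<open>With \<open>al\<close> and \<open>be\<close> the function \<open>H1\<close> becomes \<open>al *\<^sub>R A + be *\<^sub>R C\<close>, where \<open>A\<close> and \<open>C\<close> are
  differences of translates of the pattern; \<open>k0\<close>, \<open>k1\<close> and \<open>k2\<close> express it and its derivatives.\<close>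

definition k0 :: "real \<Rightarrow> real^'n \<Rightarrow> real^'n \<Rightarrow> real^'n" where
  "k0 x A C = al x *\<^sub>R A + be x *\<^sub>R C"
definition k1 :: "real \<Rightarrow> real^'n \<Rightarrow> real^'n \<Rightarrow> real^'n \<Rightarrow> real^'n \<Rightarrow> real^'n" where
  "k1 x A A' C C' = (\<phi>1 x / 2) *\<^sub>R (A - C) + k0 x A' C'"
definition k2 :: "real \<Rightarrow> real^'n \<Rightarrow> real^'n \<Rightarrow> real^'n \<Rightarrow> real^'n \<Rightarrow> real^'n \<Rightarrow> real^'n \<Rightarrow> real^'n" where
  "k2 x A A' A'' C C' C'' = (\<phi>2 x / 2) *\<^sub>R (A - C) + \<phi>1 x *\<^sub>R (A' - C') + k0 x A'' C''"

lemma k_diff: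
  "k0 x A C - k0 x P Q = k0 x (A - P) (C - Q)"
  "k1 x A A' C C' - k1 x P P' Q Q' = k1 x (A - P) (A' - P') (C - Q) (C' - Q')"
  "k2 x A A' A'' C C' C'' - k2 x P P' P'' Q Q' Q'' = k2 x (A - P) (A' - P') (A'' - P'') (C - Q) (C' - Q') (C'' - Q'')"
  by (simp_all add: k0_def k1_def k2_def algebra_simps)

lemma unif_le_k0:
  assumes "unif_le I A g" "unif_le I C g"
  shows "unif_le I (\<lambda>i x. k0 x (A i x) (C i x)) g"
  unfolding k0_def
  by (rule unif_le_add[OF unif_le_scaleR_right[OF unif_le_al(1) assms(1)] unif_le_scaleR_right[OF unif_le_al(2) assms(2)]])

lemma unif_le_half: "unif_le I p (\<lambda>i x. 1) \<Longrightarrow> unif_le I (\<lambda>i x. p i x / (2::real)) (\<lambda>i x. 1)"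
  using unif_le_linear[OF bounded_linear_mult_right[of "1/2"]] by fastforce

lemma unif_le_k1:
  assumes "unif_le I A g" "unif_le I A' g" "unif_le I C g" "unif_le I C' g"
  shows "unif_le I (\<lambda>i x. k1 x (A i x) (A' i x) (C i x) (C' i x)) g"
  unfolding k1_def
  by (rule unif_le_add[OF unif_le_scaleR_right[OF unif_le_half[OF unif_le_data(10)[where h="\<lambda>i x. x"]] unif_le_diff[OF assms(1,3)]]
    unif_le_k0[OF assms(2,4)]])

lemma unif_le_k2:
  assumes "unif_le I A g" "unif_le I A' g" "unif_le I A'' g" "unif_le I C g" "unif_le I C' g" "unif_le I C'' g"
  shows "unif_le I (\<lambda>i x. k2 x (A i x) (A' i x) (A'' i x) (C i x) (C' i x) (C'' i x)) g"
  unfolding k2_def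
  by (rule unif_le_add[OF unif_le_add[OF
      unif_le_scaleR_right[OF unif_le_half[OF unif_le_data(11)[where h="\<lambda>i x. x"]] unif_le_diff[OF assms(1,4)]]
      unif_le_scaleR_right[OF unif_le_data(10)[where h="\<lambda>i x. x"] unif_le_diff[OF assms(2,5)]]]
    unif_le_k0[OF assms(3,6)]])

lemma cont_k [continuous_intros]:
  assumes "continuous_on S A" "continuous_on S A'" "continuous_on S A''" "continuous_on S C" "continuous_on S C'" "continuous_on S C''"
  shows "continuous_on S (\<lambda>x. k2 x (A x) (A' x) (A'' x) (C x) (C' x) (C'' x))"
  unfolding k2_def k0_def by (intro continuous_intros assms) simp_all

lemma d_k0:
  assumes "(A has_vector_derivative A' x) (at x)" "(C has_vector_derivative C' x) (at x)"
  shows "((\<lambda>x. k0 x (A x) (C x)) has_vector_derivative k1 x (A x) (A' x) (C x) (C' x)) (at x)"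
proof -
  have "((\<lambda>x. al x *\<^sub>R A x + be x *\<^sub>R C x) has_vector_derivative
      (al x *\<^sub>R A' x + (\<phi>1 x / 2) *\<^sub>R A x) + (be x *\<^sub>R C' x + (- \<phi>1 x / 2) *\<^sub>R C x)) (at x)"
    by (intro has_vector_derivative_add bounded_bilinear.has_vector_derivative[OF bounded_bilinear_scaleR] d_al assms)
  then show ?thesis unfolding k0_def[abs_def] k1_def by (simp add: algebra_simps)
qed

lemma d_k1:
  assumes "(A has_vector_derivative A' x) (at x)" "(C has_vector_derivative C' x) (at x)"
    "(A' has_vector_derivative A'' x) (at x)" "(C' has_vector_derivative C'' x) (at x)"
  shows "((\<lambda>x. k1 x (A x) (A' x) (C x) (C' x)) has_vector_derivative k2 x (A x) (A' x) (A'' x) (C x) (C' x) (C'' x)) (at x)"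
proof -
  have "((\<lambda>x. (\<phi>1 x / 2) *\<^sub>R (A x - C x) + k0 x (A' x) (C' x)) has_vector_derivative
      ((\<phi>1 x / 2) *\<^sub>R (A' x - C' x) + (\<phi>2 x / 2) *\<^sub>R (A x - C x)) + k1 x (A' x) (A'' x) (C' x) (C'' x)) (at x)"
    by (intro has_vector_derivative_add bounded_bilinear.has_vector_derivative[OF bounded_bilinear_scaleR]
      has_vector_derivative_diff has_vector_derivative_divide d\<phi> d_k0 assms)
  moreover have "\<phi>1 x *\<^sub>R (A' x - C' x) = (\<phi>1 x / 2) *\<^sub>R (A' x - C' x) + (\<phi>1 x / 2) *\<^sub>R (A' x - C' x)"
    unfolding scaleR_add_left[symmetric] by simp
  ultimately show ?thesis unfolding k1_def[abs_def] k2_def by (simp only: k1_def ac_simps)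
qed

end

section \<open>Families of cells and the scales of smallness\<close>

text \<open>For each index, \<open>a\<close>, \<open>b\<close>, \<open>c\<close> are the phases of
  the right neighbour, of the cell itself and of the left neighbour. \<open>W\<close> is carried as
  a function on the whole line with absolutely continuous derivative \<open>W1\<close>, which makes
  the values at the ends of the cell meaningful. The condition with \<open>\<rho>\<close> keeps the
  shifted \<open>\<psi>\<close> inside the cell.\<close>

locale cell_family = cell_problem D f u u1 u2 u3 u4 z z1 z2 \<phi> \<phi>1 \<phi>2 \<psi> \<psi>1 \<psi>2 \<psi>3 \<rho>
  for D :: "real^'n^'n" and f u u1 u2 u3 u4 z z1 z2 \<phi> \<phi>1 \<phi>2 \<psi> \<psi>1 \<psi>2 \<psi>3 \<rho> +
  fixes I :: "'i set" and a b c :: "'i \<Rightarrow> real" and W W1 W2 :: "'i \<Rightarrow> real \<Rightarrow> real^'n"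
  assumes abc: "\<And>i. i \<in> I \<Longrightarrow> \<bar>a i\<bar> \<le> 1" "\<And>i. i \<in> I \<Longrightarrow> \<bar>b i\<bar> \<le> 1" "\<And>i. i \<in> I \<Longrightarrow> \<bar>c i\<bar> \<le> 1"
    "\<And>i. i \<in> I \<Longrightarrow> \<rho> + \<bar>b i\<bar> < pi"
    and dW: "\<And>i x. i \<in> I \<Longrightarrow> (W i has_vector_derivative W1 i x) (at x)"
    and W2: "\<And>i x y. i \<in> I \<Longrightarrow> W2 i absolutely_integrable_on {x..y}"
    and W1: "\<And>i x y. i \<in> I \<Longrightarrow> x \<le> y \<Longrightarrow> W1 i y - W1 i x = integral {x..y} (W2 i)"
    and W_bound: "\<And>i x. i \<in> I \<Longrightarrow> x \<in> {-pi..pi} \<Longrightarrow> norm (W i x) \<le> 1"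
begin

text \<open>\<open>dA\<close> and \<open>dC\<close> compare the right and left neighbour with the
  cell itself. When \<open>g1\<close> is the derivative of \<open>g\<close>, \<open>lA g1\<close>
  and \<open>lC g1\<close> are the first-order parts of \<open>dA g\<close> and \<open>dC g\<close>
  at zero phases.\<close>

definition dA :: "(real \<Rightarrow> real^'n) \<Rightarrow> 'i \<Rightarrow> real \<Rightarrow> real^'n" where "dA g i x = g (x - a i) - g (x - b i)"
definition dC :: "(real \<Rightarrow> real^'n) \<Rightarrow> 'i \<Rightarrow> real \<Rightarrow> real^'n" where "dC g i x = g (x - c i) - g (x - b i)"
definition lA :: "(real \<Rightarrow> real^'n) \<Rightarrow> 'i \<Rightarrow> real \<Rightarrow> real^'n" where "lA g i x = - ((a i - b i) *\<^sub>R g x)"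
definition lC :: "(real \<Rightarrow> real^'n) \<Rightarrow> 'i \<Rightarrow> real \<Rightarrow> real^'n" where "lC g i x = - ((c i - b i) *\<^sub>R g x)"
text \<open>The scales of all estimates: \<open>del\<close> for phase differences,
  \<open>sig\<close> for phases, \<open>m\<close> for the L^1 norm of \<open>W\<close>.
  \<open>siz\<close> is the size of the correction H, and \<open>err\<close> the size of its
  deviation from the first-order part; both contain a term with \<open>m\<close> because
  \<open>W\<close> enters the phase coefficient.\<close>

definition del :: "'i \<Rightarrow> real" where "del i = \<bar>a i - b i\<bar> + \<bar>c i - b i\<bar>"
definition sig :: "'i \<Rightarrow> real" where "sig i = \<bar>a i\<bar> + \<bar>b i\<bar> + \<bar>c i\<bar>"
definition m :: "'i \<Rightarrow> real" where "m i = integral {-pi..pi} (\<lambda>x. norm (W i x))"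
definition err :: "'i \<Rightarrow> real" where "err i = del i * sig i + \<bar>b i\<bar> * m i"
definition siz :: "'i \<Rightarrow> real" where "siz i = del i + \<bar>b i\<bar> * m i"

definition h0 :: "'i \<Rightarrow> real \<Rightarrow> real^'n" where "h0 i x = k0 x (dA u i x) (dC u i x)"
definition h1 :: "'i \<Rightarrow> real \<Rightarrow> real^'n" where "h1 i x = k1 x (dA u i x) (dA u1 i x) (dC u i x) (dC u1 i x)"
definition h2 :: "'i \<Rightarrow> real \<Rightarrow> real^'n" where
  "h2 i x = k2 x (dA u i x) (dA u1 i x) (dA u2 i x) (dC u i x) (dC u1 i x) (dC u2 i x)"
definition hl0 :: "'i \<Rightarrow> real \<Rightarrow> real^'n" where "hl0 i x = k0 x (lA u1 i x) (lC u1 i x)"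
definition hl1 :: "'i \<Rightarrow> real \<Rightarrow> real^'n" where "hl1 i x = k1 x (lA u1 i x) (lA u2 i x) (lC u1 i x) (lC u2 i x)"
definition hl2 :: "'i \<Rightarrow> real \<Rightarrow> real^'n" where
  "hl2 i x = k2 x (lA u1 i x) (lA u2 i x) (lA u3 i x) (lC u1 i x) (lC u2 i x) (lC u3 i x)"
text \<open>\<open>cc\<close> is the phase coefficient c_j and \<open>ccl\<close> its part linear in
  the phases. Accordingly \<open>hh0\<close> is the correction H_j and \<open>hhl0\<close> its
  linear part.\<close>

definition cc :: "'i \<Rightarrow> real" where
  "cc i = - integral {-pi..pi} (\<lambda>x. h0 i x \<bullet> z (x - b i)) - integral {-pi..pi} (\<lambda>x. W i x \<bullet> (z (x - b i) - z x))"
definition ccl :: "'i \<Rightarrow> real" where "ccl i = (a i + c i - 2 * b i) / 4"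
definition hh0 :: "'i \<Rightarrow> real \<Rightarrow> real^'n" where "hh0 i x = h0 i x + cc i *\<^sub>R \<psi> (x - b i)"
definition hh1 :: "'i \<Rightarrow> real \<Rightarrow> real^'n" where "hh1 i x = h1 i x + cc i *\<^sub>R \<psi>1 (x - b i)"
definition hh2 :: "'i \<Rightarrow> real \<Rightarrow> real^'n" where "hh2 i x = h2 i x + cc i *\<^sub>R \<psi>2 (x - b i)"
definition hhl0 :: "'i \<Rightarrow> real \<Rightarrow> real^'n" where "hhl0 i x = hl0 i x + ccl i *\<^sub>R \<psi> x"
definition hhl1 :: "'i \<Rightarrow> real \<Rightarrow> real^'n" where "hhl1 i x = hl1 i x + ccl i *\<^sub>R \<psi>1 x"
definition hhl2 :: "'i \<Rightarrow> real \<Rightarrow> real^'n" where "hhl2 i x = hl2 i x + ccl i *\<^sub>R \<psi>2 x"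
text \<open>\<open>Q\<close> is the second-order Taylor remainder of the nonlinearity at the shifted
  pattern. \<open>Fr\<close> is the right-hand side of the chopped equation once the equations
  satisfied by the pattern and by its translate have been used.\<close>

definition Q :: "'i \<Rightarrow> real \<Rightarrow> real^'n" where
  "Q i x = f (u (x - b i) + (W i x + hh0 i x)) - f (u (x - b i)) - jac f (u (x - b i)) *v (W i x + hh0 i x)"
definition Fr :: "'i \<Rightarrow> real \<Rightarrow> real^'n" where
  "Fr i x = D *v (W2 i x + hh2 i x) + (f (u (x - b i) + (W i x + hh0 i x)) - f (u (x - b i)))"

lemma cont_W [continuous_intros]: "i \<in> I \<Longrightarrow> continuous_on S (W i)"
  by (rule has_vector_derivative_imp_continuous_on[OF dW])

lemma cont_diff [continuous_intros]:
  assumes "continuous_on UNIV g"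
  shows "continuous_on S (dA g i)" "continuous_on S (dC g i)" "continuous_on S (lA g i)" "continuous_on S (lC g i)"
  unfolding dA_def[abs_def] dC_def[abs_def] lA_def[abs_def] lC_def[abs_def]
  by (intro continuous_intros continuous_compose_UNIV[OF assms] continuous_on_subset[OF assms subset_UNIV])+

lemma cont_h [continuous_intros]:
  "continuous_on S (h0 i)" "continuous_on S (h2 i)" "continuous_on S (hl0 i)" "continuous_on S (hl2 i)"
  "continuous_on S (hh0 i)" "continuous_on S (hh2 i)" "continuous_on S (hhl0 i)" "continuous_on S (hhl2 i)"
proof -
  show 1: "continuous_on S (h0 i)" "continuous_on S (hl0 i)"
    unfolding h0_def[abs_def] hl0_def[abs_def] k0_def by (intro continuous_intros cont_data)+
  show 2: "continuous_on S (h2 i)" "continuous_on S (hl2 i)"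
    unfolding h2_def[abs_def] hl2_def[abs_def] by (intro continuous_intros cont_data)+
  show "continuous_on S (hh0 i)" "continuous_on S (hh2 i)" "continuous_on S (hhl0 i)" "continuous_on S (hhl2 i)"
    unfolding hh0_def[abs_def] hh2_def[abs_def] hhl0_def[abs_def] hhl2_def[abs_def]
    by (intro continuous_intros 1 2)+
qed

lemma cont_Q [continuous_intros]: "i \<in> I \<Longrightarrow> continuous_on S (Q i)"
  unfolding Q_def[abs_def] by (intro continuous_intros) simp_all

lemma d_dA:
  assumes "\<And>x. (g has_vector_derivative g1 x) (at x)"
  shows "(dA g i has_vector_derivative dA g1 i x) (at x)" "(dC g i has_vector_derivative dC g1 i x) (at x)"
    "(lA g i has_vector_derivative lA g1 i x) (at x)" "(lC g i has_vector_derivative lC g1 i x) (at x)"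
  unfolding dA_def[abs_def] dC_def[abs_def] lA_def[abs_def] lC_def[abs_def]
  by (intro has_vector_derivative_diff has_vector_derivative_shift assms has_vector_derivative_minus
    bounded_linear.has_vector_derivative[OF bounded_linear_scaleR_right])+

lemma d_h:
  "(hh0 i has_vector_derivative hh1 i x) (at x)" "(hh1 i has_vector_derivative hh2 i x) (at x)"
  "(hhl0 i has_vector_derivative hhl1 i x) (at x)" "(hhl1 i has_vector_derivative hhl2 i x) (at x)"
  unfolding hh0_def[abs_def] hh1_def[abs_def] hh2_def hhl0_def[abs_def] hhl1_def[abs_def] hhl2_def
    h0_def h1_def h2_def hl0_def hl1_def hl2_def
  by (intro has_vector_derivative_add d_k0 d_k1 d_dA du d\<psi> has_vector_derivative_shift
    bounded_linear.has_vector_derivative[OF bounded_linear_scaleR_right])+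

lemma nonneg: "0 \<le> del i" "0 \<le> sig i" "i \<in> I \<Longrightarrow> 0 \<le> m i" "i \<in> I \<Longrightarrow> 0 \<le> \<bar>b i\<bar> * m i" "i \<in> I \<Longrightarrow> 0 \<le> err i" "i \<in> I \<Longrightarrow> 0 \<le> siz i"
proof -
  show 1: "0 \<le> del i" "0 \<le> sig i" by (simp_all add: del_def sig_def)
  show 2: "0 \<le> m i" if "i \<in> I" unfolding m_def by (rule Henstock_Kurzweil_Integration.integral_nonneg)
    (use that in \<open>auto intro!: integrable_continuous_real continuous_intros\<close>)
  show "i \<in> I \<Longrightarrow> 0 \<le> \<bar>b i\<bar> * m i" "i \<in> I \<Longrightarrow> 0 \<le> err i" "i \<in> I \<Longrightarrow> 0 \<le> siz i"
    using 1 2 by (simp_all add: err_def siz_def)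
qed

lemma m_le: "i \<in> I \<Longrightarrow> m i \<le> 2 * pi"
proof -
  assume i: "i \<in> I"
  have "m i \<le> integral {-pi..pi} (\<lambda>x. 1)"
    unfolding m_def by (rule integral_le) (use i W_bound in \<open>auto intro!: integrable_continuous_real continuous_intros\<close>)
  then show ?thesis by simp
qed

text \<open>The exchange rates between the scales. The bounds \<open>sig i \<le> 3\<close> and
  \<open>m i \<le> 2 * pi\<close> come from the normalization to 1; combined, they turn products
  such as \<open>siz\<close> with \<open>sig\<close>, and the square of \<open>siz\<close>, into
  multiples of \<open>err\<close>.\<close>

lemma elementary: assumes "i \<in> I"
  shows "\<bar>b i\<bar> \<le> sig i" "del i \<le> 2 * sig i" "sig i \<le> 3" "del i * sig i \<le> err i" "\<bar>b i\<bar> * m i \<le> err i"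
    "err i \<le> 3 * siz i" "siz i * sig i \<le> 3 * err i" "siz i \<le> (2 + 2 * pi) * sig i" "(siz i)\<^sup>2 \<le> (2 + 2 * pi) * 6 * err i"
    "del i \<le> siz i"
proof -
  note n = nonneg(1,2)[of i] nonneg(3-6)[OF assms]
  note mm = m_le[OF assms]
  have arith: "x + w \<le> 3 * (y + w)" if "x \<le> y * 3" "0 \<le> w" for x y w :: real
    using that by (simp add: distrib_left)
  show 1: "\<bar>b i\<bar> \<le> sig i" "del i \<le> 2 * sig i" by (auto simp: sig_def del_def)
  show 2: "sig i \<le> 3" using abc[OF assms] by (simp add: sig_def)
  show 3: "del i * sig i \<le> err i" "\<bar>b i\<bar> * m i \<le> err i" "del i \<le> siz i"
    using n mult_nonneg_nonneg[OF n(1,2)] by (simp_all add: err_def siz_def)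
  have ds: "del i * sig i \<le> del i * 3" by (rule mult_left_mono[OF 2 n(1)])
  then show "err i \<le> 3 * siz i" unfolding err_def siz_def using arith[OF _ n(4)] by simp
  have bs: "\<bar>b i\<bar> * m i * sig i \<le> \<bar>b i\<bar> * m i * 3" by (rule mult_left_mono[OF 2 n(4)])
  have "siz i * sig i = del i * sig i + \<bar>b i\<bar> * m i * sig i" by (simp add: siz_def distrib_right)
  with bs show 4: "siz i * sig i \<le> 3 * err i"
    unfolding err_def using arith[of "\<bar>b i\<bar> * m i * sig i", OF _ mult_nonneg_nonneg[OF n(1,2)]] by (simp add: add.commute)
  have "\<bar>b i\<bar> * m i \<le> sig i * (2 * pi)" using 1 n mm by (intro mult_mono) auto
  then show 5: "siz i \<le> (2 + 2 * pi) * sig i" using 1 by (simp add: siz_def algebra_simps)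
  have "siz i * siz i \<le> siz i * ((2 + 2 * pi) * sig i)" by (rule mult_left_mono[OF 5 n(6)])
  also have "\<dots> = (2 + 2 * pi) * (siz i * sig i)" by simp
  also have "\<dots> \<le> (2 + 2 * pi) * (3 * err i)" by (rule mult_left_mono[OF 4]) simp
  also have "\<dots> \<le> (2 + 2 * pi) * (6 * err i)" by (rule mult_left_mono) (use n(5) in simp_all)
  also have "\<dots> = (2 + 2 * pi) * 6 * err i" by simp
  finally show "(siz i)\<^sup>2 \<le> (2 + 2 * pi) * 6 * err i" by (simp add: power2_eq_square)
qed

lemma unif_dA:
  assumes "\<And>x. (g has_vector_derivative g1 x) (at x)" "\<exists>B. \<forall>x. norm (g1 x) \<le> B"
  shows "unif_le I (dA g) (\<lambda>i x. del i)" "unif_le I (dC g) (\<lambda>i x. del i)"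
proof -
  obtain B where B: "\<forall>x. norm (g1 x) \<le> B" using assms(2) ..
  have B0: "0 \<le> B" using order_trans[OF norm_ge_zero] B by blast
  have "norm (dA g i x) \<le> B * del i" "norm (dC g i x) \<le> B * del i" for i x
  proof -
    have "norm (dA g i x) \<le> B * \<bar>(x - a i) - (x - b i)\<bar>" "norm (dC g i x) \<le> B * \<bar>(x - c i) - (x - b i)\<bar>"
      unfolding dA_def dC_def by (rule shift_diff_bound[OF assms(1)], use B in blast)+
    moreover have "B * \<bar>(x - a i) - (x - b i)\<bar> \<le> B * del i" "B * \<bar>(x - c i) - (x - b i)\<bar> \<le> B * del i"
      by (intro mult_left_mono B0, simp add: del_def)+
    ultimately show "norm (dA g i x) \<le> B * del i" "norm (dC g i x) \<le> B * del i" by linarith+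
  qed
  then show "unif_le I (dA g) (\<lambda>i x. del i)" "unif_le I (dC g) (\<lambda>i x. del i)"
    using B0 by (auto intro: unif_leI)
qed

lemma unif_dA_taylor:
  assumes "\<And>x. (g has_vector_derivative g1 x) (at x)" "\<And>x. (g1 has_vector_derivative g2 x) (at x)" "\<exists>B. \<forall>x. norm (g2 x) \<le> B"
  shows "unif_le I (\<lambda>i x. dA g i x - lA g1 i x) (\<lambda>i x. del i * sig i)"
    "unif_le I (\<lambda>i x. dC g i x - lC g1 i x) (\<lambda>i x. del i * sig i)"
proof -
  obtain B where B: "\<forall>x. norm (g2 x) \<le> B" using assms(3) ..
  have B0: "0 \<le> B" using order_trans[OF norm_ge_zero] B by blast
  have "norm (dA g i x - lA g1 i x) \<le> B * (del i * sig i)" "norm (dC g i x - lC g1 i x) \<le> B * (del i * sig i)" for i x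
  proof -
    have "norm (dA g i x - lA g1 i x) \<le> B * (\<bar>a i\<bar> + \<bar>b i\<bar>) * \<bar>a i - b i\<bar>"
      "norm (dC g i x - lC g1 i x) \<le> B * (\<bar>c i\<bar> + \<bar>b i\<bar>) * \<bar>c i - b i\<bar>"
      unfolding dA_def lA_def dC_def lC_def diff_minus_eq_add by (rule shift_diff_taylor[OF assms(1,2)], use B in blast)+
    moreover have "B * (\<bar>a i\<bar> + \<bar>b i\<bar>) * \<bar>a i - b i\<bar> \<le> B * sig i * del i" "B * (\<bar>c i\<bar> + \<bar>b i\<bar>) * \<bar>c i - b i\<bar> \<le> B * sig i * del i"
      by (intro mult_mono mult_left_mono mult_nonneg_nonneg B0 nonneg; simp add: sig_def del_def)+
    ultimately show "norm (dA g i x - lA g1 i x) \<le> B * (del i * sig i)" "norm (dC g i x - lC g1 i x) \<le> B * (del i * sig i)"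
      by (simp_all add: ac_simps)
  qed
  then show "unif_le I (\<lambda>i x. dA g i x - lA g1 i x) (\<lambda>i x. del i * sig i)" "unif_le I (\<lambda>i x. dC g i x - lC g1 i x) (\<lambda>i x. del i * sig i)"
    using B0 by (auto intro: unif_leI)
qed

lemma unif_lA:
  assumes "\<exists>B. \<forall>x. norm (g x) \<le> B"
  shows "unif_le I (lA g) (\<lambda>i x. del i)" "unif_le I (lC g) (\<lambda>i x. del i)"
  unfolding lA_def[abs_def] lC_def[abs_def]
  by (rule unif_le_minus[OF unif_le_scaleR_left[OF _ unif_le_of_bounded[OF assms]]], rule unif_leI[of 1]; simp add: del_def)+

lemma unif_shift:
  assumes "\<And>x. (g has_vector_derivative g1 x) (at x)" "\<exists>B. \<forall>x. norm (g1 x) \<le> B"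
  shows "unif_le I (\<lambda>i x. g (x - b i) - g x) (\<lambda>i x. \<bar>b i\<bar>)"
proof -
  obtain B where B: "\<forall>x. norm (g1 x) \<le> B" using assms(2) ..
  have B0: "0 \<le> B" using order_trans[OF norm_ge_zero] B by blast
  have "norm (g (x - b i) - g x) \<le> B * \<bar>(x - b i) - x\<bar>" for i x
    by (rule shift_diff_bound[OF assms(1)]) (use B in blast)
  then show ?thesis using B0 by (intro unif_leI[of B]) simp_all
qed

lemma unif_h: "unif_le I h0 (\<lambda>i x. del i)" "unif_le I h1 (\<lambda>i x. del i)" "unif_le I h2 (\<lambda>i x. del i)" "unif_le I hl0 (\<lambda>i x. del i)"
  unfolding h0_def[abs_def] h1_def[abs_def] h2_def[abs_def] hl0_def[abs_def]
  by (intro unif_le_k0 unif_le_k1 unif_le_k2 unif_dA[OF du(1)] unif_dA[OF du(2)] unif_dA[OF du(3)] unif_lA bounded_data)+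

lemma unif_h_diff:
  "unif_le I (\<lambda>i x. h0 i x - hl0 i x) (\<lambda>i x. del i * sig i)" "unif_le I (\<lambda>i x. h2 i x - hl2 i x) (\<lambda>i x. del i * sig i)"
  unfolding h0_def h2_def hl0_def hl2_def k_diff
  by (intro unif_le_k0 unif_le_k2 unif_dA_taylor[OF du(1,2)] unif_dA_taylor[OF du(2,3)] unif_dA_taylor[OF du(3,4)] bounded_data)+

end

section \<open>Wronskian and Green identities\<close>

context cell_problem begin

lemma u1_odd: "u1 (- x) = - u1 x"
proof -
  have "((\<lambda>x. u (- x)) has_vector_derivative (- 1) *\<^sub>R u1 (- x)) (at x)"
    by (rule vector_diff_chain_at[of "\<lambda>x. - x" "-1" x u, unfolded o_def])
      (auto intro!: derivative_eq_intros du simp: has_real_derivative_iff_has_vector_derivative[symmetric])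
  then have "(u has_vector_derivative - u1 (- x)) (at x)" by (simp add: u_even)
  from vector_derivative_unique_at[OF this du(1)] show ?thesis by (metis minus_equation_iff)
qed

lemma periodic_pi: "periodic g \<Longrightarrow> g (pi - t) = g (- pi - t)"
proof -
  assume "periodic g"
  then have "g (- pi - t + 2 * pi) = g (- pi - t)" unfolding periodic_def ..
  then show ?thesis by (simp add: algebra_simps)
qed

text \<open>An odd periodic function vanishes at the half period. At zero shift the boundary terms
  of Green's identity therefore involve only the derivative of \<open>z\<close>.\<close>

lemma z_pi: "z pi = 0" "z (- pi) = 0" and u1_pi: "u1 pi = 0" "u1 (- pi) = 0"
proof -
  have e: "z pi = z (- pi)" "u1 pi = u1 (- pi)"
    using periodic_pi[OF per_z, of 0] periodic_pi[OF periodic_data(1), of 0] by simp_all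
  have "z pi = - z pi" "u1 pi = - u1 pi" using z_odd[of pi] u1_odd[of pi] e by simp_all
  then show "z pi = 0" "u1 pi = 0" by (simp_all add: eq_neg_iff_add_eq_0 flip: scaleR_2)
  with e show "z (- pi) = 0" "u1 (- pi) = 0" by simp_all
qed

lemma pattern_derivative: "D *v u3 x + jac f (u x) *v u1 x = 0"
proof -
  have fd: "((\<lambda>x. f (u x)) has_vector_derivative jac f (u x) *v u1 x) (at x)"
    using vector_derivative_diff_chain_within[of u "u1 x" x UNIV f] du(1)[of x] f_has_derivative[of "u x"]
    by (simp add: o_def has_derivative_at_withinI)
  have "((\<lambda>x. D *v u2 x + f (u x)) has_vector_derivative D *v u3 x + jac f (u x) *v u1 x) (at x)"
    by (intro has_vector_derivative_add bounded_linear.has_vector_derivative[OF matrix_vector_mul_bounded_linear] du fd)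
  moreover have "((\<lambda>x. D *v u2 x + f (u x)) has_vector_derivative 0) (at x)"
    unfolding pattern by (rule has_vector_derivative_const)
  ultimately show ?thesis by (rule vector_derivative_unique_at)
qed

lemma adjoint_inner: "(jac f (u x) *v v) \<bullet> z x = - (v \<bullet> (D *v z2 x))"
proof -
  have "(jac f (u x) *v v) \<bullet> z x = v \<bullet> (transpose (jac f (u x)) *v z x)"
    using dot_lmul_matrix[of "z x" "jac f (u x)" v] by (simp add: inner_commute)
  moreover have "transpose (jac f (u x)) *v z x = - (D *v z2 x)"
    using adjoint[of x] by (metis add_eq_0_iff)
  ultimately show ?thesis by simp
qed

text \<open>\<open>u1\<close> and \<open>z\<close> solve adjoint linear equations, so their Wronskian is constant; it vanishes at \<open>pi\<close>.\<close>

lemma wronskian: "(D *v u2 y) \<bullet> z y = (D *v u1 y) \<bullet> z1 y"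
proof -
  have "((\<lambda>y. (D *v u2 y) \<bullet> z y - (D *v u1 y) \<bullet> z1 y) has_vector_derivative
      ((D *v u2 y) \<bullet> z1 y + (D *v u3 y) \<bullet> z y) - ((D *v u1 y) \<bullet> z2 y + (D *v u2 y) \<bullet> z1 y)) (at y)" for y
    by (intro has_vector_derivative_diff bounded_bilinear.has_vector_derivative[OF bounded_bilinear_inner]
      bounded_linear.has_vector_derivative[OF matrix_vector_mul_bounded_linear] du dz)
  moreover have "((D *v u2 y) \<bullet> z1 y + (D *v u3 y) \<bullet> z y) - ((D *v u1 y) \<bullet> z2 y + (D *v u2 y) \<bullet> z1 y) = 0" for y
  proof -
    have "D *v u3 y = - (jac f (u y) *v u1 y)" using pattern_derivative[of y] by (simp add: eq_neg_iff_add_eq_0)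
    then show ?thesis by (simp add: adjoint_inner D_sym)
  qed
  ultimately have "((\<lambda>y. (D *v u2 y) \<bullet> z y - (D *v u1 y) \<bullet> z1 y) has_derivative (\<lambda>h. 0)) (at y)" for y
    by (simp add: has_vector_derivative_def)
  then have "(D *v u2 y) \<bullet> z y - (D *v u1 y) \<bullet> z1 y = (D *v u2 pi) \<bullet> z pi - (D *v u1 pi) \<bullet> z1 pi"
    by (intro has_derivative_zero_unique[of UNIV "\<lambda>y. (D *v u2 y) \<bullet> z y - (D *v u1 y) \<bullet> z1 y"]) simp_all
  then show ?thesis by (simp add: z_pi u1_pi)
qed

text \<open>Green's identity for the linearization at the pattern shifted by \<open>t\<close>: the
  shifted adjoint mode solves the adjoint equation, so two integrations by parts leave boundary
  terms only. \<open>X2\<close> is merely integrable, which is why integration by parts for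
  primitives is needed.\<close>

lemma green:
  fixes X X1 X2 :: "real \<Rightarrow> real^'n"
  assumes dX: "\<And>x. (X has_vector_derivative X1 x) (at x)" and X2: "X2 absolutely_integrable_on {-pi..pi}"
    and X1: "\<And>x. x \<in> {-pi..pi} \<Longrightarrow> X1 x - X1 (-pi) = integral {-pi..x} X2"
  shows "(\<lambda>x. (D *v X2 x + jac f (u (x - t)) *v X x) \<bullet> z (x - t)) integrable_on {-pi..pi}"
    "integral {-pi..pi} (\<lambda>x. (D *v X2 x + jac f (u (x - t)) *v X x) \<bullet> z (x - t)) =
      ((D *v X1 pi) \<bullet> z (pi - t) - (D *v X pi) \<bullet> z1 (pi - t)) -
      ((D *v X1 (-pi)) \<bullet> z (-pi - t) - (D *v X (-pi)) \<bullet> z1 (-pi - t))"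
proof -
  let ?e = "\<lambda>x. D *v z (x - t)" and ?e1 = "\<lambda>x. D *v z1 (x - t)" and ?e2 = "\<lambda>x. D *v z2 (x - t)"
  note bl = bounded_linear.has_vector_derivative[OF matrix_vector_mul_bounded_linear]
  have de: "(?e has_vector_derivative ?e1 x) (at x within S)" "(?e1 has_vector_derivative ?e2 x) (at x within S)" for x S
    by (rule has_vector_derivative_at_within, rule bl, rule has_vector_derivative_shift, rule dz)+
  have ce: "continuous_on S ?e" "continuous_on S ?e1" "continuous_on S ?e2" for S
    by (intro continuous_intros)+
  have cX: "continuous_on S X" for S by (rule has_vector_derivative_imp_continuous_on[OF dX])
  have cX1: "continuous_on {-pi..pi} X1"
  proof -
    have "continuous_on {-pi..pi} (\<lambda>x. X1 (-pi) + integral {-pi..x} X2)"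
      using X2 by (intro continuous_intros indefinite_integral_continuous_1) (simp add: absolutely_integrable_on_def)
    then show ?thesis by (rule continuous_on_eq) (simp flip: X1)
  qed
  have p: "- pi \<le> pi" by simp
  note P = integral_by_parts_primitive[OF bounded_bilinear_inner p X2 X1 de(1) ce(2)]
  have X1i: "X1 absolutely_integrable_on {-pi..pi}" by (rule absolutely_integrable_continuous_real[OF cX1])
  have Xi: "X x - X (-pi) = integral {-pi..x} X1" if "x \<in> {-pi..pi}" for x
    using integral_unique[OF has_integral_derivative[OF dX, of "-pi" x]] that by simp
  note P1 = integral_by_parts_primitive[OF bounded_bilinear_inner p X1i Xi de(2) ce(3)]
  have eq: "(D *v X2 x + jac f (u (x - t)) *v X x) \<bullet> z (x - t) = X2 x \<bullet> ?e x - X x \<bullet> ?e2 x" for x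
    by (simp add: inner_add_left adjoint_inner D_sym)
  have i1: "(\<lambda>x. X2 x \<bullet> ?e x) integrable_on {-pi..pi}" using P(1) by (simp add: absolutely_integrable_on_def)
  have i2: "(\<lambda>x. X x \<bullet> ?e2 x) integrable_on {-pi..pi}"
    by (intro integrable_continuous_real continuous_intros cX ce)
  show "(\<lambda>x. (D *v X2 x + jac f (u (x - t)) *v X x) \<bullet> z (x - t)) integrable_on {-pi..pi}"
    unfolding eq by (rule integrable_diff[OF i1 i2])
  show "integral {-pi..pi} (\<lambda>x. (D *v X2 x + jac f (u (x - t)) *v X x) \<bullet> z (x - t)) =
      ((D *v X1 pi) \<bullet> z (pi - t) - (D *v X pi) \<bullet> z1 (pi - t)) -
      ((D *v X1 (-pi)) \<bullet> z (-pi - t) - (D *v X (-pi)) \<bullet> z1 (-pi - t))"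
    unfolding eq Henstock_Kurzweil_Integration.integral_diff[OF i1 i2] using P(2) P1(2) by (simp add: D_sym)
qed

lemma al_be_ends: "al pi = 1 / 2" "be pi = 0" "al (-pi) = 0" "be (-pi) = 1 / 2" "\<phi>1 pi = 0" "\<phi>1 (-pi) = 0"
proof -
  have "\<phi> pi = 1 / 2" by (rule \<phi>_right) simp
  moreover have "\<phi> (-pi) = - 1 / 2" by (rule \<phi>_left) simp
  moreover show "\<phi>1 pi = 0" "\<phi>1 (-pi) = 0" by (rule \<phi>1_outside; simp)+
  ultimately show "al pi = 1 / 2" "be pi = 0" "al (-pi) = 0" "be (-pi) = 1 / 2"
    by (simp_all add: al_def be_def)
qed

end

section \<open>Size of the correction H and of the Taylor remainder\<close>

context cell_family begin

lemma unif_le_err: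
  "unif_le I p (\<lambda>i x. del i * sig i) \<Longrightarrow> unif_le I p (\<lambda>i x. err i)"
  "unif_le I p (\<lambda>i x. \<bar>b i\<bar> * m i) \<Longrightarrow> unif_le I p (\<lambda>i x. err i)"
  "unif_le I p (\<lambda>i x. del i * \<bar>b i\<bar>) \<Longrightarrow> unif_le I p (\<lambda>i x. err i)"
  "unif_le I p (\<lambda>i x. siz i * sig i) \<Longrightarrow> unif_le I p (\<lambda>i x. err i)"
  "unif_le I p (\<lambda>i x. siz i * \<bar>b i\<bar>) \<Longrightarrow> unif_le I p (\<lambda>i x. err i)"
  "unif_le I p (\<lambda>i x. err i) \<Longrightarrow> unif_le I p (\<lambda>i x. siz i)"
  "unif_le I p (\<lambda>i x. del i) \<Longrightarrow> unif_le I p (\<lambda>i x. siz i)"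
  "unif_le I p (\<lambda>i x. siz i) \<Longrightarrow> unif_le I p (\<lambda>i x. sig i)"
proof -
  show "unif_le I p (\<lambda>i x. del i * sig i) \<Longrightarrow> unif_le I p (\<lambda>i x. err i)"
    "unif_le I p (\<lambda>i x. \<bar>b i\<bar> * m i) \<Longrightarrow> unif_le I p (\<lambda>i x. err i)"
    "unif_le I p (\<lambda>i x. del i) \<Longrightarrow> unif_le I p (\<lambda>i x. siz i)"
    by (erule unif_le_mono1, rule elementary, assumption)+
  show "unif_le I p (\<lambda>i x. siz i * sig i) \<Longrightarrow> unif_le I p (\<lambda>i x. err i)"
    "unif_le I p (\<lambda>i x. err i) \<Longrightarrow> unif_le I p (\<lambda>i x. siz i)"
    by (erule unif_le_mono[where K=3], simp, rule elementary, assumption)+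
  show "unif_le I p (\<lambda>i x. siz i) \<Longrightarrow> unif_le I p (\<lambda>i x. sig i)"
    by (erule unif_le_mono[where K="2 + 2 * pi"], simp, rule elementary, assumption)
  show "unif_le I p (\<lambda>i x. del i * \<bar>b i\<bar>) \<Longrightarrow> unif_le I p (\<lambda>i x. err i)"
  proof (erule unif_le_mono1)
    fix i assume i: "i \<in> I"
    have "del i * \<bar>b i\<bar> \<le> del i * sig i" by (rule mult_left_mono[OF elementary(1)[OF i] nonneg(1)])
    also have "\<dots> \<le> err i" by (rule elementary(4)[OF i])
    finally show "del i * \<bar>b i\<bar> \<le> err i" .
  qed
  show "unif_le I p (\<lambda>i x. siz i * \<bar>b i\<bar>) \<Longrightarrow> unif_le I p (\<lambda>i x. err i)"
  proof (erule unif_le_mono[where K=3])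
    fix i assume i: "i \<in> I"
    have "siz i * \<bar>b i\<bar> \<le> siz i * sig i" by (rule mult_left_mono[OF elementary(1)[OF i] nonneg(6)[OF i]])
    also have "\<dots> \<le> 3 * err i" by (rule elementary(7)[OF i])
    finally show "siz i * \<bar>b i\<bar> \<le> 3 * err i" .
  qed simp
qed

text \<open>The part of the weights proportional to the odd function \<open>\<phi>\<close>
  integrates to zero against the even function formed by \<open>u1\<close> and \<open>z\<close>; the
  constant part 1/4 meets the normalization of \<open>z\<close>. This explains the value of
  \<open>ccl\<close>.\<close>

lemma hl0_integral: "integral {-pi..pi} (\<lambda>x. hl0 i x \<bullet> z x) = - ccl i"
proof -
  have e: "hl0 i x \<bullet> z x = - ccl i *\<^sub>R (u1 x \<bullet> z x) + - ((a i - c i) / 2) *\<^sub>R (\<phi> x * (u1 x \<bullet> z x))" for x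
  proof -
    have "hl0 i x \<bullet> z x = - (al x * ((a i - b i) * (u1 x \<bullet> z x))) - be x * ((c i - b i) * (u1 x \<bullet> z x))"
      by (simp add: hl0_def k0_def lA_def lC_def inner_add_left inner_diff_left)
    then show ?thesis by (simp add: al_def be_def ccl_def field_simps)
  qed
  have i1: "(\<lambda>x. u1 x \<bullet> z x) integrable_on {-pi..pi}" and i2: "(\<lambda>x. \<phi> x * (u1 x \<bullet> z x)) integrable_on {-pi..pi}"
    by (intro integrable_continuous_real continuous_intros)+
  have "integral {-pi..pi} (\<lambda>x. \<phi> x * (u1 x \<bullet> z x)) = 0"
    by (rule odd_integral_zero) (simp add: \<phi>_odd u1_odd z_odd)
  then show ?thesis
    unfolding e Henstock_Kurzweil_Integration.integral_add[OF integrable_cmul[OF i1] integrable_cmul[OF i2]] integral_cmul uz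
    by simp
qed

lemma unif_z: "unif_le I (\<lambda>i x. z (x - b i)) (\<lambda>i x. 1)" "unif_le I (\<lambda>i x. z x) (\<lambda>i x. 1)"
  "unif_le I (\<lambda>i x. z1 (x - b i)) (\<lambda>i x. 1)"
  by (rule unif_le_data)+

lemma unif_z_shift: "unif_le I (\<lambda>i x. z (x - b i) - z x) (\<lambda>i x. \<bar>b i\<bar>)"
  by (rule unif_shift[OF dz(1) bounded_data(7)])

lemma unif_W_integral:
  assumes "unif_le I p (\<lambda>i x. g i)" "\<And>i. i \<in> I \<Longrightarrow> continuous_on {-pi..pi} (p i)"
  shows "unif_le I (\<lambda>i x. integral {-pi..pi} (\<lambda>x. W i x \<bullet> p i x)) (\<lambda>i x. g i * m i)"
proof -
  have "unif_le I (\<lambda>i x. W i x \<bullet> p i x) (\<lambda>i x. norm (W i x) * g i)"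
    by (rule unif_le_inner[OF unif_le_self assms(1)])
  then have "unif_le I (\<lambda>i x. integral {-pi..pi} (\<lambda>x. W i x \<bullet> p i x)) (\<lambda>i x. integral {-pi..pi} (\<lambda>x. norm (W i x) * g i))"
    by (rule unif_le_integral) (intro integrable_continuous_real continuous_intros assms; simp)+
  then show ?thesis by (simp add: m_def mult.commute)
qed

text \<open>Three error sources: the nonlinear part of the translates, the shift of \<open>z\<close>
  acting on an already small factor, and the pairing of \<open>W\<close> with the shift of
  \<open>z\<close>.\<close>

lemma unif_cc_diff: "unif_le I (\<lambda>i x. cc i - ccl i) (\<lambda>i x. err i)"
proof -
  let ?p = "\<lambda>i x. (h0 i x - hl0 i x) \<bullet> z (x - b i) + hl0 i x \<bullet> (z (x - b i) - z x)"
  have "unif_le I ?p (\<lambda>i x. err i)"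
    by (rule unif_le_add[OF unif_le_err(1)[OF unif_le_inner_left[OF unif_h_diff(1) unif_z(1)]]
      unif_le_err(3)[OF unif_le_inner[OF unif_h(4) unif_z_shift]]])
  then have 1: "unif_le I (\<lambda>i x. integral {-pi..pi} (?p i)) (\<lambda>i x. err i)"
    by (rule unif_le_integral_const) (intro integrable_continuous_real continuous_intros)
  have 2: "unif_le I (\<lambda>i x. integral {-pi..pi} (\<lambda>x. W i x \<bullet> (z (x - b i) - z x))) (\<lambda>i x. err i)"
    by (rule unif_le_err(2)[OF unif_W_integral[OF unif_z_shift]]) (intro continuous_intros)
  have eq: "cc i - ccl i = - integral {-pi..pi} (?p i) - integral {-pi..pi} (\<lambda>x. W i x \<bullet> (z (x - b i) - z x))" for i
  proof -
    have i1: "(\<lambda>x. h0 i x \<bullet> z (x - b i)) integrable_on {-pi..pi}" and i2: "(\<lambda>x. hl0 i x \<bullet> z x) integrable_on {-pi..pi}"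
      by (intro integrable_continuous_real continuous_intros)+
    have "integral {-pi..pi} (?p i) = integral {-pi..pi} (\<lambda>x. h0 i x \<bullet> z (x - b i) - hl0 i x \<bullet> z x)"
      by (simp add: inner_diff_left inner_diff_right)
    also have "\<dots> = integral {-pi..pi} (\<lambda>x. h0 i x \<bullet> z (x - b i)) + ccl i"
      using Henstock_Kurzweil_Integration.integral_diff[OF i1 i2] hl0_integral[of i] by simp
    finally show ?thesis by (simp add: cc_def)
  qed
  show ?thesis unfolding eq by (rule unif_le_diff[OF unif_le_minus[OF 1] 2])
qed

lemma unif_ccl: "unif_le I (\<lambda>i x. ccl i) (\<lambda>i x. del i)"
proof (rule unif_leI[of 1])
  fix i
  have "norm (ccl i) = \<bar>a i + c i - 2 * b i\<bar> / 4" by (simp add: ccl_def)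
  also have "\<dots> \<le> \<bar>a i + c i - 2 * b i\<bar>" by simp
  also have "\<dots> \<le> 1 * del i"
    using abs_triangle_ineq[of "a i - b i" "c i - b i"] by (simp add: del_def)
  finally show "norm (ccl i) \<le> 1 * del i" .
qed simp

lemma unif_cc: "unif_le I (\<lambda>i x. cc i) (\<lambda>i x. siz i)"
  using unif_le_add[OF unif_le_err(6)[OF unif_cc_diff] unif_le_err(7)[OF unif_ccl]] by simp

lemma unif_hh: "unif_le I hh0 (\<lambda>i x. siz i)" "unif_le I hh1 (\<lambda>i x. siz i)" "unif_le I hh2 (\<lambda>i x. siz i)"
  unfolding hh0_def[abs_def] hh1_def[abs_def] hh2_def[abs_def]
  by (rule unif_le_add, rule unif_le_err(7), rule unif_h, rule unif_le_scaleR_left[OF unif_cc], rule unif_le_data)+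

lemma unif_hh_diff:
  "unif_le I (\<lambda>i x. hh0 i x - hhl0 i x) (\<lambda>i x. err i)" "unif_le I (\<lambda>i x. hh2 i x - hhl2 i x) (\<lambda>i x. err i)"
proof -
  have e: "hh0 i x - hhl0 i x = (h0 i x - hl0 i x) + ((cc i - ccl i) *\<^sub>R \<psi> (x - b i) + ccl i *\<^sub>R (\<psi> (x - b i) - \<psi> x))"
    "hh2 i x - hhl2 i x = (h2 i x - hl2 i x) + ((cc i - ccl i) *\<^sub>R \<psi>2 (x - b i) + ccl i *\<^sub>R (\<psi>2 (x - b i) - \<psi>2 x))" for i x
    by (simp_all add: hh0_def hhl0_def hh2_def hhl2_def algebra_simps)
  show "unif_le I (\<lambda>i x. hh0 i x - hhl0 i x) (\<lambda>i x. err i)"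
    unfolding e by (rule unif_le_add[OF unif_le_err(1)[OF unif_h_diff(1)] unif_le_add[OF unif_le_scaleR_left[OF unif_cc_diff unif_le_data(12)]
      unif_le_err(3)[OF unif_le_scaleR[OF unif_ccl unif_shift[OF d\<psi>(1) bounded_data(13)]]]]])
  show "unif_le I (\<lambda>i x. hh2 i x - hhl2 i x) (\<lambda>i x. err i)"
    unfolding e by (rule unif_le_add[OF unif_le_err(1)[OF unif_h_diff(2)] unif_le_add[OF unif_le_scaleR_left[OF unif_cc_diff unif_le_data(14)]
      unif_le_err(3)[OF unif_le_scaleR[OF unif_ccl unif_shift[OF d\<psi>(3) bounded_data(15)]]]]])
qed

lemma unif_le_jac_shift:
  assumes "unif_le I p g"
  shows "unif_le I (\<lambda>i x. jac f (u (x - b i)) *v p i x - jac f (u x) *v p i x) (\<lambda>i x. \<bar>b i\<bar> * g i x)"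
proof -
  obtain R where R: "\<forall>x. norm (u x) \<le> R" using bounded_data(1) ..
  obtain L where L: "L \<ge> 0" "\<And>y y' v. norm y \<le> R \<Longrightarrow> norm y' \<le> R \<Longrightarrow>
    norm (jac f y *v v - jac f y' *v v) \<le> L * norm (y - y') * norm v"
    using jac_lipschitz_on_cball[OF f, of R] by blast
  have 1: "unif_le I (\<lambda>i x. jac f (u (x - b i)) *v p i x - jac f (u x) *v p i x) (\<lambda>i x. norm (u (x - b i) - u x) * norm (p i x))"
    by (rule unif_leI[OF L(1)]) (use L(2) R in \<open>simp add: mult.assoc\<close>)
  have "unif_le I (\<lambda>i x. norm (u (x - b i) - u x) * norm (p i x)) (\<lambda>i x. \<bar>b i\<bar> * g i x)"
    by (rule unif_le_mult) (simp_all add: unif_le_norm assms unif_shift[OF du(1) bounded_data(2)])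
  then obtain K where K: "K \<ge> 0" "\<forall>i\<in>I. \<forall>x\<in>{-pi..pi}. norm (norm (u (x - b i) - u x) * norm (p i x)) \<le> K * (\<bar>b i\<bar> * g i x)"
    by (rule unif_leE)
  show ?thesis by (rule unif_le_mono[OF 1 K(1)]) (use K(2) in \<open>auto simp: abs_mult\<close>)
qed

lemma unif_le_jac:
  assumes "unif_le I p g"
  shows "unif_le I (\<lambda>i x. jac f (u (h i x)) *v p i x) g"
proof -
  have c: "continuous_on UNIV (\<lambda>x. jac f (u x) *v axis k 1)" for k by (intro continuous_intros)
  have p: "periodic (\<lambda>x. jac f (u x) *v axis k 1)" for k using per_u by (simp add: periodic_def)
  have "\<exists>B. \<forall>x. norm (jac f (u x) *v axis k 1) \<le> B" for k
    by (rule periodic_bounded[OF p c]) blast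
  then obtain B where B: "\<And>k x. norm (jac f (u x) *v axis k 1) \<le> B k" by metis
  have S: "0 \<le> (\<Sum>k\<in>UNIV. B k)" by (rule sum_nonneg) (rule order_trans[OF norm_ge_zero B])
  have 1: "unif_le I (\<lambda>i x. jac f (u (h i x)) *v p i x) (\<lambda>i x. norm (p i x))"
  proof (rule unif_leI[OF S])
    fix i x
    have "norm (jac f (u (h i x)) *v p i x) \<le> (\<Sum>k\<in>UNIV. norm (jac f (u (h i x)) *v axis k 1)) * norm (p i x)"
      by (rule matrix_mult_norm_le_rows)
    also have "\<dots> \<le> (\<Sum>k\<in>UNIV. B k) * norm (p i x)" by (intro mult_right_mono sum_mono B) simp
    finally show "norm (jac f (u (h i x)) *v p i x) \<le> (\<Sum>k\<in>UNIV. B k) * norm (p i x)" .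
  qed
  obtain K where K: "K \<ge> 0" "\<forall>i\<in>I. \<forall>x\<in>{-pi..pi}. norm (p i x) \<le> K * g i x" by (rule unif_leE[OF assms])
  show ?thesis by (rule unif_le_mono[OF 1 K(1)]) (use K(2) in auto)
qed

lemma unif_hh0_bounded: "unif_le I hh0 (\<lambda>i x. 1)"
proof (rule unif_le_mono[OF unif_le_err(8)[OF unif_hh(1)], of 3])
  show "sig i \<le> 3 * 1" if "i \<in> I" for i using elementary(3)[OF that] by simp
qed simp

lemma unif_Q0: "unif_le I Q (\<lambda>i x. (norm (W i x))\<^sup>2 + (siz i)\<^sup>2)"
proof -
  obtain R where R: "\<forall>x. norm (u x) \<le> R" using bounded_data(1) ..
  obtain C where C: "C \<ge> 0" "\<forall>i\<in>I. \<forall>x\<in>{-pi..pi}. norm (hh0 i x) \<le> C * 1" by (rule unif_leE[OF unif_hh0_bounded])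
  obtain C' where C': "C' \<ge> 0" "\<forall>i\<in>I. \<forall>x\<in>{-pi..pi}. norm (hh0 i x) \<le> C' * siz i" by (rule unif_leE[OF unif_hh(1)])
  \<comment> \<open>This ball contains both the shifted pattern and its perturbation: the pattern is
    bounded by \<open>R\<close>, \<open>W\<close> by 1 and the correction by
    \<open>C\<close>.\<close>
  obtain L where L: "L \<ge> 0" "\<And>y h. norm y \<le> R + 1 + C \<Longrightarrow> norm (y + h) \<le> R + 1 + C \<Longrightarrow>
    norm (f (y + h) - f y - jac f y *v h) \<le> L * (norm h)\<^sup>2"
    using jac_taylor_on_cball[OF f, of "R + 1 + C"] by blast
  show ?thesis
  proof (rule unif_leI[of "L * (2 + 2 * C'\<^sup>2)"])
    fix i x assume ix: "i \<in> I" "x \<in> {-pi..pi}"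
    let ?h = "W i x + hh0 i x"
    have 1: "norm (u (x - b i)) \<le> R" "norm (W i x) \<le> 1" "norm (hh0 i x) \<le> C" "norm (hh0 i x) \<le> C' * siz i"
      using R W_bound[OF ix] C(2) C'(2) ix by auto
    have h: "norm ?h \<le> norm (W i x) + C' * siz i"
      using norm_triangle_ineq[of "W i x" "hh0 i x"] 1(4) by linarith
    have "norm (u (x - b i) + ?h) \<le> R + 1 + C"
      using norm_triangle_ineq[of "u (x - b i)" ?h] norm_triangle_ineq[of "W i x" "hh0 i x"] 1(1-3) by linarith
    then have "norm (Q i x) \<le> L * (norm ?h)\<^sup>2"
      unfolding Q_def by (intro L(2)) (use 1(1) C(1) in linarith)
    also have "\<dots> \<le> L * (norm (W i x) + C' * siz i)\<^sup>2"
      by (rule mult_left_mono[OF power_mono[OF h norm_ge_zero] L(1)])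
    also have "(norm (W i x) + C' * siz i)\<^sup>2 \<le> 2 * (norm (W i x))\<^sup>2 + 2 * (C' * siz i)\<^sup>2"
      using zero_le_power2[of "norm (W i x) - C' * siz i"] by (simp add: power2_eq_square algebra_simps)
    also have "\<dots> \<le> (2 + 2 * C'\<^sup>2) * ((norm (W i x))\<^sup>2 + (siz i)\<^sup>2)"
      by (simp add: algebra_simps power_mult_distrib)
    finally show "norm (Q i x) \<le> L * (2 + 2 * C'\<^sup>2) * ((norm (W i x))\<^sup>2 + (siz i)\<^sup>2)"
      using L(1) by (simp add: mult_left_mono mult.assoc)
  qed (use L(1) in simp)
qed

end

section \<open>Pairings of translated functions\<close>

lemma integral_translate:
  fixes g :: "real \<Rightarrow> 'b::euclidean_space"
  assumes "continuous_on UNIV g"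
  shows "integral {r..s} (\<lambda>x. g (x - t)) = integral {r - t..s - t} g"
  using integral_shift[of r "- t" s g] continuous_on_subset[OF assms subset_UNIV] by (simp add: o_def)

context cell_problem begin

lemma ci: "continuous_on UNIV g \<Longrightarrow> (g :: real \<Rightarrow> 'b::euclidean_space) integrable_on {r..s}"
  by (rule integrable_continuous_real[OF continuous_on_subset[OF _ subset_UNIV]])

lemma uz_shift: "integral {-pi..pi} (\<lambda>x. u1 (x - t) \<bullet> z (x - t)) = 1"
proof -
  have c: "continuous_on UNIV (\<lambda>x. u1 x \<bullet> z x)" by (intro continuous_intros)
  have p: "periodic (\<lambda>x. u1 x \<bullet> z x)" using per_z periodic_data(1) by (simp add: periodic_def)
  have "integral {-pi..pi} (\<lambda>x. u1 (x - t) \<bullet> z (x - t)) = integral {-pi - t..pi - t} (\<lambda>x. u1 x \<bullet> z x)"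
    by (rule integral_translate[OF c])
  also have "pi - t = (-pi - t) + 2 * pi" by simp
  also have "integral {-pi - t..(-pi - t) + 2 * pi} (\<lambda>x. u1 x \<bullet> z x) = integral {-pi..pi} (\<lambda>x. u1 x \<bullet> z x)"
    by (rule periodic_shift_integral[OF p c])
  finally show ?thesis using uz by simp
qed

text \<open>\<open>\<psi>\<close> is not periodic; the normalization survives the shift because the
  shifted support still lies inside the cell.\<close>

lemma \<psi>z_shift:
  assumes t: "\<rho> + \<bar>t\<bar> < pi"
  shows "integral {-pi..pi} (\<lambda>x. \<psi> (x - t) \<bullet> z (x - t)) = 1"
proof -
  let ?g = "\<lambda>x. \<psi> x \<bullet> z x"
  have c: "continuous_on UNIV ?g" by (intro continuous_intros)
  have o: "?g x = 0" if "x \<notin> {-\<rho>..\<rho>}" for x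
  proof -
    have "\<bar>x\<bar> > \<rho>" using that by auto
    then show ?thesis by (simp add: \<psi>_supp)
  qed
  note sup = integral_unique[OF has_integral_on_superset[OF integrable_integral[OF ci[OF c]] o]]
  have "integral {-pi..pi} (\<lambda>x. \<psi> (x - t) \<bullet> z (x - t)) = integral {-pi - t..pi - t} ?g"
    by (rule integral_translate[OF c])
  also have "\<dots> = integral {-\<rho>..\<rho>} ?g" by (rule sup) (use t in auto)
  also have "\<dots> = integral {-pi..pi} ?g" by (rule sup[symmetric]) (use \<rho> in auto)
  finally show ?thesis using \<psi>z by simp
qed

lemma \<psi>_ends:
  assumes t: "\<rho> + \<bar>t\<bar> < pi"
  shows "\<psi> (pi - t) = 0" "\<psi> (- pi - t) = 0" "\<psi>1 (pi - t) = 0" "\<psi>1 (- pi - t) = 0"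
  by (rule \<psi>_supp \<psi>1_outside; use t in linarith)+

lemma \<psi>1z_shift:
  assumes t: "\<rho> + \<bar>t\<bar> < pi"
  shows "integral {-pi..pi} (\<lambda>x. \<psi>1 (x - t) \<bullet> z (x - t)) = - integral {-pi..pi} (\<lambda>x. \<psi> (x - t) \<bullet> z1 (x - t))"
proof -
  have "((\<lambda>x. \<psi> (x - t) \<bullet> z (x - t)) has_vector_derivative \<psi> (x - t) \<bullet> z1 (x - t) + \<psi>1 (x - t) \<bullet> z (x - t)) (at x)" for x
    by (intro bounded_bilinear.has_vector_derivative[OF bounded_bilinear_inner] has_vector_derivative_shift d\<psi> dz)
  from has_integral_derivative[OF this, of "-pi" pi]
  have "((\<lambda>x. \<psi> (x - t) \<bullet> z1 (x - t) + \<psi>1 (x - t) \<bullet> z (x - t)) has_integral 0) {-pi..pi}"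
    by (simp add: \<psi>_ends[OF t])
  then have "integral {-pi..pi} (\<lambda>x. \<psi> (x - t) \<bullet> z1 (x - t) + \<psi>1 (x - t) \<bullet> z (x - t)) = 0" by (rule integral_unique)
  moreover have "integral {-pi..pi} (\<lambda>x. \<psi> (x - t) \<bullet> z1 (x - t) + \<psi>1 (x - t) \<bullet> z (x - t)) =
      integral {-pi..pi} (\<lambda>x. \<psi> (x - t) \<bullet> z1 (x - t)) + integral {-pi..pi} (\<lambda>x. \<psi>1 (x - t) \<bullet> z (x - t))"
    by (intro Henstock_Kurzweil_Integration.integral_add ci continuous_intros)
  ultimately show ?thesis by (simp add: eq_neg_iff_add_eq_0 add.commute)
qed

lemma al_uz: "integral {-pi..pi} (\<lambda>x. al x * (u1 x \<bullet> z x)) = 1 / 4" "integral {-pi..pi} (\<lambda>x. be x * (u1 x \<bullet> z x)) = 1 / 4"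
proof -
  have o: "integral {-pi..pi} (\<lambda>x. \<phi> x * (u1 x \<bullet> z x)) = 0"
    by (rule odd_integral_zero) (simp add: \<phi>_odd u1_odd z_odd)
  have i1: "(\<lambda>x. u1 x \<bullet> z x) integrable_on {-pi..pi}" and i2: "(\<lambda>x. \<phi> x * (u1 x \<bullet> z x)) integrable_on {-pi..pi}"
    by (intro ci continuous_intros)+
  have e: "al x * (u1 x \<bullet> z x) = (1/2) *\<^sub>R (\<phi> x * (u1 x \<bullet> z x)) + (1/4) *\<^sub>R (u1 x \<bullet> z x)"
    "be x * (u1 x \<bullet> z x) = (-1/2) *\<^sub>R (\<phi> x * (u1 x \<bullet> z x)) + (1/4) *\<^sub>R (u1 x \<bullet> z x)" for x
    by (simp_all add: al_def be_def field_simps)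
  show "integral {-pi..pi} (\<lambda>x. al x * (u1 x \<bullet> z x)) = 1 / 4" "integral {-pi..pi} (\<lambda>x. be x * (u1 x \<bullet> z x)) = 1 / 4"
    unfolding e Henstock_Kurzweil_Integration.integral_add[OF integrable_cmul[OF i2] integrable_cmul[OF i1]] integral_cmul uz o
    by simp_all
qed

lemma inner_abs_int:
  fixes X g :: "real \<Rightarrow> real^'n"
  assumes "continuous_on UNIV g" "X absolutely_integrable_on {r..s}"
  shows "(\<lambda>x. X x \<bullet> g x) integrable_on {r..s}"
  using absolutely_integrable_bilinear_continuous[OF bounded_bilinear_inner assms(2) continuous_on_subset[OF assms(1) subset_UNIV]]
  by (simp add: absolutely_integrable_on_def)

end

section \<open>The scalar equation for the phase speed\<close>

context cell_family begin

text \<open>\<open>dH i p q r\<close> is the rate of change of \<open>H1\<close> when the phases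
  \<open>a\<close>, \<open>b\<close>, \<open>c\<close> move with speeds \<open>p\<close>,
  \<open>q\<close>, \<open>r\<close>; \<open>dcf\<close> is the corresponding rate of the phase
  coefficient when moreover \<open>W\<close> moves with speed \<open>V\<close>.\<close>

definition dH :: "'i \<Rightarrow> real \<Rightarrow> real \<Rightarrow> real \<Rightarrow> real \<Rightarrow> real^'n" where
  "dH i p q r x = (q / 2) *\<^sub>R u1 (x - b i) - (al x * p) *\<^sub>R u1 (x - a i) - (be x * r) *\<^sub>R u1 (x - c i)"
definition dcf :: "'i \<Rightarrow> real \<Rightarrow> real \<Rightarrow> real \<Rightarrow> (real \<Rightarrow> real^'n) \<Rightarrow> real" where
  "dcf i p q r V = - integral {-pi..pi} (\<lambda>x. dH i p q r x \<bullet> z (x - b i)) + q * integral {-pi..pi} (\<lambda>x. h0 i x \<bullet> z1 (x - b i)) -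
     integral {-pi..pi} (\<lambda>x. V x \<bullet> (z (x - b i) - z x)) + q * integral {-pi..pi} (\<lambda>x. W i x \<bullet> z1 (x - b i))"
text \<open>\<open>kap\<close> is the factor with which the constraint that W + H is orthogonal to
  the shifted \<open>z\<close> reacts to a motion of the phase \<open>b\<close>. It is small, so
  \<open>1 - kap\<close> can be divided out. Likewise \<open>kpsi\<close> is close to 1 for small
  \<open>b\<close>.\<close>

definition kap :: "'i \<Rightarrow> real" where "kap i = integral {-pi..pi} (\<lambda>x. (W i x + hh0 i x) \<bullet> z1 (x - b i))"
definition kpsi :: "'i \<Rightarrow> real" where "kpsi i = integral {-pi..pi} (\<lambda>x. \<psi> (x - b i) \<bullet> z x)"
text \<open>The speed \<open>dc\<close> of the phase coefficient is a separate argument. For the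
  derivative of the decomposition it equals \<open>dcf\<close>; in the existence proof it is first
  chosen freely and the equality is derived.\<close>

definition dT :: "'i \<Rightarrow> real \<Rightarrow> real \<Rightarrow> real \<Rightarrow> (real \<Rightarrow> real^'n) \<Rightarrow> real \<Rightarrow> real \<Rightarrow> real^'n" where
  "dT i p q r V dc x = V x + (dH i p q r x + dc *\<^sub>R \<psi> (x - b i) - (cc i * q) *\<^sub>R \<psi>1 (x - b i) - q *\<^sub>R u1 (x - b i))"
definition qW :: "'i \<Rightarrow> real" where "qW i = integral {-pi..pi} (\<lambda>x. (norm (W i x))\<^sup>2)"
definition dw :: "'i \<Rightarrow> real^'n" where "dw i = W i pi - W i (- pi)"
definition dw1 :: "'i \<Rightarrow> real^'n" where "dw1 i = W1 i pi - W1 i (- pi)"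

lemma cont_dH [continuous_intros]: "continuous_on S (dH i p q r)"
  unfolding dH_def[abs_def] by (intro continuous_intros)

lemma kap_eq:
  assumes "i \<in> I"
  shows "kap i = integral {-pi..pi} (\<lambda>x. W i x \<bullet> z1 (x - b i)) + integral {-pi..pi} (\<lambda>x. h0 i x \<bullet> z1 (x - b i)) +
    cc i * integral {-pi..pi} (\<lambda>x. \<psi> (x - b i) \<bullet> z1 (x - b i))"
proof -
  have i: "(\<lambda>x. W i x \<bullet> z1 (x - b i)) integrable_on {-pi..pi}" "(\<lambda>x. h0 i x \<bullet> z1 (x - b i)) integrable_on {-pi..pi}"
    "(\<lambda>x. \<psi> (x - b i) \<bullet> z1 (x - b i)) integrable_on {-pi..pi}"
    by (intro ci continuous_intros assms)+
  have "kap i = integral {-pi..pi} (\<lambda>x. (W i x \<bullet> z1 (x - b i) + h0 i x \<bullet> z1 (x - b i)) + cc i *\<^sub>R (\<psi> (x - b i) \<bullet> z1 (x - b i)))"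
    by (simp add: kap_def hh0_def inner_add_left add.assoc)
  also have "\<dots> = integral {-pi..pi} (\<lambda>x. W i x \<bullet> z1 (x - b i)) + integral {-pi..pi} (\<lambda>x. h0 i x \<bullet> z1 (x - b i)) +
      cc i *\<^sub>R integral {-pi..pi} (\<lambda>x. \<psi> (x - b i) \<bullet> z1 (x - b i))"
    unfolding Henstock_Kurzweil_Integration.integral_add[OF integrable_add[OF i(1,2)] integrable_cmul[OF i(3)]]
      Henstock_Kurzweil_Integration.integral_add[OF i(1,2)] integral_cmul ..
  finally show ?thesis by simp
qed

text \<open>The derivative of the constraint that the decomposition imposes on the phase \<open>b\<close>.\<close>

lemma dT_pairing:
  assumes i: "i \<in> I" and V: "V absolutely_integrable_on {-pi..pi}"
  shows "integral {-pi..pi} (\<lambda>x. dT i p q r V dc x \<bullet> z (x - b i)) =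
      integral {-pi..pi} (\<lambda>x. V x \<bullet> z x) + q * (kap i - 1) + (dc - dcf i p q r V)"
proof -
  let ?z = "\<lambda>x. z (x - b i)"
  have cz: "continuous_on UNIV ?z" "continuous_on UNIV z" by (intro continuous_intros)+
  have iV: "(\<lambda>x. V x \<bullet> ?z x) integrable_on {-pi..pi}" "(\<lambda>x. V x \<bullet> z x) integrable_on {-pi..pi}"
    by (rule inner_abs_int[OF _ V], rule cz)+
  have iH: "(\<lambda>x. dH i p q r x \<bullet> ?z x) integrable_on {-pi..pi}" and i\<psi>: "(\<lambda>x. \<psi> (x - b i) \<bullet> ?z x) integrable_on {-pi..pi}"
    and i\<psi>1: "(\<lambda>x. \<psi>1 (x - b i) \<bullet> ?z x) integrable_on {-pi..pi}" and iu: "(\<lambda>x. u1 (x - b i) \<bullet> ?z x) integrable_on {-pi..pi}"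
    by (intro ci continuous_intros)+
  note j = integrable_add[OF iH integrable_cmul[OF i\<psi>, of dc]]
  note j' = integrable_diff[OF j integrable_cmul[OF i\<psi>1, of "cc i * q"]]
  have "integral {-pi..pi} (\<lambda>x. dT i p q r V dc x \<bullet> ?z x) =
      integral {-pi..pi} (\<lambda>x. V x \<bullet> ?z x + (dH i p q r x \<bullet> ?z x + dc *\<^sub>R (\<psi> (x - b i) \<bullet> ?z x) -
        (cc i * q) *\<^sub>R (\<psi>1 (x - b i) \<bullet> ?z x) - q *\<^sub>R (u1 (x - b i) \<bullet> ?z x)))"
    by (simp add: dT_def inner_add_left inner_diff_left)
  also have "\<dots> = integral {-pi..pi} (\<lambda>x. V x \<bullet> ?z x) + (integral {-pi..pi} (\<lambda>x. dH i p q r x \<bullet> ?z x) +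
      dc *\<^sub>R integral {-pi..pi} (\<lambda>x. \<psi> (x - b i) \<bullet> ?z x) - (cc i * q) *\<^sub>R integral {-pi..pi} (\<lambda>x. \<psi>1 (x - b i) \<bullet> ?z x) -
      q *\<^sub>R integral {-pi..pi} (\<lambda>x. u1 (x - b i) \<bullet> ?z x))"
    unfolding Henstock_Kurzweil_Integration.integral_add[OF iV(1) integrable_diff[OF j' integrable_cmul[OF iu]]]
      Henstock_Kurzweil_Integration.integral_diff[OF j' integrable_cmul[OF iu]]
      Henstock_Kurzweil_Integration.integral_diff[OF j integrable_cmul[OF i\<psi>1]]
      Henstock_Kurzweil_Integration.integral_add[OF iH integrable_cmul[OF i\<psi>]] integral_cmul ..
  also have "integral {-pi..pi} (\<lambda>x. \<psi> (x - b i) \<bullet> ?z x) = 1" by (rule \<psi>z_shift[OF abc(4)[OF i]])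
  also have "integral {-pi..pi} (\<lambda>x. u1 (x - b i) \<bullet> ?z x) = 1" by (rule uz_shift)
  also have "integral {-pi..pi} (\<lambda>x. \<psi>1 (x - b i) \<bullet> ?z x) = - integral {-pi..pi} (\<lambda>x. \<psi> (x - b i) \<bullet> z1 (x - b i))"
    by (rule \<psi>1z_shift[OF abc(4)[OF i]])
  finally have *: "integral {-pi..pi} (\<lambda>x. dT i p q r V dc x \<bullet> ?z x) = integral {-pi..pi} (\<lambda>x. V x \<bullet> ?z x) +
      (integral {-pi..pi} (\<lambda>x. dH i p q r x \<bullet> ?z x) + dc + (cc i * q) * integral {-pi..pi} (\<lambda>x. \<psi> (x - b i) \<bullet> z1 (x - b i)) - q)"
    by simp
  have "integral {-pi..pi} (\<lambda>x. V x \<bullet> (?z x - z x)) = integral {-pi..pi} (\<lambda>x. V x \<bullet> ?z x) - integral {-pi..pi} (\<lambda>x. V x \<bullet> z x)"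
    unfolding inner_diff_right by (rule Henstock_Kurzweil_Integration.integral_diff[OF iV])
  then show ?thesis unfolding * dcf_def kap_eq[OF i] by (simp add: algebra_simps)
qed

lemma Fr_eq: "Fr i x = (D *v (W2 i x + hh2 i x) + jac f (u (x - b i)) *v (W i x + hh0 i x)) + Q i x"
  by (simp add: Fr_def Q_def)

lemma W_hh_green_prems:
  assumes "i \<in> I"
  shows "((\<lambda>x. W i x + hh0 i x) has_vector_derivative W1 i x + hh1 i x) (at x)"
    "(\<lambda>x. W2 i x + hh2 i x) absolutely_integrable_on {r..s}"
    "r \<le> s \<Longrightarrow> (W1 i s + hh1 i s) - (W1 i r + hh1 i r) = integral {r..s} (\<lambda>x. W2 i x + hh2 i x)"
proof -
  show "((\<lambda>x. W i x + hh0 i x) has_vector_derivative W1 i x + hh1 i x) (at x)"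
    by (rule has_vector_derivative_add[OF dW[OF assms] d_h(1)])
  have h2: "hh2 i absolutely_integrable_on {r..s}" by (rule absolutely_integrable_continuous_real) (rule cont_h)
  show "(\<lambda>x. W2 i x + hh2 i x) absolutely_integrable_on {r..s}" by (rule set_integral_add(1)[OF W2[OF assms] h2])
  assume rs: "r \<le> s"
  have "integral {r..s} (\<lambda>x. W2 i x + hh2 i x) = integral {r..s} (W2 i) + integral {r..s} (hh2 i)"
    by (rule Henstock_Kurzweil_Integration.integral_add) (use W2[OF assms, of r s] h2 in \<open>simp_all add: absolutely_integrable_on_def\<close>)
  then show "(W1 i s + hh1 i s) - (W1 i r + hh1 i r) = integral {r..s} (\<lambda>x. W2 i x + hh2 i x)"
    using W1[OF assms rs] integral_unique[OF has_integral_derivative[OF d_h(2) rs, of i]] by simp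
qed

text \<open>Boundary terms left by Green's identity. In \<open>bdW\<close> only the jumps of
  \<open>W\<close> and of its derivative across the cell occur, since \<open>z\<close> and its
  derivative take the same values at both ends.\<close>

definition bdH :: "'i \<Rightarrow> real" where
  "bdH i = ((D *v hh1 i pi) \<bullet> z (pi - b i) - (D *v hh0 i pi) \<bullet> z1 (pi - b i)) -
    ((D *v hh1 i (-pi)) \<bullet> z (-pi - b i) - (D *v hh0 i (-pi)) \<bullet> z1 (-pi - b i))"
definition bdW :: "'i \<Rightarrow> real" where
  "bdW i = (D *v dw1 i) \<bullet> z (pi - b i) - (D *v dw i) \<bullet> z1 (pi - b i)"

lemma Fr_pairing:
  assumes i: "i \<in> I"
  shows "(\<lambda>x. Fr i x \<bullet> z (x - b i)) integrable_on {-pi..pi}"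
    "integral {-pi..pi} (\<lambda>x. Fr i x \<bullet> z (x - b i)) = bdW i + bdH i + integral {-pi..pi} (\<lambda>x. Q i x \<bullet> z (x - b i))"
proof -
  have X1: "(W1 i x + hh1 i x) - (W1 i (-pi) + hh1 i (-pi)) = integral {-pi..x} (\<lambda>x. W2 i x + hh2 i x)" if "x \<in> {-pi..pi}" for x
    by (rule W_hh_green_prems(3)[OF i]) (use that in simp)
  note g = green[OF W_hh_green_prems(1)[OF i] W_hh_green_prems(2)[OF i] X1, of "b i"]
  have iQ: "(\<lambda>x. Q i x \<bullet> z (x - b i)) integrable_on {-pi..pi}" by (intro ci continuous_intros i)
  show "(\<lambda>x. Fr i x \<bullet> z (x - b i)) integrable_on {-pi..pi}"
    unfolding Fr_eq inner_add_left[of _ "Q i _"] by (rule integrable_add[OF g(1) iQ])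
  have "integral {-pi..pi} (\<lambda>x. Fr i x \<bullet> z (x - b i)) =
      integral {-pi..pi} (\<lambda>x. (D *v (W2 i x + hh2 i x) + jac f (u (x - b i)) *v (W i x + hh0 i x)) \<bullet> z (x - b i)) +
      integral {-pi..pi} (\<lambda>x. Q i x \<bullet> z (x - b i))"
    unfolding Fr_eq inner_add_left[of _ "Q i _"] by (rule Henstock_Kurzweil_Integration.integral_add[OF g(1) iQ])
  also have "integral {-pi..pi} (\<lambda>x. (D *v (W2 i x + hh2 i x) + jac f (u (x - b i)) *v (W i x + hh0 i x)) \<bullet> z (x - b i)) =
      ((D *v (W1 i pi + hh1 i pi)) \<bullet> z (pi - b i) - (D *v (W i pi + hh0 i pi)) \<bullet> z1 (pi - b i)) -
      ((D *v (W1 i (-pi) + hh1 i (-pi))) \<bullet> z (-pi - b i) - (D *v (W i (-pi) + hh0 i (-pi))) \<bullet> z1 (-pi - b i))"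
    by (rule g(2))
  also have "\<dots> = bdW i + bdH i"
    unfolding bdW_def bdH_def dw_def dw1_def periodic_pi[OF per_z] periodic_pi[OF periodic_data(5)]
    by (simp add: matrix_vector_right_distrib matrix_vector_mult_diff_distrib inner_add_left inner_diff_left)
  finally show "integral {-pi..pi} (\<lambda>x. Fr i x \<bullet> z (x - b i)) = bdW i + bdH i + integral {-pi..pi} (\<lambda>x. Q i x \<bullet> z (x - b i))" .
qed

lemma unif_le_at:
  assumes "unif_le I p (\<lambda>i x. g i)" "y \<in> {-pi..pi}"
  shows "unif_le I (\<lambda>i x. p i y) (\<lambda>i x. g i)"
  using assms unfolding unif_le_def by blast

text \<open>Expanding around the shifted point \<open>x - b i\<close> instead of \<open>x\<close>
  gives an error quadratic in the phase differences alone, without a factor \<open>sig\<close>. The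
  first term in the bound for N^theta depends on this.\<close>

lemma unif_dA_taylor_b:
  assumes "\<And>x. (g has_vector_derivative g1 x) (at x)" "\<And>x. (g1 has_vector_derivative g2 x) (at x)" "\<exists>B. \<forall>x. norm (g2 x) \<le> B"
  shows "unif_le I (\<lambda>i x. dA g i x + (a i - b i) *\<^sub>R g1 (x - b i)) (\<lambda>i x. (del i)\<^sup>2)"
    "unif_le I (\<lambda>i x. dC g i x + (c i - b i) *\<^sub>R g1 (x - b i)) (\<lambda>i x. (del i)\<^sup>2)"
proof -
  obtain B where B: "\<forall>x. norm (g2 x) \<le> B" using assms(3) ..
  have B0: "0 \<le> B" using order_trans[OF norm_ge_zero] B by blast
  have t: "norm (g (y - s) - g (y - 0) + (s - 0) *\<^sub>R g1 y) \<le> B * (\<bar>s\<bar> + \<bar>0\<bar>) * \<bar>s - 0\<bar>" for y s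
    by (rule shift_diff_taylor[OF assms(1,2)]) (use B in blast)
  have sq: "B * \<bar>s\<bar> * \<bar>s\<bar> \<le> B * (del i)\<^sup>2" if "\<bar>s\<bar> \<le> del i" for s i
    unfolding power2_eq_square mult.assoc by (intro mult_left_mono mult_mono that B0 nonneg) simp
  have "norm (dA g i x + (a i - b i) *\<^sub>R g1 (x - b i)) \<le> B * (del i)\<^sup>2"
    "norm (dC g i x + (c i - b i) *\<^sub>R g1 (x - b i)) \<le> B * (del i)\<^sup>2" for i x
    using t[of "x - b i" "a i - b i"] sq[of "a i - b i" i] t[of "x - b i" "c i - b i"] sq[of "c i - b i" i]
    by (simp_all add: dA_def dC_def del_def algebra_simps)
  then show "unif_le I (\<lambda>i x. dA g i x + (a i - b i) *\<^sub>R g1 (x - b i)) (\<lambda>i x. (del i)\<^sup>2)"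
    "unif_le I (\<lambda>i x. dC g i x + (c i - b i) *\<^sub>R g1 (x - b i)) (\<lambda>i x. (del i)\<^sup>2)"
    using B0 by (auto intro: unif_leI)
qed

text \<open>By \<open>wronskian\<close> the first-order terms of the expansion cancel between the
  two boundary products, so they may be added for free; what remains is the quadratic error of
  \<open>unif_dA_taylor_b\<close>.\<close>

lemma unif_bdH: "unif_le I (\<lambda>i x. bdH i) (\<lambda>i x. (del i)\<^sup>2)"
proof -
  define P where "P i x = (D *v (dA u1 i x + (a i - b i) *\<^sub>R u2 (x - b i))) \<bullet> z (x - b i) - (D *v (dA u i x + (a i - b i) *\<^sub>R u1 (x - b i))) \<bullet> z1 (x - b i)" for i x
  define P' where "P' i x = (D *v (dC u1 i x + (c i - b i) *\<^sub>R u2 (x - b i))) \<bullet> z (x - b i) - (D *v (dC u i x + (c i - b i) *\<^sub>R u1 (x - b i))) \<bullet> z1 (x - b i)" for i x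
  have e: "P i x = (D *v dA u1 i x) \<bullet> z (x - b i) - (D *v dA u i x) \<bullet> z1 (x - b i)"
    "P' i x = (D *v dC u1 i x) \<bullet> z (x - b i) - (D *v dC u i x) \<bullet> z1 (x - b i)" for i x
    by (simp_all add: P_def P'_def matrix_vector_right_distrib matrix_vector_mult_scaleR inner_add_left wronskian)
  note L = unif_le_linear[OF matrix_vector_mul_bounded_linear]
  have P: "unif_le I P (\<lambda>i x. (del i)\<^sup>2)" "unif_le I P' (\<lambda>i x. (del i)\<^sup>2)"
    unfolding P_def[abs_def] P'_def[abs_def]
    by (rule unif_le_diff[OF unif_le_inner_left[OF L[OF unif_dA_taylor_b(1)[OF du(2,3) bounded_data(4)]] unif_z(1)]
        unif_le_inner_left[OF L[OF unif_dA_taylor_b(1)[OF du(1,2) bounded_data(3)]] unif_z(3)]]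
      unif_le_diff[OF unif_le_inner_left[OF L[OF unif_dA_taylor_b(2)[OF du(2,3) bounded_data(4)]] unif_z(1)]
        unif_le_inner_left[OF L[OF unif_dA_taylor_b(2)[OF du(1,2) bounded_data(3)]] unif_z(3)]])+
  have p: "pi \<in> {-pi..pi}" "-pi \<in> {-pi..pi}" by auto
  have "unif_le I (\<lambda>i x. (1/2) *\<^sub>R (P i pi - P' i (-pi))) (\<lambda>i x. (del i)\<^sup>2)"
    by (rule unif_le_linear[OF bounded_linear_scaleR_right unif_le_diff[OF unif_le_at[OF P(1) p(1)] unif_le_at[OF P(2) p(2)]]])
  then show ?thesis
  proof (rule unif_le_cong)
    fix i assume i: "i \<in> I"
    \<comment> \<open>At each end only the adjacent neighbour carries weight, and neither the
      shifted \<open>\<psi>\<close> nor the derivative of the cutoff reaches the boundary.\<close>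
    have h: "hh0 i pi = (1/2) *\<^sub>R dA u i pi" "hh1 i pi = (1/2) *\<^sub>R dA u1 i pi"
      "hh0 i (-pi) = (1/2) *\<^sub>R dC u i (-pi)" "hh1 i (-pi) = (1/2) *\<^sub>R dC u1 i (-pi)"
      by (simp_all add: hh0_def hh1_def h0_def h1_def k0_def k1_def al_be_ends \<psi>_ends[OF abc(4)[OF i]])
    show "bdH i = (1/2) *\<^sub>R (P i pi - P' i (-pi))"
      unfolding bdH_def h e by (simp add: matrix_vector_mult_scaleR right_diff_distrib)
  qed
qed

text \<open>At zero phase \<open>bdW i\<close> is exactly \<open>- g i\<close> because
  \<open>z\<close> vanishes at \<open>pi\<close>; shifting \<open>z\<close> and \<open>z1\<close> by
  \<open>b i\<close> costs a factor \<open>\<bar>b i\<bar>\<close>.\<close>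

lemma unif_bdW:
  assumes g: "\<And>i. i \<in> I \<Longrightarrow> g i = dw i \<bullet> (D *v z1 pi)"
  shows "unif_le I (\<lambda>i x. bdW i + g i) (\<lambda>i x. \<bar>b i\<bar> * (norm (dw i) + norm (dw1 i)))"
proof -
  note L = unif_le_linear[OF matrix_vector_mul_bounded_linear]
  have p: "pi \<in> {-pi..pi}" by simp
  have d: "unif_le I (\<lambda>i x. dw i) (\<lambda>i x. norm (dw i) + norm (dw1 i))" "unif_le I (\<lambda>i x. dw1 i) (\<lambda>i x. norm (dw i) + norm (dw1 i))"
    by (rule unif_leI[of 1]; simp)+
  have "unif_le I (\<lambda>i x. (D *v dw1 i) \<bullet> (z (pi - b i) - z pi) - (D *v dw i) \<bullet> (z1 (pi - b i) - z1 pi))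
      (\<lambda>i x. (norm (dw i) + norm (dw1 i)) * \<bar>b i\<bar>)"
    by (rule unif_le_diff[OF unif_le_inner[OF L[OF d(2)] unif_le_at[OF unif_z_shift p]]
      unif_le_inner[OF L[OF d(1)] unif_le_at[OF unif_shift[OF dz(2) bounded_data(8)] p]]])
  then have "unif_le I (\<lambda>i x. (D *v dw1 i) \<bullet> (z (pi - b i) - z pi) - (D *v dw i) \<bullet> (z1 (pi - b i) - z1 pi))
      (\<lambda>i x. \<bar>b i\<bar> * (norm (dw i) + norm (dw1 i)))" by (simp add: mult.commute)
  then show ?thesis
    by (rule unif_le_cong) (simp add: g bdW_def z_pi inner_diff_right D_sym)
qed

lemma unif_kap: "unif_le I (\<lambda>i x. kap i) (\<lambda>i x. m i + sig i)"
proof -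
  have 1: "unif_le I (\<lambda>i x. integral {-pi..pi} (\<lambda>x. W i x \<bullet> z1 (x - b i))) (\<lambda>i x. 1 * m i)"
    by (rule unif_W_integral[OF unif_z(3)]) (intro continuous_intros)
  have 2: "unif_le I (\<lambda>i x. integral {-pi..pi} (\<lambda>x. hh0 i x \<bullet> z1 (x - b i))) (\<lambda>i x. sig i)"
    by (rule unif_le_integral_const[OF unif_le_inner_left[OF unif_le_err(8)[OF unif_hh(1)] unif_z(3)]]) (intro ci continuous_intros)
  have "unif_le I (\<lambda>i x. integral {-pi..pi} (\<lambda>x. W i x \<bullet> z1 (x - b i)) + integral {-pi..pi} (\<lambda>x. hh0 i x \<bullet> z1 (x - b i))) (\<lambda>i x. m i + sig i)"
    by (rule unif_le_add[OF unif_le_mono1[OF 1] unif_le_mono1[OF 2]]) (use nonneg in simp_all)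
  then show ?thesis
  proof (rule unif_le_cong)
    fix i assume i: "i \<in> I"
    show "kap i = integral {-pi..pi} (\<lambda>x. W i x \<bullet> z1 (x - b i)) + integral {-pi..pi} (\<lambda>x. hh0 i x \<bullet> z1 (x - b i))"
      unfolding kap_def inner_add_left
      by (rule Henstock_Kurzweil_Integration.integral_add) (intro ci continuous_intros i)+
  qed
qed

lemma unif_kpsi: "unif_le I (\<lambda>i x. kpsi i - 1) (\<lambda>i x. \<bar>b i\<bar>)"
proof -
  have "unif_le I (\<lambda>i x. integral {-pi..pi} (\<lambda>x. (\<psi> (x - b i) - \<psi> x) \<bullet> z x)) (\<lambda>i x. \<bar>b i\<bar>)"
    by (rule unif_le_integral_const[OF unif_le_inner_left[OF unif_shift[OF d\<psi>(1) bounded_data(13)] unif_z(2)]]) (intro ci continuous_intros)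
  then show ?thesis
  proof (rule unif_le_cong)
    fix i
    have "integral {-pi..pi} (\<lambda>x. (\<psi> (x - b i) - \<psi> x) \<bullet> z x) = kpsi i - integral {-pi..pi} (\<lambda>x. \<psi> x \<bullet> z x)"
      unfolding kpsi_def inner_diff_left by (rule Henstock_Kurzweil_Integration.integral_diff) (intro ci continuous_intros)+
    then show "kpsi i - 1 = integral {-pi..pi} (\<lambda>x. (\<psi> (x - b i) - \<psi> x) \<bullet> z x)" using \<psi>z by simp
  qed
qed

lemma m_square_le: assumes "i \<in> I" shows "(m i)\<^sup>2 \<le> 2 * pi * qW i" "0 \<le> qW i"
proof -
  note ciW = ci[OF continuous_on_norm[OF cont_W[OF assms]]]
  have i2: "(\<lambda>x. (norm (W i x))\<^sup>2) integrable_on {-pi..pi}" by (intro ci continuous_intros assms)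
  show "0 \<le> qW i" unfolding qW_def by (rule Henstock_Kurzweil_Integration.integral_nonneg[OF i2]) simp
  \<comment> \<open>Cauchy-Schwarz in the form that the variance is nonnegative; \<open>s\<close> is
    the mean of the norm of \<open>W\<close>.\<close>
  define s where "s = m i / (2 * pi)"
  have "0 \<le> integral {-pi..pi} (\<lambda>x. (norm (W i x) - s)\<^sup>2)"
    by (rule Henstock_Kurzweil_Integration.integral_nonneg) (intro ci continuous_intros assms, simp)
  also have "\<dots> = integral {-pi..pi} (\<lambda>x. ((norm (W i x))\<^sup>2 - (2 * s) *\<^sub>R norm (W i x)) + s\<^sup>2)"
    by (simp add: power2_eq_square algebra_simps)
  also have "\<dots> = qW i - 2 * s * m i + 2 * pi * s\<^sup>2"
    unfolding Henstock_Kurzweil_Integration.integral_add[OF integrable_diff[OF i2 integrable_cmul[OF ciW]] integrable_const_ivl]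
      Henstock_Kurzweil_Integration.integral_diff[OF i2 integrable_cmul[OF ciW]] integral_cmul by (simp add: qW_def m_def)
  also have "\<dots> = qW i - (m i)\<^sup>2 / (2 * pi)" by (simp add: s_def power2_eq_square field_simps)
  finally show "(m i)\<^sup>2 \<le> 2 * pi * qW i" by (simp add: field_simps)
qed

lemma unif_Q_err: "unif_le I Q (\<lambda>i x. (norm (W i x))\<^sup>2 + err i)"
proof (rule unif_le_mono[OF unif_Q0, of "1 + (2 + 2 * pi) * 6"])
  fix i x assume i: "i \<in> I"
  let ?K = "(2 + 2 * pi) * 6"
  have "?K * err i \<le> (1 + ?K) * err i"
    by (rule mult_right_mono[OF _ nonneg(5)[OF i]]) simp
  with elementary(9)[OF i] have 1: "(siz i)\<^sup>2 \<le> (1 + ?K) * err i" by (rule order_trans)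
  have "1 * (norm (W i x))\<^sup>2 \<le> (1 + ?K) * (norm (W i x))\<^sup>2"
    by (rule mult_right_mono) simp_all
  from add_mono[OF this 1] show "(norm (W i x))\<^sup>2 + (siz i)\<^sup>2 \<le> (1 + ?K) * ((norm (W i x))\<^sup>2 + err i)"
    by (simp only: distrib_left mult_1)
qed simp

text \<open>Here the square of \<open>siz\<close> must not be traded for \<open>err\<close>, which
  would bring in phase differences times phases. Since \<open>\<bar>b i\<bar> \<le> 1\<close>,
  \<open>siz\<close> is at most \<open>del + m\<close>, and the square of \<open>m\<close> is
  controlled by \<open>qW\<close>.\<close>

lemma unif_Q_pairing: "unif_le I (\<lambda>i x. integral {-pi..pi} (\<lambda>x. Q i x \<bullet> z (x - b i))) (\<lambda>i x. (del i)\<^sup>2 + qW i)"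
proof -
  have "unif_le I (\<lambda>i x. integral {-pi..pi} (\<lambda>x. Q i x \<bullet> z (x - b i))) (\<lambda>i x. integral {-pi..pi} (\<lambda>x. (norm (W i x))\<^sup>2 + (siz i)\<^sup>2))"
    by (rule unif_le_integral[OF unif_le_inner_left[OF unif_Q0 unif_z(1)]]) (intro ci continuous_intros; assumption)+
  then show ?thesis
  proof (rule unif_le_mono[where K="1 + 2 * pi * (4 * pi + 2)"])
    fix i assume i: "i \<in> I"
    have e: "integral {-pi..pi} (\<lambda>x. (norm (W i x))\<^sup>2 + (siz i)\<^sup>2) = qW i + 2 * pi * (siz i)\<^sup>2"
      unfolding qW_def by (subst Henstock_Kurzweil_Integration.integral_add) (intro ci continuous_intros i integrable_const_ivl | simp)+
    have "(siz i)\<^sup>2 \<le> 2 * (del i)\<^sup>2 + 4 * pi * qW i"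
    proof -
      have "siz i \<le> del i + m i"
        unfolding siz_def using mult_right_mono[OF abc(2)[OF i] nonneg(3)[OF i]] by simp
      then have "(siz i)\<^sup>2 \<le> (del i + m i)\<^sup>2" by (rule power_mono[OF _ nonneg(6)[OF i]])
      also have "\<dots> \<le> 2 * (del i)\<^sup>2 + 2 * (m i)\<^sup>2"
        using zero_le_power2[of "del i - m i"] by (simp add: power2_eq_square algebra_simps)
      finally show ?thesis using m_square_le(1)[OF i] by simp
    qed
    then have "2 * pi * (siz i)\<^sup>2 \<le> 2 * pi * (2 * (del i)\<^sup>2 + 4 * pi * qW i)" by (rule mult_left_mono) simp
    also have "\<dots> \<le> 2 * pi * ((4 * pi + 2) * ((del i)\<^sup>2 + qW i))"
      using m_square_le(2)[OF i] by (intro mult_left_mono) (simp_all add: algebra_simps)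
    finally have 1: "2 * pi * (siz i)\<^sup>2 \<le> (2 * pi * (4 * pi + 2)) * ((del i)\<^sup>2 + qW i)" by (simp only: mult.assoc)
    have "qW i \<le> 1 * ((del i)\<^sup>2 + qW i)" by simp
    from add_mono[OF this 1]
    show "integral {-pi..pi} (\<lambda>x. (norm (W i x))\<^sup>2 + (siz i)\<^sup>2) \<le> (1 + 2 * pi * (4 * pi + 2)) * ((del i)\<^sup>2 + qW i)"
      unfolding e distrib_right[of 1] .
  qed simp
qed

end

section \<open>The remainder of the profile equation\<close>

context cell_family begin

lemma unif_shift_gen:
  assumes "\<And>x. (g has_vector_derivative g1 x) (at x)" "\<exists>B. \<forall>x. norm (g1 x) \<le> B" "\<And>i. i \<in> I \<Longrightarrow> \<bar>t i\<bar> \<le> sig i"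
  shows "unif_le I (\<lambda>i x. g (x - t i) - g x) (\<lambda>i x. sig i)"
proof -
  obtain B where B: "\<forall>x. norm (g1 x) \<le> B" using assms(2) ..
  have B0: "0 \<le> B" using order_trans[OF norm_ge_zero] B by blast
  have "norm (g (x - t i) - g x) \<le> B * \<bar>(x - t i) - x\<bar>" for i x
    by (rule shift_diff_bound[OF assms(1)]) (use B in blast)
  moreover have "B * \<bar>(x - t i) - x\<bar> \<le> B * sig i" if "i \<in> I" for i x
    using mult_left_mono[OF assms(3)[OF that] B0] by simp
  ultimately show ?thesis using B0 by (intro unif_leI[of B]) (auto intro: order_trans)
qed

text \<open>Solves \<open>k * n = T\<close> for \<open>n\<close>: a factor within 1/2 of 1 is
  divided out at the price of doubling the constant. It is applied with \<open>1 - kap\<close> and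
  with \<open>kpsi\<close>.\<close>

lemma unif_le_half_bound:
  assumes "unif_le I (\<lambda>i x. T i) (\<lambda>i x. g i)" "\<And>i. i \<in> I \<Longrightarrow> \<bar>k i - 1\<bar> \<le> 1 / 2" "\<And>i. i \<in> I \<Longrightarrow> k i * n i = T i"
  shows "unif_le I (\<lambda>i x. n i :: real) (\<lambda>i x. g i)"
proof -
  obtain C where C: "C \<ge> 0" "\<forall>i\<in>I. \<forall>x\<in>{-pi..pi}. norm (T i) \<le> C * g i" by (rule unif_leE[OF assms(1)])
  show ?thesis
  proof (rule unif_leI[of "2 * C"])
    fix i and x :: real assume ix: "i \<in> I" "x \<in> {-pi..pi}"
    have "1 / 2 \<le> k i" using abs_le_D2[OF assms(2)[OF ix(1)]] by simp
    then have "1 / 2 * \<bar>n i\<bar> \<le> k i * \<bar>n i\<bar>" by (rule mult_right_mono) simp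
    also have "\<dots> = \<bar>T i\<bar>" using \<open>1 / 2 \<le> k i\<close> assms(3)[OF ix(1)] by (simp add: abs_mult flip: assms(3)[OF ix(1)])
    also have "\<bar>T i\<bar> = norm (T i)" by simp
    also have "norm (T i) \<le> C * g i" using C(2) ix by blast
    finally show "norm (n i) \<le> 2 * C * g i" by simp
  qed (use C(1) in simp)
qed

text \<open>The three numbers are values of a sequence in the right neighbour, the cell and the left
  neighbour. \<open>dc0\<close> is the leading part of the speed of the phase coefficient,
  \<open>Eg\<close> the convolution with the kernel E, and \<open>Anf\<close> the profile component
  of the linear normal form.\<close>

definition dc0 :: "real \<Rightarrow> real \<Rightarrow> real \<Rightarrow> real" where "dc0 p q r = (p + r - 2 * q) / 4"
definition Eg :: "real \<Rightarrow> real \<Rightarrow> real \<Rightarrow> real \<Rightarrow> real^'n" where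
  "Eg p q r x = dc0 p q r *\<^sub>R \<psi> x - (al x * p) *\<^sub>R u1 x - (be x * r) *\<^sub>R u1 x - (q / 2) *\<^sub>R u1 x"
definition Anf :: "'i \<Rightarrow> real \<Rightarrow> real \<Rightarrow> real \<Rightarrow> real \<Rightarrow> real^'n" where
  "Anf i p q r x = (D *v hhl2 i x + jac f (u x) *v hhl0 i x) + (D *v W2 i x + jac f (u x) *v W i x) - Eg p q r x"
text \<open>\<open>ea\<close>, \<open>eb\<close>, \<open>ec\<close> are the true phase speeds and
  \<open>p\<close>, \<open>q\<close>, \<open>r\<close> their linear parts. Each summand is a
  difference that vanishes to first order: true against linear correction, Taylor remainder,
  Jacobian at shifted against unshifted pattern, and true against linear transport of the
  pattern.\<close>

definition MM :: "'i \<Rightarrow> real \<Rightarrow> real \<Rightarrow> real \<Rightarrow> real \<Rightarrow> real \<Rightarrow> real \<Rightarrow> real \<Rightarrow> real^'n" where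
  "MM i ea eb ec p q r x = D *v (hh2 i x - hhl2 i x) + Q i x + (jac f (u (x - b i)) *v W i x - jac f (u x) *v W i x) +
     (jac f (u (x - b i)) *v hh0 i x - jac f (u x) *v hh0 i x) + jac f (u x) *v (hh0 i x - hhl0 i x) +
     (al x *\<^sub>R (ea *\<^sub>R u1 (x - a i) - p *\<^sub>R u1 x) + be x *\<^sub>R (ec *\<^sub>R u1 (x - c i) - r *\<^sub>R u1 x) +
       (1 / 2) *\<^sub>R (eb *\<^sub>R u1 (x - b i) - q *\<^sub>R u1 x)) + (cc i * eb) *\<^sub>R \<psi>1 (x - b i)"

text \<open>Solve the evolution equation for \<open>V\<close> and subtract \<open>Anf\<close>. Apart
  from \<open>MM\<close> only two multiples of \<open>\<psi>\<close> are left, one shifted and with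
  the still unknown speed of the phase coefficient, one unshifted with its leading part.\<close>

lemma remainder_eq:
  assumes "dT i ea eb ec V dc x = Fr i x"
  shows "V x - Anf i p q r x = MM i ea eb ec p q r x - dc *\<^sub>R \<psi> (x - b i) + dc0 p q r *\<^sub>R \<psi> x"
proof -
  have h: "(1 / 2) *\<^sub>R (eb *\<^sub>R y - w) = eb *\<^sub>R y - (eb / 2) *\<^sub>R y - (1 / 2) *\<^sub>R w" for y w :: "real^'n"
  proof -
    have e: "eb *\<^sub>R y - (eb / 2) *\<^sub>R y = (eb / 2) *\<^sub>R y" unfolding scaleR_diff_left[symmetric] by simp
    show ?thesis unfolding e by (simp add: scaleR_right_diff_distrib)
  qed
  have "V x = Fr i x - dH i ea eb ec x - dc *\<^sub>R \<psi> (x - b i) + (cc i * eb) *\<^sub>R \<psi>1 (x - b i) + eb *\<^sub>R u1 (x - b i)"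
    unfolding assms[symmetric] dT_def by simp
  then show ?thesis
    unfolding Fr_eq Anf_def MM_def h dH_def Eg_def
    by (simp add: matrix_vector_right_distrib matrix_vector_mult_diff_distrib scaleR_right_diff_distrib)
qed

lemma cont_MM [continuous_intros]: "i \<in> I \<Longrightarrow> continuous_on S (MM i ea eb ec p q r)"
  unfolding MM_def[abs_def] by (intro continuous_intros) simp_all

text \<open>By Green's identity at zero shift the linearization applied to the correction
  contributes nothing and applied to \<open>W\<close> contributes \<open>- q\<close>. Parity and the
  normalizations show that \<open>Eg\<close> pairs to \<open>- q\<close> as well, so the two cancel:
  the linear flow stays in the orthogonal complement.\<close>

lemma Anf_pairing:
  assumes i: "i \<in> I" and q: "q = dw i \<bullet> (D *v z1 pi)"
  shows "(\<lambda>x. Anf i p q r x \<bullet> z x) integrable_on {-pi..pi}" "integral {-pi..pi} (\<lambda>x. Anf i p q r x \<bullet> z x) = 0"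
proof -
  have hl: "hhl2 i absolutely_integrable_on {-pi..pi}" by (rule absolutely_integrable_continuous_real) (rule cont_h)
  have hl1: "hhl1 i x - hhl1 i (-pi) = integral {-pi..x} (hhl2 i)" if "x \<in> {-pi..pi}" for x
    using integral_unique[OF has_integral_derivative[OF d_h(4), of "-pi" x i]] that by simp
  have g1: "(\<lambda>x. (D *v hhl2 i x + jac f (u x) *v hhl0 i x) \<bullet> z x) integrable_on {-pi..pi}"
    "integral {-pi..pi} (\<lambda>x. (D *v hhl2 i x + jac f (u x) *v hhl0 i x) \<bullet> z x) =
      ((D *v hhl1 i pi) \<bullet> z pi - (D *v hhl0 i pi) \<bullet> z1 pi) - ((D *v hhl1 i (-pi)) \<bullet> z (-pi) - (D *v hhl0 i (-pi)) \<bullet> z1 (-pi))"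
    using green[OF d_h(3) hl hl1, of 0] by simp_all
  have W1i: "W1 i x - W1 i (-pi) = integral {-pi..x} (W2 i)" if "x \<in> {-pi..pi}" for x
    by (rule W1[OF i]) (use that in simp)
  have g2: "(\<lambda>x. (D *v W2 i x + jac f (u x) *v W i x) \<bullet> z x) integrable_on {-pi..pi}"
    "integral {-pi..pi} (\<lambda>x. (D *v W2 i x + jac f (u x) *v W i x) \<bullet> z x) =
      ((D *v W1 i pi) \<bullet> z pi - (D *v W i pi) \<bullet> z1 pi) - ((D *v W1 i (-pi)) \<bullet> z (-pi) - (D *v W i (-pi)) \<bullet> z1 (-pi))"
    using green[OF dW[OF i] W2[OF i] W1i, of 0] by simp_all
  have ends: "hhl0 i pi = 0" "hhl0 i (-pi) = 0"
    using \<psi>_ends(1,2)[of 0] \<rho> by (simp_all add: hhl0_def hl0_def k0_def lA_def lC_def u1_pi)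
  have z1p: "z1 (-pi) = z1 pi" using periodic_pi[OF periodic_data(5), of 0] by simp
  have 1: "integral {-pi..pi} (\<lambda>x. (D *v hhl2 i x + jac f (u x) *v hhl0 i x) \<bullet> z x) = 0"
    using g1(2) by (simp add: ends z_pi)
  have 2: "integral {-pi..pi} (\<lambda>x. (D *v W2 i x + jac f (u x) *v W i x) \<bullet> z x) = - q"
    using g2(2) by (simp add: z_pi z1p q dw_def D_sym inner_diff_left)
  have j: "(\<lambda>x. \<psi> x \<bullet> z x) integrable_on {-pi..pi}" "(\<lambda>x. al x * (u1 x \<bullet> z x)) integrable_on {-pi..pi}"
    "(\<lambda>x. be x * (u1 x \<bullet> z x)) integrable_on {-pi..pi}" "(\<lambda>x. u1 x \<bullet> z x) integrable_on {-pi..pi}"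
    by (intro ci continuous_intros)+
  have e: "Eg p q r x \<bullet> z x = ((dc0 p q r *\<^sub>R (\<psi> x \<bullet> z x) - p *\<^sub>R (al x * (u1 x \<bullet> z x))) - r *\<^sub>R (be x * (u1 x \<bullet> z x))) - (q / 2) *\<^sub>R (u1 x \<bullet> z x)" for x
    by (simp add: Eg_def inner_diff_left)
  note i1 = integrable_diff[OF integrable_cmul[OF j(1)] integrable_cmul[OF j(2)]]
  note i2 = integrable_diff[OF i1 integrable_cmul[OF j(3)]]
  note i3 = integrable_diff[OF i2 integrable_cmul[OF j(4)]]
  have 3: "integral {-pi..pi} (\<lambda>x. Eg p q r x \<bullet> z x) = - q"
    unfolding e Henstock_Kurzweil_Integration.integral_diff[OF i2 integrable_cmul[OF j(4)]]
      Henstock_Kurzweil_Integration.integral_diff[OF i1 integrable_cmul[OF j(3)]]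
      Henstock_Kurzweil_Integration.integral_diff[OF integrable_cmul[OF j(1)] integrable_cmul[OF j(2)]]
      integral_cmul uz \<psi>z al_uz by (simp add: dc0_def field_simps)
  have iE: "(\<lambda>x. Eg p q r x \<bullet> z x) integrable_on {-pi..pi}" unfolding e by (rule i3)
  have A: "Anf i p q r x \<bullet> z x = ((D *v hhl2 i x + jac f (u x) *v hhl0 i x) \<bullet> z x + (D *v W2 i x + jac f (u x) *v W i x) \<bullet> z x) - Eg p q r x \<bullet> z x" for x
    unfolding Anf_def inner_diff_left inner_add_left[of "D *v hhl2 i x + _"] ..
  show "(\<lambda>x. Anf i p q r x \<bullet> z x) integrable_on {-pi..pi}"
    unfolding A by (rule integrable_diff[OF integrable_add[OF g1(1) g2(1)] iE])
  show "integral {-pi..pi} (\<lambda>x. Anf i p q r x \<bullet> z x) = 0"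
    unfolding A Henstock_Kurzweil_Integration.integral_diff[OF integrable_add[OF g1(1) g2(1)] iE]
      Henstock_Kurzweil_Integration.integral_add[OF g1(1) g2(1)] 1 2 3 by simp
qed

end

section \<open>Bounds for the nonlinear terms in one cell\<close>

text \<open>\<open>ea\<close>, \<open>eb\<close>, \<open>ec\<close> are the phase speeds in cells
  j+1, j, j-1 and \<open>ga\<close>, \<open>gb\<close>, \<open>gc\<close> their linear parts, the
  jumps of Gamma W; the differences are the components of N^theta. The equation \<open>eqn\<close>
  is the one that determines the nonlinear terms, read in cell j.\<close>

locale cell_equation = cell_family D f u u1 u2 u3 u4 z z1 z2 \<phi> \<phi>1 \<phi>2 \<psi> \<psi>1 \<psi>2 \<psi>3 \<rho> I a b c W W1 W2
  for D :: "real^'n^'n" and f u u1 u2 u3 u4 z z1 z2 \<phi> \<phi>1 \<phi>2 \<psi> \<psi>1 \<psi>2 \<psi>3 \<rho>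
    and I :: "'i set" and a b c W W1 W2 +
  fixes ea eb ec ga gb gc :: "'i \<Rightarrow> real" and V :: "'i \<Rightarrow> real \<Rightarrow> real^'n"
  assumes gb: "\<And>i. i \<in> I \<Longrightarrow> gb i = dw i \<bullet> (D *v z1 pi)"
    and V_int: "\<And>i. i \<in> I \<Longrightarrow> V i absolutely_integrable_on {-pi..pi}"
    and V_perp: "\<And>i. i \<in> I \<Longrightarrow> integral {-pi..pi} (\<lambda>x. V i x \<bullet> z x) = 0"
    and eqn: "\<And>i. i \<in> I \<Longrightarrow> AE x in lebesgue. x \<in> cell \<longrightarrow>
      dT i (ea i) (eb i) (ec i) (V i) (dcf i (ea i) (eb i) (ec i) (V i)) x = Fr i x"
    and kap_small: "\<And>i. i \<in> I \<Longrightarrow> \<bar>kap i\<bar> \<le> 1 / 2"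
    and kpsi_near: "\<And>i. i \<in> I \<Longrightarrow> \<bar>kpsi i - 1\<bar> \<le> 1 / 2"
begin

definition Eth :: "'i \<Rightarrow> real" where
  "Eth i = (del i)\<^sup>2 + sig i * (norm (dw i) + norm (dw1 i)) + m i * norm (dw i) + qW i"

lemma integral_spike_cell:
  fixes p q :: "real \<Rightarrow> 'b::euclidean_space"
  assumes "AE x in lebesgue. x \<in> cell \<longrightarrow> p x = q x"
  shows "integral {-pi..pi} p = integral {-pi..pi} q"
proof -
  obtain N where N: "negligible N" "{x. \<not> (x \<in> cell \<longrightarrow> p x = q x)} \<subseteq> N"
    using assms unfolding eventually_ae_filter_negligible by blast
  show ?thesis
  proof (rule integral_spike[of "N \<union> {-pi, pi}"])
    show "negligible (N \<union> {-pi, pi})" using N(1) by simp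
    fix x assume "x \<in> {-pi..pi} - (N \<union> {-pi, pi})"
    then have "x \<in> cell" "x \<notin> N" by auto
    then show "q x = p x" using N(2) by force
  qed
qed

text \<open>Pairing \<open>eqn\<close> with the shifted adjoint mode eliminates \<open>V\<close>,
  the neighbouring speeds and the speed of the phase coefficient. Only the own speed
  \<open>eb i\<close>, boundary terms and the Taylor remainder survive.\<close>

lemma phase_equation:
  assumes i: "i \<in> I"
  shows "eb i * (kap i - 1) = bdW i + bdH i + integral {-pi..pi} (\<lambda>x. Q i x \<bullet> z (x - b i))"
proof -
  let ?dc = "dcf i (ea i) (eb i) (ec i) (V i)"
  have "AE x in lebesgue. x \<in> cell \<longrightarrow> dT i (ea i) (eb i) (ec i) (V i) ?dc x \<bullet> z (x - b i) = Fr i x \<bullet> z (x - b i)"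
    using eqn[OF i] by (rule AE_mp) (rule AE_I2, simp)
  from integral_spike_cell[OF this] show ?thesis
    unfolding dT_pairing[OF i V_int[OF i]] V_perp[OF i] Fr_pairing(2)[OF i] by simp
qed

text \<open>Rewrite \<open>phase_equation\<close> as \<open>(1 - kap i) * (eb i - gb i)\<close>
  equal to a sum of four small terms. The linear part \<open>gb i\<close> cancels against the
  leading part of \<open>bdW i\<close>, and \<open>gb i * kap i\<close> is what the factor
  \<open>1 - kap i\<close> leaves behind.\<close>

lemma unif_N_theta: "unif_le I (\<lambda>i x. eb i - gb i) (\<lambda>i x. Eth i)"
proof (rule unif_le_half_bound[where k="\<lambda>i. 1 - kap i"])
  let ?T = "\<lambda>i. - (bdW i + gb i) - bdH i - integral {-pi..pi} (\<lambda>x. Q i x \<bullet> z (x - b i)) + gb i * kap i"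
  note n = nonneg m_square_le(2)
  have E: "0 \<le> (del i)\<^sup>2" "0 \<le> sig i * (norm (dw i) + norm (dw1 i))" "0 \<le> m i * norm (dw i)" "0 \<le> qW i"
    "\<bar>b i\<bar> * (norm (dw i) + norm (dw1 i)) \<le> sig i * (norm (dw i) + norm (dw1 i))"
    "norm (dw i) * (m i + sig i) \<le> Eth i" if i: "i \<in> I" for i
  proof -
    show "0 \<le> (del i)\<^sup>2" "0 \<le> sig i * (norm (dw i) + norm (dw1 i))" "0 \<le> m i * norm (dw i)" "0 \<le> qW i"
      using n i by simp_all
    show "\<bar>b i\<bar> * (norm (dw i) + norm (dw1 i)) \<le> sig i * (norm (dw i) + norm (dw1 i))"
      by (rule mult_right_mono[OF elementary(1)[OF i]]) simp
    have "norm (dw i) * (m i + sig i) \<le> sig i * (norm (dw i) + norm (dw1 i)) + m i * norm (dw i)"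
      using mult_nonneg_nonneg[OF n(2) norm_ge_zero[of "dw1 i"]] by (simp add: algebra_simps)
    also have "\<dots> \<le> Eth i" using n i by (simp add: Eth_def)
    finally show "norm (dw i) * (m i + sig i) \<le> Eth i" .
  qed
  have 1: "unif_le I (\<lambda>i x. bdW i + gb i) (\<lambda>i x. Eth i)"
    by (rule unif_le_mono1[OF unif_bdW[OF gb]], assumption) (use E in \<open>simp add: Eth_def add_increasing2 add_increasing\<close>)
  have 2: "unif_le I (\<lambda>i x. bdH i) (\<lambda>i x. Eth i)"
    by (rule unif_le_mono1[OF unif_bdH]) (use E in \<open>simp add: Eth_def\<close>)
  have 3: "unif_le I (\<lambda>i x. integral {-pi..pi} (\<lambda>x. Q i x \<bullet> z (x - b i))) (\<lambda>i x. Eth i)"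
    by (rule unif_le_mono1[OF unif_Q_pairing]) (use E in \<open>simp add: Eth_def\<close>)
  have g: "unif_le I (\<lambda>i x. gb i) (\<lambda>i x. norm (dw i))"
  proof -
    have "unif_le I (\<lambda>i x. dw i \<bullet> (D *v z1 pi)) (\<lambda>i x. norm (dw i))"
      by (rule unif_le_inner_left[OF unif_le_self]) (rule unif_leI[of "norm (D *v z1 pi)"]; simp)
    then show ?thesis by (rule unif_le_cong) (rule gb)
  qed
  have 4: "unif_le I (\<lambda>i x. gb i * kap i) (\<lambda>i x. Eth i)"
    by (rule unif_le_mono1[OF unif_le_mult[OF g unif_kap] E(6)])
  show "unif_le I (\<lambda>i x. ?T i) (\<lambda>i x. Eth i)"
    by (rule unif_le_add[OF unif_le_diff[OF unif_le_diff[OF unif_le_minus[OF 1] 2] 3] 4])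
  show "\<bar>1 - kap i - 1\<bar> \<le> 1 / 2" if "i \<in> I" for i using kap_small[OF that] by simp
  show "(1 - kap i) * (eb i - gb i) = ?T i" if "i \<in> I" for i
    using phase_equation[OF that] by (simp add: algebra_simps)
qed

text \<open>\<open>ns\<close> collects N^theta in the three cells and \<open>gs\<close> the linear
  speeds. \<open>KN\<close> is the part of the bound for N^w that is constant on the cell, and
  \<open>EN\<close> the full pointwise bound.\<close>

definition ns :: "'i \<Rightarrow> real" where "ns i = \<bar>ea i - ga i\<bar> + \<bar>eb i - gb i\<bar> + \<bar>ec i - gc i\<bar>"
definition gs :: "'i \<Rightarrow> real" where "gs i = \<bar>ga i\<bar> + \<bar>gb i\<bar> + \<bar>gc i\<bar>"
definition KN :: "'i \<Rightarrow> real" where "KN i = err i + qW i + ns i + sig i * gs i"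
definition EN :: "'i \<Rightarrow> real \<Rightarrow> real" where "EN i x = (norm (W i x))\<^sup>2 + \<bar>b i\<bar> * norm (W i x) + KN i"

lemma KN_ge:
  assumes i: "i \<in> I"
  shows "err i \<le> KN i" "qW i \<le> KN i" "ns i \<le> KN i" "sig i * gs i \<le> KN i" "0 \<le> KN i"
proof -
  have "0 \<le> ns i" "0 \<le> gs i" by (simp_all add: ns_def gs_def)
  then have "0 \<le> err i" "0 \<le> qW i" "0 \<le> ns i" "0 \<le> sig i * gs i"
    using nonneg[of i] m_square_le(2) i by simp_all
  then show "err i \<le> KN i" "qW i \<le> KN i" "ns i \<le> KN i" "sig i * gs i \<le> KN i" "0 \<le> KN i"
    by (simp_all add: KN_def)
qed

lemma EN_ge: "i \<in> I \<Longrightarrow> KN i \<le> EN i x" "i \<in> I \<Longrightarrow> \<bar>b i\<bar> * norm (W i x) \<le> EN i x"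
  "i \<in> I \<Longrightarrow> (norm (W i x))\<^sup>2 + err i \<le> EN i x"
  using KN_ge[of i] by (simp_all add: EN_def add_increasing)

lemma unif_le_KN:
  "unif_le I p (\<lambda>i x. err i) \<Longrightarrow> unif_le I p (\<lambda>i x. KN i)"
  "unif_le I p (\<lambda>i x. ns i) \<Longrightarrow> unif_le I p (\<lambda>i x. KN i)"
  "unif_le I p (\<lambda>i x. sig i * gs i) \<Longrightarrow> unif_le I p (\<lambda>i x. KN i)"
  by (erule unif_le_mono1, rule KN_ge, assumption)+

lemma unif_le_EN: "unif_le I p (\<lambda>i x. KN i) \<Longrightarrow> unif_le I p EN"
  by (erule unif_le_mono1, rule EN_ge, assumption)

lemma unif_scalars:
  "unif_le I (\<lambda>i x. ea i - ga i) (\<lambda>i x. ns i)" "unif_le I (\<lambda>i x. eb i - gb i) (\<lambda>i x. ns i)" "unif_le I (\<lambda>i x. ec i - gc i) (\<lambda>i x. ns i)"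
  "unif_le I (\<lambda>i x. ga i) (\<lambda>i x. gs i)" "unif_le I (\<lambda>i x. gb i) (\<lambda>i x. gs i)" "unif_le I (\<lambda>i x. gc i) (\<lambda>i x. gs i)"
  by (rule unif_leI[of 1]; simp add: ns_def gs_def)+

lemma unif_transport:
  assumes "unif_le I (\<lambda>i x. e i - g i) (\<lambda>i x. ns i)" "unif_le I (\<lambda>i x. g i) (\<lambda>i x. gs i)" "\<And>i. i \<in> I \<Longrightarrow> \<bar>t i\<bar> \<le> sig i"
  shows "unif_le I (\<lambda>i x. e i *\<^sub>R u1 (x - t i) - g i *\<^sub>R u1 x) (\<lambda>i x. KN i)"
proof -
  have e: "e i *\<^sub>R u1 (x - t i) - g i *\<^sub>R u1 x = (e i - g i) *\<^sub>R u1 (x - t i) + g i *\<^sub>R (u1 (x - t i) - u1 x)" for i x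
    by (simp add: algebra_simps)
  have 2: "unif_le I (\<lambda>i x. g i *\<^sub>R (u1 (x - t i) - u1 x)) (\<lambda>i x. gs i * sig i)"
    by (rule unif_le_scaleR[OF assms(2) unif_shift_gen[OF du(2) bounded_data(3) assms(3)]])
  then have 2: "unif_le I (\<lambda>i x. g i *\<^sub>R (u1 (x - t i) - u1 x)) (\<lambda>i x. sig i * gs i)" by (simp add: mult.commute)
  show ?thesis unfolding e
    by (rule unif_le_add[OF unif_le_KN(2)[OF unif_le_scaleR_left[OF assms(1) unif_le_data(2)]] unif_le_KN(3)[OF 2]])
qed

lemma unif_MM: "unif_le I (\<lambda>i. MM i (ea i) (eb i) (ec i) (ga i) (gb i) (gc i)) EN"
proof -
  note L = unif_le_linear[OF matrix_vector_mul_bounded_linear]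
  have t1: "unif_le I (\<lambda>i x. D *v (hh2 i x - hhl2 i x)) EN"
    by (rule unif_le_EN[OF unif_le_KN(1)[OF L[OF unif_hh_diff(2)]]])
  have t2: "unif_le I Q EN" by (rule unif_le_mono1[OF unif_Q_err EN_ge(3)])
  have t3: "unif_le I (\<lambda>i x. jac f (u (x - b i)) *v W i x - jac f (u x) *v W i x) EN"
    by (rule unif_le_mono1[OF unif_le_jac_shift[OF unif_le_self] EN_ge(2)])
  have t4: "unif_le I (\<lambda>i x. jac f (u (x - b i)) *v hh0 i x - jac f (u x) *v hh0 i x) EN"
  proof -
    have "unif_le I (\<lambda>i x. jac f (u (x - b i)) *v hh0 i x - jac f (u x) *v hh0 i x) (\<lambda>i x. siz i * \<bar>b i\<bar>)"
      using unif_le_jac_shift[OF unif_hh(1)] by (simp add: mult.commute)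
    then show ?thesis by (rule unif_le_EN[OF unif_le_KN(1)[OF unif_le_err(5)]])
  qed
  have t5: "unif_le I (\<lambda>i x. jac f (u x) *v (hh0 i x - hhl0 i x)) EN"
    by (rule unif_le_EN[OF unif_le_KN(1)[OF unif_le_jac[where h="\<lambda>i x. x", OF unif_hh_diff(1)]]])
  have ab: "\<bar>a i\<bar> \<le> sig i" "\<bar>b i\<bar> \<le> sig i" "\<bar>c i\<bar> \<le> sig i" for i by (simp_all add: sig_def)
  have t6: "unif_le I (\<lambda>i x. al x *\<^sub>R (ea i *\<^sub>R u1 (x - a i) - ga i *\<^sub>R u1 x) + be x *\<^sub>R (ec i *\<^sub>R u1 (x - c i) - gc i *\<^sub>R u1 x) +
       (1 / 2) *\<^sub>R (eb i *\<^sub>R u1 (x - b i) - gb i *\<^sub>R u1 x)) EN"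
    by (rule unif_le_EN[OF unif_le_add[OF unif_le_add[OF
        unif_le_scaleR_right[OF unif_le_al(1) unif_transport[OF unif_scalars(1,4) ab(1)]]
        unif_le_scaleR_right[OF unif_le_al(2) unif_transport[OF unif_scalars(3,6) ab(3)]]]
        unif_le_linear[OF bounded_linear_scaleR_right unif_transport[OF unif_scalars(2,5) ab(2)]]]])
  have c1: "unif_le I (\<lambda>i x. cc i) (\<lambda>i x. 1)"
    by (rule unif_le_mono[OF unif_le_err(8)[OF unif_cc], of 3]) (use elementary(3) in simp_all)
  have ce: "unif_le I (\<lambda>i x. cc i * eb i) (\<lambda>i x. KN i)"
  proof -
    have e: "cc i * eb i = cc i *\<^sub>R (eb i - gb i) + cc i * gb i" for i by (simp add: algebra_simps)
    show ?thesis unfolding e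
      by (rule unif_le_add[OF unif_le_KN(2)[OF unif_le_scaleR_right[OF c1 unif_scalars(2)]]
        unif_le_KN(3)[OF unif_le_mult[OF unif_le_err(8)[OF unif_cc] unif_scalars(5)]]])
  qed
  have t7: "unif_le I (\<lambda>i x. (cc i * eb i) *\<^sub>R \<psi>1 (x - b i)) EN"
    by (rule unif_le_EN[OF unif_le_scaleR_left[OF ce unif_le_data(13)]])
  show ?thesis
    unfolding MM_def[abs_def]
    by (rule unif_le_add[OF unif_le_add[OF unif_le_add[OF unif_le_add[OF unif_le_add[OF unif_le_add[OF t1 t2] t3] t4] t5] t6] t7])
qed

text \<open>\<open>PN\<close> is an explicit continuous function that agrees with \<open>Nw\<close>
  almost everywhere and can be estimated at every point. \<open>dcd\<close> is the deviation of the
  speed of the phase coefficient from its leading part.\<close>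

definition Nw :: "'i \<Rightarrow> real \<Rightarrow> real^'n" where "Nw i x = V i x - Anf i (ga i) (gb i) (gc i) x"
definition dcd :: "'i \<Rightarrow> real" where
  "dcd i = dcf i (ea i) (eb i) (ec i) (V i) - dc0 (ga i) (gb i) (gc i)"
definition PN :: "'i \<Rightarrow> real \<Rightarrow> real^'n" where
  "PN i x = MM i (ea i) (eb i) (ec i) (ga i) (gb i) (gc i) x - dcd i *\<^sub>R \<psi> (x - b i) -
    dc0 (ga i) (gb i) (gc i) *\<^sub>R (\<psi> (x - b i) - \<psi> x)"

lemma Nw_AE: assumes i: "i \<in> I" shows "AE x in lebesgue. x \<in> cell \<longrightarrow> Nw i x = PN i x"
proof -
  have "Nw i x = PN i x" if "dT i (ea i) (eb i) (ec i) (V i) (dcf i (ea i) (eb i) (ec i) (V i)) x = Fr i x" for x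
    unfolding Nw_def remainder_eq[OF that] PN_def dcd_def by (simp add: algebra_simps)
  then show ?thesis using eqn[OF i] by (rule_tac AE_mp[OF eqn[OF i]]) (rule AE_I2, blast)
qed

lemma unif_dc0: "unif_le I (\<lambda>i x. dc0 (ga i) (gb i) (gc i)) (\<lambda>i x. gs i)"
proof (rule unif_leI[of 1])
  fix i
  have arith: "p + r + 2 * q \<le> 4 * (p + q + r)" if "0 \<le> p" "0 \<le> q" "0 \<le> r" for p q r :: real
    using that by simp
  have "\<bar>ga i + gc i - 2 * gb i\<bar> \<le> \<bar>ga i + gc i\<bar> + \<bar>2 * gb i\<bar>" by (rule abs_triangle_ineq4)
  also have "\<dots> \<le> (\<bar>ga i\<bar> + \<bar>gc i\<bar>) + 2 * \<bar>gb i\<bar>" by (intro add_mono abs_triangle_ineq) (simp add: abs_mult)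
  also have "\<dots> \<le> 4 * gs i" unfolding gs_def by (rule arith) simp_all
  finally have "\<bar>ga i + gc i - 2 * gb i\<bar> \<le> 4 * gs i" .
  then show "norm (dc0 (ga i) (gb i) (gc i)) \<le> 1 * gs i" by (simp add: dc0_def)
qed simp

text \<open>The speed of the phase coefficient contains a pairing with the unknown \<open>V\<close>,
  so it is not estimated from its definition. Both \<open>V\<close> and \<open>Anf\<close> are
  orthogonal to \<open>z\<close>; pairing \<open>PN\<close> with \<open>z\<close> therefore gives a
  scalar equation with factor \<open>kpsi\<close> that determines \<open>dcd\<close>.\<close>

lemma unif_dcd: "unif_le I (\<lambda>i x. dcd i) (\<lambda>i x. KN i)"
proof (rule unif_le_half_bound[where k=kpsi])
  let ?M = "\<lambda>i. MM i (ea i) (eb i) (ec i) (ga i) (gb i) (gc i)"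
  let ?d = "\<lambda>i. dc0 (ga i) (gb i) (gc i)"
  let ?T = "\<lambda>i. integral {-pi..pi} (\<lambda>x. ?M i x \<bullet> z x) - ?d i * (kpsi i - 1)"
  have "unif_le I (\<lambda>i x. integral {-pi..pi} (\<lambda>x. ?M i x \<bullet> z x)) (\<lambda>i x. integral {-pi..pi} (EN i))"
    unfolding EN_def[abs_def]
    by (rule unif_le_integral[OF unif_le_inner_left[OF unif_MM[unfolded EN_def[abs_def]] unif_z(2)]]) (intro ci continuous_intros; assumption)+
  then have 1: "unif_le I (\<lambda>i x. integral {-pi..pi} (\<lambda>x. ?M i x \<bullet> z x)) (\<lambda>i x. KN i)"
  proof (rule unif_le_mono[where K="2 + 2 * pi"])
    fix i assume i: "i \<in> I"
    have j: "(\<lambda>x. (norm (W i x))\<^sup>2) integrable_on {-pi..pi}" "(\<lambda>x. norm (W i x)) integrable_on {-pi..pi}"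
      by (intro ci continuous_intros i)+
    have "integral {-pi..pi} (EN i) = integral {-pi..pi} (\<lambda>x. ((norm (W i x))\<^sup>2 + \<bar>b i\<bar> *\<^sub>R norm (W i x)) + KN i)"
      by (simp add: EN_def[abs_def])
    also have "\<dots> = (qW i + \<bar>b i\<bar> * m i) + 2 * pi * KN i"
      unfolding Henstock_Kurzweil_Integration.integral_add[OF integrable_add[OF j(1) integrable_cmul[OF j(2)]] integrable_const_ivl]
        Henstock_Kurzweil_Integration.integral_add[OF j(1) integrable_cmul[OF j(2)]] integral_cmul by (simp add: qW_def m_def)
    also have "\<dots> \<le> (KN i + KN i) + 2 * pi * KN i"
      by (intro add_mono order_refl KN_ge i order_trans[OF elementary(5)[OF i]])
    finally show "integral {-pi..pi} (EN i) \<le> (2 + 2 * pi) * KN i" by (simp add: distrib_right)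
  qed simp
  have 2: "unif_le I (\<lambda>i x. ?d i * (kpsi i - 1)) (\<lambda>i x. KN i)"
  proof (rule unif_le_mono1[OF unif_le_mult[OF unif_dc0 unif_kpsi]])
    fix i assume i: "i \<in> I"
    have "gs i * \<bar>b i\<bar> \<le> gs i * sig i" by (rule mult_left_mono[OF elementary(1)[OF i]]) (simp add: gs_def)
    then show "gs i * \<bar>b i\<bar> \<le> KN i" using KN_ge(4)[OF i] by (simp add: mult.commute)
  qed
  show "unif_le I (\<lambda>i x. ?T i) (\<lambda>i x. KN i)" by (rule unif_le_diff[OF 1 2])
  show "\<bar>kpsi i - 1\<bar> \<le> 1 / 2" if "i \<in> I" for i by (rule kpsi_near[OF that])
  show "kpsi i * dcd i = ?T i" if i: "i \<in> I" for i
  proof -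
    have j: "(\<lambda>x. ?M i x \<bullet> z x) integrable_on {-pi..pi}" "(\<lambda>x. \<psi> (x - b i) \<bullet> z x) integrable_on {-pi..pi}"
      "(\<lambda>x. \<psi> x \<bullet> z x) integrable_on {-pi..pi}" by (intro ci continuous_intros i)+
    have e: "PN i x \<bullet> z x = (?M i x \<bullet> z x - (dcd i + ?d i) *\<^sub>R (\<psi> (x - b i) \<bullet> z x)) + ?d i *\<^sub>R (\<psi> x \<bullet> z x)" for x
      by (simp add: PN_def inner_diff_left inner_add_left algebra_simps)
    have V': "(\<lambda>x. V i x \<bullet> z x) integrable_on {-pi..pi}"
      by (rule inner_abs_int[OF _ V_int[OF i]]) (intro continuous_intros)
    note A = Anf_pairing[OF i gb[OF i], of "ga i" "gc i"]
    have "integral {-pi..pi} (\<lambda>x. PN i x \<bullet> z x) = integral {-pi..pi} (\<lambda>x. Nw i x \<bullet> z x)"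
      by (rule integral_spike_cell[OF AE_mp[OF Nw_AE[OF i]]]) (rule AE_I2, simp)
    also have "\<dots> = 0"
      unfolding Nw_def inner_diff_left Henstock_Kurzweil_Integration.integral_diff[OF V' A(1)] A(2) V_perp[OF i] by simp
    finally have "integral {-pi..pi} (\<lambda>x. ?M i x \<bullet> z x) - (dcd i + ?d i) * kpsi i + ?d i = 0"
      unfolding e Henstock_Kurzweil_Integration.integral_add[OF integrable_diff[OF j(1) integrable_cmul[OF j(2)]] integrable_cmul[OF j(3)]]
        Henstock_Kurzweil_Integration.integral_diff[OF j(1) integrable_cmul[OF j(2)]] integral_cmul \<psi>z kpsi_def[symmetric] by simp
    then show ?thesis by (simp add: algebra_simps)
  qed
qed

lemma unif_PN: "unif_le I PN EN"
proof -
  have 2: "unif_le I (\<lambda>i x. dcd i *\<^sub>R \<psi> (x - b i)) EN"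
    by (rule unif_le_EN[OF unif_le_scaleR_left[OF unif_dcd unif_le_data(12)]])
  have 3: "unif_le I (\<lambda>i x. dc0 (ga i) (gb i) (gc i) *\<^sub>R (\<psi> (x - b i) - \<psi> x)) EN"
  proof (rule unif_le_EN[OF unif_le_mono1[OF unif_le_scaleR[OF unif_dc0 unif_shift[OF d\<psi>(1) bounded_data(13)]]]])
    fix i assume i: "i \<in> I"
    have "gs i * \<bar>b i\<bar> \<le> gs i * sig i" by (rule mult_left_mono[OF elementary(1)[OF i]]) (simp add: gs_def)
    then show "gs i * \<bar>b i\<bar> \<le> KN i" using KN_ge(4)[OF i] by (simp add: mult.commute)
  qed
  show ?thesis unfolding PN_def[abs_def] by (rule unif_le_diff[OF unif_le_diff[OF unif_MM 2] 3])
qed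

end

section \<open>L^p norms with constants independent of p\<close>

text \<open>Together with \<open>powr_sum3_le\<close> this replaces Minkowski's inequality: a sum is
  split into r-th powers with factor 3^r, and r-th powers are merged back at no cost. After the r-th
  root the factor is 3 for every r.\<close>

lemma powr_superadditive:
  fixes x y r :: real
  assumes "0 \<le> x" "0 \<le> y" "1 \<le> r"
  shows "x powr r + y powr r \<le> (x + y) powr r"
proof -
  have e: "w powr r = w * w powr (r - 1)" if "0 \<le> w" for w :: real
  proof (cases "w = 0")
    case False
    then show ?thesis using powr_add[of w 1 "r - 1"] that by simp
  qed simp
  have "x powr r + y powr r \<le> x * (x + y) powr (r - 1) + y * (x + y) powr (r - 1)"
    unfolding e[OF assms(1)] e[OF assms(2)] by (intro add_mono mult_left_mono powr_mono2) (use assms in auto)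
  also have "\<dots> = (x + y) powr r" using assms by (simp add: e distrib_right)
  finally show ?thesis .
qed

lemma powr_sum3_le:
  fixes x y w r :: real
  assumes "0 \<le> x" "0 \<le> y" "0 \<le> w" "1 \<le> r"
  shows "(x + y + w) powr r \<le> 3 powr r * (x powr r + y powr r + w powr r)"
proof -
  have mx: "s \<in> {x, y, w} \<Longrightarrow> s powr r \<le> x powr r + y powr r + w powr r" for s by auto
  define s where "s = max x (max y w)"
  have s: "s \<in> {x, y, w}" "x \<le> s" "y \<le> s" "w \<le> s" by (auto simp: s_def max_def)
  have "(x + y + w) powr r \<le> (3 * s) powr r" by (rule powr_mono2) (use assms s in auto)
  also have "\<dots> = 3 powr r * s powr r" by (rule powr_mult)
  also have "\<dots> \<le> 3 powr r * (x powr r + y powr r + w powr r)" by (intro mult_left_mono mx s) simp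
  finally show ?thesis .
qed

lemma Lp_norm_powr:
  fixes w :: "real \<Rightarrow> 'b::real_normed_vector"
  assumes p: "1 \<le> p" "p \<noteq> \<infinity>" and w: "Lp_norm p S w = ennreal \<beta>" "0 \<le> \<beta>"
  shows "(\<integral>\<^sup>+ x. ennreal (norm (w x) powr enn2real p) \<partial>lebesgue_on S) = ennreal (\<beta> powr enn2real p)"
proof -
  let ?I = "\<integral>\<^sup>+ x. ennreal (norm (w x) powr enn2real p) \<partial>lebesgue_on S"
  have r: "enn2real p \<noteq> 0" using p by (auto simp: enn2real_eq_0_iff)
  have f: "?I \<noteq> \<infinity>" "ennreal (enn2real ?I powr (1 / enn2real p)) = ennreal \<beta>"
    using w(1) p(2) by (auto simp: Lp_norm_def Let_def split: if_splits)
  then have "enn2real ?I powr (1 / enn2real p) = \<beta>" using w(2) by (simp add: ennreal_inj)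
  then have "\<beta> powr enn2real p = enn2real ?I" using r by (auto simp: powr_powr)
  then show ?thesis using f(1) by (simp add: less_top)
qed

lemma Lp_norm_leI:
  fixes w :: "real \<Rightarrow> 'b::real_normed_vector"
  assumes p: "1 \<le> p" "p \<noteq> \<infinity>" and "0 \<le> \<beta>"
    and I: "(\<integral>\<^sup>+ x. ennreal (norm (w x) powr enn2real p) \<partial>lebesgue_on S) \<le> ennreal (\<beta> powr enn2real p)"
  shows "Lp_norm p S w \<le> ennreal \<beta>"
proof -
  let ?I = "\<integral>\<^sup>+ x. ennreal (norm (w x) powr enn2real p) \<partial>lebesgue_on S"
  have r: "enn2real p \<noteq> 0" using p by (auto simp: enn2real_eq_0_iff)
  have f: "?I \<noteq> \<infinity>" using I by (auto simp: top_unique)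
  have "enn2real ?I \<le> \<beta> powr enn2real p" using I by (simp add: enn2real_leI)
  then have "enn2real ?I powr (1 / enn2real p) \<le> (\<beta> powr enn2real p) powr (1 / enn2real p)"
    by (intro powr_mono2) simp_all
  also have "\<dots> = \<beta>" using r assms(3) by (simp add: powr_powr)
  finally show ?thesis using f p(2) by (simp add: Lp_norm_def Let_def ennreal_leI)
qed

lemma one_le_enn2real: "1 \<le> p \<Longrightarrow> p \<noteq> \<infinity> \<Longrightarrow> 1 \<le> enn2real p"
  by (cases p) (auto simp: ennreal_1[symmetric] simp del: ennreal_1)

text \<open>A pointwise bound by a constant, a multiple of \<open>w\<close> and \<open>v\<close>
  becomes the corresponding bound for norms. The constant \<open>3 * C * L\<close> is free of
  \<open>p\<close> and also covers the essential supremum.\<close>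

lemma Lp_norm_dominated:
  fixes N :: "real \<Rightarrow> 'b::euclidean_space" and v w :: "real \<Rightarrow> real"
  assumes p: "1 \<le> p" and N: "N \<in> borel_measurable (lebesgue_on S)" and S: "emeasure lebesgue S = ennreal L" "1 \<le> L" "S \<in> sets lebesgue"
    and vw: "v \<in> borel_measurable (lebesgue_on S)" "w \<in> borel_measurable (lebesgue_on S)"
    and v: "Lp_norm p S v = ennreal \<gamma>" "0 \<le> \<gamma>" and w: "Lp_norm p S w = ennreal \<beta>" "0 \<le> \<beta>"
    and AB: "0 \<le> A" "0 \<le> B" "0 \<le> C" and le: "AE x in lebesgue_on S. norm (N x) \<le> C * (A + B * \<bar>w x\<bar> + \<bar>v x\<bar>)"
  shows "Lp_norm p S N \<le> ennreal (3 * C * L * (A + B * \<beta> + \<gamma>))"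
proof (cases "p = \<infinity>")
  case True
  have "AE x in lebesgue_on S. ennreal (norm (w x)) \<le> ennreal \<beta>" "AE x in lebesgue_on S. ennreal (norm (v x)) \<le> ennreal \<gamma>"
    using esssup_AE[of "\<lambda>x. ennreal (norm (w x))" "lebesgue_on S"] esssup_AE[of "\<lambda>x. ennreal (norm (v x))" "lebesgue_on S"]
      v(1) w(1) True by (simp_all add: Lp_norm_def)
  then have "AE x in lebesgue_on S. ennreal (norm (N x)) \<le> ennreal (3 * C * L * (A + B * \<beta> + \<gamma>))"
    using le
  proof eventually_elim
    case (elim x)
    then have wv: "\<bar>w x\<bar> \<le> \<beta>" "\<bar>v x\<bar> \<le> \<gamma>" using v(2) w(2) by simp_all
    have "norm (N x) \<le> C * (A + B * \<beta> + \<gamma>)"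
      by (rule order_trans[OF elim(3)]) (intro mult_left_mono add_mono wv AB order_refl)
    also have "\<dots> = 1 * C * (A + B * \<beta> + \<gamma>)" by simp
    also have "\<dots> \<le> (3 * L) * C * (A + B * \<beta> + \<gamma>)" by (intro mult_right_mono) (use AB v(2) w(2) S(2) in simp_all)
    finally show ?case by (intro ennreal_leI) (simp add: mult.commute mult.left_commute)
  qed
  moreover have "(\<lambda>x. ennreal (norm (N x))) \<in> borel_measurable (lebesgue_on S)" using N by measurable
  ultimately show ?thesis using True by (simp add: Lp_norm_def esssup_I)
next
  case False
  define r where "r = enn2real p"
  have r: "1 \<le> r" unfolding r_def by (rule one_le_enn2real[OF p False])
  show ?thesis
  proof (rule Lp_norm_leI[OF p False])
    show "0 \<le> 3 * C * L * (A + B * \<beta> + \<gamma>)" using AB v(2) w(2) S(2) by simp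
    have m: "(\<lambda>x. ennreal (norm (w x) powr r)) \<in> borel_measurable (lebesgue_on S)"
      "(\<lambda>x. ennreal (norm (v x) powr r)) \<in> borel_measurable (lebesgue_on S)"
      using vw by measurable
    have "(\<integral>\<^sup>+ x. ennreal (norm (N x) powr r) \<partial>lebesgue_on S) \<le>
        (\<integral>\<^sup>+ x. ennreal ((3 * C) powr r) * ((ennreal (A powr r) + ennreal (B powr r) * ennreal (norm (w x) powr r)) + ennreal (norm (v x) powr r)) \<partial>lebesgue_on S)"
      using le
    proof (intro nn_integral_mono_AE, eventually_elim)
      case (elim x)
      have "norm (N x) powr r \<le> (C * (A + B * \<bar>w x\<bar> + \<bar>v x\<bar>)) powr r" by (rule powr_mono2) (use elim r in auto)
      also have "\<dots> = C powr r * (A + B * \<bar>w x\<bar> + \<bar>v x\<bar>) powr r" by (rule powr_mult)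
      also have "\<dots> \<le> C powr r * (3 powr r * (A powr r + (B * \<bar>w x\<bar>) powr r + \<bar>v x\<bar> powr r))"
        by (intro mult_left_mono powr_sum3_le) (use AB r in auto)
      also have "\<dots> = (3 * C) powr r * ((A powr r + B powr r * norm (w x) powr r) + norm (v x) powr r)"
        using AB by (simp add: powr_mult)
      finally have "ennreal (norm (N x) powr r) \<le> ennreal ((3 * C) powr r * ((A powr r + B powr r * norm (w x) powr r) + norm (v x) powr r))"
        by (rule ennreal_leI)
      then show ?case by (simp add: ennreal_mult ennreal_plus)
    qed
    also have "\<dots> = ennreal ((3 * C) powr r) * ((ennreal (A powr r) * ennreal L + ennreal (B powr r) * ennreal (\<beta> powr r)) + ennreal (\<gamma> powr r))"
    proof -
      have "emeasure (lebesgue_on S) S = ennreal L" using S by (simp add: emeasure_restrict_space)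
      then show ?thesis
        using m Lp_norm_powr[OF p False w] Lp_norm_powr[OF p False v]
        by (simp add: nn_integral_cmult nn_integral_add r_def[symmetric])
    qed
    also have "\<dots> = ennreal ((3 * C) powr r * ((A powr r * L + B powr r * \<beta> powr r) + \<gamma> powr r))"
      using S(2) by (simp add: ennreal_mult ennreal_plus)
    also have "\<dots> \<le> ennreal ((3 * C * L * (A + B * \<beta> + \<gamma>)) powr r)"
    proof (rule ennreal_leI)
      \<comment> \<open>As \<open>1 \<le> L\<close>, the measure \<open>L\<close> of the domain is
        at most \<open>L powr r\<close>; taking the r-th root then leaves the factor
        \<open>L\<close> for every \<open>r\<close>.\<close>
      have L: "1 \<le> L powr r" "L \<le> L powr r" using r S(2) powr_mono[of 1 r L] powr_mono[of 0 r L] by simp_all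
      have "(A powr r * L + B powr r * \<beta> powr r) + \<gamma> powr r \<le> (A powr r * L powr r + L powr r * (B powr r * \<beta> powr r)) + L powr r * \<gamma> powr r"
        using L mult_right_mono[OF L(1), of "B powr r * \<beta> powr r"] mult_right_mono[OF L(1), of "\<gamma> powr r"]
        by (intro add_mono mult_left_mono) simp_all
      also have "\<dots> = L powr r * ((A powr r + (B * \<beta>) powr r) + \<gamma> powr r)"
        using AB w(2) by (simp add: powr_mult algebra_simps)
      also have "\<dots> \<le> L powr r * ((A + B * \<beta>) powr r + \<gamma> powr r)"
        by (intro mult_left_mono add_mono powr_superadditive) (use AB v(2) w(2) r in auto)
      also have "\<dots> \<le> L powr r * (A + B * \<beta> + \<gamma>) powr r"
        by (intro mult_left_mono powr_superadditive) (use AB v(2) w(2) r in auto)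
      finally have "(3 * C) powr r * ((A powr r * L + B powr r * \<beta> powr r) + \<gamma> powr r) \<le> (3 * C) powr r * (L powr r * (A + B * \<beta> + \<gamma>) powr r)"
        by (rule mult_left_mono) simp
      also have "\<dots> = (3 * C * L * (A + B * \<beta> + \<gamma>)) powr r" using AB v(2) w(2) S(2) by (simp add: powr_mult)
      finally show "(3 * C) powr r * ((A powr r * L + B powr r * \<beta> powr r) + \<gamma> powr r) \<le> (3 * C * L * (A + B * \<beta> + \<gamma>)) powr r" .
    qed
    finally show "(\<integral>\<^sup>+ x. ennreal (norm (N x) powr enn2real p) \<partial>lebesgue_on S) \<le> ennreal ((3 * C * L * (A + B * \<beta> + \<gamma>)) powr enn2real p)"
      unfolding r_def .
  qed
qed

lemma Lp_norm_cong: "(\<And>x. x \<in> S \<Longrightarrow> v x = w x) \<Longrightarrow> S \<in> sets lebesgue \<Longrightarrow> Lp_norm p S v = Lp_norm p S w"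
proof -
  assume vw: "\<And>x. x \<in> S \<Longrightarrow> v x = w x" and S: "S \<in> sets lebesgue"
  then have s: "x \<in> space (lebesgue_on S) \<Longrightarrow> ennreal (norm (v x)) = ennreal (norm (w x))" for x by (simp add: space_restrict_space)
  have 1: "(\<integral>\<^sup>+ x. ennreal (norm (v x) powr q) \<partial>lebesgue_on S) = (\<integral>\<^sup>+ x. ennreal (norm (w x) powr q) \<partial>lebesgue_on S)" for q
    by (rule nn_integral_cong) (use vw in \<open>auto simp: space_restrict_space\<close>)
  have mc: "(\<lambda>x. ennreal (norm (v x))) \<in> borel_measurable (lebesgue_on S) \<longleftrightarrow> (\<lambda>x. ennreal (norm (w x))) \<in> borel_measurable (lebesgue_on S)"
    by (rule measurable_cong) (rule s)
  have 2: "esssup (lebesgue_on S) (\<lambda>x. ennreal (norm (v x))) = esssup (lebesgue_on S) (\<lambda>x. ennreal (norm (w x)))"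
    unfolding esssup_def mc by (intro if_cong refl Limsup_eq AE_I2) (rule s)
  show ?thesis unfolding Lp_norm_def 1 2 ..
qed

lemma Lp_norm_norm: "Lp_norm p S (\<lambda>x. norm (w x)) = Lp_norm p S w"
  by (simp add: Lp_norm_def)

lemma emeasure_cell: "emeasure lebesgue cell = ennreal (2 * pi)"
  by (simp add: emeasure_lborel_Ioo)

lemma continuous_measurable_cell:
  fixes q :: "real \<Rightarrow> 'b::euclidean_space"
  shows "continuous_on UNIV q \<Longrightarrow> q \<in> borel_measurable (lebesgue_on cell)"
  by (rule continuous_imp_measurable_on_sets_lebesgue[OF continuous_on_subset[OF _ subset_UNIV] cell_sets])

lemma continuous_Lp_norm_finite:
  fixes q :: "real \<Rightarrow> 'b::euclidean_space"
  assumes q: "continuous_on UNIV q" and p: "1 \<le> p"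
  obtains \<beta> where "0 \<le> \<beta>" "Lp_norm p cell q = ennreal \<beta>"
proof -
  obtain B where B: "\<forall>y\<in>q ` {-pi..pi}. norm y \<le> B"
    using compact_imp_bounded[OF compact_continuous_image[OF continuous_on_subset[OF q subset_UNIV] compact_Icc]]
    unfolding bounded_iff ..
  have B': "norm (q x) \<le> max B 0" if "x \<in> cell" for x
  proof -
    have "q x \<in> q ` {-pi..pi}" using that by auto
    then have "norm (q x) \<le> B" using B by blast
    then show ?thesis by simp
  qed
  have "Lp_norm p cell (\<lambda>x. 0::real) = ennreal 0"
  proof (cases "p = \<infinity>")
    case True
    then show ?thesis using esssup_I[of "\<lambda>x. 0::ennreal" "lebesgue_on cell" 0] by (simp add: Lp_norm_def)
  qed (simp add: Lp_norm_def Let_def)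
  note z = this order_refl
  have "Lp_norm p cell q \<le> ennreal (3 * 1 * (2 * pi) * (max B 0 + 0 * 0 + 0))"
    by (rule Lp_norm_dominated[OF p continuous_measurable_cell[OF q] emeasure_cell _ cell_sets _ _ z z])
      (use pi_ge_two B' in \<open>auto intro!: AE_I2 simp: space_restrict_space\<close>)
  then have "Lp_norm p cell q < \<infinity>" by (rule order.strict_trans1) simp
  then have "Lp_norm p cell q = ennreal (enn2real (Lp_norm p cell q))" by simp
  with that[OF enn2real_nonneg] show ?thesis .
qed

text \<open>Hoelder's inequality with a constant uniform in \<open>p\<close>, obtained from a
  pointwise inequality. It converts the L^1 norms that appear in the cell estimates into L^p
  norms.\<close>

lemma integral_le_Lp_norm:
  fixes w :: "real \<Rightarrow> real"
  assumes w: "continuous_on UNIV w" "\<And>x. 0 \<le> w x" and p: "1 \<le> p" and \<beta>: "Lp_norm p cell w = ennreal \<beta>" "0 \<le> \<beta>"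
  shows "integral {-pi..pi} w \<le> (2 * pi + 1) * \<beta>"
proof -
  have ai: "w absolutely_integrable_on cell"
    unfolding absolutely_integrable_cell_iff by (rule absolutely_integrable_continuous_real[OF continuous_on_subset[OF w(1) subset_UNIV]])
  have "(\<integral>\<^sup>+ x. ennreal (w x) \<partial>lebesgue_on cell) = ennreal (LINT x|lebesgue_on cell. w x)"
    by (rule nn_integral_eq_integral) (use ai w(2) in \<open>auto simp: integrable_lebesgue_on_iff cell_sets\<close>)
  also have "(LINT x|lebesgue_on cell. w x) = integral {-pi..pi} w"
    by (simp add: LINT_lebesgue_on_eq_integral[OF ai cell_sets] integral_cell)
  finally have I: "(\<integral>\<^sup>+ x. ennreal (w x) \<partial>lebesgue_on cell) = ennreal (integral {-pi..pi} w)" .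
  have c: "(\<integral>\<^sup>+ x. ennreal t \<partial>lebesgue_on cell) = ennreal (t * (2 * pi))" if "0 \<le> t" for t
    using that emeasure_cell by (simp add: emeasure_restrict_space cell_sets ennreal_mult)
  \<comment> \<open>Working with \<open>t\<close> strictly above the norm keeps \<open>t\<close>
    positive, so negative powers of it are harmless; at the end \<open>t\<close> decreases to
    \<open>\<beta>\<close>.\<close>
  have key: "integral {-pi..pi} w \<le> (2 * pi + 1) * t" if t: "\<beta> < t" for t
  proof -
    have t0: "0 < t" using t \<beta>(2) by simp
    have "(\<integral>\<^sup>+ x. ennreal (w x) \<partial>lebesgue_on cell) \<le> ennreal ((2 * pi + 1) * t)"
    proof (cases "p = \<infinity>")
      case True
      have "AE x in lebesgue_on cell. ennreal (w x) \<le> ennreal \<beta>"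
        using esssup_AE[of "\<lambda>x. ennreal (norm (w x))" "lebesgue_on cell"] \<beta>(1) True w(2) by (simp add: Lp_norm_def)
      then have "(\<integral>\<^sup>+ x. ennreal (w x) \<partial>lebesgue_on cell) \<le> (\<integral>\<^sup>+ x. ennreal t \<partial>lebesgue_on cell)"
        by (intro nn_integral_mono_AE, eventually_elim) (erule order_trans, rule ennreal_leI, use t in simp)
      also have "\<dots> \<le> ennreal ((2 * pi + 1) * t)" using t0 by (subst c) (auto intro!: ennreal_leI simp: algebra_simps)
      finally show ?thesis .
    next
      case False
      define r where "r = enn2real p"
      have r: "1 \<le> r" unfolding r_def by (rule one_le_enn2real[OF p False])
      \<comment> \<open>Either \<open>y\<close> is below \<open>t\<close>, or \<open>y\<close>
        divided by \<open>t\<close> exceeds 1 and is dominated by its r-th power.\<close>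
      have pw: "y \<le> t + t powr (1 - r) * y powr r" if y: "0 \<le> y" for y
      proof (cases "y \<le> t")
        case True
        then show ?thesis by (intro add_increasing2) simp_all
      next
        case False
        then have yt: "t < y" by simp
        have "y * t powr (r - 1) \<le> y * y powr (r - 1)" by (intro mult_left_mono powr_mono2) (use yt t0 r in auto)
        also have "\<dots> = y powr r" using yt t0 powr_add[of y 1 "r - 1"] by simp
        finally have "t powr (1 - r) * (y * t powr (r - 1)) \<le> t powr (1 - r) * y powr r" by (rule mult_left_mono) simp
        moreover have "t powr (1 - r) * (y * t powr (r - 1)) = y * t powr ((1 - r) + (r - 1))" unfolding powr_add by simp
        ultimately have "y \<le> t powr (1 - r) * y powr r" using t0 by simp
        then show ?thesis using t0 by simp
      qed
      have m: "(\<lambda>x. ennreal (norm (w x) powr r)) \<in> borel_measurable (lebesgue_on cell)"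
        using continuous_measurable_cell[OF w(1)] by measurable
      have "(\<integral>\<^sup>+ x. ennreal (w x) \<partial>lebesgue_on cell) \<le>
          (\<integral>\<^sup>+ x. ennreal t + ennreal (t powr (1 - r)) * ennreal (norm (w x) powr r) \<partial>lebesgue_on cell)"
      proof (rule nn_integral_mono)
        fix x
        show "ennreal (w x) \<le> ennreal t + ennreal (t powr (1 - r)) * ennreal (norm (w x) powr r)"
          using ennreal_leI[OF pw[OF w(2)[of x]]] w(2)[of x] t0 by (simp add: ennreal_mult ennreal_plus)
      qed
      also have "\<dots> = ennreal (t * (2 * pi)) + ennreal (t powr (1 - r)) * ennreal (\<beta> powr r)"
        using m c[of t] t0 Lp_norm_powr[OF p False \<beta>] by (simp add: nn_integral_add nn_integral_cmult r_def[symmetric])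
      also have "\<dots> = ennreal (t * (2 * pi) + t powr (1 - r) * \<beta> powr r)" using t0 by (simp add: ennreal_mult ennreal_plus)
      also have "\<dots> \<le> ennreal ((2 * pi + 1) * t)"
      proof (rule ennreal_leI)
        have "t powr (1 - r) * \<beta> powr r \<le> t powr (1 - r) * t powr r"
          by (intro mult_left_mono powr_mono2) (use t \<beta>(2) r in auto)
        also have "\<dots> = t" using t0 by (simp flip: powr_add)
        finally show "t * (2 * pi) + t powr (1 - r) * \<beta> powr r \<le> (2 * pi + 1) * t" by (simp add: algebra_simps)
      qed
      finally show ?thesis .
    qed
    then have "ennreal (integral {-pi..pi} w) \<le> ennreal ((2 * pi + 1) * t)" unfolding I .
    moreover have "0 \<le> (2 * pi + 1) * t" using t0 by simp
    ultimately show ?thesis by (simp only: ennreal_le_iff)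
  qed
  have "integral {-pi..pi} w / (2 * pi + 1) \<le> t" if "\<beta> < t" for t
    using key[OF that] by (subst pos_divide_le_eq) (simp_all add: mult.commute add_pos_pos)
  then have "integral {-pi..pi} w / (2 * pi + 1) \<le> \<beta>" by (rule dense_ge)
  then show ?thesis by (subst (asm) pos_divide_le_eq) (simp_all add: mult.commute add_pos_pos)
qed

text \<open>If a value exceeded the bound, continuity would make it exceed the bound on a nonempty
  open part of the cell, a set of positive measure. Approximation from inside covers the two end
  points.\<close>

lemma esssup_continuous_bound:
  fixes W :: "real \<Rightarrow> 'b::euclidean_space"
  assumes W: "continuous_on UNIV W" and n: "Lp_norm \<infinity> cell W \<le> ennreal \<epsilon>" "0 \<le> \<epsilon>" and x: "x \<in> {-pi..pi}"
  shows "norm (W x) \<le> \<epsilon>"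
proof (rule ccontr)
  assume c: "\<not> norm (W x) \<le> \<epsilon>"
  have "AE x in lebesgue_on cell. ennreal (norm (W x)) \<le> Lp_norm \<infinity> cell W"
    unfolding Lp_norm_def by (simp add: esssup_AE)
  then have "AE x in lebesgue_on cell. norm (W x) \<le> \<epsilon>"
  proof eventually_elim
    case (elim x)
    from order_trans[OF elim n(1)] show ?case using n(2) by simp
  qed
  then have ae: "AE x in lebesgue. x \<in> cell \<longrightarrow> norm (W x) \<le> \<epsilon>"
    by (simp add: AE_restrict_space_iff cell_sets)
  define U where "U = {y. norm (W y) > \<epsilon>}"
  have U: "open U" unfolding U_def by (rule open_Collect_less) (intro continuous_intros W continuous_on_const)+
  have "x \<in> closure cell" using x by (simp add: closure_greaterThanLessThan)
  moreover have "x \<in> U" using c by (simp add: U_def)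
  ultimately have "U \<inter> cell \<noteq> {}" using U unfolding closure_iff_nhds_not_empty by (metis Int_commute order_refl)
  moreover have "negligible (U \<inter> cell)"
  proof -
    obtain M where M: "negligible M" "{x. \<not> (x \<in> cell \<longrightarrow> norm (W x) \<le> \<epsilon>)} \<subseteq> M"
      using ae unfolding eventually_ae_filter_negligible by blast
    then show ?thesis by (rule_tac negligible_subset[OF M(1)]) (auto simp: U_def)
  qed
  moreover have "open (U \<inter> cell)" by (intro open_Int U open_greaterThanLessThan)
  ultimately show False using open_not_negligible by blast
qed

section \<open>The lattice definitions expressed in one cell\<close>

lemma has_vector_derivative_line:
  fixes g :: "real \<Rightarrow> 'b::real_normed_vector"
  assumes "\<And>x. (g has_vector_derivative g1 x) (at x)"
  shows "((\<lambda>s. g (x - (t + s * q))) has_vector_derivative (- q) *\<^sub>R g1 (x - (t + s * q))) (at s)"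
  by (rule vector_diff_chain_at[of "\<lambda>s. x - (t + s * q)" "- q" s g, unfolded o_def])
    (auto intro!: derivative_eq_intros assms simp: has_real_derivative_iff_has_vector_derivative[symmetric])

lemma pairing_eq_integral_on:
  assumes "\<And>x. x \<in> {-pi..pi} \<Longrightarrow> p x \<bullet> q x = g x" "continuous_on UNIV g"
  shows "pairing p q = integral {-pi..pi} g"
proof -
  have "continuous_on {-pi..pi} (\<lambda>x. p x \<bullet> q x)"
    by (rule iffD2[OF continuous_on_cong[OF refl assms(1)]], assumption) (rule continuous_on_subset[OF assms(2) subset_UNIV])
  then have "pairing p q = integral {-pi..pi} (\<lambda>x. p x \<bullet> q x)"
    by (intro pairing_eq_integral absolutely_integrable_continuous_real)
  also have "\<dots> = integral {-pi..pi} g" by (rule Henstock_Kurzweil_Integration.integral_cong) (rule assms(1))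
  finally show ?thesis .
qed

text \<open>Caratheodory's criterion: \<open>s * K s\<close> is differentiable at 0 as soon as
  \<open>K\<close> is continuous there. It handles the direction \<open>V\<close>, which is only
  integrable.\<close>

lemma has_vector_derivative_mult_self:
  fixes K :: "real \<Rightarrow> real"
  assumes "\<And>s. \<bar>K s - K 0\<bar> \<le> C * \<bar>s\<bar>"
  shows "((\<lambda>s. s * K s) has_vector_derivative K 0) (at 0)"
proof -
  have "((\<lambda>s. C * \<bar>s\<bar>) \<longlongrightarrow> C * \<bar>0\<bar>) (at 0)" by (intro tendsto_intros)
  then have 1: "((\<lambda>s. C * \<bar>s\<bar>) \<longlongrightarrow> 0) (at 0)" by simp
  have "\<forall>\<^sub>F s in at 0. norm (K s - K 0) \<le> C * \<bar>s\<bar>"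
    by (rule always_eventually, rule allI, unfold real_norm_def, rule assms)
  then have "((\<lambda>s. K s - K 0) \<longlongrightarrow> 0) (at 0)" by (rule Lim_null_comparison[OF _ 1])
  then have "isCont K 0" unfolding isCont_def by (rule LIM_zero_cancel)
  then show ?thesis
    unfolding has_real_derivative_iff_has_vector_derivative[symmetric] CARAT_DERIV
    by (intro exI[of _ K]) simp
qed

lemma absolutely_integrable_shift:
  fixes g :: "real \<Rightarrow> 'b::euclidean_space"
  assumes "g absolutely_integrable_on {r + t..s + t}"
  shows "(\<lambda>x. g (t + x)) absolutely_integrable_on {r..s}" "integral {r..s} (\<lambda>x. g (t + x)) = integral {r + t..s + t} g"
proof -
  have i: "g integrable_on {r + t..s + t}" "(\<lambda>x. norm (g x)) integrable_on {r + t..s + t}"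
    using assms by (simp_all add: absolutely_integrable_on_def)
  have sh: "((\<lambda>x. q (t + x)) has_integral integral {r + t..s + t} q) {r..s}" if "q integrable_on {r + t..s + t}" for q :: "real \<Rightarrow> 'c::euclidean_space"
    using has_integral_shift_real_ivl[OF integrable_integral[OF that], of t] by (simp add: add.commute)
  show "(\<lambda>x. g (t + x)) absolutely_integrable_on {r..s}"
    unfolding absolutely_integrable_on_def
    by (rule conjI) (rule has_integral_integrable[OF sh[OF i(1)]], rule has_integral_integrable[OF sh[OF i(2)]])
  show "integral {r..s} (\<lambda>x. g (t + x)) = integral {r + t..s + t} g" by (rule integral_unique[OF sh[OF i(1)]])
qed

text \<open>Connects an index with a lattice state: \<open>\<theta>\<close> and \<open>X\<close> are
  its full sequences, \<open>w\<close> the function glued from the pieces, and \<open>J\<close> the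
  number of the cell for which the index stands. \<open>\<phi>\<close> is the given cutoff and
  \<open>\<xi>\<close> its extension to the line.\<close>

locale lattice_family = cell_family D f u u1 u2 u3 u4 z z1 z2 \<xi> \<xi>1 \<xi>2 \<psi> \<psi>1 \<psi>2 \<psi>3 \<rho> I a b c W W1 W2
  for D :: "real^'n^'n" and f u u1 u2 u3 u4 z z1 z2 \<xi> \<xi>1 \<xi>2 \<psi> \<psi>1 \<psi>2 \<psi>3 \<rho> and I :: "'i set" and a b c W W1 W2 +
  fixes \<phi> :: "real \<Rightarrow> real" and \<theta> :: "'i \<Rightarrow> int \<Rightarrow> real" and X :: "'i \<Rightarrow> int \<Rightarrow> real \<Rightarrow> real^'n"
    and w w1 :: "'i \<Rightarrow> real \<Rightarrow> real^'n" and J :: "'i \<Rightarrow> int"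
  assumes \<phi>_eq: "\<And>x. x \<in> {-pi..pi} \<Longrightarrow> \<phi> x = \<xi> x"
    and \<theta>_eq: "\<And>i. i \<in> I \<Longrightarrow> \<theta> i (J i + 1) = a i" "\<And>i. i \<in> I \<Longrightarrow> \<theta> i (J i) = b i" "\<And>i. i \<in> I \<Longrightarrow> \<theta> i (J i - 1) = c i"
    and glue: "\<And>i. i \<in> I \<Longrightarrow> glues_to (X i) (w i)"
    and d_line: "\<And>i x. i \<in> I \<Longrightarrow> (w i has_vector_derivative w1 i x) (at x)"
    and W_eq: "\<And>i x. i \<in> I \<Longrightarrow> W i x = w i (2 * pi * of_int (J i) + x)"
    and W1_eq: "\<And>i x. i \<in> I \<Longrightarrow> W1 i x = w1 i (2 * pi * of_int (J i) + x)"
begin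

lemma X_line:
  assumes "i \<in> I" "x \<in> {-pi..pi}"
  shows "X i k x = w i (2 * pi * of_int k + x)"
  by (rule bspec[OF spec[OF glue[OF assms(1), unfolded glues_to_def]] assms(2), symmetric])

lemma X_eq:
  assumes "i \<in> I" "x \<in> {-pi..pi}"
  shows "X i (J i) x = W i x"
  unfolding X_line[OF assms] W_eq[OF assms(1)] ..

text \<open>Since the pieces are glued, the value of piece k+1 at its left end is the line function
  at the right end of cell k. A lattice difference is thus a jump across one cell, which is the form
  produced by Green's identity.\<close>

lemma delta_plus_X: assumes i: "i \<in> I"
  shows "delta_plus (X i) k (- pi) = w i (2 * pi * of_int k + pi) - w i (2 * pi * of_int k - pi)"
    "delta_plus (cell_deriv (X i)) k (- pi) = w1 i (2 * pi * of_int k + pi) - w1 i (2 * pi * of_int k - pi)"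
proof -
  have e: "2 * pi * of_int (k + 1) + - pi = 2 * pi * of_int k + pi" "2 * pi * of_int k + - pi = 2 * pi * of_int k - pi"
    by (simp_all add: algebra_simps)
  have cd: "cell_deriv (X i) k (- pi) = w1 i (2 * pi * of_int k + - pi)" for k
  proof -
    have "((\<lambda>x. w i (2 * pi * of_int k + x)) has_vector_derivative w1 i (2 * pi * of_int k + - pi)) (at (- pi) within cbox (-pi) pi)"
      using has_vector_derivative_at_within[OF has_vector_derivative_shift[OF d_line[OF i]], of "- (2 * pi * of_int k)" "- pi" "cbox (-pi) pi"]
      by (simp add: add.commute)
    then have "(X i k has_vector_derivative w1 i (2 * pi * of_int k + - pi)) (at (- pi) within cbox (-pi) pi)"
      by (rule has_vector_derivative_transform[rotated 2]) (simp_all add: X_line[OF i])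
    then show ?thesis
      unfolding cell_deriv_def by (simp only: cbox_interval[symmetric]) (rule vector_derivative_within_cbox, simp_all)
  qed
  show "delta_plus (X i) k (- pi) = w i (2 * pi * of_int k + pi) - w i (2 * pi * of_int k - pi)"
    unfolding delta_plus_def minus_apply by (subst (1 2) X_line[OF i]) (simp_all only: e, simp_all)
  show "delta_plus (cell_deriv (X i)) k (- pi) = w1 i (2 * pi * of_int k + pi) - w1 i (2 * pi * of_int k - pi)"
    unfolding delta_plus_def minus_apply cd e ..
qed

lemma dw_eq: assumes i: "i \<in> I"
  shows "dw i = delta_plus (X i) (J i) (- pi)" "dw1 i = delta_plus (cell_deriv (X i)) (J i) (- pi)"
  unfolding delta_plus_X[OF i] dw_def dw1_def W_eq[OF i] W1_eq[OF i] by simp_all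

lemma ddx_eq: "ddx u x = u1 x" "ddx z x = z1 x"
  by (rule vector_derivative_at, rule du dz)+

lemma A_nf_theta_eq: assumes i: "i \<in> I"
  shows "A_nf_theta D z (X i) k = delta_plus (X i) k (- pi) \<bullet> (D *v z1 pi)"
  unfolding A_nf_theta_def delta_plus_def minus_apply Gam_def ddx_eq by (simp add: inner_diff_left)

lemma H1_eq:
  assumes x: "x \<in> {-pi..pi}"
  shows "H1 u \<phi> t k x = al x *\<^sub>R u (x - t (k + 1)) + be x *\<^sub>R u (x - t (k - 1)) - (1 / 2) *\<^sub>R u (x - t k)"
  unfolding H1_def \<phi>_eq[OF x] al_def be_def by (simp add: vec_eq_iff field_simps)

lemma h0_eq: "h0 i x = al x *\<^sub>R u (x - a i) + be x *\<^sub>R u (x - c i) - (1 / 2) *\<^sub>R u (x - b i)"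
  unfolding h0_def k0_def dA_def dC_def al_def be_def by (simp add: vec_eq_iff field_simps)

lemma H1_eq_h0:
  assumes "i \<in> I" "x \<in> {-pi..pi}"
  shows "H1 u \<phi> (\<theta> i) (J i) x = h0 i x"
  unfolding H1_eq[OF assms(2)] h0_eq \<theta>_eq[OF assms(1)] ..

lemma phase_coeff_eq: assumes i: "i \<in> I" shows "phase_coeff u z \<phi> (\<theta> i) (X i) (J i) = cc i"
proof -
  have "pairing (H1 u \<phi> (\<theta> i) (J i)) (\<lambda>x. z (x - b i)) = integral {-pi..pi} (\<lambda>x. h0 i x \<bullet> z (x - b i))"
    by (rule pairing_eq_integral_on) (simp only: H1_eq_h0[OF i], intro continuous_intros)
  moreover have "pairing (X i (J i)) (\<lambda>x. z (x - b i) - z x) = integral {-pi..pi} (\<lambda>x. W i x \<bullet> (z (x - b i) - z x))"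
    by (rule pairing_eq_integral_on) (simp only: X_eq[OF i], intro continuous_intros i)
  ultimately show ?thesis unfolding phase_coeff_def cc_def \<theta>_eq[OF i] by simp
qed

lemma T_phd_eq:
  assumes i: "i \<in> I" and x: "x \<in> {-pi..pi}"
  shows "T_phd u z \<phi> \<psi> (\<theta> i) (X i) (J i) x = (W i x + hh0 i x) + u (x - b i) - u x"
  unfolding T_phd_def phase_coeff_eq[OF i] hh0_def \<theta>_eq[OF i] H1_eq_h0[OF i x] X_eq[OF i x] by simp

text \<open>The weak derivatives are replaced by explicit ones; the terms that involve only the
  pattern or its translate then disappear because both are stationary.\<close>

lemma cell_rhs_AE:
  assumes i: "i \<in> I"
  defines "v \<equiv> T_phd u z \<phi> \<psi> (\<theta> i) (X i)"
  shows "AE x in lebesgue. x \<in> cell \<longrightarrow> A_ch D f u v (J i) x + G f u v (J i) x = Fr i x"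
proof -
  have v: "v (J i) x = (W i x + hh0 i x) + u (x - b i) - u x" if "x \<in> cell" for x
    unfolding v_def by (rule T_phd_eq[OF i]) (use that in auto)
  let ?v1 = "\<lambda>x. (W1 i x + hh1 i x) + u1 (x - b i) - u1 x"
  let ?v2 = "\<lambda>x. (W2 i x + hh2 i x) + u2 (x - b i) - u2 x"
  note P = W_hh_green_prems[OF i]
  have c2: "(\<lambda>x. u2 (x - b i) - u2 x) absolutely_integrable_on {p..q}" for p q
    by (rule absolutely_integrable_continuous_real) (intro continuous_intros)
  have "AE x in lebesgue. x \<in> cell \<longrightarrow> weak_deriv cell (weak_deriv cell (v (J i))) x = ?v2 x"
  proof (rule weak_deriv_weak_deriv_AE(1)[OF cell_open_interval, where ?v1.0="?v1"])
    show "x \<in> cell \<Longrightarrow> v (J i) x = (W i x + hh0 i x) + u (x - b i) - u x" for x by (rule v)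
    show "((\<lambda>x. (W i x + hh0 i x) + u (x - b i) - u x) has_vector_derivative ?v1 x) (at x)" for x
      by (intro has_vector_derivative_diff has_vector_derivative_add[OF P(1)] has_vector_derivative_shift du)
    show "?v2 absolutely_integrable_on {p..q}" for p q
      using set_integral_add(1)[OF P(2)[of p q] c2[of p q]] by (simp add: add_diff_eq)
    show "?v1 q - ?v1 p = integral {p..q} ?v2" if "p \<le> q" for p q
    proof -
      have 1: "integral {p..q} ?v2 = integral {p..q} (\<lambda>x. W2 i x + hh2 i x) + integral {p..q} (\<lambda>x. u2 (x - b i) - u2 x)"
        unfolding add_diff_eq[symmetric]
        by (rule Henstock_Kurzweil_Integration.integral_add) (use P(2)[of p q] c2[of p q] in \<open>simp_all add: absolutely_integrable_on_def\<close>)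
      have "((\<lambda>x. u2 (x - b i) - u2 x) has_integral (u1 (q - b i) - u1 q) - (u1 (p - b i) - u1 p)) {p..q}"
        by (rule has_integral_derivative[OF _ that]) (intro has_vector_derivative_diff has_vector_derivative_shift du)
      from integral_unique[OF this] show ?thesis unfolding 1 P(3)[OF that, symmetric] by simp
    qed
  qed
  then show ?thesis
  proof (rule AE_mp, intro AE_I2 impI)
    fix x assume x: "x \<in> cell \<longrightarrow> weak_deriv cell (weak_deriv cell (v (J i))) x = ?v2 x" "x \<in> cell"
    have "A_ch D f u v (J i) x + G f u v (J i) x = D *v ?v2 x + f (u x + ((W i x + hh0 i x) + u (x - b i) - u x)) - f (u x)"
      using x by (simp add: A_ch_def G_def v)
    also have "\<dots> = Fr i x + ((D *v u2 (x - b i) + f (u (x - b i))) - (D *v u2 x + f (u x)))"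
      by (simp add: Fr_def matrix_vector_right_distrib matrix_vector_mult_diff_distrib algebra_simps)
    finally show "A_ch D f u v (J i) x + G f u v (J i) x = Fr i x" by (simp add: pattern)
  qed
qed

lemma E_conv_eq:
  assumes x: "x \<in> {-pi..pi}"
  shows "E_conv u \<phi> \<psi> t k x = Eg (t (k + 1)) (t k) (t (k - 1)) x"
proof -
  have "E_conv u \<phi> \<psi> t k x = (\<Sum>\<^sub>\<infinity>l\<in>{k - 1, k, k + 1}. t l *\<^sub>R E u \<phi> \<psi> (k - l) x)"
    unfolding E_conv_def by (rule infsum_cong_neutral) (auto simp: E_def)
  also have "\<dots> = (\<Sum>l\<in>{k - 1, k, k + 1}. t l *\<^sub>R E u \<phi> \<psi> (k - l) x)" by (rule infsum_finite) simp
  also have "\<dots> = Eg (t (k + 1)) (t k) (t (k - 1)) x"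
    unfolding Eg_def dc0_def al_def be_def by (simp add: E_def ddx_eq \<phi>_eq[OF x] vec_eq_iff field_simps)
  finally show ?thesis .
qed

text \<open>The convolution of E with the phases is the linear part of the decomposition: that of
  the correction, plus that of the shift of the pattern by \<open>b\<close>. The second piece lies
  in the kernel of the linearization.\<close>

lemma Eg_hhl0: "Eg (a i) (b i) (c i) x = hhl0 i x - b i *\<^sub>R u1 x"
  unfolding Eg_def dc0_def hhl0_def hl0_def k0_def lA_def lC_def ccl_def al_def be_def
  by (simp add: vec_eq_iff field_simps)

lemma A_nf_w_AE:
  assumes i: "i \<in> I"
  defines "g \<equiv> A_nf_theta D z (X i)"
  shows "AE x in lebesgue. x \<in> cell \<longrightarrow>
    A_nf_w D f u z \<phi> \<psi> (\<theta> i) (X i) (J i) x = Anf i (g (J i + 1)) (g (J i)) (g (J i - 1)) x"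
proof -
  have cE: "E_conv u \<phi> \<psi> t k x = Eg (t (k + 1)) (t k) (t (k - 1)) x" if "x \<in> cell" for t k x
    by (rule E_conv_eq) (use that in auto)
  have E: "E_conv u \<phi> \<psi> (\<theta> i) (J i) x = hhl0 i x - b i *\<^sub>R u1 x" if "x \<in> cell" for x
    by (simp only: cE[OF that] \<theta>_eq[OF i] Eg_hhl0)
  have 1: "AE x in lebesgue. x \<in> cell \<longrightarrow> weak_deriv cell (weak_deriv cell (E_conv u \<phi> \<psi> (\<theta> i) (J i))) x = hhl2 i x - b i *\<^sub>R u3 x"
  proof (rule weak_deriv_weak_deriv_AE(1)[OF cell_open_interval, where ?v1.0="\<lambda>x. hhl1 i x - b i *\<^sub>R u2 x"])
    show "x \<in> cell \<Longrightarrow> E_conv u \<phi> \<psi> (\<theta> i) (J i) x = hhl0 i x - b i *\<^sub>R u1 x" for x by (rule E)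
    show "((\<lambda>x. hhl0 i x - b i *\<^sub>R u1 x) has_vector_derivative hhl1 i x - b i *\<^sub>R u2 x) (at x)" for x
      by (intro has_vector_derivative_diff d_h bounded_linear.has_vector_derivative[OF bounded_linear_scaleR_right] du)
    show "(\<lambda>x. hhl2 i x - b i *\<^sub>R u3 x) absolutely_integrable_on {p..q}" for p q
      by (rule absolutely_integrable_continuous_real) (intro continuous_intros)
    show "(hhl1 i q - b i *\<^sub>R u2 q) - (hhl1 i p - b i *\<^sub>R u2 p) = integral {p..q} (\<lambda>x. hhl2 i x - b i *\<^sub>R u3 x)" if "p \<le> q" for p q
      by (rule integral_unique[symmetric, OF has_integral_derivative[OF _ that]])
        (intro has_vector_derivative_diff d_h bounded_linear.has_vector_derivative[OF bounded_linear_scaleR_right] du)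
  qed
  have 2: "AE x in lebesgue. x \<in> cell \<longrightarrow> weak_deriv cell (weak_deriv cell (X i (J i))) x = W2 i x"
    by (rule weak_deriv_weak_deriv_AE(1)[OF cell_open_interval, where ?v1.0="\<lambda>x. W1 i x" and ?v0.0="W i"])
      (use i in \<open>auto intro: X_eq dW W2 W1\<close>)
  show ?thesis
  proof (rule AE_mp[OF 1], rule AE_mp[OF 2], intro AE_I2 impI)
    fix x
    assume x: "x \<in> cell \<longrightarrow> weak_deriv cell (weak_deriv cell (X i (J i))) x = W2 i x"
      "x \<in> cell \<longrightarrow> weak_deriv cell (weak_deriv cell (E_conv u \<phi> \<psi> (\<theta> i) (J i))) x = hhl2 i x - b i *\<^sub>R u3 x" "x \<in> cell"
    have xin: "x \<in> {-pi..pi}" using x(3) by auto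
    \<comment> \<open>The additional multiple of \<open>b i\<close> is the linearization applied to
      the derivative of the pattern, hence zero.\<close>
    have "A_nf_w D f u z \<phi> \<psi> (\<theta> i) (X i) (J i) x = Anf i (g (J i + 1)) (g (J i)) (g (J i - 1)) x - b i *\<^sub>R (D *v u3 x + jac f (u x) *v u1 x)"
      unfolding A_nf_w_def A_ch_def E[OF x(3)] unfolding cE[OF x(3)] x(1)[rule_format, OF x(3)] x(2)[rule_format, OF x(3)]
        X_eq[OF i xin] g_def A_nf_theta_def Anf_def
      by (simp add: matrix_vector_mult_diff_distrib matrix_vector_mult_scaleR scaleR_right_distrib)
    then show "A_nf_w D f u z \<phi> \<psi> (\<theta> i) (X i) (J i) x = Anf i (g (J i + 1)) (g (J i)) (g (J i - 1)) x"
      by (simp add: pattern_derivative)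
  qed
qed

text \<open>Along the line through the state in direction (eta, V) the phase coefficient is
  \<open>- K1 s - s * K2 s\<close>. \<open>K1\<close> does not contain \<open>V\<close> and is
  differentiated under the integral; all occurrences of \<open>V\<close> are in \<open>K2\<close>,
  for which continuity at 0 is enough.\<close>

lemma dT_phd_eq:
  fixes \<eta> :: "int \<Rightarrow> real"
  assumes i: "i \<in> I" and V: "V (J i) absolutely_integrable_on {-pi..pi}" and x: "x \<in> {-pi..pi}"
  defines "p \<equiv> \<eta> (J i + 1)" and "q \<equiv> \<eta> (J i)" and "r \<equiv> \<eta> (J i - 1)"
  shows "dT_phd u z \<phi> \<psi> (\<theta> i) (X i) \<eta> V (J i) x = dT i p q r (V (J i)) (dcf i p q r (V (J i))) x"
proof -
  let ?a = "a i" and ?b = "b i" and ?c = "c i"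
  define Hs where "Hs s x = al x *\<^sub>R u (x - (?a + s * p)) + be x *\<^sub>R u (x - (?c + s * r)) - (1 / 2) *\<^sub>R u (x - (?b + s * q))" for s x
  define Hd where "Hd s x = al x *\<^sub>R ((- p) *\<^sub>R u1 (x - (?a + s * p))) + be x *\<^sub>R ((- r) *\<^sub>R u1 (x - (?c + s * r))) -
    (1 / 2) *\<^sub>R ((- q) *\<^sub>R u1 (x - (?b + s * q)))" for s x
  define Z where "Z s x = z (x - (?b + s * q))" for s x
  define Z1 where "Z1 s x = (- q) *\<^sub>R z1 (x - (?b + s * q))" for s x
  define K1 where "K1 s = integral {-pi..pi} (\<lambda>x. (Hs s x + W i x) \<bullet> Z s x - W i x \<bullet> z x)" for s
  define K2 where "K2 s = integral {-pi..pi} (\<lambda>x. V (J i) x \<bullet> (Z s x - z x))" for s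
  have dHs: "((\<lambda>s. Hs s x) has_vector_derivative Hd s x) (at s)" for s x
    unfolding Hs_def Hd_def
    by (intro has_vector_derivative_diff has_vector_derivative_add bounded_linear.has_vector_derivative[OF bounded_linear_scaleR_right]
      has_vector_derivative_line du)
  have dZ: "((\<lambda>s. Z s x) has_vector_derivative Z1 s x) (at s)" for s x
    unfolding Z_def Z1_def by (rule has_vector_derivative_line[OF dz(1)])
  have Hs0: "Hs 0 x = h0 i x" "Hd 0 x = dH i p q r x" "Z 0 x = z (x - ?b)" "Z1 0 x = (- q) *\<^sub>R z1 (x - ?b)" for x
    by (simp_all add: Hs_def h0_eq Hd_def dH_def Z_def Z1_def vec_eq_iff field_simps)
  have cont: "continuous_on UNIV (Hs s)" "continuous_on UNIV (Z s)" for s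
    unfolding Hs_def[abs_def] Z_def[abs_def] by (intro continuous_intros)+
  have coeff: "phase_coeff u z \<phi> (\<lambda>k. \<theta> i k + s * \<eta> k) (\<lambda>k y. X i k y + s *\<^sub>R V k y) (J i) = - K1 s - s * K2 s" for s
  proof -
    have c1: "continuous_on UNIV (\<lambda>x. Hs s x \<bullet> Z s x)" "continuous_on UNIV (\<lambda>x. W i x \<bullet> (Z s x - z x))"
      by (intro continuous_intros cont i)+
    have P1: "pairing (H1 u \<phi> (\<lambda>k. \<theta> i k + s * \<eta> k) (J i)) (\<lambda>x. z (x - (?b + s * \<eta> (J i)))) = integral {-pi..pi} (\<lambda>x. Hs s x \<bullet> Z s x)"
      by (rule pairing_eq_integral_on[OF _ c1(1)]) (simp add: H1_eq Hs_def Z_def p_def q_def r_def \<theta>_eq[OF i])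
    have ai: "(\<lambda>x. V (J i) x \<bullet> (Z s x - z x)) absolutely_integrable_on {-pi..pi}"
      by (rule absolutely_integrable_bilinear_continuous[OF bounded_bilinear_inner V]) (intro continuous_intros continuous_on_subset[OF cont(2) subset_UNIV])
    have ai1: "(\<lambda>x. W i x \<bullet> (Z s x - z x)) absolutely_integrable_on {-pi..pi}"
      by (rule absolutely_integrable_continuous_real[OF continuous_on_subset[OF c1(2) subset_UNIV]])
    have ai2: "(\<lambda>x. W i x \<bullet> (Z s x - z x) + s *\<^sub>R (V (J i) x \<bullet> (Z s x - z x))) absolutely_integrable_on {-pi..pi}"
      by (rule set_integral_add(1)[OF ai1 absolutely_integrable_scaleR_left[OF ai]])
    have e: "(X i (J i) x + s *\<^sub>R V (J i) x) \<bullet> (z (x - (?b + s * \<eta> (J i))) - z x) =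
        W i x \<bullet> (Z s x - z x) + s *\<^sub>R (V (J i) x \<bullet> (Z s x - z x))" if "x \<in> {-pi..pi}" for x
      using that by (simp add: X_eq[OF i] Z_def q_def inner_add_left)
    have ai3: "(\<lambda>x. (X i (J i) x + s *\<^sub>R V (J i) x) \<bullet> (z (x - (?b + s * \<eta> (J i))) - z x)) absolutely_integrable_on {-pi..pi}"
      by (rule absolutely_integrable_spike_AE(1)[OF ai2]) (simp, rule AE_I2, rule impI, rule e)
    have P2: "pairing (\<lambda>y. X i (J i) y + s *\<^sub>R V (J i) y) (\<lambda>x. z (x - (?b + s * \<eta> (J i))) - z x) =
        integral {-pi..pi} (\<lambda>x. W i x \<bullet> (Z s x - z x) + s *\<^sub>R (V (J i) x \<bullet> (Z s x - z x)))"
      unfolding pairing_eq_integral[OF ai3] by (rule Henstock_Kurzweil_Integration.integral_cong) (rule e)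
    have ints: "(\<lambda>x. W i x \<bullet> (Z s x - z x)) integrable_on {-pi..pi}" "(\<lambda>x. V (J i) x \<bullet> (Z s x - z x)) integrable_on {-pi..pi}"
      "(\<lambda>x. Hs s x \<bullet> Z s x) integrable_on {-pi..pi}"
      using ai ai1 ci[OF c1(1)] by (simp_all add: absolutely_integrable_on_def)
    have "integral {-pi..pi} (\<lambda>x. W i x \<bullet> (Z s x - z x) + s *\<^sub>R (V (J i) x \<bullet> (Z s x - z x))) =
        integral {-pi..pi} (\<lambda>x. W i x \<bullet> (Z s x - z x)) + s * K2 s"
      unfolding K2_def Henstock_Kurzweil_Integration.integral_add[OF ints(1) integrable_cmul[OF ints(2)]] integral_cmul by simp
    moreover have "K1 s = integral {-pi..pi} (\<lambda>x. Hs s x \<bullet> Z s x) + integral {-pi..pi} (\<lambda>x. W i x \<bullet> (Z s x - z x))"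
      unfolding K1_def Henstock_Kurzweil_Integration.integral_add[OF ints(3,1), symmetric] by (simp add: inner_add_left inner_diff_right add_diff_eq)
    ultimately show ?thesis unfolding phase_coeff_def \<theta>_eq[OF i] P1 P2 by simp
  qed
  have dK1: "((\<lambda>s. K1 s) has_vector_derivative integral {-pi..pi} (\<lambda>x. (Hs 0 x + W i x) \<bullet> Z1 0 x + Hd 0 x \<bullet> Z 0 x)) (at 0)"
  proof -
    have "((\<lambda>s. integral (cbox (-pi) pi) (\<lambda>x. (Hs s x + W i x) \<bullet> Z s x - W i x \<bullet> z x)) has_vector_derivative
        integral (cbox (-pi) pi) (\<lambda>x. (Hs 0 x + W i x) \<bullet> Z1 0 x + Hd 0 x \<bullet> Z 0 x)) (at 0 within UNIV)"
    proof (rule leibniz_rule_vector_derivative)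
      fix s x
      have "((\<lambda>s. (Hs s x + W i x) \<bullet> Z s x - W i x \<bullet> z x) has_vector_derivative ((Hs s x + W i x) \<bullet> Z1 s x + (Hd s x + 0) \<bullet> Z s x) - 0) (at s)"
        by (intro has_vector_derivative_diff bounded_bilinear.has_vector_derivative[OF bounded_bilinear_inner] has_vector_derivative_add dHs dZ has_vector_derivative_const)
      then show "((\<lambda>s. (Hs s x + W i x) \<bullet> Z s x - W i x \<bullet> z x) has_vector_derivative (Hs s x + W i x) \<bullet> Z1 s x + Hd s x \<bullet> Z s x) (at s within UNIV)"
        by simp
      show "(\<lambda>x. (Hs s x + W i x) \<bullet> Z s x - W i x \<bullet> z x) integrable_on cbox (-pi) pi"
        unfolding cbox_interval by (intro ci continuous_intros cont i)
      show "continuous_on (UNIV \<times> cbox (-pi) pi) (\<lambda>(s, x). (Hs s x + W i x) \<bullet> Z1 s x + Hd s x \<bullet> Z s x)"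
      proof -
        have cl: "continuous_on A (\<lambda>y::real \<times> real. snd y - (t + fst y * s))" for t s A
          by (intro continuous_on_diff continuous_on_add continuous_on_mult continuous_on_const continuous_on_fst continuous_on_snd continuous_on_id)
        have cs: "continuous_on A (\<lambda>y::real \<times> real. snd y)" for A
          by (rule continuous_on_snd[OF continuous_on_id])
        note c = cont_al[OF cs] cont_shift(1,2,6,7)[OF cl] continuous_compose_UNIV[OF cont_W[OF i] cs]
        show ?thesis
          unfolding split_beta Hs_def Hd_def Z1_def Z_def
          by (intro continuous_on_add continuous_on_inner continuous_on_diff continuous_on_scaleR continuous_on_const c)
      qed
    qed simp_all
    then show ?thesis unfolding K1_def[abs_def] cbox_interval by simp
  qed
  have dK2: "((\<lambda>s. s * K2 s) has_vector_derivative K2 0) (at 0)"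
  proof -
    obtain B where B: "\<forall>x. norm (z1 x) \<le> B" using bounded_data(7) ..
    have B0: "0 \<le> B" using order_trans[OF norm_ge_zero] B by blast
    have iV: "(\<lambda>x. norm (V (J i) x)) integrable_on {-pi..pi}" using V by (simp add: absolutely_integrable_on_def)
    show ?thesis
    proof (rule has_vector_derivative_mult_self)
      \<comment> \<open>\<open>K2\<close> is Lipschitz in \<open>s\<close>, since \<open>z\<close>
        is Lipschitz and the norm of \<open>V\<close> is integrable.\<close>
      fix s
      have i2: "(\<lambda>x. V (J i) x \<bullet> (Z s x - z x)) integrable_on {-pi..pi}" for s
        by (rule inner_abs_int[OF _ V]) (intro continuous_intros cont)
      have "K2 s - K2 0 = integral {-pi..pi} (\<lambda>x. V (J i) x \<bullet> (Z s x - z x) - V (J i) x \<bullet> (Z 0 x - z x))"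
        unfolding K2_def by (rule Henstock_Kurzweil_Integration.integral_diff[symmetric, OF i2 i2])
      then have "norm (K2 s - K2 0) = norm (integral {-pi..pi} (\<lambda>x. V (J i) x \<bullet> (Z s x - z x) - V (J i) x \<bullet> (Z 0 x - z x)))" by simp
      also have "\<dots> \<le> integral {-pi..pi} (\<lambda>x. (B * \<bar>q\<bar> * \<bar>s\<bar>) *\<^sub>R norm (V (J i) x))"
      proof (rule integral_norm_bound_integral[OF integrable_diff[OF i2 i2] integrable_cmul[OF iV]])
        fix x
        have "norm (z (x - (?b + s * q)) - z (x - ?b)) \<le> B * \<bar>(x - (?b + s * q)) - (x - ?b)\<bar>"
          by (rule shift_diff_bound[OF dz(1)]) (use B in blast)
        then have n: "norm (Z s x - Z 0 x) \<le> B * \<bar>q\<bar> * \<bar>s\<bar>" by (simp add: Z_def abs_mult ac_simps)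
        have "norm (V (J i) x \<bullet> (Z s x - z x) - V (J i) x \<bullet> (Z 0 x - z x)) = norm (V (J i) x \<bullet> (Z s x - Z 0 x))"
          by (simp flip: inner_diff_right)
        also have "\<dots> \<le> norm (V (J i) x) * norm (Z s x - Z 0 x)" by (simp add: Cauchy_Schwarz_ineq2)
        also have "\<dots> \<le> norm (V (J i) x) * (B * \<bar>q\<bar> * \<bar>s\<bar>)" by (rule mult_left_mono[OF n]) simp
        finally show "norm (V (J i) x \<bullet> (Z s x - z x) - V (J i) x \<bullet> (Z 0 x - z x)) \<le> (B * \<bar>q\<bar> * \<bar>s\<bar>) *\<^sub>R norm (V (J i) x)"
          by (simp add: mult.commute)
      qed
      also have "\<dots> = (B * \<bar>q\<bar> * integral {-pi..pi} (\<lambda>x. norm (V (J i) x))) * \<bar>s\<bar>" unfolding integral_cmul by simp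
      finally show "\<bar>K2 s - K2 0\<bar> \<le> (B * \<bar>q\<bar> * integral {-pi..pi} (\<lambda>x. norm (V (J i) x))) * \<bar>s\<bar>" by simp
    qed
  qed
  have dc: "((\<lambda>s. - K1 s - s * K2 s) has_vector_derivative
      - integral {-pi..pi} (\<lambda>x. (Hs 0 x + W i x) \<bullet> Z1 0 x + Hd 0 x \<bullet> Z 0 x) - K2 0) (at 0)"
    by (rule has_vector_derivative_diff[OF has_vector_derivative_minus[OF dK1] dK2])
  have dcf: "- integral {-pi..pi} (\<lambda>x. (Hs 0 x + W i x) \<bullet> Z1 0 x + Hd 0 x \<bullet> Z 0 x) - K2 0 = dcf i p q r (V (J i))"
  proof -
    have j: "(\<lambda>x. dH i p q r x \<bullet> z (x - ?b)) integrable_on {-pi..pi}" "(\<lambda>x. h0 i x \<bullet> z1 (x - ?b)) integrable_on {-pi..pi}"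
      "(\<lambda>x. W i x \<bullet> z1 (x - ?b)) integrable_on {-pi..pi}" by (intro ci continuous_intros i)+
    have "(Hs 0 x + W i x) \<bullet> Z1 0 x + Hd 0 x \<bullet> Z 0 x = (dH i p q r x \<bullet> z (x - ?b) - q *\<^sub>R (h0 i x \<bullet> z1 (x - ?b))) - q *\<^sub>R (W i x \<bullet> z1 (x - ?b))" for x
      by (simp add: Hs0 inner_add_left algebra_simps)
    then have "integral {-pi..pi} (\<lambda>x. (Hs 0 x + W i x) \<bullet> Z1 0 x + Hd 0 x \<bullet> Z 0 x) =
        integral {-pi..pi} (\<lambda>x. dH i p q r x \<bullet> z (x - ?b)) - q *\<^sub>R integral {-pi..pi} (\<lambda>x. h0 i x \<bullet> z1 (x - ?b)) - q *\<^sub>R integral {-pi..pi} (\<lambda>x. W i x \<bullet> z1 (x - ?b))"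
      by (simp only: Henstock_Kurzweil_Integration.integral_diff[OF integrable_diff[OF j(1) integrable_cmul[OF j(2)]] integrable_cmul[OF j(3)]]
        Henstock_Kurzweil_Integration.integral_diff[OF j(1) integrable_cmul[OF j(2)]] integral_cmul)
    then show ?thesis unfolding dcf_def K2_def Hs0 by simp
  qed
  have c0: "- K1 0 - 0 * K2 0 = cc i"
    using coeff[of 0] phase_coeff_eq[OF i] by simp
  have D: "((\<lambda>s. (W i x + s *\<^sub>R V (J i) x) + (Hs s x + (- K1 s - s * K2 s) *\<^sub>R \<psi> (x - (?b + s * q))) + u (x - (?b + s * q)) - u x) has_vector_derivative
      (0 + 1 *\<^sub>R V (J i) x) + (Hd 0 x + ((- K1 0 - 0 * K2 0) *\<^sub>R ((- q) *\<^sub>R \<psi>1 (x - (?b + 0 * q))) + dcf i p q r (V (J i)) *\<^sub>R \<psi> (x - (?b + 0 * q)))) +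
      (- q) *\<^sub>R u1 (x - (?b + 0 * q)) - 0) (at 0)"
    by (rule has_vector_derivative_diff[OF has_vector_derivative_add[OF has_vector_derivative_add[OF
        has_vector_derivative_add[OF has_vector_derivative_const
          bounded_linear.has_vector_derivative[OF bounded_linear_scaleR_left has_vector_derivative_id]]
        has_vector_derivative_add[OF dHs
          bounded_bilinear.has_vector_derivative[OF bounded_bilinear_scaleR dc[unfolded dcf] has_vector_derivative_line[OF d\<psi>(1)]]]]
        has_vector_derivative_line[OF du(1)]] has_vector_derivative_const])
  have T: "T_phd u z \<phi> \<psi> (\<lambda>k. \<theta> i k + s * \<eta> k) (\<lambda>k y. X i k y + s *\<^sub>R V k y) (J i) x =
      (W i x + s *\<^sub>R V (J i) x) + (Hs s x + (- K1 s - s * K2 s) *\<^sub>R \<psi> (x - (?b + s * q))) + u (x - (?b + s * q)) - u x" for s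
    unfolding T_phd_def coeff using x by (simp add: X_eq[OF i] H1_eq Hs_def p_def q_def r_def \<theta>_eq[OF i])
  show ?thesis
    unfolding dT_phd_def T vector_derivative_at[OF D] c0 dT_def Hs0 by simp
qed

end

section \<open>Solving for the nonlinear terms in one cell\<close>

lemma integral_square_le:
  fixes g :: "real \<Rightarrow> real"
  assumes "g integrable_on {-pi..pi}" "(\<lambda>x. (g x)\<^sup>2) integrable_on {-pi..pi}"
  shows "(integral {-pi..pi} g)\<^sup>2 \<le> 2 * pi * integral {-pi..pi} (\<lambda>x. (g x)\<^sup>2)"
proof -
  define s where "s = integral {-pi..pi} g / (2 * pi)"
  note j = integrable_diff[OF assms(2) integrable_cmul[OF assms(1), of "2 * s"]]
  have e: "(g x - s)\<^sup>2 = ((g x)\<^sup>2 - (2 * s) *\<^sub>R g x) + s\<^sup>2" for x by (simp add: power2_eq_square algebra_simps)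
  have "0 \<le> integral {-pi..pi} (\<lambda>x. ((g x)\<^sup>2 - (2 * s) *\<^sub>R g x) + s\<^sup>2)"
    by (rule Henstock_Kurzweil_Integration.integral_nonneg[OF integrable_add[OF j integrable_const_ivl]]) (unfold e[symmetric], rule zero_le_power2)
  also have "\<dots> = integral {-pi..pi} (\<lambda>x. (g x)\<^sup>2) - 2 * s * integral {-pi..pi} g + 2 * pi * s\<^sup>2"
    unfolding Henstock_Kurzweil_Integration.integral_add[OF j integrable_const_ivl]
      Henstock_Kurzweil_Integration.integral_diff[OF assms(2) integrable_cmul[OF assms(1)]] integral_cmul by simp
  also have "\<dots> = integral {-pi..pi} (\<lambda>x. (g x)\<^sup>2) - (integral {-pi..pi} g)\<^sup>2 / (2 * pi)"
    by (simp add: s_def power2_eq_square field_simps)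
  finally show ?thesis by (simp add: field_simps)
qed

lemma square_sum3_le: "(x + y + w)\<^sup>2 \<le> 3 * (x\<^sup>2 + y\<^sup>2 + w\<^sup>2)" for x y w :: real
proof -
  have "0 \<le> (x - y)\<^sup>2 + (y - w)\<^sup>2 + (x - w)\<^sup>2" by simp
  then show ?thesis by (simp add: power2_eq_square algebra_simps)
qed

context cell_family begin

text \<open>\<open>FB\<close> is a pointwise majorant of the right-hand side \<open>Fr\<close>, and
  \<open>SS\<close> is the quantity that is summable over the lattice and controls the squares of
  its integrals.\<close>

definition FB :: "'i \<Rightarrow> real \<Rightarrow> real" where "FB i x = norm (W2 i x) + norm (W i x) + sig i"
definition SS :: "'i \<Rightarrow> real" where
  "SS i = integral {-pi..pi} (\<lambda>x. (norm (W2 i x))\<^sup>2) + integral {-pi..pi} (\<lambda>x. (norm (W i x))\<^sup>2) + (sig i)\<^sup>2"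
text \<open>These are the equations read as definitions: \<open>eta\<close> solves the phase
  equation, \<open>RR\<close> is what the profile speed would be with no multiple of the shifted
  \<open>\<psi>\<close>, and \<open>cR\<close> is the multiple whose subtraction makes
  \<open>VR\<close> orthogonal to \<open>z\<close>.\<close>

definition eta :: "'i \<Rightarrow> real" where
  "eta i = - integral {-pi..pi} (\<lambda>x. Fr i x \<bullet> z (x - b i)) / (1 - kap i)"
definition RR :: "'i \<Rightarrow> real \<Rightarrow> real \<Rightarrow> real \<Rightarrow> real^'n" where
  "RR i p r x = Fr i x - dH i p (eta i) r x + (cc i * eta i) *\<^sub>R \<psi>1 (x - b i) + eta i *\<^sub>R u1 (x - b i)"
definition cR :: "'i \<Rightarrow> real \<Rightarrow> real \<Rightarrow> real" where
  "cR i p r = integral {-pi..pi} (\<lambda>x. RR i p r x \<bullet> z x) / kpsi i"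
definition VR :: "'i \<Rightarrow> real \<Rightarrow> real \<Rightarrow> real \<Rightarrow> real^'n" where
  "VR i p r x = RR i p r x - cR i p r *\<^sub>R \<psi> (x - b i)"

lemma FB_ge: "0 \<le> FB i x" "norm (W2 i x) \<le> FB i x" "norm (W i x) \<le> FB i x" "sig i \<le> FB i x"
  using nonneg(2)[of i] norm_ge_zero[of "W2 i x"] norm_ge_zero[of "W i x"] unfolding FB_def by simp_all

lemma Fr_abs_int: "i \<in> I \<Longrightarrow> Fr i absolutely_integrable_on {-pi..pi}"
proof -
  assume i: "i \<in> I"
  have 1: "(\<lambda>x. D *v W2 i x) absolutely_integrable_on {-pi..pi}"
    by (rule absolutely_integrable_linear[OF W2[OF i] matrix_vector_mul_bounded_linear, unfolded o_def])
  have 2: "(\<lambda>x. D *v hh2 i x + (f (u (x - b i) + (W i x + hh0 i x)) - f (u (x - b i)))) absolutely_integrable_on {-pi..pi}"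
    by (rule absolutely_integrable_continuous_real) (intro continuous_intros i)
  show ?thesis
    using set_integral_add(1)[OF 1 2] by (simp add: Fr_def[abs_def] matrix_vector_right_distrib add.assoc)
qed

lemma unif_Fr: "unif_le I Fr FB"
proof -
  note L = unif_le_linear[OF matrix_vector_mul_bounded_linear]
  have s: "unif_le I p FB" if "unif_le I p (\<lambda>i x. siz i)" for p :: "'i \<Rightarrow> real \<Rightarrow> real^'n"
  proof (rule unif_le_mono[OF that, of "2 + 2 * pi"])
    fix i x assume i: "i \<in> I"
    have "siz i \<le> (2 + 2 * pi) * sig i" by (rule elementary(8)[OF i])
    also have "\<dots> \<le> (2 + 2 * pi) * FB i x" by (rule mult_left_mono[OF FB_ge(4)]) simp
    finally show "siz i \<le> (2 + 2 * pi) * FB i x" .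
  qed simp
  have w: "unif_le I p FB" if "unif_le I p (\<lambda>i x. norm (W i x))" for p :: "'i \<Rightarrow> real \<Rightarrow> real^'n"
    by (rule unif_le_mono1[OF that FB_ge(3)])
  have 1: "unif_le I W2 FB" by (rule unif_le_mono1[OF unif_le_self FB_ge(2)])
  have q: "unif_le I Q FB"
  proof (rule unif_le_mono[OF unif_Q0, of "1 + (2 + 2 * pi) * (2 + 2 * pi) * 3"])
    fix i x assume i: "i \<in> I" and x: "x \<in> {-pi..pi}"
    have "(norm (W i x))\<^sup>2 \<le> norm (W i x) * 1"
      unfolding power2_eq_square by (rule mult_left_mono[OF W_bound[OF i x]]) simp
    then have a: "(norm (W i x))\<^sup>2 \<le> 1 * FB i x" using FB_ge(3)[of i x] by simp
    have "siz i * siz i \<le> ((2 + 2 * pi) * sig i) * ((2 + 2 * pi) * sig i)"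
      by (rule mult_mono[OF elementary(8)[OF i] elementary(8)[OF i]]) (use nonneg(2,6) i in simp_all)
    also have "\<dots> = ((2 + 2 * pi) * (2 + 2 * pi)) * (sig i * sig i)" by simp
    also have "\<dots> \<le> ((2 + 2 * pi) * (2 + 2 * pi)) * (3 * FB i x)"
      by (rule mult_left_mono[OF mult_mono[OF elementary(3)[OF i] FB_ge(4)]]) (use nonneg(2) in simp_all)
    finally have b: "(siz i)\<^sup>2 \<le> ((2 + 2 * pi) * (2 + 2 * pi) * 3) * FB i x" by (simp add: power2_eq_square)
    show "(norm (W i x))\<^sup>2 + (siz i)\<^sup>2 \<le> (1 + (2 + 2 * pi) * (2 + 2 * pi) * 3) * FB i x"
      unfolding distrib_right[of 1] by (rule add_mono[OF a b])
  qed simp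
  show ?thesis
    unfolding Fr_eq[abs_def]
    by (rule unif_le_add[OF unif_le_add[OF L[OF unif_le_add[OF 1 s[OF unif_hh(3)]]]
      unif_le_jac[OF unif_le_add[OF w[OF unif_le_self] s[OF unif_hh(1)]]]] q])
qed

lemma FB_integrable:
  assumes i: "i \<in> I" and sq: "(\<lambda>x. (norm (W2 i x))\<^sup>2) integrable_on {-pi..pi}"
  shows "FB i integrable_on {-pi..pi}" "(\<lambda>x. (FB i x)\<^sup>2) integrable_on {-pi..pi}"
    "integral {-pi..pi} (\<lambda>x. (FB i x)\<^sup>2) \<le> 3 * (1 + 2 * pi) * SS i" "(integral {-pi..pi} (FB i))\<^sup>2 \<le> 6 * pi * (1 + 2 * pi) * SS i"
proof -
  have W2n: "(\<lambda>x. norm (W2 i x)) absolutely_integrable_on {-pi..pi}" by (rule absolutely_integrable_norm[OF W2[OF i], unfolded o_def])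
  have c: "continuous_on {-pi..pi} (\<lambda>x. norm (W i x) + sig i)" by (intro continuous_intros i)
  have cs: "(\<lambda>x. norm (W i x) + sig i) absolutely_integrable_on {-pi..pi}" "(\<lambda>x. (norm (W i x) + sig i)\<^sup>2) absolutely_integrable_on {-pi..pi}"
    by (rule absolutely_integrable_continuous_real, intro continuous_intros i)+
  show 1: "FB i integrable_on {-pi..pi}"
    using integrable_add[OF set_lebesgue_integral_eq_integral(1)[OF W2n] set_lebesgue_integral_eq_integral(1)[OF cs(1)]]
    by (simp add: FB_def[abs_def] add.assoc)
  have m: "(\<lambda>x. (norm (W i x) + sig i) * norm (W2 i x)) absolutely_integrable_on {-pi..pi}"
    using absolutely_integrable_bilinear_continuous[OF bounded_bilinear_mult W2n c] by (simp add: mult.commute)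
  have "(\<lambda>x. (norm (W2 i x))\<^sup>2 + 2 *\<^sub>R ((norm (W i x) + sig i) * norm (W2 i x)) + (norm (W i x) + sig i)\<^sup>2) integrable_on {-pi..pi}"
    by (intro integrable_add sq integrable_cmul set_lebesgue_integral_eq_integral(1)[OF m] set_lebesgue_integral_eq_integral(1)[OF cs(2)])
  then show 2: "(\<lambda>x. (FB i x)\<^sup>2) integrable_on {-pi..pi}"
    by (rule integrable_eq) (simp add: FB_def power2_eq_square algebra_simps)
  have iW: "(\<lambda>x. (norm (W i x))\<^sup>2) integrable_on {-pi..pi}" by (intro ci continuous_intros i)
  have r: "(\<lambda>x. 3 *\<^sub>R ((norm (W2 i x))\<^sup>2 + (norm (W i x))\<^sup>2 + (sig i)\<^sup>2)) integrable_on {-pi..pi}"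
    by (intro integrable_cmul integrable_add sq iW integrable_const_ivl)
  have "integral {-pi..pi} (\<lambda>x. (FB i x)\<^sup>2) \<le> integral {-pi..pi} (\<lambda>x. 3 *\<^sub>R ((norm (W2 i x))\<^sup>2 + (norm (W i x))\<^sup>2 + (sig i)\<^sup>2))"
    by (rule integral_le[OF 2 r]) (unfold FB_def real_scaleR_def, rule square_sum3_le)
  also have "\<dots> = 3 * (integral {-pi..pi} (\<lambda>x. (norm (W2 i x))\<^sup>2) + integral {-pi..pi} (\<lambda>x. (norm (W i x))\<^sup>2) + 2 * pi * (sig i)\<^sup>2)"
    unfolding integral_cmul Henstock_Kurzweil_Integration.integral_add[OF integrable_add[OF sq iW] integrable_const_ivl]
      Henstock_Kurzweil_Integration.integral_add[OF sq iW] by simp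
  also have "\<dots> \<le> 3 * ((1 + 2 * pi) * SS i)"
  proof (rule mult_left_mono)
    have p: "0 \<le> integral {-pi..pi} (\<lambda>x. (norm (W2 i x))\<^sup>2)" "0 \<le> integral {-pi..pi} (\<lambda>x. (norm (W i x))\<^sup>2)"
      by (rule Henstock_Kurzweil_Integration.integral_nonneg[OF sq], simp, rule Henstock_Kurzweil_Integration.integral_nonneg[OF iW], simp)
    have arith: "P + Q' + 2 * pi * T \<le> (1 + 2 * pi) * (P + Q' + T)" if "0 \<le> P" "0 \<le> Q'" "0 \<le> T" for P Q' T :: real
      using that mult_nonneg_nonneg[of "2 * pi" "P + Q'"] by (simp add: algebra_simps)
    show "integral {-pi..pi} (\<lambda>x. (norm (W2 i x))\<^sup>2) + integral {-pi..pi} (\<lambda>x. (norm (W i x))\<^sup>2) + 2 * pi * (sig i)\<^sup>2 \<le> (1 + 2 * pi) * SS i"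
      unfolding SS_def by (rule arith[OF p]) simp
  qed simp
  finally show 3: "integral {-pi..pi} (\<lambda>x. (FB i x)\<^sup>2) \<le> 3 * (1 + 2 * pi) * SS i" by (simp only: mult.assoc)
  have "(integral {-pi..pi} (FB i))\<^sup>2 \<le> 2 * pi * integral {-pi..pi} (\<lambda>x. (FB i x)\<^sup>2)" by (rule integral_square_le[OF 1 2])
  also have "\<dots> \<le> 2 * pi * (3 * (1 + 2 * pi) * SS i)" by (rule mult_left_mono[OF 3]) simp
  also have "\<dots> = 6 * pi * (1 + 2 * pi) * SS i" by (simp add: algebra_simps)
  finally show "(integral {-pi..pi} (FB i))\<^sup>2 \<le> 6 * pi * (1 + 2 * pi) * SS i" .
qed

lemma RR_abs_int: "i \<in> I \<Longrightarrow> RR i p r absolutely_integrable_on {-pi..pi}"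
proof -
  assume i: "i \<in> I"
  have "(\<lambda>x. eta i *\<^sub>R u1 (x - b i) + (cc i * eta i) *\<^sub>R \<psi>1 (x - b i) - dH i p (eta i) r x) absolutely_integrable_on {-pi..pi}"
    by (rule absolutely_integrable_continuous_real) (intro continuous_intros)
  from set_integral_add(1)[OF Fr_abs_int[OF i] this] show ?thesis by (simp add: RR_def[abs_def] algebra_simps)
qed

lemma VR_abs_int: "i \<in> I \<Longrightarrow> VR i p r absolutely_integrable_on {-pi..pi}"
  unfolding VR_def[abs_def]
  by (rule set_integral_diff(1)[OF RR_abs_int absolutely_integrable_continuous_real]) (assumption, intro continuous_intros)

text \<open>By construction the equation holds with \<open>cR\<close> as speed of the phase
  coefficient. That \<open>cR\<close> is the correct speed \<open>dcf\<close> is a consequence: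
  \<open>dT_pairing\<close> computes the pairing of the left side up to the difference of the two,
  and the choice of \<open>eta\<close> already accounts for all of it.\<close>

lemma solution:
  assumes i: "i \<in> I" and k: "\<bar>kap i\<bar> \<le> 1 / 2" "\<bar>kpsi i - 1\<bar> \<le> 1 / 2"
  shows "integral {-pi..pi} (\<lambda>x. VR i p r x \<bullet> z x) = 0"
    "dT i p (eta i) r (VR i p r) (dcf i p (eta i) r (VR i p r)) x = Fr i x"
proof -
  have k0: "kpsi i \<noteq> 0" "1 - kap i \<noteq> 0" using k by auto
  have j: "(\<lambda>x. RR i p r x \<bullet> z x) integrable_on {-pi..pi}" "(\<lambda>x. \<psi> (x - b i) \<bullet> z x) integrable_on {-pi..pi}"
    by (rule inner_abs_int[OF _ RR_abs_int[OF i]]) (intro ci continuous_intros)+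
  have "integral {-pi..pi} (\<lambda>x. VR i p r x \<bullet> z x) = integral {-pi..pi} (\<lambda>x. RR i p r x \<bullet> z x - cR i p r *\<^sub>R (\<psi> (x - b i) \<bullet> z x))"
    by (simp add: VR_def inner_diff_left)
  also have "\<dots> = integral {-pi..pi} (\<lambda>x. RR i p r x \<bullet> z x) - cR i p r * kpsi i"
    unfolding Henstock_Kurzweil_Integration.integral_diff[OF j(1) integrable_cmul[OF j(2)]] integral_cmul kpsi_def by simp
  finally show V: "integral {-pi..pi} (\<lambda>x. VR i p r x \<bullet> z x) = 0" using k0(1) by (simp add: cR_def)
  have e: "dT i p (eta i) r (VR i p r) (cR i p r) x = Fr i x" for x
    by (simp add: dT_def VR_def RR_def)
  have "integral {-pi..pi} (\<lambda>x. Fr i x \<bullet> z (x - b i)) = eta i * (kap i - 1) + (cR i p r - dcf i p (eta i) r (VR i p r))"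
    using dT_pairing[OF i VR_abs_int[OF i, of p r], where p=p and q="eta i" and r=r and dc="cR i p r"] unfolding e V by simp
  moreover have "eta i * (kap i - 1) = integral {-pi..pi} (\<lambda>x. Fr i x \<bullet> z (x - b i))"
    using k0(2) by (simp add: eta_def field_simps)
  ultimately have "dcf i p (eta i) r (VR i p r) = cR i p r" by simp
  then show "dT i p (eta i) r (VR i p r) (dcf i p (eta i) r (VR i p r)) x = Fr i x" using e by simp
qed

definition AA :: "'i \<Rightarrow> real" where "AA i = integral {-pi..pi} (FB i)"

lemma unif_eta:
  assumes k: "\<And>i. i \<in> I \<Longrightarrow> \<bar>kap i\<bar> \<le> 1 / 2"
    and sq: "\<And>i. i \<in> I \<Longrightarrow> (\<lambda>x. (norm (W2 i x))\<^sup>2) integrable_on {-pi..pi}"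
  shows "unif_le I (\<lambda>i x. eta i) (\<lambda>i x. AA i)"
proof (rule unif_le_half_bound[where k="\<lambda>i. 1 - kap i"])
  show "unif_le I (\<lambda>i x. - integral {-pi..pi} (\<lambda>x. Fr i x \<bullet> z (x - b i))) (\<lambda>i x. AA i)"
    unfolding AA_def
    by (rule unif_le_minus[OF unif_le_integral[OF unif_le_inner_left[OF unif_Fr unif_z(1)]]]) (rule Fr_pairing FB_integrable(1)[OF _ sq]; assumption)+
  show "\<bar>1 - kap i - 1\<bar> \<le> 1 / 2" if "i \<in> I" for i using k[OF that] by simp
  show "(1 - kap i) * eta i = - integral {-pi..pi} (\<lambda>x. Fr i x \<bullet> z (x - b i))" if "i \<in> I" for i
  proof -
    have "1 - kap i \<noteq> 0" using k[OF that] by auto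
    then show ?thesis by (simp add: eta_def)
  qed
qed

text \<open>The neighbouring speeds enter only through the derivative of H, so they appear on the
  right as given data.\<close>

lemma unif_VR:
  fixes p r :: "'i \<Rightarrow> real"
  assumes k: "\<And>i. i \<in> I \<Longrightarrow> \<bar>kap i\<bar> \<le> 1 / 2" "\<And>i. i \<in> I \<Longrightarrow> \<bar>kpsi i - 1\<bar> \<le> 1 / 2"
    and sq: "\<And>i. i \<in> I \<Longrightarrow> (\<lambda>x. (norm (W2 i x))\<^sup>2) integrable_on {-pi..pi}"
  shows "unif_le I (\<lambda>i. VR i (p i) (r i)) (\<lambda>i x. FB i x + (AA i + (\<bar>p i\<bar> + \<bar>r i\<bar>)))"
proof -
  let ?GG = "\<lambda>i x. FB i x + (AA i + (\<bar>p i\<bar> + \<bar>r i\<bar>))"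
  have A0: "0 \<le> AA i" if "i \<in> I" for i
    unfolding AA_def by (rule Henstock_Kurzweil_Integration.integral_nonneg[OF FB_integrable(1)[OF that sq[OF that]] FB_ge(1)])
  have g: "FB i x \<le> ?GG i x" "AA i \<le> ?GG i x" "\<bar>p i\<bar> \<le> ?GG i x" "\<bar>r i\<bar> \<le> ?GG i x" if "i \<in> I" for i x
  proof -
    have arith: "F \<le> F + (A + (P + R))" "A \<le> F + (A + (P + R))" "P \<le> F + (A + (P + R))" "R \<le> F + (A + (P + R))"
      if "0 \<le> F" "0 \<le> A" "0 \<le> P" "0 \<le> R" for F A P R :: real using that by linarith+
    show "FB i x \<le> ?GG i x" "AA i \<le> ?GG i x" "\<bar>p i\<bar> \<le> ?GG i x" "\<bar>r i\<bar> \<le> ?GG i x"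
      by (rule arith[OF FB_ge(1) A0[OF that] abs_ge_zero abs_ge_zero])+
  qed
  have e: "unif_le I (\<lambda>i x. eta i) ?GG" by (rule unif_le_mono1[OF unif_eta[OF k(1) sq] g(2)])
  have pr: "unif_le I (\<lambda>i x. p i) ?GG" "unif_le I (\<lambda>i x. r i) ?GG"
    by (rule unif_leI[of 1], simp, use g(3) in simp, rule unif_leI[of 1], simp, use g(4) in simp)
  have c1: "unif_le I (\<lambda>i x. cc i) (\<lambda>i x. 1)"
    by (rule unif_le_mono[OF unif_le_err(8)[OF unif_cc], of 3]) (use elementary(3) in simp_all)
  have ce: "unif_le I (\<lambda>i x. cc i * eta i) ?GG"
    using unif_le_mult[OF c1 e] by simp
  have dHe: "dH i (p i) (eta i) (r i) x = (1 / 2) *\<^sub>R (eta i *\<^sub>R u1 (x - b i)) - al x *\<^sub>R (p i *\<^sub>R u1 (x - a i)) - be x *\<^sub>R (r i *\<^sub>R u1 (x - c i))" for i x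
    by (simp add: dH_def)
  have H: "unif_le I (\<lambda>i x. dH i (p i) (eta i) (r i) x) ?GG"
    unfolding dHe
    by (rule unif_le_diff[OF unif_le_diff[OF unif_le_linear[OF bounded_linear_scaleR_right unif_le_scaleR_left[OF e unif_le_data(2)]]
      unif_le_scaleR_right[OF unif_le_al(1) unif_le_scaleR_left[OF pr(1) unif_le_data(2)]]]
      unif_le_scaleR_right[OF unif_le_al(2) unif_le_scaleR_left[OF pr(2) unif_le_data(2)]]])
  have R: "unif_le I (\<lambda>i. RR i (p i) (r i)) ?GG"
    unfolding RR_def[abs_def]
    by (rule unif_le_add[OF unif_le_add[OF unif_le_diff[OF unif_le_mono1[OF unif_Fr g(1)] H]
      unif_le_scaleR_left[OF ce unif_le_data(13)]] unif_le_scaleR_left[OF e unif_le_data(2)]])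
  have GGi: "?GG i integrable_on {-pi..pi}" if "i \<in> I" for i
    by (rule integrable_add[OF FB_integrable(1)[OF that sq[OF that]] integrable_const_ivl])
  have "unif_le I (\<lambda>i x. cR i (p i) (r i)) (\<lambda>i x. integral {-pi..pi} (?GG i))"
  proof (rule unif_le_half_bound[where k=kpsi])
    show "unif_le I (\<lambda>i x. integral {-pi..pi} (\<lambda>x. RR i (p i) (r i) x \<bullet> z x)) (\<lambda>i x. integral {-pi..pi} (?GG i))"
      by (rule unif_le_integral[OF unif_le_inner_left[OF R unif_z(2)]]) (rule inner_abs_int[OF cont_data(6) RR_abs_int] GGi; assumption)+
    show "\<bar>kpsi i - 1\<bar> \<le> 1 / 2" if "i \<in> I" for i by (rule k(2)[OF that])
    show "kpsi i * cR i (p i) (r i) = integral {-pi..pi} (\<lambda>x. RR i (p i) (r i) x \<bullet> z x)" if "i \<in> I" for i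
    proof -
      have "kpsi i \<noteq> 0" using k(2)[OF that] by auto
      then show ?thesis by (simp add: cR_def)
    qed
  qed
  then have c: "unif_le I (\<lambda>i x. cR i (p i) (r i)) ?GG"
  proof (rule unif_le_mono[where K="1 + 2 * pi"])
    fix i x assume i: "i \<in> I"
    have "integral {-pi..pi} (?GG i) = AA i + 2 * pi * (AA i + (\<bar>p i\<bar> + \<bar>r i\<bar>))"
      unfolding Henstock_Kurzweil_Integration.integral_add[OF FB_integrable(1)[OF i sq[OF i]] integrable_const_ivl] by (simp add: AA_def)
    also have "\<dots> \<le> ?GG i x + 2 * pi * ?GG i x"
      by (rule add_mono[OF g(2)[OF i] mult_left_mono[OF add_increasing[OF FB_ge(1) order_refl]]]) simp
    finally show "integral {-pi..pi} (?GG i) \<le> (1 + 2 * pi) * ?GG i x" by (simp only: distrib_right mult_1)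
  qed simp
  show ?thesis unfolding VR_def[abs_def] by (rule unif_le_diff[OF R unif_le_scaleR_left[OF c unif_le_data(12)]])
qed

end

section \<open>Assembling the two estimates\<close>

definition bound_theta :: "(int \<Rightarrow> real) \<Rightarrow> (int \<Rightarrow> real \<Rightarrow> real^'n) \<Rightarrow> ennreal \<Rightarrow> int \<Rightarrow> ennreal" where
  "bound_theta \<theta> W p j =
     ennreal (\<Sum>k=-1..0. \<bar>delta_plus \<theta> (j + k)\<bar>\<^sup>2) +
     ennreal ((\<Sum>k=-1..1. \<bar>\<theta> (j + k)\<bar> ^ 3) * (\<Sum>k=-1..0. \<bar>delta_plus \<theta> (j + k)\<bar>)) +
     ennreal ((\<Sum>k=-1..1. \<bar>\<theta> (j + k)\<bar>) *
       (norm (delta_plus W j (-pi)) + norm (delta_plus (cell_deriv W) j (-pi)))) +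
     Lp_norm p cell (W j) * ennreal (norm (delta_plus W j (-pi))) +
     Lp_norm p cell (\<lambda>x. (norm (W j x))\<^sup>2)"

definition bound_w :: "(int \<Rightarrow> real) \<Rightarrow> (int \<Rightarrow> real \<Rightarrow> real^'n) \<Rightarrow> (int \<Rightarrow> real) \<Rightarrow> ennreal \<Rightarrow> int \<Rightarrow> ennreal" where
  "bound_w \<theta> W N\<theta> p j =
     ennreal ((\<Sum>k=-1..0. \<bar>delta_plus \<theta> (j + k)\<bar>) * (\<Sum>k=-1..1. \<bar>\<theta> (j + k)\<bar>)) +
     ennreal \<bar>\<theta> j\<bar> * Lp_norm p cell (W j) +
     ennreal ((\<Sum>k=-1..1. \<bar>\<theta> (j + k)\<bar>) *
       (\<Sum>k=-1..1. norm (delta_plus W (j + k) (-pi)) +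
                   norm (delta_plus (cell_deriv W) (j + k) (-pi)))) +
     Lp_norm p cell (W j) * ennreal (norm (delta_plus W j (-pi))) +
     Lp_norm p cell (\<lambda>x. (norm (W j x))\<^sup>2) +
     ennreal \<bar>N\<theta> j\<bar> + ennreal \<bar>N\<theta> (j + 1)\<bar> + ennreal \<bar>N\<theta> (j - 1)\<bar>"

lemma sum_neighbours:
  fixes g :: "int \<Rightarrow> 'a::comm_monoid_add"
  shows "(\<Sum>k=-1..1. g (j + k)) = g (j - 1) + (g j + g (j + 1))" "(\<Sum>k=-1..0. g (j + k)) = g (j - 1) + g j"
proof -
  have "{-1..1::int} = {-1, 0, 1}" "{-1..0::int} = {-1, 0}" by auto
  then show "(\<Sum>k=-1..1. g (j + k)) = g (j - 1) + (g j + g (j + 1))" "(\<Sum>k=-1..0. g (j + k)) = g (j - 1) + g j" by simp_all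
qed

text \<open>On the bounded cell the inequality t <= 1 + t^2 makes square integrable directions
  integrable, as the cell computations with \<open>V\<close> require.\<close>

lemma in_L2_cell_absolutely_integrable:
  fixes v :: "real \<Rightarrow> 'b::euclidean_space"
  assumes "in_Lp 2 cell v"
  shows "v absolutely_integrable_on {-pi..pi}"
proof -
  have v: "v \<in> borel_measurable (lebesgue_on cell)" "Lp_norm 2 cell v < \<infinity>" using assms by (simp_all add: in_Lp_def)
  then have e: "Lp_norm 2 cell v = ennreal (enn2real (Lp_norm 2 cell v))" by simp
  have p: "(1::ennreal) \<le> 2" "(2::ennreal) \<noteq> \<infinity>" by simp_all
  have I: "(\<integral>\<^sup>+ x. ennreal (norm (v x) powr 2) \<partial>lebesgue_on cell) = ennreal (enn2real (Lp_norm 2 cell v) powr 2)"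
    using Lp_norm_powr[OF p e enn2real_nonneg] by simp
  have m: "(\<lambda>x. ennreal (norm (v x) powr 2)) \<in> borel_measurable (lebesgue_on cell)" using v(1) by measurable
  have le: "t \<le> 1 + t powr 2" if "0 \<le> t" for t :: real
  proof -
    have "0 \<le> (t - 1 / 2)\<^sup>2 + 3 / 4" by simp
    then show ?thesis using that by (simp add: power2_eq_square algebra_simps)
  qed
  have "(\<integral>\<^sup>+ x. ennreal (norm (v x)) \<partial>lebesgue_on cell) \<le> (\<integral>\<^sup>+ x. ennreal 1 + ennreal (norm (v x) powr 2) \<partial>lebesgue_on cell)"
  proof (rule nn_integral_mono)
    fix x
    have "ennreal (norm (v x)) \<le> ennreal (1 + norm (v x) powr 2)" by (rule ennreal_leI[OF le]) simp
    also have "\<dots> = ennreal 1 + ennreal (norm (v x) powr 2)" by (rule ennreal_plus) simp_all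
    finally show "ennreal (norm (v x)) \<le> ennreal 1 + ennreal (norm (v x) powr 2)" .
  qed
  also have "\<dots> = (\<integral>\<^sup>+ x. ennreal 1 \<partial>lebesgue_on cell) + ennreal (enn2real (Lp_norm 2 cell v) powr 2)"
    unfolding I[symmetric] by (rule nn_integral_add[OF _ m]) simp
  also have "\<dots> < \<infinity>" using emeasure_cell by (simp add: emeasure_restrict_space cell_sets)
  finally have "integrable (lebesgue_on cell) v" using v(1) by (intro integrableI_bounded)
  then show ?thesis by (simp add: integrable_lebesgue_on_iff cell_sets absolutely_integrable_cell_iff)
qed

lemma AE_lebesgue_on_cell: "(AE x in lebesgue_on cell. P x) \<longleftrightarrow> (AE x in lebesgue. x \<in> cell \<longrightarrow> P x)"
  by (simp add: AE_restrict_space_iff cell_sets)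

lemma absolutely_integrable_imp_measurable_cell:
  fixes v :: "real \<Rightarrow> 'b::euclidean_space"
  assumes "v absolutely_integrable_on cell"
  shows "v \<in> borel_measurable (lebesgue_on cell)"
  using assms by (simp flip: integrable_lebesgue_on_iff[OF cell_sets])

context lattice_family begin

text \<open>Turns the defining property of the nonlinear terms, read in the cell \<open>J i\<close>,
  into the hypotheses on \<open>V\<close> in \<open>cell_equation\<close>.\<close>

lemma nonlinear_terms_cell:
  fixes N\<theta> :: "int \<Rightarrow> real" and Nw :: "int \<Rightarrow> real \<Rightarrow> real^'n"
  assumes i: "i \<in> I" and NT: "nonlinear_terms D f u z \<phi> \<psi> (\<theta> i) (X i) N\<theta> Nw"
    and \<eta>_def: "\<eta> = (\<lambda>j. A_nf_theta D z (X i) j + N\<theta> j)" and V_def: "V = (\<lambda>j x. A_nf_w D f u z \<phi> \<psi> (\<theta> i) (X i) j x + Nw j x)"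
  shows "V (J i) absolutely_integrable_on {-pi..pi}" "integral {-pi..pi} (\<lambda>x. V (J i) x \<bullet> z x) = 0"
    "AE x in lebesgue. x \<in> cell \<longrightarrow> dT i (\<eta> (J i + 1)) (\<eta> (J i)) (\<eta> (J i - 1)) (V (J i))
      (dcf i (\<eta> (J i + 1)) (\<eta> (J i)) (\<eta> (J i - 1)) (V (J i))) x = Fr i x"
proof -
  have nt: "in_X2_perp z V" "\<And>j. AE x in lebesgue_on cell. dT_phd u z \<phi> \<psi> (\<theta> i) (X i) \<eta> V j x =
      A_ch D f u (T_phd u z \<phi> \<psi> (\<theta> i) (X i)) j x + G f u (T_phd u z \<phi> \<psi> (\<theta> i) (X i)) j x"
    using NT unfolding nonlinear_terms_def Let_def V_def \<eta>_def by blast+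
  have "in_Lp 2 cell (V (J i))" using nt(1) by (simp add: in_X2_perp_def)
  then show V: "V (J i) absolutely_integrable_on {-pi..pi}" by (rule in_L2_cell_absolutely_integrable)
  have "(\<lambda>x. V (J i) x \<bullet> z x) absolutely_integrable_on {-pi..pi}"
    by (rule absolutely_integrable_bilinear_continuous[OF bounded_bilinear_inner V]) (intro continuous_intros)
  from pairing_eq_integral[OF this] show "integral {-pi..pi} (\<lambda>x. V (J i) x \<bullet> z x) = 0"
    using nt(1) by (simp add: in_X2_perp_def)
  show "AE x in lebesgue. x \<in> cell \<longrightarrow> dT i (\<eta> (J i + 1)) (\<eta> (J i)) (\<eta> (J i - 1)) (V (J i))
      (dcf i (\<eta> (J i + 1)) (\<eta> (J i)) (\<eta> (J i - 1)) (V (J i))) x = Fr i x"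
  proof (rule AE_mp[OF cell_rhs_AE[OF i]], rule AE_mp[OF nt(2)[of "J i", unfolded AE_lebesgue_on_cell]], intro AE_I2 impI)
    fix x
    assume x: "x \<in> cell \<longrightarrow> dT_phd u z \<phi> \<psi> (\<theta> i) (X i) \<eta> V (J i) x =
        A_ch D f u (T_phd u z \<phi> \<psi> (\<theta> i) (X i)) (J i) x + G f u (T_phd u z \<phi> \<psi> (\<theta> i) (X i)) (J i) x"
      "x \<in> cell \<longrightarrow> A_ch D f u (T_phd u z \<phi> \<psi> (\<theta> i) (X i)) (J i) x + G f u (T_phd u z \<phi> \<psi> (\<theta> i) (X i)) (J i) x = Fr i x" "x \<in> cell"
    have xin: "x \<in> {-pi..pi}" using x(3) by auto
    show "dT i (\<eta> (J i + 1)) (\<eta> (J i)) (\<eta> (J i - 1)) (V (J i)) (dcf i (\<eta> (J i + 1)) (\<eta> (J i)) (\<eta> (J i - 1)) (V (J i))) x = Fr i x"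
      unfolding dT_phd_eq[where V=V and \<eta>=\<eta>, OF i V xin, symmetric] x(1)[rule_format, OF x(3)] x(2)[rule_format, OF x(3)] ..
  qed
qed

lemma bounds_eq:
  assumes i: "i \<in> I" and p: "1 \<le> p"
    and \<beta>: "Lp_norm p cell (\<lambda>x. norm (W i x)) = ennreal \<beta>" "0 \<le> \<beta>" and \<gamma>: "Lp_norm p cell (\<lambda>x. (norm (W i x))\<^sup>2) = ennreal \<gamma>" "0 \<le> \<gamma>"
  shows "bound_theta (\<theta> i) (X i) p (J i) = ennreal ((\<bar>b i - c i\<bar>\<^sup>2 + \<bar>a i - b i\<bar>\<^sup>2) +
      (\<bar>c i\<bar> ^ 3 + (\<bar>b i\<bar> ^ 3 + \<bar>a i\<bar> ^ 3)) * (\<bar>b i - c i\<bar> + \<bar>a i - b i\<bar>) + sig i * (norm (dw i) + norm (dw1 i)) + \<beta> * norm (dw i) + \<gamma>)"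
    "bound_w (\<theta> i) (X i) N\<theta> p (J i) = ennreal (del i * sig i + \<bar>b i\<bar> * \<beta> +
      sig i * (\<Sum>k=-1..1. norm (delta_plus (X i) (J i + k) (-pi)) + norm (delta_plus (cell_deriv (X i)) (J i + k) (-pi))) +
      \<beta> * norm (dw i) + \<gamma> + \<bar>N\<theta> (J i)\<bar> + \<bar>N\<theta> (J i + 1)\<bar> + \<bar>N\<theta> (J i - 1)\<bar>)"
proof -
  have X: "X i (J i) x = W i x" if "x \<in> cell" for x by (rule X_eq[OF i]) (use that in auto)
  have L: "Lp_norm p cell (X i (J i)) = ennreal \<beta>" "Lp_norm p cell (\<lambda>x. (norm (X i (J i) x))\<^sup>2) = ennreal \<gamma>"
    using \<beta>(1) \<gamma>(1) Lp_norm_cong[of cell "X i (J i)" "W i" p, OF X cell_sets]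
      Lp_norm_cong[of cell "\<lambda>x. (norm (X i (J i) x))\<^sup>2" "\<lambda>x. (norm (W i x))\<^sup>2" p, OF _ cell_sets] X
    by (simp_all add: Lp_norm_norm)
  have s: "\<bar>c i\<bar> + (\<bar>b i\<bar> + \<bar>a i\<bar>) = sig i" "\<bar>b i - c i\<bar> + \<bar>a i - b i\<bar> = del i"
    by (simp_all add: sig_def del_def abs_minus_commute)
  have dp: "delta_plus (\<theta> i) (J i - 1) = b i - c i" "delta_plus (\<theta> i) (J i) = a i - b i"
    by (simp_all add: delta_plus_def \<theta>_eq[OF i])
  note sums = sum_neighbours[of "\<lambda>k. \<bar>\<theta> i k\<bar>"] sum_neighbours[of "\<lambda>k. \<bar>\<theta> i k\<bar> ^ 3"]
    sum_neighbours(2)[of "\<lambda>k. \<bar>delta_plus (\<theta> i) k\<bar>"] sum_neighbours(2)[of "\<lambda>k. \<bar>delta_plus (\<theta> i) k\<bar>\<^sup>2"]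
  note n = nonneg(1,2)[of i]
  have dn: "0 \<le> (\<Sum>k=-1..1. norm (delta_plus (X i) (J i + k) (-pi)) + norm (delta_plus (cell_deriv (X i)) (J i + k) (-pi)))"
    by (intro sum_nonneg) simp
  show "bound_theta (\<theta> i) (X i) p (J i) = ennreal ((\<bar>b i - c i\<bar>\<^sup>2 + \<bar>a i - b i\<bar>\<^sup>2) +
      (\<bar>c i\<bar> ^ 3 + (\<bar>b i\<bar> ^ 3 + \<bar>a i\<bar> ^ 3)) * (\<bar>b i - c i\<bar> + \<bar>a i - b i\<bar>) + sig i * (norm (dw i) + norm (dw1 i)) + \<beta> * norm (dw i) + \<gamma>)"
    unfolding bound_theta_def sums dp \<theta>_eq[OF i] s(1) L dw_eq[OF i, symmetric]
    using n \<beta>(2) \<gamma>(2) by (simp add: ennreal_plus ennreal_mult)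
  show "bound_w (\<theta> i) (X i) N\<theta> p (J i) = ennreal (del i * sig i + \<bar>b i\<bar> * \<beta> +
      sig i * (\<Sum>k=-1..1. norm (delta_plus (X i) (J i + k) (-pi)) + norm (delta_plus (cell_deriv (X i)) (J i + k) (-pi))) +
      \<beta> * norm (dw i) + \<gamma> + \<bar>N\<theta> (J i)\<bar> + \<bar>N\<theta> (J i + 1)\<bar> + \<bar>N\<theta> (J i - 1)\<bar>)"
    unfolding bound_w_def sums dp \<theta>_eq[OF i] s L dw_eq[OF i, symmetric]
    using n dn \<beta>(2) \<gamma>(2) by (simp add: ennreal_plus ennreal_mult)
qed

text \<open>The abstract bounds \<open>Eth\<close> and \<open>EN\<close> are compared with the
  brackets of the two estimates. L^1 quantities in the cell become L^p norms, and everything that is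
  constant on the cell is absorbed by the bounded measure of the cell.\<close>

lemma nonlinear_terms_bounds:
  fixes N\<theta> :: "'i \<Rightarrow> int \<Rightarrow> real" and Nw :: "'i \<Rightarrow> int \<Rightarrow> real \<Rightarrow> real^'n"
  assumes NT: "\<And>i. i \<in> I \<Longrightarrow> nonlinear_terms D f u z \<phi> \<psi> (\<theta> i) (X i) (N\<theta> i) (Nw i)"
    and k: "\<And>i. i \<in> I \<Longrightarrow> \<bar>kap i\<bar> \<le> 1 / 2" "\<And>i. i \<in> I \<Longrightarrow> \<bar>kpsi i - 1\<bar> \<le> 1 / 2"
  shows "\<exists>C>0. \<forall>i\<in>I. \<forall>p\<ge>1. ennreal \<bar>N\<theta> i (J i)\<bar> \<le> ennreal C * bound_theta (\<theta> i) (X i) p (J i) \<and>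
    Lp_norm p cell (Nw i (J i)) \<le> ennreal C * bound_w (\<theta> i) (X i) (N\<theta> i) p (J i)"
proof -
  define \<eta> where "\<eta> i j = A_nf_theta D z (X i) j + N\<theta> i j" for i j
  define g where "g i j = A_nf_theta D z (X i) j" for i j
  define V where "V i j x = A_nf_w D f u z \<phi> \<psi> (\<theta> i) (X i) j x + Nw i j x" for i j x
  interpret ce: cell_equation D f u u1 u2 u3 u4 z z1 z2 \<xi> \<xi>1 \<xi>2 \<psi> \<psi>1 \<psi>2 \<psi>3 \<rho> I a b c W W1 W2
    "\<lambda>i. \<eta> i (J i + 1)" "\<lambda>i. \<eta> i (J i)" "\<lambda>i. \<eta> i (J i - 1)" "\<lambda>i. g i (J i + 1)" "\<lambda>i. g i (J i)" "\<lambda>i. g i (J i - 1)" "\<lambda>i. V i (J i)"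
  proof
    fix i assume i: "i \<in> I"
    have e: "\<eta> i = (\<lambda>j. A_nf_theta D z (X i) j + N\<theta> i j)" "V i = (\<lambda>j x. A_nf_w D f u z \<phi> \<psi> (\<theta> i) (X i) j x + Nw i j x)"
      by (rule ext, rule \<eta>_def, rule ext, rule ext, rule V_def)
    note nt = nonlinear_terms_cell[OF i NT[OF i] e]
    show "g i (J i) = dw i \<bullet> (D *v z1 pi)" unfolding g_def A_nf_theta_eq[OF i] dw_eq[OF i] ..
    show "V i (J i) absolutely_integrable_on {-pi..pi}" by (rule nt(1))
    show "integral {-pi..pi} (\<lambda>x. V i (J i) x \<bullet> z x) = 0" by (rule nt(2))
    show "AE x in lebesgue. x \<in> cell \<longrightarrow> dT i (\<eta> i (J i + 1)) (\<eta> i (J i)) (\<eta> i (J i - 1)) (V i (J i))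
      (dcf i (\<eta> i (J i + 1)) (\<eta> i (J i)) (\<eta> i (J i - 1)) (V i (J i))) x = Fr i x" by (rule nt(3))
    show "\<bar>kap i\<bar> \<le> 1 / 2" "\<bar>kpsi i - 1\<bar> \<le> 1 / 2" by (rule k[OF i])+
  qed
  obtain C1 where C1: "C1 \<ge> 0" "\<forall>i\<in>I. \<forall>x\<in>{-pi..pi}. norm (\<eta> i (J i) - g i (J i)) \<le> C1 * ce.Eth i"
    by (rule unif_leE[OF ce.unif_N_theta])
  obtain C2 where C2: "C2 \<ge> 0" "\<forall>i\<in>I. \<forall>x\<in>{-pi..pi}. norm (ce.PN i x) \<le> C2 * ce.EN i x"
    by (rule unif_leE[OF ce.unif_PN])
  \<comment> \<open>\<open>P\<close> is the constant of \<open>integral_le_Lp_norm\<close>, and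
    \<open>Cg\<close> bounds a jump of Gamma W by the jump of \<open>W\<close>.\<close>
  define P where "P = 2 * pi + 1"
  define Cg where "Cg = norm (D *v z1 pi)"
  have P: "2 \<le> P" "1 \<le> P" "0 \<le> P" "0 \<le> Cg" using pi_ge_two by (simp_all add: P_def Cg_def)
  define K1 where "K1 = C1 * P"
  define K2 where "K2 = 3 * C2 * (2 * pi) * (P + Cg + 1)"
  have K: "0 \<le> K1" "0 \<le> K2" using C1(1) C2(1) P by (simp_all add: K1_def K2_def)
  have "ennreal \<bar>N\<theta> i (J i)\<bar> \<le> ennreal (K1 + K2 + 1) * bound_theta (\<theta> i) (X i) p (J i) \<and>
      Lp_norm p cell (Nw i (J i)) \<le> ennreal (K1 + K2 + 1) * bound_w (\<theta> i) (X i) (N\<theta> i) p (J i)" if i: "i \<in> I" and p: "1 \<le> p" for i p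
  proof -
    have cn: "continuous_on UNIV (\<lambda>x. norm (W i x))" "continuous_on UNIV (\<lambda>x. (norm (W i x))\<^sup>2)"
      by (intro continuous_intros i)+
    obtain \<beta> where \<beta>: "0 \<le> \<beta>" "Lp_norm p cell (\<lambda>x. norm (W i x)) = ennreal \<beta>" by (rule continuous_Lp_norm_finite[OF cn(1) p])
    obtain \<gamma> where \<gamma>: "0 \<le> \<gamma>" "Lp_norm p cell (\<lambda>x. (norm (W i x))\<^sup>2) = ennreal \<gamma>" by (rule continuous_Lp_norm_finite[OF cn(2) p])
    note be = bounds_eq[OF i p \<beta>(2,1) \<gamma>(2,1)]
    have m: "m i \<le> P * \<beta>" unfolding m_def P_def by (rule integral_le_Lp_norm[OF cn(1) norm_ge_zero p \<beta>(2,1)])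
    have q: "qW i \<le> P * \<gamma>" unfolding qW_def P_def by (rule integral_le_Lp_norm[OF cn(2) zero_le_power2 p \<gamma>(2,1)])
    note n = nonneg(1,2)[of i]
    have N1: "\<bar>N\<theta> i (J i)\<bar> \<le> C1 * ce.Eth i"
      using C1(2)[rule_format, OF i, of 0] by (simp add: \<eta>_def g_def)
    have d2: "(del i)\<^sup>2 \<le> P * (\<bar>b i - c i\<bar>\<^sup>2 + \<bar>a i - b i\<bar>\<^sup>2)"
    proof -
      have "(del i)\<^sup>2 \<le> 2 * (\<bar>b i - c i\<bar>\<^sup>2 + \<bar>a i - b i\<bar>\<^sup>2)"
        using sum_squares_bound[of "\<bar>a i - b i\<bar>" "\<bar>c i - b i\<bar>"] by (simp add: del_def power2_sum power2_commute[of "c i"] algebra_simps)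
      also have "\<dots> \<le> P * (\<bar>b i - c i\<bar>\<^sup>2 + \<bar>a i - b i\<bar>\<^sup>2)" by (rule mult_right_mono[OF P(1)]) simp
      finally show ?thesis .
    qed
    have Eth: "ce.Eth i \<le> P * ((\<bar>b i - c i\<bar>\<^sup>2 + \<bar>a i - b i\<bar>\<^sup>2) +
      (\<bar>c i\<bar> ^ 3 + (\<bar>b i\<bar> ^ 3 + \<bar>a i\<bar> ^ 3)) * (\<bar>b i - c i\<bar> + \<bar>a i - b i\<bar>) + sig i * (norm (dw i) + norm (dw1 i)) + \<beta> * norm (dw i) + \<gamma>)"
    proof -
      have "sig i * (norm (dw i) + norm (dw1 i)) \<le> P * (sig i * (norm (dw i) + norm (dw1 i)))"
        using mult_right_mono[OF P(2), of "sig i * (norm (dw i) + norm (dw1 i))"] n by simp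
      moreover have "m i * norm (dw i) \<le> P * (\<beta> * norm (dw i))" using mult_right_mono[OF m, of "norm (dw i)"] by simp
      moreover have "0 \<le> P * ((\<bar>c i\<bar> ^ 3 + (\<bar>b i\<bar> ^ 3 + \<bar>a i\<bar> ^ 3)) * (\<bar>b i - c i\<bar> + \<bar>a i - b i\<bar>))" using P by simp
      moreover have "x1 + x3 + x4 + x5 \<le> P * (t1 + t2 + t3 + t4 + t5)"
        if "x3 \<le> P * t3" "x4 \<le> P * t4" "0 \<le> P * t2" "x1 \<le> P * t1" "x5 \<le> P * t5" for x1 x3 x4 x5 t1 t2 t3 t4 t5
        using that by (simp add: distrib_left)
      ultimately show ?thesis unfolding ce.Eth_def using d2 q by blast
    qed
    let ?S1 = "(\<bar>b i - c i\<bar>\<^sup>2 + \<bar>a i - b i\<bar>\<^sup>2) +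
      (\<bar>c i\<bar> ^ 3 + (\<bar>b i\<bar> ^ 3 + \<bar>a i\<bar> ^ 3)) * (\<bar>b i - c i\<bar> + \<bar>a i - b i\<bar>) + sig i * (norm (dw i) + norm (dw1 i)) + \<beta> * norm (dw i) + \<gamma>"
    have S1: "0 \<le> ?S1" using n \<beta>(1) \<gamma>(1) by simp
    have "\<bar>N\<theta> i (J i)\<bar> \<le> C1 * (P * ?S1)" by (rule order_trans[OF N1 mult_left_mono[OF Eth C1(1)]])
    also have "\<dots> = K1 * ?S1" by (simp add: K1_def)
    also have "\<dots> \<le> (K1 + K2 + 1) * ?S1" by (rule mult_right_mono[OF _ S1]) (use K in simp)
    finally have "ennreal \<bar>N\<theta> i (J i)\<bar> \<le> ennreal ((K1 + K2 + 1) * ?S1)" by (rule ennreal_leI)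
    then have 1: "ennreal \<bar>N\<theta> i (J i)\<bar> \<le> ennreal (K1 + K2 + 1) * bound_theta (\<theta> i) (X i) p (J i)"
      unfolding be(1) using K S1 by (simp only: ennreal_mult add_nonneg_nonneg zero_le_one)
    define D1 where "D1 = (\<Sum>k=-1..1. norm (delta_plus (X i) (J i + k) (-pi)) + norm (delta_plus (cell_deriv (X i)) (J i + k) (-pi)))"
    define N3 where "N3 = \<bar>N\<theta> i (J i)\<bar> + \<bar>N\<theta> i (J i + 1)\<bar> + \<bar>N\<theta> i (J i - 1)\<bar>"
    have D1: "0 \<le> D1" unfolding D1_def by (intro sum_nonneg) simp
    have ns: "ce.ns i = N3" unfolding ce.ns_def unfolding \<eta>_def g_def N3_def by simp
    have gs: "ce.gs i \<le> Cg * D1"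
    proof -
      have b: "\<bar>g i l\<bar> \<le> Cg * (norm (delta_plus (X i) l (-pi)) + norm (delta_plus (cell_deriv (X i)) l (-pi)))" for l
      proof -
        have "\<bar>g i l\<bar> \<le> norm (delta_plus (X i) l (-pi)) * Cg"
          unfolding g_def A_nf_theta_eq[OF i] Cg_def by (rule Cauchy_Schwarz_ineq2)
        also have "\<dots> \<le> Cg * (norm (delta_plus (X i) l (-pi)) + norm (delta_plus (cell_deriv (X i)) l (-pi)))"
          unfolding mult.commute[of _ Cg] by (rule mult_left_mono[OF _ P(4)]) simp
        finally show ?thesis .
      qed
      show ?thesis
        using b[of "J i + 1"] b[of "J i"] b[of "J i - 1"]
        unfolding D1_def sum_neighbours[of "\<lambda>k. norm (delta_plus (X i) k (-pi)) + norm (delta_plus (cell_deriv (X i)) k (-pi))"] ce.gs_def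
        by (simp add: distrib_left)
    qed
    let ?S2 = "del i * sig i + \<bar>b i\<bar> * \<beta> + sig i * D1 + \<beta> * norm (dw i) + \<gamma> + \<bar>N\<theta> i (J i)\<bar> + \<bar>N\<theta> i (J i + 1)\<bar> + \<bar>N\<theta> i (J i - 1)\<bar>"
    have nn: "0 \<le> del i * sig i" "0 \<le> \<bar>b i\<bar> * \<beta>" "0 \<le> sig i * D1" "0 \<le> \<beta> * norm (dw i)" "0 \<le> N3"
      using n \<beta>(1) D1 by (simp_all add: N3_def)
    have S2: "?S2 = del i * sig i + \<bar>b i\<bar> * \<beta> + sig i * D1 + \<beta> * norm (dw i) + \<gamma> + N3" by (simp add: N3_def)
    have S20: "0 \<le> ?S2" unfolding S2 using nn \<gamma>(1) by simp
    \<comment> \<open>The contribution of \<open>m\<close> in \<open>err\<close> becomes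
      \<open>P\<close> times the L^p norm of \<open>W\<close>, that of \<open>qW\<close> becomes
      \<open>P\<close> times the L^p norm of its square, and the linear speeds are controlled by the
      jumps collected in \<open>D1\<close>.\<close>
    have "ce.KN i \<le> (del i * sig i + P * (\<bar>b i\<bar> * \<beta>)) + P * \<gamma> + N3 + Cg * (sig i * D1)"
      unfolding ce.KN_def err_def ns using mult_left_mono[OF m, of "\<bar>b i\<bar>"] q mult_left_mono[OF gs n(2)] by (intro add_mono) (simp_all add: ac_simps)
    then have KN: "ce.KN i + \<bar>b i\<bar> * \<beta> + \<gamma> \<le> (P + Cg + 1) * ?S2"
    proof -
      have arith: "x1 + y1 + w1 \<le> (P + Cg + 1) * (x2 + x3 + x4 + x5 + x6 + x7)"
        if "x1 \<le> (x2 + P * x3) + P * x6 + x7 + Cg * x4" "y1 = x3" "w1 = x6" "0 \<le> x2" "0 \<le> x3" "0 \<le> x4" "0 \<le> x5" "0 \<le> x6" "0 \<le> x7" for x1 y1 w1 x2 x3 x4 x5 x6 x7 :: real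
      proof -
        have "0 \<le> P * x2" "0 \<le> P * x4" "0 \<le> P * x5" "0 \<le> P * x7" "0 \<le> Cg * x2" "0 \<le> Cg * x3" "0 \<le> Cg * x5" "0 \<le> Cg * x6" "0 \<le> Cg * x7"
          using that P by simp_all
        then show ?thesis using that by (simp add: distrib_left distrib_right)
      qed
      assume "ce.KN i \<le> (del i * sig i + P * (\<bar>b i\<bar> * \<beta>)) + P * \<gamma> + N3 + Cg * (sig i * D1)"
      then show ?thesis unfolding S2 by (rule arith[OF _ refl refl nn(1-4) \<gamma>(1) nn(5)])
    qed
    have Nae: "AE x in lebesgue. x \<in> cell \<longrightarrow> Nw i (J i) x = ce.PN i x"
    proof (rule AE_mp[OF ce.Nw_AE[OF i]], rule AE_mp[OF A_nf_w_AE[OF i]], intro AE_I2 impI)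
      fix x assume "x \<in> cell" "x \<in> cell \<longrightarrow> ce.Nw i x = ce.PN i x"
        "x \<in> cell \<longrightarrow> A_nf_w D f u z \<phi> \<psi> (\<theta> i) (X i) (J i) x =
          Anf i (A_nf_theta D z (X i) (J i + 1)) (A_nf_theta D z (X i) (J i)) (A_nf_theta D z (X i) (J i - 1)) x"
      moreover have "ce.Nw i x = Nw i (J i) x + (A_nf_w D f u z \<phi> \<psi> (\<theta> i) (X i) (J i) x -
          Anf i (A_nf_theta D z (X i) (J i + 1)) (A_nf_theta D z (X i) (J i)) (A_nf_theta D z (X i) (J i - 1)) x)"
        unfolding ce.Nw_def unfolding V_def g_def by simp
      ultimately show "Nw i (J i) x = ce.PN i x" by simp
    qed
    have "ce.PN i absolutely_integrable_on cell"
      unfolding absolutely_integrable_cell_iff ce.PN_def[abs_def]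
      by (rule absolutely_integrable_continuous_real) (intro continuous_intros i)
    from absolutely_integrable_spike_AE(1)[OF this cell_sets Nae]
    have meas: "Nw i (J i) \<in> borel_measurable (lebesgue_on cell)" by (rule absolutely_integrable_imp_measurable_cell)
    have "Lp_norm p cell (Nw i (J i)) \<le> ennreal (3 * C2 * (2 * pi) * (ce.KN i + \<bar>b i\<bar> * \<beta> + \<gamma>))"
    proof (rule Lp_norm_dominated[OF p meas emeasure_cell _ cell_sets _ _ \<gamma>(2,1) \<beta>(2,1)])
      show "1 \<le> 2 * pi" using pi_ge_two by simp
      show "(\<lambda>x. (norm (W i x))\<^sup>2) \<in> borel_measurable (lebesgue_on cell)" "(\<lambda>x. norm (W i x)) \<in> borel_measurable (lebesgue_on cell)"
        by (rule continuous_measurable_cell, rule cn)+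
      show "0 \<le> ce.KN i" by (rule ce.KN_ge(5)[OF i])
      show "AE x in lebesgue_on cell. norm (Nw i (J i) x) \<le> C2 * (ce.KN i + \<bar>b i\<bar> * \<bar>norm (W i x)\<bar> + \<bar>(norm (W i x))\<^sup>2\<bar>)"
        unfolding AE_lebesgue_on_cell
      proof (rule AE_mp[OF Nae], intro AE_I2 impI)
        fix x assume x: "x \<in> cell \<longrightarrow> Nw i (J i) x = ce.PN i x" "x \<in> cell"
        have EN: "ce.EN i x = ce.KN i + \<bar>b i\<bar> * \<bar>norm (W i x)\<bar> + \<bar>(norm (W i x))\<^sup>2\<bar>"
          unfolding ce.EN_def by simp
        have "norm (ce.PN i x) \<le> C2 * ce.EN i x" using C2(2) i x(2) by simp
        then show "norm (Nw i (J i) x) \<le> C2 * (ce.KN i + \<bar>b i\<bar> * \<bar>norm (W i x)\<bar> + \<bar>(norm (W i x))\<^sup>2\<bar>)"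
          unfolding x(1)[rule_format, OF x(2)] EN .
      qed
    qed (use C2(1) in simp_all)
    also have "\<dots> \<le> ennreal ((K1 + K2 + 1) * ?S2)"
    proof (rule ennreal_leI)
      have "3 * C2 * (2 * pi) * (ce.KN i + \<bar>b i\<bar> * \<beta> + \<gamma>) \<le> 3 * C2 * (2 * pi) * ((P + Cg + 1) * ?S2)"
        by (rule mult_left_mono[OF KN]) (use C2(1) in simp)
      also have "\<dots> = K2 * ?S2" by (simp only: K2_def mult.assoc)
      also have "\<dots> \<le> (K1 + K2 + 1) * ?S2" by (rule mult_right_mono[OF _ S20]) (use K in simp)
      finally show "3 * C2 * (2 * pi) * (ce.KN i + \<bar>b i\<bar> * \<beta> + \<gamma>) \<le> (K1 + K2 + 1) * ?S2" .
    qed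
    also have "\<dots> = ennreal (K1 + K2 + 1) * bound_w (\<theta> i) (X i) (N\<theta> i) p (J i)"
      unfolding be(2) D1_def[symmetric] by (rule ennreal_mult) (use K S20 in simp_all)
    finally show ?thesis using 1 by blast
  qed
  moreover have "0 < K1 + K2 + 1" using K by simp
  ultimately show ?thesis by blast
qed

end

section \<open>Square summability and existence of the nonlinear terms\<close>

lemma summable_on_int_shift:
  fixes g :: "int \<Rightarrow> real"
  assumes "g summable_on UNIV"
  shows "(\<lambda>j. g (j + k)) summable_on UNIV"
proof -
  have "bij_betw (\<lambda>j. j + k) UNIV (UNIV :: int set)" by (rule bij_betwI[where g="\<lambda>j. j - k"]) simp_all
  then show ?thesis using summable_on_reindex_bij_betw[of "\<lambda>j. j + k" UNIV UNIV g] assms by blast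
qed

lemma cells_intersection_negligible:
  fixes i k :: int
  assumes "i \<noteq> k"
  shows "negligible ({-pi + 2 * pi * of_int i..pi + 2 * pi * of_int i} \<inter> {-pi + 2 * pi * of_int k..pi + 2 * pi * of_int k})"
proof (rule negligible_subset)
  show "negligible {pi + 2 * pi * real_of_int i, pi + 2 * pi * real_of_int k}" by simp
  have le: "pi + 2 * pi * real_of_int p \<le> - pi + 2 * pi * real_of_int q" if "p < q" for p q :: int
  proof -
    have "real_of_int p + 1 \<le> real_of_int q" using that by linarith
    then have "2 * pi * (real_of_int p + 1) \<le> 2 * pi * real_of_int q" by (rule mult_left_mono) simp
    then show ?thesis by (simp add: distrib_left)
  qed
  from assms have "i < k \<or> k < i" by linarith
  then show "{-pi + 2 * pi * of_int i..pi + 2 * pi * of_int i} \<inter> {-pi + 2 * pi * of_int k..pi + 2 * pi * of_int k}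
      \<subseteq> {pi + 2 * pi * of_int i, pi + 2 * pi * of_int k}"
    using le[of i k] le[of k i] by force
qed

text \<open>The closed cells overlap only in null sets, so every finite sum of cell integrals is an
  integral over part of the line and bounded by the total.\<close>

lemma summable_on_cells:
  fixes g :: "real \<Rightarrow> real"
  assumes g: "g absolutely_integrable_on UNIV" and nn: "\<And>x. 0 \<le> g x"
  shows "(\<lambda>j::int. integral {-pi..pi} (\<lambda>x. g (2 * pi * of_int j + x))) summable_on UNIV"
    "(\<lambda>x. g (t + x)) integrable_on {r..s}"
proof -
  have gi: "g absolutely_integrable_on {p..q}" for p q by (rule set_integrable_subset[OF g]) simp_all
  show "(\<lambda>x. g (t + x)) integrable_on {r..s}"
    by (rule set_lebesgue_integral_eq_integral(1)[OF absolutely_integrable_shift(1)[OF gi]])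
  define T where "T j = {-pi + 2 * pi * real_of_int j..pi + 2 * pi * real_of_int j}" for j :: int
  have e: "integral {-pi..pi} (\<lambda>x. g (2 * pi * of_int j + x)) = integral (T j) g" for j :: int
    unfolding T_def by (rule absolutely_integrable_shift(2)[OF gi])
  have Ti: "(g has_integral integral (T j) g) (T j)" for j
    unfolding T_def by (rule integrable_integral[OF set_lebesgue_integral_eq_integral(1)[OF gi]])
  show "(\<lambda>j::int. integral {-pi..pi} (\<lambda>x. g (2 * pi * of_int j + x))) summable_on UNIV"
    unfolding e
  proof (rule nonneg_bounded_partial_sums_imp_summable_on)
    show "0 \<le> integral (T j) g" for j by (rule has_integral_nonneg[OF Ti nn])
    show "\<forall>\<^sub>F F in finite_subsets_at_top UNIV. (\<Sum>j\<in>F. integral (T j) g) \<le> integral UNIV g"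
    proof (rule eventually_finite_subsets_at_top_weakI)
      fix F :: "int set" assume F: "finite F"
      have "(g has_integral (\<Sum>j\<in>F. integral (T j) g)) (\<Union>j\<in>F. T j)"
        by (rule has_integral_UN[OF F Ti]) (unfold pairwise_def T_def, intro ballI impI, rule cells_intersection_negligible, assumption)
      moreover have "(g has_integral integral UNIV g) UNIV"
        by (rule integrable_integral[OF set_lebesgue_integral_eq_integral(1)[OF g]])
      ultimately show "(\<Sum>j\<in>F. integral (T j) g) \<le> integral UNIV g"
        by (rule has_integral_subset_le[OF subset_UNIV]) (simp add: nn)
    qed
  qed
qed

lemma in_L2_line_square:
  fixes h :: "real \<Rightarrow> 'b::euclidean_space"
  assumes "in_Lp 2 UNIV h"
  shows "(\<lambda>x. (norm (h x))\<^sup>2) absolutely_integrable_on UNIV"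
proof -
  have h: "h \<in> borel_measurable (lebesgue_on UNIV)" "Lp_norm 2 UNIV h < \<infinity>" using assms by (simp_all add: in_Lp_def)
  then have e: "Lp_norm 2 UNIV h = ennreal (enn2real (Lp_norm 2 UNIV h))" by simp
  have p: "(1::ennreal) \<le> 2" "(2::ennreal) \<noteq> \<infinity>" by simp_all
  have "(\<integral>\<^sup>+ x. ennreal (norm (h x) powr 2) \<partial>lebesgue_on UNIV) < \<infinity>"
    using Lp_norm_powr[OF p e enn2real_nonneg] by simp
  then have I: "(\<integral>\<^sup>+ x. ennreal (norm ((norm (h x))\<^sup>2)) \<partial>lebesgue_on UNIV) < \<infinity>" by simp
  have m: "(\<lambda>x. (norm (h x))\<^sup>2) \<in> borel_measurable (lebesgue_on UNIV)" using h(1) by measurable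
  have "integrable (lebesgue_on UNIV) (\<lambda>x. (norm (h x))\<^sup>2)" by (rule integrableI_bounded[OF m I])
  then show ?thesis by (subst (asm) integrable_lebesgue_on_iff) simp_all
qed

lemma L2_norm_square_le:
  fixes v :: "real \<Rightarrow> 'b::euclidean_space"
  assumes v: "v absolutely_integrable_on {-pi..pi}" and g: "g integrable_on {-pi..pi}" "\<And>x. 0 \<le> g x"
    and le: "\<And>x. x \<in> cell \<Longrightarrow> (norm (v x))\<^sup>2 \<le> g x"
  shows "in_Lp 2 cell v" "(Lp_norm 2 cell v)\<^sup>2 \<le> ennreal (integral {-pi..pi} g)"
proof -
  have m: "v \<in> borel_measurable (lebesgue_on cell)"
    by (rule absolutely_integrable_imp_measurable_cell) (simp add: v absolutely_integrable_cell_iff)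
  have ai: "g absolutely_integrable_on cell"
    unfolding absolutely_integrable_cell_iff by (rule nonnegative_absolutely_integrable_1[OF g(1)]) (rule g(2))
  have I0: "0 \<le> integral {-pi..pi} g" by (rule Henstock_Kurzweil_Integration.integral_nonneg[OF g(1) g(2)])
  have "(\<integral>\<^sup>+ x. ennreal (norm (v x) powr 2) \<partial>lebesgue_on cell) \<le> (\<integral>\<^sup>+ x. ennreal (g x) \<partial>lebesgue_on cell)"
    by (rule nn_integral_mono) (use le in \<open>simp add: ennreal_leI\<close>)
  also have "\<dots> = ennreal (LINT x|lebesgue_on cell. g x)"
    by (rule nn_integral_eq_integral) (use ai g(2) in \<open>auto simp: integrable_lebesgue_on_iff cell_sets\<close>)
  also have "(LINT x|lebesgue_on cell. g x) = integral {-pi..pi} g"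
    by (simp add: LINT_lebesgue_on_eq_integral[OF ai cell_sets] integral_cell)
  finally have "(\<integral>\<^sup>+ x. ennreal (norm (v x) powr enn2real 2) \<partial>lebesgue_on cell) \<le> ennreal (sqrt (integral {-pi..pi} g) powr enn2real 2)"
    using I0 by simp
  from Lp_norm_leI[OF _ _ _ this] have L: "Lp_norm 2 cell v \<le> ennreal (sqrt (integral {-pi..pi} g))" using I0 by simp
  then have "Lp_norm 2 cell v < \<infinity>" by (rule order.strict_trans1) simp
  with m show "in_Lp 2 cell v" by (simp add: in_Lp_def)
  have "(Lp_norm 2 cell v)\<^sup>2 \<le> (ennreal (sqrt (integral {-pi..pi} g)))\<^sup>2" by (rule power_mono[OF L]) simp
  also have "\<dots> = ennreal (integral {-pi..pi} g)" using I0 by (simp add: ennreal_power)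
  finally show "(Lp_norm 2 cell v)\<^sup>2 \<le> ennreal (integral {-pi..pi} g)" .
qed

lemma infsum_ennreal_finite:
  fixes q :: "'a \<Rightarrow> real"
  assumes q: "q summable_on UNIV" "\<And>j. 0 \<le> q j" and t: "\<And>j. t j \<le> ennreal (q j)"
  shows "(\<Sum>\<^sub>\<infinity>j. t j) < (\<infinity>::ennreal)"
proof -
  have "(\<Sum>\<^sub>\<infinity>j. t j) \<le> ennreal (infsum q UNIV)"
  proof (rule infsum_le_finite_sums)
    show "t summable_on UNIV" by (rule nonneg_summable_on_complete) simp
    fix F :: "'a set" assume F: "finite F"
    have "sum t F \<le> (\<Sum>j\<in>F. ennreal (q j))" by (rule sum_mono) (rule t)
    also have "\<dots> = ennreal (sum q F)" by (rule sum_ennreal) (rule q(2))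
    also have "\<dots> \<le> ennreal (infsum q UNIV)" by (rule ennreal_leI[OF finite_sum_le_infsum[OF q(1) F]]) (simp_all add: q(2))
    finally show "sum t F \<le> ennreal (infsum q UNIV)" .
  qed
  then show ?thesis by (rule order.strict_trans1) simp
qed

lemma square_sum4_le: "(x + (y + (w + v)))\<^sup>2 \<le> 4 * (x\<^sup>2 + (y\<^sup>2 + (w\<^sup>2 + v\<^sup>2)))" for x y w v :: real
proof -
  have "0 \<le> (x - y)\<^sup>2 + (y - w)\<^sup>2 + (x - w)\<^sup>2 + (x - v)\<^sup>2 + (y - v)\<^sup>2 + (w - v)\<^sup>2" by simp
  then show ?thesis by (simp add: power2_eq_square algebra_simps)
qed

text \<open>Supplies the smallness by which \<open>1 - kap\<close> and \<open>kpsi\<close> stay away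
  from zero once the state is small enough; the constant \<open>K\<close> is common to the whole
  family.\<close>

lemma (in cell_family) unif_small:
  "\<exists>K\<ge>0. \<forall>i\<in>I. \<forall>e. \<bar>a i\<bar> \<le> e \<longrightarrow> \<bar>b i\<bar> \<le> e \<longrightarrow> \<bar>c i\<bar> \<le> e \<longrightarrow> (\<forall>x\<in>{-pi..pi}. norm (W i x) \<le> e) \<longrightarrow>
    \<bar>kap i\<bar> \<le> K * e \<and> \<bar>kpsi i - 1\<bar> \<le> K * e"
proof -
  obtain C1 where C1: "C1 \<ge> 0" "\<forall>i\<in>I. \<forall>x\<in>{-pi..pi}. norm (kap i) \<le> C1 * (m i + sig i)" by (rule unif_leE[OF unif_kap])
  obtain C2 where C2: "C2 \<ge> 0" "\<forall>i\<in>I. \<forall>x\<in>{-pi..pi}. norm (kpsi i - 1) \<le> C2 * \<bar>b i\<bar>" by (rule unif_leE[OF unif_kpsi])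
  have "\<bar>kap i\<bar> \<le> (C1 * (2 * pi + 3) + C2) * e \<and> \<bar>kpsi i - 1\<bar> \<le> (C1 * (2 * pi + 3) + C2) * e"
    if i: "i \<in> I" and e: "\<bar>a i\<bar> \<le> e" "\<bar>b i\<bar> \<le> e" "\<bar>c i\<bar> \<le> e" "\<forall>x\<in>{-pi..pi}. norm (W i x) \<le> e" for i e
  proof -
    have e0: "0 \<le> e" using e(1) by (rule order_trans[OF abs_ge_zero])
    have "m i \<le> integral {-pi..pi} (\<lambda>x. e)"
      unfolding m_def by (rule integral_le[OF ci integrable_const_ivl]) (use e(4) in \<open>auto intro!: continuous_intros i\<close>)
    then have m: "m i \<le> 2 * pi * e" by simp
    have s: "sig i \<le> 3 * e" using e(1-3) by (simp add: sig_def)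
    have "\<bar>kap i\<bar> \<le> C1 * (m i + sig i)" using C1(2)[rule_format, OF i, of 0] by simp
    also have "\<dots> \<le> C1 * (2 * pi * e + 3 * e)" by (rule mult_left_mono[OF add_mono[OF m s] C1(1)])
    also have "\<dots> = (C1 * (2 * pi + 3)) * e" by (simp add: algebra_simps)
    also have "\<dots> \<le> (C1 * (2 * pi + 3) + C2) * e" by (rule mult_right_mono[OF _ e0]) (simp add: C2(1))
    finally have 1: "\<bar>kap i\<bar> \<le> (C1 * (2 * pi + 3) + C2) * e" .
    have "\<bar>kpsi i - 1\<bar> \<le> C2 * \<bar>b i\<bar>" using C2(2)[rule_format, OF i, of 0] by simp
    also have "\<dots> \<le> C2 * e" by (rule mult_left_mono[OF e(2) C2(1)])
    also have "\<dots> \<le> (C1 * (2 * pi + 3) + C2) * e" by (rule mult_right_mono[OF _ e0]) (use C1(1) in simp)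
    finally show ?thesis using 1 by blast
  qed
  moreover have "0 \<le> C1 * (2 * pi + 3) + C2" using C1(1) C2(1) by simp
  ultimately show ?thesis by blast
qed

text \<open>\<open>\<iota>\<close> selects, for one fixed state, the index of each of its cells. The
  cellwise solutions are put together, and the bounds by \<open>SS\<close> show that speeds and
  profiles are square summable over the lattice.\<close>

lemma (in lattice_family) nonlinear_terms_exist:
  fixes \<iota> :: "int \<Rightarrow> 'i" and t :: "int \<Rightarrow> real" and Y :: "int \<Rightarrow> real \<Rightarrow> real^'n" and l l2 :: "real \<Rightarrow> real^'n"
  assumes k: "\<And>i. i \<in> I \<Longrightarrow> \<bar>kap i\<bar> \<le> 1 / 2" "\<And>i. i \<in> I \<Longrightarrow> \<bar>kpsi i - 1\<bar> \<le> 1 / 2"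
    and sq: "\<And>i. i \<in> I \<Longrightarrow> (\<lambda>x. (norm (W2 i x))\<^sup>2) integrable_on {-pi..pi}"
    and \<iota>: "\<And>j. \<iota> j \<in> I" "\<And>j. J (\<iota> j) = j" "\<And>j. \<theta> (\<iota> j) = t" "\<And>j. X (\<iota> j) = Y" "\<And>j. w (\<iota> j) = l"
      "\<And>j x. W2 (\<iota> j) x = l2 (2 * pi * of_int j + x)"
    and l: "in_Lp 2 UNIV l" "in_Lp 2 UNIV l2" and t: "(\<lambda>j. \<bar>t j\<bar>) summable_on UNIV"
  shows "\<exists>N\<theta> Nw. nonlinear_terms D f u z \<phi> \<psi> t Y N\<theta> Nw"
proof -
  note I = \<iota>(1)
  \<comment> \<open>The phase equation involves no neighbouring speed, so all speeds are determined
    first, cell by cell; only afterwards are they inserted into the profiles. No infinite coupled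
    system has to be inverted.\<close>
  define et where "et j = eta (\<iota> j)" for j
  define V where "V j = VR (\<iota> j) (et (j + 1)) (et (j - 1))" for j
  have abc_\<iota>: "a (\<iota> j) = t (j + 1)" "b (\<iota> j) = t j" "c (\<iota> j) = t (j - 1)" for j
    using \<theta>_eq[OF I, of j] unfolding \<iota>(2,3) by simp_all
  have t1: "\<bar>t j\<bar> \<le> 1" for j using abc(2)[OF I, of j] by (simp add: abc_\<iota>)
  have t2: "(\<lambda>j. (t j)\<^sup>2) summable_on UNIV"
  proof (rule summable_on_comparison_test[OF t])
    fix j :: int
    have "\<bar>t j\<bar> * \<bar>t j\<bar> \<le> \<bar>t j\<bar> * 1" by (rule mult_left_mono[OF t1]) simp
    then show "(t j)\<^sup>2 \<le> \<bar>t j\<bar>" by (simp add: power2_eq_square abs_mult_self_eq)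
  qed simp
  have SSs: "(\<lambda>j. SS (\<iota> j)) summable_on UNIV"
  proof -
    have "(\<lambda>j. (sig (\<iota> j))\<^sup>2) summable_on UNIV"
    proof (rule summable_on_comparison_test)
      \<comment> \<open>Summability of the squared phases is inherited by both shifts; writing the
        left shift as \<open>j + - 1\<close> lets one shift lemma serve both directions.\<close>
      show "(\<lambda>j. 3 * ((t (j + 1))\<^sup>2 + (t j)\<^sup>2 + (t (j + - 1))\<^sup>2)) summable_on UNIV"
        by (intro summable_on_cmult_right summable_on_add summable_on_int_shift[OF t2] t2)
      show "(sig (\<iota> j))\<^sup>2 \<le> 3 * ((t (j + 1))\<^sup>2 + (t j)\<^sup>2 + (t (j + - 1))\<^sup>2)" for j
        using square_sum3_le[of "\<bar>t (j + 1)\<bar>" "\<bar>t j\<bar>" "\<bar>t (j - 1)\<bar>"] by (simp add: sig_def abc_\<iota>)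
    qed simp
    then show ?thesis
      unfolding SS_def \<iota>(6) W_eq[OF I] \<iota>(2,5)
      by (intro summable_on_add summable_on_cells(1)[OF in_L2_line_square] l zero_le_power2)
  qed
  have S0: "0 \<le> SS (\<iota> j)" for j
    unfolding SS_def by (intro add_nonneg_nonneg Henstock_Kurzweil_Integration.integral_nonneg sq[OF I] zero_le_power2)
      (intro ci continuous_intros I)
  note FBi = FB_integrable[OF I sq[OF I]]
  have AAs: "(AA (\<iota> j))\<^sup>2 \<le> 6 * pi * (1 + 2 * pi) * SS (\<iota> j)" for j unfolding AA_def by (rule FBi(4))
  obtain C where C: "C \<ge> 0" "\<forall>i\<in>I. \<forall>x\<in>{-pi..pi}. norm (eta i) \<le> C * AA i" by (rule unif_leE[OF unif_eta[OF k(1) sq]])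
  have ets: "(et j)\<^sup>2 \<le> C\<^sup>2 * (6 * pi * (1 + 2 * pi)) * SS (\<iota> j)" for j
  proof -
    have "\<bar>et j\<bar> \<le> C * AA (\<iota> j)" using C(2)[rule_format, OF I, of 0 j] by (simp add: et_def)
    then have "\<bar>et j\<bar>\<^sup>2 \<le> (C * AA (\<iota> j))\<^sup>2" by (rule power_mono) simp
    then have "(et j)\<^sup>2 \<le> (C * AA (\<iota> j))\<^sup>2" by (simp only: power2_abs)
    also have "\<dots> = C\<^sup>2 * (AA (\<iota> j))\<^sup>2" by (simp add: power_mult_distrib)
    also have "\<dots> \<le> C\<^sup>2 * (6 * pi * (1 + 2 * pi) * SS (\<iota> j))" by (rule mult_left_mono[OF AAs]) simp
    finally show ?thesis by (simp only: mult.assoc)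
  qed
  have et2: "(\<lambda>j. (et j)\<^sup>2) summable_on UNIV"
    by (rule summable_on_comparison_test[OF summable_on_cmult_right[OF SSs] ets]) simp
  obtain C' where C': "C' \<ge> 0" "\<forall>i\<in>I. \<forall>x\<in>{-pi..pi}. norm (VR i (et (J i + 1)) (et (J i - 1)) x) \<le>
      C' * (FB i x + (AA i + (\<bar>et (J i + 1)\<bar> + \<bar>et (J i - 1)\<bar>)))"
    by (rule unif_leE[OF unif_VR[OF k sq]])
  define q where "q j x = 4 * C'\<^sup>2 * ((FB (\<iota> j) x)\<^sup>2 + ((AA (\<iota> j))\<^sup>2 + ((et (j + 1))\<^sup>2 + (et (j + - 1))\<^sup>2)))" for j x
  define r where "r j = (AA (\<iota> j))\<^sup>2 + ((et (j + 1))\<^sup>2 + (et (j + - 1))\<^sup>2)" for j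
  have V: "V j absolutely_integrable_on {-pi..pi}" for j unfolding V_def by (rule VR_abs_int[OF I])
  have Vq: "(norm (V j x))\<^sup>2 \<le> q j x" if "x \<in> cell" for j x
  proof -
    have "norm (V j x) \<le> C' * (FB (\<iota> j) x + (AA (\<iota> j) + (\<bar>et (j + 1)\<bar> + \<bar>et (j + - 1)\<bar>)))"
      using C'(2)[rule_format, OF I, of x j] that by (simp add: V_def \<iota>(2))
    then have "(norm (V j x))\<^sup>2 \<le> (C' * (FB (\<iota> j) x + (AA (\<iota> j) + (\<bar>et (j + 1)\<bar> + \<bar>et (j + - 1)\<bar>))))\<^sup>2"
      by (rule power_mono) simp
    also have "\<dots> = C'\<^sup>2 * (FB (\<iota> j) x + (AA (\<iota> j) + (\<bar>et (j + 1)\<bar> + \<bar>et (j + - 1)\<bar>)))\<^sup>2" by (simp only: power_mult_distrib)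
    also have "\<dots> \<le> C'\<^sup>2 * (4 * ((FB (\<iota> j) x)\<^sup>2 + ((AA (\<iota> j))\<^sup>2 + (\<bar>et (j + 1)\<bar>\<^sup>2 + \<bar>et (j + - 1)\<bar>\<^sup>2))))"
      by (rule mult_left_mono[OF square_sum4_le]) simp
    also have "\<dots> = q j x" unfolding q_def by (simp only: power2_abs ac_simps)
    finally show ?thesis .
  qed
  have qi: "q j integrable_on {-pi..pi}" "integral {-pi..pi} (q j) = 4 * C'\<^sup>2 * (integral {-pi..pi} (\<lambda>x. (FB (\<iota> j) x)\<^sup>2) + 2 * pi * r j)" for j
  proof -
    have e: "q j = (\<lambda>x. (4 * C'\<^sup>2) *\<^sub>R ((FB (\<iota> j) x)\<^sup>2 + r j))" by (simp add: q_def[abs_def] r_def)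
    show "q j integrable_on {-pi..pi}" unfolding e by (intro integrable_cmul integrable_add FBi(2) integrable_const_ivl)
    show "integral {-pi..pi} (q j) = 4 * C'\<^sup>2 * (integral {-pi..pi} (\<lambda>x. (FB (\<iota> j) x)\<^sup>2) + 2 * pi * r j)"
      unfolding e integral_cmul Henstock_Kurzweil_Integration.integral_add[OF FBi(2) integrable_const_ivl] by simp
  qed
  have q0: "0 \<le> q j x" for j x unfolding q_def by simp
  note L2 = L2_norm_square_le[OF V qi(1) q0 Vq]
  have "(\<lambda>j. r j) summable_on UNIV"
    unfolding r_def
    by (intro summable_on_add summable_on_int_shift[OF et2] summable_on_comparison_test[OF summable_on_cmult_right[OF SSs] AAs] zero_le_power2)
  moreover have "(\<lambda>j. integral {-pi..pi} (\<lambda>x. (FB (\<iota> j) x)\<^sup>2)) summable_on UNIV"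
    by (rule summable_on_comparison_test[OF summable_on_cmult_right[OF SSs] FBi(3)])
      (rule Henstock_Kurzweil_Integration.integral_nonneg[OF FBi(2)], simp)
  ultimately have qs: "(\<lambda>j. integral {-pi..pi} (q j)) summable_on UNIV"
    unfolding qi(2) by (intro summable_on_cmult_right summable_on_add)
  have X2: "in_X2_perp z V"
    unfolding in_X2_perp_def
  proof (intro conjI allI)
    show "in_Lp 2 cell (V j)" for j by (rule L2(1))
    show "(\<Sum>\<^sub>\<infinity>j. (Lp_norm 2 cell (V j))\<^sup>2) < \<infinity>"
      by (rule infsum_ennreal_finite[OF qs _ L2(2)]) (rule Henstock_Kurzweil_Integration.integral_nonneg[OF qi(1) q0])
    fix j
    have "(\<lambda>x. V j x \<bullet> z x) absolutely_integrable_on {-pi..pi}"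
      by (rule absolutely_integrable_bilinear_continuous[OF bounded_bilinear_inner V]) (intro continuous_intros)
    from pairing_eq_integral[OF this] show "pairing (V j) z = 0"
      using solution(1)[OF I k[OF I], of j "et (j + 1)" "et (j - 1)"] by (simp add: V_def)
  qed
  have eq: "AE x in lebesgue_on cell. dT_phd u z \<phi> \<psi> t Y et V j x = A_ch D f u (T_phd u z \<phi> \<psi> t Y) j x + G f u (T_phd u z \<phi> \<psi> t Y) j x" for j
    unfolding AE_lebesgue_on_cell
  proof (rule AE_mp[OF cell_rhs_AE[OF I, of j, unfolded \<iota>(2-4)]], intro AE_I2 impI)
    fix x
    assume x: "x \<in> cell \<longrightarrow> A_ch D f u (T_phd u z \<phi> \<psi> t Y) j x + G f u (T_phd u z \<phi> \<psi> t Y) j x = Fr (\<iota> j) x" "x \<in> cell"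
    have xin: "x \<in> {-pi..pi}" using x(2) by auto
    have VJ: "V (J (\<iota> j)) absolutely_integrable_on {-pi..pi}" by (rule V)
    have "dT_phd u z \<phi> \<psi> t Y et V j x = dT (\<iota> j) (et (j + 1)) (et j) (et (j - 1)) (V j) (dcf (\<iota> j) (et (j + 1)) (et j) (et (j - 1)) (V j)) x"
      using dT_phd_eq[where V=V and \<eta>=et and i="\<iota> j" and x=x, OF I VJ xin] unfolding \<iota>(2-4) .
    also have "\<dots> = Fr (\<iota> j) x" unfolding V_def et_def[of j] by (rule solution(2)[OF I k[OF I]])
    finally show "dT_phd u z \<phi> \<psi> t Y et V j x = A_ch D f u (T_phd u z \<phi> \<psi> t Y) j x + G f u (T_phd u z \<phi> \<psi> t Y) j x"
      using x by simp
  qed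
  have "nonlinear_terms D f u z \<phi> \<psi> t Y (\<lambda>j. et j - A_nf_theta D z Y j) (\<lambda>j x. V j x - A_nf_w D f u z \<phi> \<psi> t Y j x)"
    unfolding nonlinear_terms_def Let_def add_diff_cancel_left' add.commute[of "A_nf_theta D z Y _"] add.commute[of "A_nf_w D f u z \<phi> \<psi> t Y _ _"] diff_add_cancel
    using et2 X2 eq by (simp add: in_l2_def)
  then show ?thesis by blast
qed

section \<open>From the hypotheses to the abstract cell\<close>

text \<open>The given cutoff is regular only inside the cell, but it is constant on the outer parts,
  so continuing it by these constants is smooth. The cell and the two half lines beyond
  \<open>pi / 2\<close> are open and cover the line, and the candidate derivatives agree on the
  overlaps by uniqueness of derivatives.\<close>

lemma cutoff_extension:
  fixes \<phi> :: "real \<Rightarrow> real"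
  assumes c: "C_k_on (Suc (Suc k)) cell \<phi>" and odd: "\<forall>x\<in>{-pi..pi}. \<phi> (-x) = - \<phi> x"
    and right: "\<forall>x\<in>{pi/2<..pi}. \<phi> x = 1/2" and left: "\<forall>x\<in>{-pi..<-pi/2}. \<phi> x = -1/2"
  obtains \<xi> \<xi>1 \<xi>2 :: "real \<Rightarrow> real"
  where "\<forall>x. (\<xi> has_vector_derivative \<xi>1 x) (at x)" "\<forall>x. (\<xi>1 has_vector_derivative \<xi>2 x) (at x)" "continuous_on UNIV \<xi>2"
    "\<forall>x. \<xi> (- x) = - \<xi> x" "\<forall>x. x > pi / 2 \<longrightarrow> \<xi> x = 1 / 2" "\<forall>x. x < - (pi / 2) \<longrightarrow> \<xi> x = - 1 / 2"
    "\<forall>x\<in>{-pi..pi}. \<phi> x = \<xi> x"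
proof -
  obtain \<phi>1 where \<phi>1: "\<forall>x\<in>cell. (\<phi> has_vector_derivative \<phi>1 x) (at x)" "C_k_on (Suc k) cell \<phi>1"
    by (rule C_k_on_SucE[OF cell_open_interval(1) c])
  obtain \<phi>2 where \<phi>2: "\<forall>x\<in>cell. (\<phi>1 has_vector_derivative \<phi>2 x) (at x)" "C_k_on k cell \<phi>2"
    by (rule C_k_on_SucE[OF cell_open_interval(1) \<phi>1(2)])
  have c2: "continuous_on cell \<phi>2" using \<phi>2(2)
  proof (cases k)
    case (Suc l)
    then show ?thesis using \<phi>2(2) by (simp add: differentiable_imp_continuous_on)
  qed simp
  define \<xi> where "\<xi> x = (if x \<in> cell then \<phi> x else if 0 < x then 1 / 2 else - 1 / 2)" for x
  define \<xi>1 where "\<xi>1 x = (if x \<in> cell then \<phi>1 x else 0)" for x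
  define \<xi>2 where "\<xi>2 x = (if x \<in> cell then \<phi>2 x else 0)" for x
  have op: "open {pi / 2<..}" "open {..<- (pi / 2)}" by simp_all
  have r: "\<xi> x = 1 / 2" if "x \<in> {pi / 2<..}" for x
    using that right by (auto simp: \<xi>_def) (use pi_gt_zero in linarith)
  have l: "\<xi> x = - 1 / 2" if "x \<in> {..<- (pi / 2)}" for x
    using that left by (auto simp: \<xi>_def) (use pi_gt_zero in linarith)
  have cases: "x \<in> cell \<or> x \<in> {pi / 2<..} \<or> x \<in> {..<- (pi / 2)}" for x
    using pi_gt_zero by (simp only: greaterThanLessThan_iff greaterThan_iff lessThan_iff) linarith
  have const: "(g has_vector_derivative 0) (at x)" if "open S" "x \<in> S" "\<And>y. y \<in> S \<Longrightarrow> g y = e" for g :: "real \<Rightarrow> real" and S e x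
    by (rule has_vector_derivative_transform_within_open[OF has_vector_derivative_const[of e] that(1,2)]) (simp add: that(3))
  have d0: "(\<xi> has_vector_derivative \<phi>1 x) (at x)" if "x \<in> cell" for x
    by (rule has_vector_derivative_transform_within_open[OF \<phi>1(1)[rule_format, OF that] cell_open_interval(1) that]) (simp add: \<xi>_def)
  have c0: "(\<xi> has_vector_derivative 0) (at x)" if "x \<in> {pi / 2<..} \<or> x \<in> {..<- (pi / 2)}" for x
  proof (rule disjE[OF that])
    assume x: "x \<in> {pi / 2<..}"
    show ?thesis by (rule const[OF op(1) x]) (rule r)
  next
    assume x: "x \<in> {..<- (pi / 2)}"
    show ?thesis by (rule const[OF op(2) x]) (rule l)
  qed
  have out1: "\<xi>1 x = 0" if "x \<in> {pi / 2<..} \<or> x \<in> {..<- (pi / 2)}" for x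
    using vector_derivative_unique_at[OF d0 c0[OF that]] by (cases "x \<in> cell") (simp_all only: \<xi>1_def if_True if_False)
  have d1: "(\<xi>1 has_vector_derivative \<phi>2 x) (at x)" if "x \<in> cell" for x
    by (rule has_vector_derivative_transform_within_open[OF \<phi>2(1)[rule_format, OF that] cell_open_interval(1) that]) (simp add: \<xi>1_def)
  have c1: "(\<xi>1 has_vector_derivative 0) (at x)" if "x \<in> {pi / 2<..} \<or> x \<in> {..<- (pi / 2)}" for x
  proof (rule disjE[OF that])
    assume x: "x \<in> {pi / 2<..}"
    show ?thesis by (rule const[OF op(1) x]) (rule out1, rule disjI1)
  next
    assume x: "x \<in> {..<- (pi / 2)}"
    show ?thesis by (rule const[OF op(2) x]) (rule out1, rule disjI2)
  qed
  have out2: "\<xi>2 x = 0" if "x \<in> {pi / 2<..} \<or> x \<in> {..<- (pi / 2)}" for x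
    using vector_derivative_unique_at[OF d1 c1[OF that]] by (cases "x \<in> cell") (simp_all only: \<xi>2_def if_True if_False)
  show ?thesis
  proof (rule that)
    show "\<forall>x. (\<xi> has_vector_derivative \<xi>1 x) (at x)"
    proof
      fix x show "(\<xi> has_vector_derivative \<xi>1 x) (at x)"
      proof (cases "x \<in> cell")
        case True
        then have "\<xi>1 x = \<phi>1 x" by (simp only: \<xi>1_def if_True)
        then show ?thesis using d0[OF True] by simp
      next
        case False
        then have x: "x \<in> {pi / 2<..} \<or> x \<in> {..<- (pi / 2)}" using cases[of x] by blast
        show ?thesis unfolding out1[OF x] by (rule c0[OF x])
      qed
    qed
    show "\<forall>x. (\<xi>1 has_vector_derivative \<xi>2 x) (at x)"
    proof
      fix x show "(\<xi>1 has_vector_derivative \<xi>2 x) (at x)"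
      proof (cases "x \<in> cell")
        case True
        then have "\<xi>2 x = \<phi>2 x" by (simp only: \<xi>2_def if_True)
        then show ?thesis using d1[OF True] by simp
      next
        case False
        then have x: "x \<in> {pi / 2<..} \<or> x \<in> {..<- (pi / 2)}" using cases[of x] by blast
        show ?thesis unfolding out2[OF x] by (rule c1[OF x])
      qed
    qed
    show "continuous_on UNIV \<xi>2"
    proof (rule continuous_at_imp_continuous_on, rule ballI)
      fix x :: real
      have "continuous_on cell \<xi>2" using c2 by (rule continuous_on_eq) (simp add: \<xi>2_def)
      moreover have "continuous_on {pi / 2<..} \<xi>2" "continuous_on {..<- (pi / 2)} \<xi>2"
        by (rule continuous_on_eq[OF continuous_on_const[of _ 0]], simp add: out2)+
      ultimately show "isCont \<xi>2 x"
        using cases[of x] continuous_on_eq_continuous_at[OF cell_open_interval(1)] continuous_on_eq_continuous_at[OF op(1)]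
          continuous_on_eq_continuous_at[OF op(2)] by blast
    qed
    show "\<forall>x. \<xi> (- x) = - \<xi> x" using odd by (auto simp: \<xi>_def)
    show "\<forall>x. x > pi / 2 \<longrightarrow> \<xi> x = 1 / 2" "\<forall>x. x < - (pi / 2) \<longrightarrow> \<xi> x = - 1 / 2" using r l by auto
    show "\<forall>x\<in>{-pi..pi}. \<phi> x = \<xi> x"
    proof
      fix x assume x: "x \<in> {-pi..pi}"
      have "x \<in> cell \<or> x = pi \<or> x = - pi" using x by auto
      then show "\<phi> x = \<xi> x"
        using right[rule_format, of pi] left[rule_format, of "- pi"] pi_gt_zero by (auto simp: \<xi>_def)
    qed
  qed
qed

lemma C_k_on_UNIV_Suc_imp: "C_k_on (Suc k) UNIV f \<Longrightarrow> C_k_on k UNIV f"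
proof (induction k arbitrary: f)
  case 0
  then show ?case by (simp add: differentiable_imp_continuous_on)
next
  case (Suc k)
  then show ?case unfolding C_k_on.simps(2)[of "Suc k"] C_k_on.simps(2)[of k UNIV f] by blast
qed

lemma cell_problem_exists:
  fixes D :: "real^'n^'n"
  assumes pp: "periodic_pattern 5 D f u" and ad: "adjoint_mode D f u z" and co: "phase_cutoffs 5 z \<phi> \<psi>"
  obtains u1 u2 u3 u4 z1 z2 \<xi> \<xi>1 \<xi>2 \<psi>1 \<psi>2 \<psi>3 \<rho>
  where "cell_problem D f u u1 u2 u3 u4 z z1 z2 \<xi> \<xi>1 \<xi>2 \<psi> \<psi>1 \<psi>2 \<psi>3 \<rho>" "\<forall>x\<in>{-pi..pi}. \<phi> x = \<xi> x"
proof -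
  have five: "(5::nat) = Suc (Suc (Suc (Suc (Suc 0))))" by simp
  have D: "\<And>i j. i \<noteq> j \<Longrightarrow> D $ i $ j = 0" "\<And>i. D $ i $ i > 0"
    and f5: "C_k_on (Suc (Suc (Suc (Suc (Suc 0))))) UNIV f" and u5: "C_k_on (Suc (Suc (Suc (Suc (Suc 0))))) UNIV u"
    and ue: "\<And>x. u (- x) = u x" and up: "periodic u" and ueq: "\<And>x. D *v ddx (ddx u) x + f (u x) = 0"
    using pp unfolding periodic_pattern_def five by blast+
  have f2: "C_k_on (Suc (Suc 0)) UNIV f" by (rule C_k_on_UNIV_Suc_imp[OF C_k_on_UNIV_Suc_imp[OF C_k_on_UNIV_Suc_imp[OF f5]]])
  obtain u1 where u1: "\<forall>x. (u has_vector_derivative u1 x) (at x)" "C_k_on (Suc (Suc (Suc (Suc 0)))) UNIV u1" by (rule C_k_on_SucE_UNIV[OF u5])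
  obtain u2 where u2: "\<forall>x. (u1 has_vector_derivative u2 x) (at x)" "C_k_on (Suc (Suc (Suc 0))) UNIV u2" by (rule C_k_on_SucE_UNIV[OF u1(2)])
  obtain u3 where u3: "\<forall>x. (u2 has_vector_derivative u3 x) (at x)" "C_k_on (Suc (Suc 0)) UNIV u3" by (rule C_k_on_SucE_UNIV[OF u2(2)])
  obtain u4 where u4: "\<forall>x. (u3 has_vector_derivative u4 x) (at x)" "C_k_on (Suc 0) UNIV u4" by (rule C_k_on_SucE_UNIV[OF u3(2)])
  have cu4: "continuous_on UNIV u4" using u4(2) by (simp add: differentiable_imp_continuous_on)
  have ker: "in_adjoint_kernel D f u (\<lambda>x. cvec (z x))" and zc: "continuous_on UNIV z" and zo: "\<And>x. z (- x) = - z x"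
    and uz: "pairing (ddx u) z = 1" using ad unfolding adjoint_mode_def by blast+
  have cu: "continuous_on UNIV u" by (rule has_vector_derivative_imp_continuous_on) (rule u1(1)[rule_format])
  have J: "continuous_on UNIV (\<lambda>x. jac f (u x))" by (rule continuous_on_compose2[OF jac_continuous[OF f2] cu]) simp
  obtain z1 z2 where z': "periodic z" "\<forall>x. (z has_vector_derivative z1 x) (at x)" "\<forall>x. (z1 has_vector_derivative z2 x) (at x)"
    "continuous_on UNIV z2" "\<forall>x. D *v z2 x + transpose (jac f (u x)) *v z x = 0"
  proof (rule adjoint_mode_regular[OF D J up ker zc])
    fix z1 z2
    assume a: "periodic z" "\<And>x. (z has_vector_derivative z1 x) (at x)" "\<And>x. (z1 has_vector_derivative z2 x) (at x)"
      "continuous_on UNIV z2" "\<And>x. D *v z2 x + transpose (jac f (u x)) *v z x = 0"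
    show thesis by (rule that[of z1 z2]) (use a in simp_all)
  qed
  note z = z'(1) z'(2)[rule_format] z'(3)[rule_format] z'(4) z'(5)[rule_format]
  have \<phi>: "C_k_on (Suc (Suc (Suc (Suc (Suc 0))))) cell \<phi>" "\<forall>x\<in>{-pi..pi}. \<phi> (-x) = - \<phi> x"
    "\<forall>x\<in>{pi/2<..pi}. \<phi> x = 1/2" "\<forall>x\<in>{-pi..<-pi/2}. \<phi> x = -1/2"
    and \<psi>: "test_function cell \<psi>" "\<forall>x. \<psi> (- x) = - \<psi> x" "pairing \<psi> z = 1"
    using co unfolding phase_cutoffs_def five by blast+
  obtain \<xi> \<xi>1 \<xi>2 :: "real \<Rightarrow> real" where \<xi>: "\<forall>x. (\<xi> has_vector_derivative \<xi>1 x) (at x)" "\<forall>x. (\<xi>1 has_vector_derivative \<xi>2 x) (at x)"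
    "continuous_on UNIV \<xi>2" "\<forall>x. \<xi> (- x) = - \<xi> x" "\<forall>x. x > pi / 2 \<longrightarrow> \<xi> x = 1 / 2"
    "\<forall>x. x < - (pi / 2) \<longrightarrow> \<xi> x = - 1 / 2" "\<forall>x\<in>{-pi..pi}. \<phi> x = \<xi> x"
    by (rule cutoff_extension[OF \<phi>])
  have \<psi>4: "C_k_on (Suc (Suc (Suc (Suc 0)))) UNIV \<psi>" using \<psi>(1) unfolding test_function_def by blast
  obtain \<psi>1 where \<psi>1: "\<forall>x. (\<psi> has_vector_derivative \<psi>1 x) (at x)" "C_k_on (Suc (Suc (Suc 0))) UNIV \<psi>1" by (rule C_k_on_SucE_UNIV[OF \<psi>4])
  obtain \<psi>2 where \<psi>2: "\<forall>x. (\<psi>1 has_vector_derivative \<psi>2 x) (at x)" "C_k_on (Suc (Suc 0)) UNIV \<psi>2" by (rule C_k_on_SucE_UNIV[OF \<psi>1(2)])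
  obtain \<psi>3 where \<psi>3: "\<forall>x. (\<psi>2 has_vector_derivative \<psi>3 x) (at x)" "C_k_on (Suc 0) UNIV \<psi>3" by (rule C_k_on_SucE_UNIV[OF \<psi>2(2)])
  have c\<psi>3: "continuous_on UNIV \<psi>3" using \<psi>3(2) by (simp add: differentiable_imp_continuous_on)
  have pp: "- pi < pi" using pi_gt_zero by linarith
  obtain r s where rs: "- pi < r" "r < s" "s < pi" "\<forall>x. x \<notin> {r..s} \<longrightarrow> \<psi> x = 0" by (rule test_function_support[OF \<psi>(1) pp]) blast
  \<comment> \<open>The support interval is enlarged to a symmetric one; it is nondegenerate because
    \<open>r < s\<close>, so its radius is positive, and it remains below \<open>pi\<close>.\<close>
  define \<rho> where "\<rho> = max \<bar>r\<bar> \<bar>s\<bar>"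
  have \<rho>: "0 < \<rho>" "\<rho> < pi" using rs(1-3) by (auto simp: \<rho>_def)
  have supp: "\<psi> x = 0" if "\<bar>x\<bar> > \<rho>" for x by (rule rs(4)[rule_format]) (use that in \<open>auto simp: \<rho>_def\<close>)
  have c1: "continuous_on UNIV u1" "continuous_on UNIV \<psi>"
    by (rule has_vector_derivative_imp_continuous_on, rule u2(1)[rule_format], rule has_vector_derivative_imp_continuous_on, rule \<psi>1(1)[rule_format])
  have du: "ddx u x = u1 x" "ddx u1 x = u2 x" for x
    by (rule vector_derivative_at, rule u1(1)[rule_format], rule vector_derivative_at, rule u2(1)[rule_format])
  have "cell_problem D f u u1 u2 u3 u4 z z1 z2 \<xi> \<xi>1 \<xi>2 \<psi> \<psi>1 \<psi>2 \<psi>3 \<rho>"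
  proof
    show "(D *v x) \<bullet> y = x \<bullet> (D *v y)" for x y by (rule diagonal_inner[OF D(1)])
    show "D *v u2 x + f (u x) = 0" for x using ueq[of x] unfolding du .
    show "integral {-pi..pi} (\<lambda>x. u1 x \<bullet> z x) = 1"
      using uz unfolding du by (subst (asm) pairing_eq_integral_on[OF refl]) (intro continuous_intros c1 zc)
    show "integral {-pi..pi} (\<lambda>x. \<psi> x \<bullet> z x) = 1"
      using \<psi>(3) by (subst (asm) pairing_eq_integral_on[OF refl]) (intro continuous_intros c1 zc)
    show "0 < \<rho>" "\<rho> < pi" by (rule \<rho>)+
    show "\<psi> x = 0" if "\<bar>x\<bar> > \<rho>" for x by (rule supp[OF that])
    show "\<xi> x = 1 / 2" if "x > pi / 2" for x using \<xi>(5) that by blast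
    show "\<xi> x = - 1 / 2" if "x < - (pi / 2)" for x using \<xi>(6) that by blast
    show "\<xi> (- x) = - \<xi> x" for x using \<xi>(4) by blast
  qed (fact f2 cu4 up ue z zo c\<psi>3 \<xi>(3) | rule u1(1)[rule_format] u2(1)[rule_format] u3(1)[rule_format] u4(1)[rule_format]
      \<psi>1(1)[rule_format] \<psi>2(1)[rule_format] \<psi>3(1)[rule_format] \<xi>(1)[rule_format] \<xi>(2)[rule_format])+
  from that[OF this \<xi>(7)] show ?thesis .
qed

text \<open>Extracts from the norms what the cell estimates use: the glued function is C^1 with
  absolutely continuous derivative, and it and all phases are pointwise at most
  \<open>\<epsilon>\<close>. The sup part of the norm controls every value because the function is
  continuous.\<close>

lemma admissible_line:
  fixes W :: "int \<Rightarrow> real \<Rightarrow> real^'n"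
  assumes ad: "admissible z \<theta> W" and X: "Xch_norm W < ennreal \<epsilon>" and s: "(\<Sum>\<^sub>\<infinity>j. \<bar>\<theta> j\<bar>) < \<epsilon>"
  obtains w w1 w2 where "glues_to W w" "\<forall>x. (w has_vector_derivative w1 x) (at x)"
    "\<forall>x y. w2 absolutely_integrable_on {x..y}" "\<forall>x y. x \<le> y \<longrightarrow> w1 y - w1 x = integral {x..y} w2"
    "\<forall>x. norm (w x) \<le> \<epsilon>" "\<forall>k. \<bar>\<theta> k\<bar> \<le> \<epsilon>" "in_Lp 2 UNIV w" "in_Lp 2 UNIV w2" "(\<lambda>j. \<bar>\<theta> j\<bar>) summable_on UNIV"
proof -
  obtain w where w: "glues_to W w" "continuous_on UNIV w" "in_H2_line w" and \<theta>: "(\<lambda>j. \<bar>\<theta> j\<bar>) summable_on UNIV"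
    using ad unfolding admissible_def by blast
  obtain g h where gh: "in_Lp 2 UNIV h" "has_weak_deriv UNIV w g" "has_weak_deriv UNIV g h" and wL: "in_Lp 2 UNIV w"
    using w(3) unfolding in_H2_line_def by blast
  obtain w1 where w1: "\<forall>x. (w has_vector_derivative w1 x) (at x)" "\<forall>a b. a \<le> b \<longrightarrow> w1 b - w1 a = integral {a..b} h"
    "\<forall>a b. h absolutely_integrable_on {a..b}"
    by (rule weak_second_derivative_regularity[OF w(2) gh(2,3)]) blast
  have tb: "\<bar>\<theta> k\<bar> \<le> \<epsilon>" for k
  proof -
    have "sum (\<lambda>j. \<bar>\<theta> j\<bar>) {k} \<le> (\<Sum>\<^sub>\<infinity>j. \<bar>\<theta> j\<bar>)" by (rule finite_sum_le_infsum[OF \<theta>]) simp_all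
    then show ?thesis using s by simp
  qed
  have e0: "0 \<le> \<epsilon>" using order_trans[OF abs_ge_zero tb] .
  have wb: "norm (w x) \<le> \<epsilon>" for x
  proof -
    define j where "j = \<lfloor>(x + pi) / (2 * pi)\<rfloor>"
    define y where "y = x - 2 * pi * of_int j"
    have "real_of_int j \<le> (x + pi) / (2 * pi)" "(x + pi) / (2 * pi) \<le> real_of_int j + 1"
      unfolding j_def by linarith+
    then have "real_of_int j * (2 * pi) \<le> x + pi" "x + pi \<le> (real_of_int j + 1) * (2 * pi)"
      by (simp_all add: pos_le_divide_eq pos_divide_le_eq)
    then have y: "y \<in> {-pi..pi}" by (simp add: y_def algebra_simps)
    have c: "continuous_on UNIV (\<lambda>x. w (2 * pi * of_int j + x))"
      by (rule continuous_compose_UNIV[OF w(2)]) (intro continuous_intros)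
    have "Lp_norm \<infinity> cell (\<lambda>x. w (2 * pi * of_int j + x)) = Lp_norm \<infinity> cell (W j)"
      by (rule Lp_norm_cong[OF _ cell_sets]) (use w(1) in \<open>auto simp: glues_to_def\<close>)
    also have "\<dots> \<le> (SUP j. Lp_norm \<infinity> cell (W j))" by (rule SUP_upper) simp
    also have "\<dots> \<le> Xch_norm W" unfolding Xch_norm_def by (rule add_increasing) simp_all
    also have "\<dots> \<le> ennreal \<epsilon>" by (rule less_imp_le[OF X])
    finally have "norm (w (2 * pi * of_int j + y)) \<le> \<epsilon>" by (rule esssup_continuous_bound[OF c _ e0 y])
    then show ?thesis by (simp add: y_def)
  qed
  show ?thesis by (rule that[of w w1 h]) (use w(1) w1 wb tb gh(1) wL \<theta> in blast)+
qed

section \<open>One constant for all states\<close>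

text \<open>An index carries a complete state together with its nonlinear terms and a cell number. A
  bound uniform over a set of such indices is uniform over states, nonlinear terms and cells
  simultaneously.\<close>

type_synonym 'n cell_index = "(int \<Rightarrow> real) \<times> (int \<Rightarrow> real \<Rightarrow> real^'n) \<times> (real \<Rightarrow> real^'n) \<times> (real \<Rightarrow> real^'n) \<times>
  (real \<Rightarrow> real^'n) \<times> (int \<Rightarrow> real) \<times> (int \<Rightarrow> real \<Rightarrow> real^'n) \<times> int"

text \<open>The family estimates are used twice: on all states below a crude radius \<open>r\<close>
  to learn how small \<open>kap\<close> and \<open>kpsi - 1\<close> become, and then on the states
  below \<open>\<epsilon>\<^sub>0\<close> that carry nonlinear terms, to obtain the final
  constant.\<close>

lemma uniform_bounds:
  fixes D :: "real^'n^'n"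
  assumes cp: "cell_problem D f u u1 u2 u3 u4 z z1 z2 \<xi> \<xi>1 \<xi>2 \<psi> \<psi>1 \<psi>2 \<psi>3 \<rho>" and \<phi>\<xi>: "\<forall>x\<in>{-pi..pi}. \<phi> x = \<xi> x"
  shows "\<exists>\<epsilon>\<^sub>0>0. \<exists>C>0. \<forall>\<epsilon> \<theta> W. \<epsilon> \<le> \<epsilon>\<^sub>0 \<and> admissible z \<theta> W \<and> Xch_norm W < ennreal \<epsilon> \<and> (\<Sum>\<^sub>\<infinity>j. \<bar>\<theta> j\<bar>) < \<epsilon> \<longrightarrow>
    (\<exists>N\<theta> Nw. nonlinear_terms D f u z \<phi> \<psi> \<theta> W N\<theta> Nw) \<and>
    (\<forall>N\<theta> Nw. nonlinear_terms D f u z \<phi> \<psi> \<theta> W N\<theta> Nw \<longrightarrow> (\<forall>j p. 1 \<le> p \<longrightarrow>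
      ennreal \<bar>N\<theta> j\<bar> \<le> ennreal C * bound_theta \<theta> W p j \<and> Lp_norm p cell (Nw j) \<le> ennreal C * bound_w \<theta> W N\<theta> p j))"
proof -
  interpret cell_problem D f u u1 u2 u3 u4 z z1 z2 \<xi> \<xi>1 \<xi>2 \<psi> \<psi>1 \<psi>2 \<psi>3 \<rho> by (rule cp)
  define state where "state \<epsilon> \<theta> X w w1 w2 \<longleftrightarrow> glues_to X w \<and> (\<forall>x. (w has_vector_derivative w1 x) (at x)) \<and>
    (\<forall>x y. w2 absolutely_integrable_on {x..y}) \<and> (\<forall>x y. x \<le> y \<longrightarrow> w1 y - w1 x = integral {x..y} w2) \<and>
    (\<forall>x. norm (w x) \<le> \<epsilon>) \<and> (\<forall>k. \<bar>\<theta> k\<bar> \<le> \<epsilon>) \<and> in_Lp 2 UNIV w2"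
    for \<epsilon> :: real and \<theta> :: "int \<Rightarrow> real" and X :: "int \<Rightarrow> real \<Rightarrow> real^'n" and w w1 w2 :: "real \<Rightarrow> real^'n"
  \<comment> \<open>Phases and profiles below \<open>r\<close> are at most 1, and the shifted
    support of \<open>\<psi>\<close> remains inside the cell.\<close>
  define r where "r = min 1 ((pi - \<rho>) / 2)"
  have r: "0 < r" "r \<le> 1" "\<rho> + r < pi" using \<rho> by (auto simp: r_def min_def field_simps)
  let ?a = "(\<lambda>(\<theta>, X, w, w1, w2, N\<theta>, Nw, j). \<theta> (j + 1)) :: 'n cell_index \<Rightarrow> real" and ?b = "(\<lambda>(\<theta>, X, w, w1, w2, N\<theta>, Nw, j). \<theta> j) :: 'n cell_index \<Rightarrow> real"
    and ?c = "(\<lambda>(\<theta>, X, w, w1, w2, N\<theta>, Nw, j). \<theta> (j - 1)) :: 'n cell_index \<Rightarrow> real"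
    and ?W = "(\<lambda>(\<theta>, X, w, w1, w2, N\<theta>, Nw, j). \<lambda>x. w (2 * pi * of_int j + x)) :: 'n cell_index \<Rightarrow> real \<Rightarrow> real^'n"
    and ?W1 = "(\<lambda>(\<theta>, X, w, w1, w2, N\<theta>, Nw, j). \<lambda>x. w1 (2 * pi * of_int j + x)) :: 'n cell_index \<Rightarrow> real \<Rightarrow> real^'n"
    and ?W2 = "(\<lambda>(\<theta>, X, w, w1, w2, N\<theta>, Nw, j). \<lambda>x. w2 (2 * pi * of_int j + x)) :: 'n cell_index \<Rightarrow> real \<Rightarrow> real^'n"
    and ?\<theta> = "(\<lambda>(\<theta>, X, w, w1, w2, N\<theta>, Nw, j). \<theta>) :: 'n cell_index \<Rightarrow> int \<Rightarrow> real" and ?X = "(\<lambda>(\<theta>, X, w, w1, w2, N\<theta>, Nw, j). X) :: 'n cell_index \<Rightarrow> int \<Rightarrow> real \<Rightarrow> real^'n"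
    and ?w = "(\<lambda>(\<theta>, X, w, w1, w2, N\<theta>, Nw, j). w) :: 'n cell_index \<Rightarrow> real \<Rightarrow> real^'n" and ?w1 = "(\<lambda>(\<theta>, X, w, w1, w2, N\<theta>, Nw, j). w1) :: 'n cell_index \<Rightarrow> real \<Rightarrow> real^'n"
    and ?N\<theta> = "(\<lambda>(\<theta>, X, w, w1, w2, N\<theta>, Nw, j). N\<theta>) :: 'n cell_index \<Rightarrow> int \<Rightarrow> real" and ?Nw = "(\<lambda>(\<theta>, X, w, w1, w2, N\<theta>, Nw, j). Nw) :: 'n cell_index \<Rightarrow> int \<Rightarrow> real \<Rightarrow> real^'n"
    and ?J = "(\<lambda>(\<theta>, X, w, w1, w2, N\<theta>, Nw, j). j) :: 'n cell_index \<Rightarrow> int"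
  define I :: "real \<Rightarrow> 'n cell_index set" where "I \<epsilon> = {(\<theta>, X, w, w1, w2, N\<theta>, Nw, j). state \<epsilon> \<theta> X w w1 w2}" for \<epsilon>
  have L: "lattice_family D f u u1 u2 u3 u4 z z1 z2 \<xi> \<xi>1 \<xi>2 \<psi> \<psi>1 \<psi>2 \<psi>3 \<rho> S ?a ?b ?c ?W ?W1 ?W2 \<phi> ?\<theta> ?X ?w ?w1 ?J"
    if S: "S \<subseteq> I r" for S
  proof -
    have facts: "\<bar>?a i\<bar> \<le> 1 \<and> \<bar>?b i\<bar> \<le> 1 \<and> \<bar>?c i\<bar> \<le> 1 \<and> \<rho> + \<bar>?b i\<bar> < pi \<and>
      (\<forall>x. (?W i has_vector_derivative ?W1 i x) (at x)) \<and> (\<forall>x y. ?W2 i absolutely_integrable_on {x..y}) \<and>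
      (\<forall>x y. x \<le> y \<longrightarrow> ?W1 i y - ?W1 i x = integral {x..y} (?W2 i)) \<and> (\<forall>x. norm (?W i x) \<le> 1) \<and>
      ?\<theta> i (?J i + 1) = ?a i \<and> ?\<theta> i (?J i) = ?b i \<and> ?\<theta> i (?J i - 1) = ?c i \<and> glues_to (?X i) (?w i) \<and>
      (\<forall>x. (?w i has_vector_derivative ?w1 i x) (at x)) \<and> (\<forall>x. ?W i x = ?w i (2 * pi * of_int (?J i) + x)) \<and>
      (\<forall>x. ?W1 i x = ?w1 i (2 * pi * of_int (?J i) + x))" if iS: "i \<in> S" for i
    proof -
      obtain \<theta> X w w1 w2 N\<theta> Nw j where i: "i = (\<theta>, X, w, w1, w2, N\<theta>, Nw, j)" "state r \<theta> X w w1 w2"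
        using iS S unfolding I_def by blast
      have st: "glues_to X w" "(w has_vector_derivative w1 x) (at x)" "w2 absolutely_integrable_on {x..y}"
        "x \<le> y \<Longrightarrow> w1 y - w1 x = integral {x..y} w2" "norm (w x) \<le> r" "\<bar>\<theta> k\<bar> \<le> r" for x y k
        using i(2) unfolding state_def by blast+
      have le: "\<bar>\<theta> k\<bar> \<le> 1" "\<rho> + \<bar>\<theta> k\<bar> < pi" for k using st(6)[of k] r by linarith+
      have dW: "((\<lambda>x. w (2 * pi * of_int j + x)) has_vector_derivative w1 (2 * pi * of_int j + x)) (at x)" for x
        using has_vector_derivative_shift[OF st(2), of "- (2 * pi * of_int j)" x] by (simp add: add.commute)
      have dW1: "w1 (2 * pi * of_int j + y) - w1 (2 * pi * of_int j + x) = integral {x..y} (\<lambda>x. w2 (2 * pi * of_int j + x))" if "x \<le> y" for x y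
        unfolding absolutely_integrable_shift(2)[OF st(3)]
        using st(4)[of "x + 2 * pi * of_int j" "y + 2 * pi * of_int j"] that by (simp add: add.commute)
      have aW2: "(\<lambda>x. w2 (2 * pi * of_int j + x)) absolutely_integrable_on {x..y}" for x y
        by (rule absolutely_integrable_shift(1)[OF st(3)])
      have nW: "norm (w (2 * pi * of_int j + x)) \<le> 1" for x by (rule order_trans[OF st(5) r(2)])
      show ?thesis unfolding i(1) prod.case by (intro conjI allI impI le dW dW1 aW2 nW st(1,2) refl)
    qed
    show ?thesis by unfold_locales (use facts \<phi>\<xi> in blast)+
  qed
  \<comment> \<open>\<open>kap\<close> and \<open>kpsi\<close> are defined without reference to the
    index set, so the smallness proved for this large family passes to every subfamily.\<close>
  interpret F: lattice_family D f u u1 u2 u3 u4 z z1 z2 \<xi> \<xi>1 \<xi>2 \<psi> \<psi>1 \<psi>2 \<psi>3 \<rho> "I r" ?a ?b ?c ?W ?W1 ?W2 \<phi> ?\<theta> ?X ?w ?w1 ?J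
    by (rule L) simp
  obtain K where K: "0 \<le> K" "\<forall>i\<in>I r. \<forall>e. \<bar>?a i\<bar> \<le> e \<longrightarrow> \<bar>?b i\<bar> \<le> e \<longrightarrow> \<bar>?c i\<bar> \<le> e \<longrightarrow> (\<forall>x\<in>{-pi..pi}. norm (?W i x) \<le> e) \<longrightarrow>
      \<bar>F.kap i\<bar> \<le> K * e \<and> \<bar>F.kpsi i - 1\<bar> \<le> K * e"
    using F.unif_small by blast
  \<comment> \<open>The second entry makes \<open>K\<close> times the radius at most 1/2, the
    threshold under which \<open>1 - kap\<close> and \<open>kpsi\<close> can be divided out;
    \<open>K + 1\<close> avoids division by zero.\<close>
  define \<epsilon>\<^sub>0 where "\<epsilon>\<^sub>0 = min r (1 / (2 * (K + 1)))"
  have \<epsilon>0: "0 < \<epsilon>\<^sub>0" "\<epsilon>\<^sub>0 \<le> r" using r(1) K(1) by (simp_all add: \<epsilon>\<^sub>0_def)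
  have K\<epsilon>: "K * \<epsilon>\<^sub>0 \<le> 1 / 2"
  proof -
    have "K * \<epsilon>\<^sub>0 \<le> K * (1 / (2 * (K + 1)))" by (rule mult_left_mono[OF _ K(1)]) (simp add: \<epsilon>\<^sub>0_def)
    also have "\<dots> \<le> 1 / 2" using K(1) by (simp add: field_simps)
    finally show ?thesis .
  qed
  have mono: "state r \<theta> X w w1 w2" if "state \<epsilon>\<^sub>0 \<theta> X w w1 w2" for \<theta> X w w1 w2
    using that \<epsilon>0(2) unfolding state_def by (blast intro: order_trans)
  have sub: "I \<epsilon>\<^sub>0 \<subseteq> I r" unfolding I_def using mono by blast
  have small: "\<bar>F.kap i\<bar> \<le> 1 / 2 \<and> \<bar>F.kpsi i - 1\<bar> \<le> 1 / 2" if iI: "i \<in> I \<epsilon>\<^sub>0" for i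
  proof -
    obtain \<theta> X w w1 w2 N\<theta> Nw j where i: "i = (\<theta>, X, w, w1, w2, N\<theta>, Nw, j)" "state \<epsilon>\<^sub>0 \<theta> X w w1 w2"
      using iI unfolding I_def by blast
    have st: "\<bar>\<theta> k\<bar> \<le> \<epsilon>\<^sub>0" "norm (w x) \<le> \<epsilon>\<^sub>0" for k x using i(2) unfolding state_def by blast+
    have "\<bar>F.kap i\<bar> \<le> K * \<epsilon>\<^sub>0 \<and> \<bar>F.kpsi i - 1\<bar> \<le> K * \<epsilon>\<^sub>0"
      by (rule K(2)[rule_format, OF subsetD[OF sub iI]]) (simp_all only: i(1) prod.case st)
    then show ?thesis using K\<epsilon> by linarith
  qed
  have sq: "(\<lambda>x. (norm (?W2 i x))\<^sup>2) integrable_on {-pi..pi}" if iI: "i \<in> I \<epsilon>\<^sub>0" for i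
  proof -
    obtain \<theta> X w w1 w2 N\<theta> Nw j where i: "i = (\<theta>, X, w, w1, w2, N\<theta>, Nw, j)" "state \<epsilon>\<^sub>0 \<theta> X w w1 w2"
      using iI unfolding I_def by blast
    have "in_Lp 2 UNIV w2" using i(2) unfolding state_def by blast
    from summable_on_cells(2)[OF in_L2_line_square[OF this] zero_le_power2] show ?thesis unfolding i(1) prod.case .
  qed
  \<comment> \<open>Putting the nonlinear terms into the index makes the constant independent of
    which admissible pair is considered.\<close>
  define S where "S = {i \<in> I \<epsilon>\<^sub>0. nonlinear_terms D f u z \<phi> \<psi> (?\<theta> i) (?X i) (?N\<theta> i) (?Nw i)}"
  have S: "S \<subseteq> I \<epsilon>\<^sub>0" "S \<subseteq> I r" using sub unfolding S_def by blast+
  have NT: "nonlinear_terms D f u z \<phi> \<psi> (?\<theta> i) (?X i) (?N\<theta> i) (?Nw i)" if "i \<in> S" for i using that unfolding S_def by blast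
  have kS: "\<bar>F.kap i\<bar> \<le> 1 / 2" "\<bar>F.kpsi i - 1\<bar> \<le> 1 / 2" if "i \<in> S" for i using small subsetD[OF S(1) that] by blast+
  have kI: "\<bar>F.kap i\<bar> \<le> 1 / 2" "\<bar>F.kpsi i - 1\<bar> \<le> 1 / 2" if "i \<in> I \<epsilon>\<^sub>0" for i using small[OF that] by blast+
  obtain C where C: "0 < C" "\<forall>i\<in>S. \<forall>p\<ge>1. ennreal \<bar>?N\<theta> i (?J i)\<bar> \<le> ennreal C * bound_theta (?\<theta> i) (?X i) p (?J i) \<and>
      Lp_norm p cell (?Nw i (?J i)) \<le> ennreal C * bound_w (?\<theta> i) (?X i) (?N\<theta> i) p (?J i)"
    using lattice_family.nonlinear_terms_bounds[OF L[OF S(2)] NT kS] by blast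
  show ?thesis
  proof (rule exI[of _ \<epsilon>\<^sub>0], rule conjI[OF \<epsilon>0(1)], rule exI[of _ C], rule conjI[OF C(1)], intro allI impI)
    fix \<epsilon> :: real and \<theta> :: "int \<Rightarrow> real" and W :: "int \<Rightarrow> real \<Rightarrow> real^'n"
    assume as: "\<epsilon> \<le> \<epsilon>\<^sub>0 \<and> admissible z \<theta> W \<and> Xch_norm W < ennreal \<epsilon> \<and> (\<Sum>\<^sub>\<infinity>j. \<bar>\<theta> j\<bar>) < \<epsilon>"
    then obtain w w1 w2 where w: "glues_to W w" "\<forall>x. (w has_vector_derivative w1 x) (at x)"
      "\<forall>x y. w2 absolutely_integrable_on {x..y}" "\<forall>x y. x \<le> y \<longrightarrow> w1 y - w1 x = integral {x..y} w2"
      "\<forall>x. norm (w x) \<le> \<epsilon>" "\<forall>k. \<bar>\<theta> k\<bar> \<le> \<epsilon>" "in_Lp 2 UNIV w" "in_Lp 2 UNIV w2" "(\<lambda>j. \<bar>\<theta> j\<bar>) summable_on UNIV"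
      using admissible_line[of z \<theta> W \<epsilon>] by blast
    have st: "state \<epsilon>\<^sub>0 \<theta> W w w1 w2"
      unfolding state_def using w as by (blast intro: order_trans)
    have "\<exists>N\<theta> Nw. nonlinear_terms D f u z \<phi> \<psi> \<theta> W N\<theta> Nw"
      \<comment> \<open>Before existence is known the slots for the nonlinear terms are filled with
        zeros; these entries do not enter the cell data.\<close>
      by (rule lattice_family.nonlinear_terms_exist[OF L[OF sub] kI sq, where \<iota>="\<lambda>j. (\<theta>, W, w, w1, w2, \<lambda>_. 0, \<lambda>_ _. 0, j)" and l=w and ?l2.0=w2])
        (simp_all add: I_def st w(7-9))
    moreover have "ennreal \<bar>N\<theta> j\<bar> \<le> ennreal C * bound_theta \<theta> W p j \<and> Lp_norm p cell (Nw j) \<le> ennreal C * bound_w \<theta> W N\<theta> p j"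
      if nt: "nonlinear_terms D f u z \<phi> \<psi> \<theta> W N\<theta> Nw" and p: "1 \<le> p" for N\<theta> Nw j p
    proof -
      have "(\<theta>, W, w, w1, w2, N\<theta>, Nw, j) \<in> S" using nt st by (simp add: S_def I_def)
      from C(2)[rule_format, OF this p] show ?thesis by (simp only: prod.case)
    qed
    ultimately show "(\<exists>N\<theta> Nw. nonlinear_terms D f u z \<phi> \<psi> \<theta> W N\<theta> Nw) \<and>
      (\<forall>N\<theta> Nw. nonlinear_terms D f u z \<phi> \<psi> \<theta> W N\<theta> Nw \<longrightarrow> (\<forall>j p. 1 \<le> p \<longrightarrow>
        ennreal \<bar>N\<theta> j\<bar> \<le> ennreal C * bound_theta \<theta> W p j \<and> Lp_norm p cell (Nw j) \<le> ennreal C * bound_w \<theta> W N\<theta> p j))"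
      by blast
  qed
qed

theorem lemma6p1:
  shows "\<exists>K::nat. \<forall>(D::real^'n^'n) f ustar uad \<phi> \<psi>.
    periodic_pattern K D f ustar \<and> spectrally_stable K D f ustar \<and>
    adjoint_mode D f ustar uad \<and> phase_cutoffs K uad \<phi> \<psi> \<longrightarrow>
    (\<exists>\<epsilon>\<^sub>0>0. \<exists>C :: real \<Rightarrow> real.
       (\<forall>\<epsilon>\<in>{0<..\<epsilon>\<^sub>0}. C \<epsilon> > 0) \<and> mono_on {0<..\<epsilon>\<^sub>0} C \<and>
       (\<forall>\<epsilon> \<theta> W. 0 < \<epsilon> \<and> \<epsilon> \<le> \<epsilon>\<^sub>0 \<and> admissible uad \<theta> W \<and>
          Xch_norm W < ennreal \<epsilon> \<and> (\<Sum>\<^sub>\<infinity>j. \<bar>\<theta> j\<bar>) < \<epsilon> \<longrightarrow>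
          (\<exists>N\<theta> Nw. nonlinear_terms D f ustar uad \<phi> \<psi> \<theta> W N\<theta> Nw) \<and>
          (\<forall>N\<theta> Nw. nonlinear_terms D f ustar uad \<phi> \<psi> \<theta> W N\<theta> Nw \<longrightarrow>
            (\<forall>(j::int) (p::ennreal). 1 \<le> p \<longrightarrow>
               ennreal \<bar>N\<theta> j\<bar> \<le> ennreal (C \<epsilon>) *
                 (ennreal (\<Sum>k=-1..0. \<bar>delta_plus \<theta> (j + k)\<bar>\<^sup>2) +
                  ennreal ((\<Sum>k=-1..1. \<bar>\<theta> (j + k)\<bar> ^ 3) * (\<Sum>k=-1..0. \<bar>delta_plus \<theta> (j + k)\<bar>)) +
                  ennreal ((\<Sum>k=-1..1. \<bar>\<theta> (j + k)\<bar>) *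
                    (norm (delta_plus W j (-pi)) + norm (delta_plus (cell_deriv W) j (-pi)))) +
                  Lp_norm p cell (W j) * ennreal (norm (delta_plus W j (-pi))) +
                  Lp_norm p cell (\<lambda>x. (norm (W j x))\<^sup>2))
               \<and>
               Lp_norm p cell (Nw j) \<le> ennreal (C \<epsilon>) *
                 (ennreal ((\<Sum>k=-1..0. \<bar>delta_plus \<theta> (j + k)\<bar>) * (\<Sum>k=-1..1. \<bar>\<theta> (j + k)\<bar>)) +
                  ennreal \<bar>\<theta> j\<bar> * Lp_norm p cell (W j) +
                  ennreal ((\<Sum>k=-1..1. \<bar>\<theta> (j + k)\<bar>) *
                    (\<Sum>k=-1..1. norm (delta_plus W (j + k) (-pi)) +
                                norm (delta_plus (cell_deriv W) (j + k) (-pi)))) +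
                  Lp_norm p cell (W j) * ennreal (norm (delta_plus W j (-pi))) +
                  Lp_norm p cell (\<lambda>x. (norm (W j x))\<^sup>2) +
                  ennreal \<bar>N\<theta> j\<bar> + ennreal \<bar>N\<theta> (j + 1)\<bar> + ennreal \<bar>N\<theta> (j - 1)\<bar>)))))"
\<comment> \<open>Order 5 covers the four derivatives of the pattern that appear when the second
  derivative of H is expanded to second order in the phases.\<close>
proof (rule exI[of _ 5], intro allI impI, goal_cases)
  case (1 D f ustar uad \<phi> \<psi>)
  obtain u1 u2 u3 u4 z1 z2 \<xi> \<xi>1 \<xi>2 \<psi>1 \<psi>2 \<psi>3 \<rho>
    where cp: "cell_problem D f ustar u1 u2 u3 u4 uad z1 z2 \<xi> \<xi>1 \<xi>2 \<psi> \<psi>1 \<psi>2 \<psi>3 \<rho>" "\<forall>x\<in>{-pi..pi}. \<phi> x = \<xi> x"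
    by (rule cell_problem_exists[of D f ustar uad \<phi> \<psi>]) (use 1 in blast)+
  obtain \<epsilon>\<^sub>0 C where *: "0 < \<epsilon>\<^sub>0" "0 < C" "\<forall>\<epsilon> \<theta> W. \<epsilon> \<le> \<epsilon>\<^sub>0 \<and> admissible uad \<theta> W \<and> Xch_norm W < ennreal \<epsilon> \<and> (\<Sum>\<^sub>\<infinity>j. \<bar>\<theta> j\<bar>) < \<epsilon> \<longrightarrow>
    (\<exists>N\<theta> Nw. nonlinear_terms D f ustar uad \<phi> \<psi> \<theta> W N\<theta> Nw) \<and>
    (\<forall>N\<theta> Nw. nonlinear_terms D f ustar uad \<phi> \<psi> \<theta> W N\<theta> Nw \<longrightarrow> (\<forall>j p. 1 \<le> p \<longrightarrow>
      ennreal \<bar>N\<theta> j\<bar> \<le> ennreal C * bound_theta \<theta> W p j \<and> Lp_norm p cell (Nw j) \<le> ennreal C * bound_w \<theta> W N\<theta> p j))"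
    using uniform_bounds[OF cp] by blast
  show ?case
  \<comment> \<open>The constant from \<open>uniform_bounds\<close> depends on the threshold
    \<open>\<epsilon>\<^sub>0\<close> only, so a constant function of \<open>\<epsilon>\<close> is a
    valid nondecreasing choice.\<close>
  proof (rule exI[of _ \<epsilon>\<^sub>0], rule conjI[OF *(1)], rule exI[of _ "\<lambda>_. C"], intro conjI)
    show "\<forall>\<epsilon>\<in>{0<..\<epsilon>\<^sub>0}. 0 < C" using *(2) by blast
    show "mono_on {0<..\<epsilon>\<^sub>0} (\<lambda>_. C)" by (rule mono_onI) simp
  qed (use *(3)[unfolded bound_theta_def bound_w_def] in blast)
qed

end
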